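(* Let $(\mathcal{V},\mathcal{E})$ be a finite directed graph whose adjacency matrix $M$ is irreducible and is not a permutation matrix, let $(X,\sigma)$ be the associated one-sided shift of finite type, let $G$ be the étale groupoid of $(X,\sigma)$, and let $Y\subset X$ be a non-empty clopen subset. (1) The abelianization $[[G|Y]]/D([[G|Y]])$ of the topological full group $[[G|Y]]$ is isomorphic to $(H_0(G)\otimes\mathbb{Z}_2)\oplus H_1(G)$. (2) The group $[[G|Y]]_0/D([[G|Y]])$ is isomorphic to $H_0(G)\otimes\mathbb{Z}_2$. (3) The group $[[G|Y]]$ is simple if and only if $H_0(G)$ is $2$-divisible.
   Context: $\mathbb{Z}_2$ is the cyclic group of order $2$; $D(\Gamma)$ is the commutator subgroup of a group $\Gamma$. An abelian group $A$ is $2$-divisible if $2A=A$. Étale groupoids: an étale groupoid is a second countable locally compact Hausdorff topological groupoid $G$ whose range map is a local homeomorphism. $G^{(0)}$ is the unit space, $s,r$ are the source and range maps, and $gh$ is defined when $s(g)=r(h)$. For an open set $Y\subset G^{(0)}$, $G|Y=r^{-1}(Y)\cap s^{-1}(Y)$ is the reduction, an étale groupoid with unit space $Y$. A $G$-set is a subset $U\subset G$ such that $r|U$ and $s|U$ are injective; for an open $G$-set $U$, $\pi_U=r\circ(s|U)^{-1}:s(U)\to r(U)$. When $G^{(0)}$ is compact, the topological full group $[[G]]$ is the group of all $\alpha\in\mathrm{Homeo}(G^{(0)})$ for which there is a compact open $G$-set $U$ with $\alpha=\pi_U$ (so $s(U)=r(U)=G^{(0)}$); for the groupoids considered here (which are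 essentially principal, i.e. the interior of $\{g\in G\mid r(g)=s(g)\}$ is $G^{(0)}$) this $U$ is unique. Homology: $C_c(Y,\mathbb{Z})$ is the group of compactly supported continuous functions $Y\to\mathbb{Z}$. For a local homeomorphism $\pi:Y\to Z$, $\pi_*(f)(z)=\sum_{\pi(y)=z}f(y)$. Let $G^{(2)}$ be the space of pairs $(g_1,g_2)$ with $s(g_1)=r(g_2)$, and $d_0(g_1,g_2)=g_2$, $d_1(g_1,g_2)=g_1g_2$, $d_2(g_1,g_2)=g_1$. Put $\delta_1=s_*-r_*:C_c(G,\mathbb{Z})\to C_c(G^{(0)},\mathbb{Z})$ and $\delta_2=d_{0*}-d_{1*}+d_{2*}:C_c(G^{(2)},\mathbb{Z})\to C_c(G,\mathbb{Z})$. Then $H_0(G)=C_c(G^{(0)},\mathbb{Z})/\mathrm{Im}\,\delta_1$ and $H_1(G)=\ker\delta_1/\mathrm{Im}\,\delta_2$. The index map is the homomorphism $I:[[G]]\to H_1(G)$, $I(\pi_U)=[1_U]$ ($1_U$ the characteristic function of the compact open $G$-set $U$), and $[[G]]_0=\ker I$. The definitions of $[[\cdot]]$ and $[[\cdot]]_0$ are applied to $G|Y$. Shifts of finite type: $\mathbb{N}=\{1,2,\dots\}$. For $e\in\mathcal{E}$, $i(e)$ and $t(e)$ are the initial and terminal vertices. $M(\xi,\eta)=\#\{e\in\mathcal{E}\mid i(e)=\xi,\ t(e)=\eta\}$; $M$ is irreducible if for all $\xi,\eta\in\mathcal{V}$ there is $n\in\mathbb{N}$ with $M^n(\xi,\eta)>0$.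 $X=\{(x_k)_{k\in\mathbb{N}}\in\mathcal{E}^{\mathbb{N}}\mid t(x_k)=i(x_{k+1})\ \forall k\}$ with the product topology (a Cantor set), and $\sigma:X\to X$, $\sigma(x)_k=x_{k+1}$. The étale groupoid of $(X,\sigma)$ is $G=\{(x,n,y)\in X\times\mathbb{Z}\times X\mid\exists k,l\in\mathbb{N},\ n=k-l,\ \sigma^k(x)=\sigma^l(y)\}$, with product $(x,n,y)(y,n',y')=(x,n+n',y')$, inverse $(x,n,y)^{-1}=(y,-n,x)$, and topology generated by the sets $\{(x,k-l,y)\in G\mid x\in A,\ y\in B,\ \sigma^k(x)=\sigma^l(y)\}$ for $A,B\subset X$ open and $k,l\in\mathbb{N}$. $X$ is identified with $G^{(0)}$ via $x\mapsto(x,0,x)$. *)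

theory Defs
  imports
    "HOL-Analysis.Abstract_Topology"
    "HOL-Analysis.Function_Topology"
    "HOL-Analysis.Product_Topology"
    "HOL-Combinatorics.Permutations"
    "HOL-Algebra.Bij"
    "HOL-Algebra.Generated_Groups"
    "HOL-Algebra.Elementary_Groups"
    "HOL-Algebra.Free_Abelian_Groups"
    "Graph_Theory.Digraph"
begin

section \<open>Groups\<close>

definition abelianization :: "('a, 'b) monoid_scheme \<Rightarrow> 'a set monoid" where
  "abelianization \<Gamma> = \<Gamma> Mod (derived \<Gamma> (carrier \<Gamma>))"

text \<open>
  The library locale \<open>simple_group\<close> demands \<open>order G > 1\<close>, where \<open>order\<close> is a cardinality in
  \<open>nat\<close> that is \<open>0\<close> for infinite groups; it is therefore never satisfied by an infinite group.
\<close>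

definition is_simple_group :: "('a, 'b) monoid_scheme \<Rightarrow> bool" where
  "is_simple_group \<Gamma> \<longleftrightarrow> group \<Gamma> \<and> carrier \<Gamma> \<noteq> {\<one>\<^bsub>\<Gamma>\<^esub>} \<and>
     (\<forall>N. N \<lhd> \<Gamma> \<longrightarrow> N = carrier \<Gamma> \<or> N = {\<one>\<^bsub>\<Gamma>\<^esub>})"

text \<open>Abelian groups are written multiplicatively in HOL-Algebra, so \<open>2A\<close> is the set of squares.\<close>

definition two_divisible :: "('a, 'b) monoid_scheme \<Rightarrow> bool" where
  "two_divisible A \<longleftrightarrow> (\<lambda>a. a [^]\<^bsub>A\<^esub> (2::nat)) ` carrier A = carrier A"

definition bilinear_relations ::
  "('a, 'c) monoid_scheme \<Rightarrow> ('b, 'd) monoid_scheme \<Rightarrow> ('a \<times> 'b \<Rightarrow>\<^sub>0 int) set" where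
  "bilinear_relations A B =
     {frag_of (a \<otimes>\<^bsub>A\<^esub> a', b) - frag_of (a, b) - frag_of (a', b) | a a' b.
        a \<in> carrier A \<and> a' \<in> carrier A \<and> b \<in> carrier B} \<union>
     {frag_of (a, b \<otimes>\<^bsub>B\<^esub> b') - frag_of (a, b) - frag_of (a, b') | a b b'.
        a \<in> carrier A \<and> b \<in> carrier B \<and> b' \<in> carrier B}"

text \<open>Tensor product over the integers; \<open>frag_of\<close> is the basis element of the free abelian group.\<close>

definition tensor_group ::
  "('a, 'c) monoid_scheme \<Rightarrow> ('b, 'd) monoid_scheme \<Rightarrow> ('a \<times> 'b \<Rightarrow>\<^sub>0 int) set monoid" where
  "tensor_group A B =
     (let F = free_Abelian_group (carrier A \<times> carrier B)
      in F Mod (generate F (bilinear_relations A B)))"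


section \<open>Topological groupoids\<close>

text \<open>
  The space of arrows is \<open>topspace (gtop G)\<close>. The product \<open>gmult G g h\<close> is only meaningful for
  arrows with \<open>src G g = rng G h\<close>. The unit space is a subset of the space of arrows, with the
  subspace topology, and source and range take their values in it.
\<close>

record 'g top_groupoid =
  gtop :: "'g topology"
  gmult :: "'g \<Rightarrow> 'g \<Rightarrow> 'g"
  ginv :: "'g \<Rightarrow> 'g"

definition src :: "'g top_groupoid \<Rightarrow> 'g \<Rightarrow> 'g" where
  "src G g = gmult G (ginv G g) g"

definition rng :: "'g top_groupoid \<Rightarrow> 'g \<Rightarrow> 'g" where
  "rng G g = gmult G g (ginv G g)"

definition units :: "'g top_groupoid \<Rightarrow> 'g set" where
  "units G = rng G ` topspace (gtop G)"

definition unit_top :: "'g top_groupoid \<Rightarrow> 'g topology" where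
  "unit_top G = subtopology (gtop G) (units G)"

definition reduction :: "'g top_groupoid \<Rightarrow> 'g set \<Rightarrow> 'g top_groupoid" where
  "reduction G Y = G\<lparr>gtop := subtopology (gtop G) {g. rng G g \<in> Y \<and> src G g \<in> Y}\<rparr>"

definition G_set :: "'g top_groupoid \<Rightarrow> 'g set \<Rightarrow> bool" where
  "G_set G U \<longleftrightarrow> U \<subseteq> topspace (gtop G) \<and> inj_on (rng G) U \<and> inj_on (src G) U"

text \<open>\<open>G_set_map G U\<close> is the map \<open>\<pi>\<^sub>U\<close>, extended by \<open>undefined\<close> outside \<open>s(U)\<close>.\<close>

definition G_set_map :: "'g top_groupoid \<Rightarrow> 'g set \<Rightarrow> 'g \<Rightarrow> 'g" where
  "G_set_map G U = restrict (rng G \<circ> inv_into U (src G)) (src G ` U)"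

definition represents :: "'g top_groupoid \<Rightarrow> 'g set \<Rightarrow> ('g \<Rightarrow> 'g) \<Rightarrow> bool" where
  "represents G U \<alpha> \<longleftrightarrow>
     G_set G U \<and> openin (gtop G) U \<and> compactin (gtop G) U \<and>
     src G ` U = units G \<and> rng G ` U = units G \<and> \<alpha> = G_set_map G U"

text \<open>
  Following the library group of bijections \<open>BijGroup\<close>, homeomorphisms of the unit space are
  represented by extensional functions; the group operation is composition.
\<close>

definition full_group :: "'g top_groupoid \<Rightarrow> ('g \<Rightarrow> 'g) monoid" where
  "full_group G = (BijGroup (units G))
     \<lparr>carrier := {\<alpha> \<in> Bij (units G).
        homeomorphic_map (unit_top G) (unit_top G) \<alpha> \<and> (\<exists>U. represents G U \<alpha>)}\<rparr>"


section \<open>Homology of groupoids\<close>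

text \<open>Functions are extended by \<open>0\<close> outside the space.\<close>

definition Cc :: "'a topology \<Rightarrow> ('a \<Rightarrow> int) monoid" where
  "Cc T = \<lparr>carrier = {f. continuous_map T (discrete_topology UNIV) f \<and>
                        compactin T (T closure_of {x \<in> topspace T. f x \<noteq> 0}) \<and>
                        (\<forall>x. x \<notin> topspace T \<longrightarrow> f x = 0)},
           monoid.mult = (\<lambda>f g x. f x + g x),
           one = (\<lambda>x. 0)\<rparr>"

text \<open>Fibres may be infinite, and \<open>sum\<close> over an infinite set is \<open>0\<close>; hence the restriction to the
  points with \<open>f y \<noteq> 0\<close>, of which a fibre of a local homeomorphism contains only finitely many.\<close>

definition pushforward :: "'a topology \<Rightarrow> ('a \<Rightarrow> 'b) \<Rightarrow> ('a \<Rightarrow> int) \<Rightarrow> 'b \<Rightarrow> int" where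
  "pushforward T p f z = (\<Sum>y \<in> {y \<in> topspace T. p y = z \<and> f y \<noteq> 0}. f y)"

definition pairs_top :: "'g top_groupoid \<Rightarrow> ('g \<times> 'g) topology" where
  "pairs_top G = subtopology (prod_topology (gtop G) (gtop G)) {(g, h). src G g = rng G h}"

definition delta1 :: "'g top_groupoid \<Rightarrow> ('g \<Rightarrow> int) \<Rightarrow> 'g \<Rightarrow> int" where
  "delta1 G f = (\<lambda>z. pushforward (gtop G) (src G) f z - pushforward (gtop G) (rng G) f z)"

definition delta2 :: "'g top_groupoid \<Rightarrow> ('g \<times> 'g \<Rightarrow> int) \<Rightarrow> 'g \<Rightarrow> int" where
  "delta2 G f = (\<lambda>z. pushforward (pairs_top G) (\<lambda>(g, h). h) f z
                   - pushforward (pairs_top G) (\<lambda>(g, h). gmult G g h) f z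
                   + pushforward (pairs_top G) (\<lambda>(g, h). g) f z)"

definition H0 :: "'g top_groupoid \<Rightarrow> ('g \<Rightarrow> int) set monoid" where
  "H0 G = Cc (unit_top G) Mod (delta1 G ` carrier (Cc (gtop G)))"

definition cycles1 :: "'g top_groupoid \<Rightarrow> ('g \<Rightarrow> int) monoid" where
  "cycles1 G = (Cc (gtop G))
     \<lparr>carrier := kernel (Cc (gtop G)) (Cc (unit_top G)) (delta1 G)\<rparr>"

definition boundaries1 :: "'g top_groupoid \<Rightarrow> ('g \<Rightarrow> int) set" where
  "boundaries1 G = delta2 G ` carrier (Cc (pairs_top G))"

definition H1 :: "'g top_groupoid \<Rightarrow> ('g \<Rightarrow> int) set monoid" where
  "H1 G = cycles1 G Mod boundaries1 G"

text \<open>The representing set is unique when \<open>G\<close> is essentially principal.\<close>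

definition index_map :: "'g top_groupoid \<Rightarrow> ('g \<Rightarrow> 'g) \<Rightarrow> ('g \<Rightarrow> int) set" where
  "index_map G \<alpha> =
     boundaries1 G #>\<^bsub>cycles1 G\<^esub> (indicator (THE U. represents G U \<alpha>) :: 'g \<Rightarrow> int)"

definition full_group_0 :: "'g top_groupoid \<Rightarrow> ('g \<Rightarrow> 'g) monoid" where
  "full_group_0 G = (full_group G)\<lparr>carrier := kernel (full_group G) (H1 G) (index_map G)\<rparr>"


section \<open>One-sided shifts of finite type\<close>

text \<open>\<open>tail\<close> and \<open>head\<close> of an arc are its initial and its terminal vertex.\<close>

definition adjacency :: "('v, 'e) pre_digraph \<Rightarrow> 'v \<Rightarrow> 'v \<Rightarrow> nat" where
  "adjacency Q \<xi> \<eta> = card {e \<in> arcs Q. tail Q e = \<xi> \<and> head Q e = \<eta>}"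

text \<open>Square matrices with rows and columns indexed by a finite set \<open>V\<close> are functions
  \<open>'v \<Rightarrow> 'v \<Rightarrow> nat\<close>, of which only the values on \<open>V\<close> matter.\<close>

primrec mat_power :: "'v set \<Rightarrow> ('v \<Rightarrow> 'v \<Rightarrow> nat) \<Rightarrow> nat \<Rightarrow> 'v \<Rightarrow> 'v \<Rightarrow> nat" where
  "mat_power V M 0 = (\<lambda>\<xi> \<eta>. if \<xi> = \<eta> then 1 else 0)"
| "mat_power V M (Suc n) = (\<lambda>\<xi> \<eta>. \<Sum>\<zeta>\<in>V. mat_power V M n \<xi> \<zeta> * M \<zeta> \<eta>)"

definition irreducible_mat :: "'v set \<Rightarrow> ('v \<Rightarrow> 'v \<Rightarrow> nat) \<Rightarrow> bool" where
  "irreducible_mat V M \<longleftrightarrow> (\<forall>\<xi>\<in>V. \<forall>\<eta>\<in>V. \<exists>n\<ge>1. mat_power V M n \<xi> \<eta> > 0)"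

definition permutation_mat :: "'v set \<Rightarrow> ('v \<Rightarrow> 'v \<Rightarrow> nat) \<Rightarrow> bool" where
  "permutation_mat V M \<longleftrightarrow>
     (\<exists>p. p permutes V \<and> (\<forall>\<xi>\<in>V. \<forall>\<eta>\<in>V. M \<xi> \<eta> = (if \<eta> = p \<xi> then 1 else 0)))"

text \<open>Sequences are indexed from \<open>0\<close>; the exponents \<open>k\<close>, \<open>l\<close> below are positive.\<close>

definition shift_space :: "('v, 'e) pre_digraph \<Rightarrow> (nat \<Rightarrow> 'e) topology" where
  "shift_space Q = subtopology (product_topology (\<lambda>_. discrete_topology (arcs Q)) UNIV)
                     {x. \<forall>k. head Q (x k) = tail Q (x (Suc k))}"

definition shift :: "(nat \<Rightarrow> 'e) \<Rightarrow> nat \<Rightarrow> 'e" where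
  "shift x = (\<lambda>k. x (Suc k))"

type_synonym 'e sft_arrow = "(nat \<Rightarrow> 'e) \<times> int \<times> (nat \<Rightarrow> 'e)"

definition sft_basic_open ::
  "(nat \<Rightarrow> 'e) set \<Rightarrow> (nat \<Rightarrow> 'e) set \<Rightarrow> nat \<Rightarrow> nat \<Rightarrow> 'e sft_arrow set" where
  "sft_basic_open A B k l =
     {(x, int k - int l, y) | x y. x \<in> A \<and> y \<in> B \<and> (shift ^^ k) x = (shift ^^ l) y}"

definition sft_groupoid :: "('v, 'e) pre_digraph \<Rightarrow> 'e sft_arrow top_groupoid" where
  "sft_groupoid Q =
     \<lparr>gtop = topology_generated_by
        {sft_basic_open A B k l | A B k l.
           openin (shift_space Q) A \<and> openin (shift_space Q) B \<and> k \<ge> 1 \<and> l \<ge> 1},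
      gmult = (\<lambda>(x, n, y) (y', n', z). (x, n + n', z)),
      ginv = (\<lambda>(x, n, y). (y, - n, x))\<rparr>"

definition sft_unit :: "(nat \<Rightarrow> 'e) \<Rightarrow> 'e sft_arrow" where
  "sft_unit x = (x, 0, x)"

lemma topspace_shift_space:
  "topspace (shift_space Q) = {x. \<forall>k. x k \<in> arcs Q \<and> head Q (x k) = tail Q (x (Suc k))}"
  by (auto simp: shift_space_def PiE_iff)

lemma topspace_sft_groupoid:
  "topspace (gtop (sft_groupoid Q)) =
     {(x, n, y). x \<in> topspace (shift_space Q) \<and> y \<in> topspace (shift_space Q) \<and>
        (\<exists>k\<ge>1. \<exists>l\<ge>1. n = int k - int l \<and> (shift ^^ k) x = (shift ^^ l) y)}"
  (is "_ = ?R")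
proof -
  have "topspace (gtop (sft_groupoid Q)) = \<Union> {sft_basic_open A B k l | A B k l.
           openin (shift_space Q) A \<and> openin (shift_space Q) B \<and> k \<ge> 1 \<and> l \<ge> 1}"
    by (simp add: sft_groupoid_def topology_generated_by_topspace)
  also have "\<dots> = ?R"
  proof (intro subset_antisym subsetI)
    fix g assume "g \<in> \<Union> {sft_basic_open A B k l | A B k l.
           openin (shift_space Q) A \<and> openin (shift_space Q) B \<and> k \<ge> 1 \<and> l \<ge> 1}"
    then obtain A B k l where "openin (shift_space Q) A" "openin (shift_space Q) B"
      "k \<ge> 1" "l \<ge> 1" "g \<in> sft_basic_open A B k l" by blast
    then show "g \<in> ?R"
      using openin_subset by (fastforce simp: sft_basic_open_def)
  next
    fix g assume "g \<in> ?R"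
    then obtain x k l y where "g = (x, int k - int l, y)" "x \<in> topspace (shift_space Q)"
      "y \<in> topspace (shift_space Q)" "k \<ge> 1" "l \<ge> 1" "(shift ^^ k) x = (shift ^^ l) y"
      by auto
    then have "g \<in> sft_basic_open (topspace (shift_space Q)) (topspace (shift_space Q)) k l"
      "k \<ge> 1" "l \<ge> 1"
      by (auto simp: sft_basic_open_def)
    then show "g \<in> \<Union> {sft_basic_open A B k l | A B k l.
           openin (shift_space Q) A \<and> openin (shift_space Q) B \<and> k \<ge> 1 \<and> l \<ge> 1}"
      by blast
  qed
  finally show ?thesis .
qed

lemma src_sft_groupoid [simp]: "src (sft_groupoid Q) (x, n, y) = sft_unit y"
  and rng_sft_groupoid [simp]: "rng (sft_groupoid Q) (x, n, y) = sft_unit x"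
  by (simp_all add: src_def rng_def sft_groupoid_def sft_unit_def)

lemma units_sft_groupoid: "units (sft_groupoid Q) = sft_unit ` topspace (shift_space Q)"
proof -
  have "sft_unit x \<in> topspace (gtop (sft_groupoid Q))" if "x \<in> topspace (shift_space Q)" for x
    using that by (auto simp: topspace_sft_groupoid sft_unit_def)
  then show ?thesis
    by (force simp: units_def topspace_sft_groupoid sft_unit_def image_iff
        simp flip: sft_unit_def)
qed

end

theory Submission
 imports Defs "HOL-Library.Z2" "HOL-Library.Sublist" "HOL-Library.Multiset"
begin

text \<open>
 An element of the topological full group is given by a table: a bijection between two partitions
 of \<open>Y\<close> into cylinder sets that replaces each prefix by one with the same last arc (its type).
 Comparing how often words of each type are expanded when a common partition is refined to the two
 sides of a table gives an integer vector that is fixed by the adjacency matrix. It vanishes exactly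
 on the kernel of the index map, and elements for which it vanishes are products of transpositions
 of disjoint cylinder sets of the same type.

 Modulo commutators a transposition depends only on its type, has order two, and is the product of
 the transpositions of its children. This bounds the kernel of the index map modulo commutators from
 above by the tensor product with the cyclic group of order two. A sign, which counts inversions of
 the lexicographic order weighted by coordinates of the types, shows that nothing else collapses.

 Two elements of a group of this kind commute modulo every nontrivial normal subgroup, because they
 can be compressed into disjoint sets by conjugation. If the zeroth homology group is
 \<open>2\<close>-divisible, then the identity minus the adjacency matrix is invertible modulo \<open>2\<close>, hence
 injective over the integers by descent, and the group is perfect.
\<close>

section \<open>Words and cylinder sets\<close>

text \<open>Two elements that together move every point cannot be compressed at the same time, and
  transpositions are compared modulo commutators through a cylinder that both leave free. Both
  obstacles are met in the same way: an element is split into factors each of which fixes a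
  cylinder, usually after correction by a swap. This is why \<open>TN\<close> consists of products
  of two factors with separate free cylinders, and why the commutation argument needs four disjoint
  words inside one.

  A bijection of infinitely many points has no sign of its own. The lexicographic order supplies
  one, because a table is increasing on each of its cylinders, so that only inversions between
  different cylinders count.

  Essential principality enters as uniqueness of the length difference of a table on a cylinder. The
  index is computed in the first homology of the whole groupoid also for elements supported in
  \<open>Y\<close>; only its kernel is compared with that of the index map of the reduction.\<close>

definition pfx :: "(nat => 'a) => nat => 'a list" where
 "pfx x n = map x [0..<n]"

text \<open>Prefix replacement as a total function: the first \<open>length w\<close> letters of
  \<open>x\<close> are dropped without being inspected, so that \<open>rp_trans\<close> holds for
  all sequences and composition needs no case distinction.\<close>

definition rp :: "'a list => 'a list => (nat => 'a) => nat => 'a" where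
 "rp w v x = (%i. if i < length v then v ! i else x (i - length v + length w))"

lemma length_pfx [simp]: "length (pfx x n) = n"
 by (simp add: pfx_def)

lemma nth_pfx [simp]: "i < n ==> pfx x n ! i = x i"
 by (simp add: pfx_def)

lemma pfx_0 [simp]: "pfx x 0 = []"
 by (simp add: pfx_def)

lemma pfx_eq_Nil [simp]: "pfx x n = [] \<longleftrightarrow> n = 0"
 by (simp add: pfx_def)

lemma last_pfx: "n > 0 ==> last (pfx x n) = x (n - 1)"
 by (simp add: last_conv_nth)

lemma pfx_eq_iff: "pfx x n = w \<longleftrightarrow> length w = n & (\<forall>i<n. x i = w ! i)"
 by (auto simp: list_eq_iff_nth_eq)

lemma pfx_Suc: "pfx x (Suc n) = pfx x n @ [x n]"
 by (simp add: pfx_def)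

lemma pfx_add: "pfx x (m + n) = pfx x m @ pfx (%i. x (m + i)) n"
 by (auto simp: list_eq_iff_nth_eq nth_append)

lemma take_pfx: "m \<le> n ==> take m (pfx x n) = pfx x m"
 by (simp add: list_eq_iff_nth_eq)

lemma prefix_pfx: "m \<le> n ==> prefix (pfx x m) (pfx x n)"
 by (metis take_pfx take_is_prefix)

lemma rp_trans: "rp v u (rp w v x) = rp w u x"
proof
 fix i show "rp v u (rp w v x) i = rp w u x i"
  by (cases "i < length u") (auto simp: rp_def)
qed

lemma pfx_rp: "pfx (rp w v x) (length v) = v"
 by (simp add: pfx_eq_iff rp_def)

lemma funpow_shift: "(shift ^^ n) x = (%i. x (i + n))"
 by (induction n arbitrary: x) (auto simp: shift_def funpow_swap1)

text \<open>The graph enters only through its arcs. Connectedness uses the proper transitive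
  closure, so that every arc also has a successor; \<open>branching\<close> is what remains of the
  assumption that the matrix is not a permutation matrix.\<close>

locale sft =
 fixes Q :: "('v, 'e) pre_digraph"
 assumes finite_arcs: "finite (arcs Q)"
  and arcs_connected: "!!e f. e \<in> arcs Q ==> f \<in> arcs Q ==>
   (e, f) \<in> {(a, b). a \<in> arcs Q & b \<in> arcs Q & tail Q b = head Q a}\<^sup>+"
  and branching: "\<exists>e\<in>arcs Q. \<exists>f\<in>arcs Q. \<exists>g\<in>arcs Q.
   tail Q f = head Q e & tail Q g = head Q e & f ~= g"
begin

abbreviation "X \<equiv> topspace (shift_space Q)"

definition nx :: "'e => 'e set" where
 "nx e = {f \<in> arcs Q. tail Q f = head Q e}"

text \<open>Words are nonempty so that the last arc, on which all possible continuations depend, is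
  always defined.\<close>

definition words :: "'e list set" where
 "words = {w. w ~= [] & set w \<subseteq> arcs Q & successively (%e f. f \<in> nx e) w}"

definition cyl :: "'e list => (nat => 'e) set" where
 "cyl w = {x \<in> X. pfx x (length w) = w}"

definition children :: "'e list => 'e list set" where
 "children w = (%f. w @ [f]) ` nx (last w)"

lemma X_iff: "x \<in> X \<longleftrightarrow> (\<forall>k. x k \<in> arcs Q & x (Suc k) \<in> nx (x k))"
 by (auto simp: topspace_shift_space nx_def)

lemma nx_arcs: "f \<in> nx e ==> f \<in> arcs Q"
 by (simp add: nx_def)

lemma finite_nx [simp]: "finite (nx e)"
 by (simp add: nx_def finite_arcs)

lemma nx_nonempty: "e \<in> arcs Q ==> nx e ~= {}"
 using arcs_connected[of e e] by (auto simp: nx_def dest!: tranclD)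

lemma words_nonempty [simp]: "[] \<notin> words"
 by (simp add: words_def)

lemma last_in_arcs: "w \<in> words ==> last w \<in> arcs Q"
 by (auto simp: words_def)

lemma single_word: "e \<in> arcs Q ==> [e] \<in> words"
 by (simp add: words_def)

lemma words_snoc: "w \<in> words ==> w @ [f] \<in> words \<longleftrightarrow> f \<in> nx (last w)"
 by (auto simp: words_def successively_append_iff nx_arcs)

lemma words_append:
 "w \<in> words ==> w @ p \<in> words \<longleftrightarrow> p = [] \<or> p \<in> words & hd p \<in> nx (last w)"
 by (auto simp: words_def successively_append_iff)

lemma words_appendD: "w @ p \<in> words ==> w ~= [] ==> w \<in> words"
 by (auto simp: words_def successively_append_iff)

lemma words_append_last:
 assumes "w \<in> words" "v \<in> words" "last w = last v"
 shows "w @ p \<in> words \<longleftrightarrow> v @ p \<in> words" and "last (w @ p) = last (v @ p)"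
 using assms by (auto simp: words_append last_append)

lemma children_words: "w \<in> words ==> children w \<subseteq> words"
 by (auto simp: children_def words_snoc)

lemma finite_children [simp]: "finite (children w)"
 by (simp add: children_def)

lemma pfx_words: "x \<in> X ==> n > 0 ==> pfx x n \<in> words"
proof (induction n)
 case (Suc n)
 then show ?case
 proof (cases "n = 0")
  case True
  with Suc show ?thesis by (simp add: pfx_Suc words_def X_iff)
 next
  case False
  then obtain m where "n = Suc m" by (cases n) auto
  with Suc False have "pfx x n \<in> words" "x n \<in> nx (last (pfx x n))"
   by (auto simp: last_pfx X_iff)
  then show ?thesis by (simp add: pfx_Suc words_snoc)
 qed
qed simp

lemma cylI: "x \<in> X ==> pfx x (length w) = w ==> x \<in> cyl w"
 by (simp add: cyl_def)

lemma cyl_X: "x \<in> cyl w ==> x \<in> X"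
 by (simp add: cyl_def)

lemma cyl_subset_X: "cyl w \<subseteq> X"
 by (auto simp: cyl_def)

lemma cyl_nth: "x \<in> cyl w ==> i < length w ==> x i = w ! i"
 by (auto simp: cyl_def pfx_eq_iff)

lemma in_cyl_pfx [simp]: "x \<in> X ==> x \<in> cyl (pfx x n)"
 by (simp add: cyl_def)

lemma cyl_pfx: "x \<in> cyl w ==> pfx x (length w) = w"
 by (simp add: cyl_def)

lemma cyl_prefix: "prefix w v ==> cyl v \<subseteq> cyl w"
 by (auto simp: cyl_def prefix_def pfx_eq_iff nth_append)

lemma cyl_append_subset: "cyl (w @ p) \<subseteq> cyl w"
 by (rule cyl_prefix) simp

lemma cyl_meet: "x \<in> cyl w ==> x \<in> cyl v ==> length w \<le> length v ==> prefix w v"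
 by (metis cyl_pfx prefix_pfx)

lemma cyl_disjoint_iff:
 assumes "w \<in> words" "v \<in> words"
 shows "prefix w v \<or> prefix v w \<or> cyl w \<inter> cyl v = {}"
 using cyl_meet[of _ w v] cyl_meet[of _ v w] by (metis disjoint_iff nle_le)

lemma cyl_same_length: "length w = length v ==> w ~= v ==> cyl w \<inter> cyl v = {}"
 by (auto simp: cyl_def)

lemma exists_path: "e \<in> arcs Q ==> \<exists>x\<in>X. x 0 = e"
proof -
 assume e: "e \<in> arcs Q"
 define x where "x = rec_nat e (%_ a. SOME f. f \<in> nx a)"
 have "x k \<in> arcs Q & x (Suc k) \<in> nx (x k)" for k
 proof (induction k)
  case 0
  show ?case using e nx_nonempty[OF e] by (simp add: x_def some_in_eq)
 next
  case (Suc k)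
  then have "x (Suc k) \<in> arcs Q" by (blast dest: nx_arcs)
  then show ?case using nx_nonempty[of "x (Suc k)"] by (simp add: x_def some_in_eq)
 qed
 then show ?thesis by (intro bexI[of _ x]) (auto simp: X_iff x_def)
qed

text \<open>Which letters may follow a word depends only on its last arc, so the tail after
  \<open>w\<close> may also follow \<open>v\<close>. The delicate position is the last letter of
  \<open>v\<close>, where the new prefix meets the old tail.\<close>

lemma rp_in_cyl:
 assumes v: "v \<in> words" and w: "w ~= []" "last w = last v" and x: "x \<in> cyl w"
 shows "rp w v x \<in> cyl v"
proof (rule cylI)
 have xX: "x \<in> X" using x by (rule cyl_X)
 have v0: "v ~= []" using v by auto
 have step: "v ! Suc k \<in> nx (v ! k)" if "Suc k < length v" for k
 proof -
  have "v = take (Suc k) v @ drop (Suc k) v" by simp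
  with v have "successively (%e f. f \<in> nx e) (take (Suc k) v @ drop (Suc k) v)"
   by (simp add: words_def)
  with that have "hd (drop (Suc k) v) \<in> nx (last (take (Suc k) v))"
   using v0 by (subst (asm) successively_append_iff) auto
  with that show ?thesis by (simp add: hd_drop_conv_nth take_Suc_conv_app_nth)
 qed
 have arc: "v ! k \<in> arcs Q" if "k < length v" for k
  using v that by (auto simp: words_def)
 have lst: "x (length w - 1) = v ! (length v - 1)"
  using cyl_nth[OF x, of "length w - 1"] w v0 by (simp add: last_conv_nth)
 show "rp w v x \<in> X" unfolding X_iff
 proof (intro allI conjI)
  fix k
  show "rp w v x k \<in> arcs Q" using arc xX by (auto simp: rp_def X_iff)
  consider "Suc k < length v" | "Suc k = length v" | "length v \<le> k" by linarith
  then show "rp w v x (Suc k) \<in> nx (rp w v x k)"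
  proof cases
   case 1
   then show ?thesis using step by (simp add: rp_def)
  next
   case 2
   then have "rp w v x k = x (length w - 1)" using lst by (simp add: rp_def flip: 2)
   moreover have "rp w v x (Suc k) = x (Suc (length w - 1))"
    using 2 w by (simp add: rp_def)
   ultimately show ?thesis using xX by (auto simp: X_iff)
  next
   case 3
   then show ?thesis using xX by (simp add: rp_def X_iff Suc_diff_le)
  qed
 qed
qed (rule pfx_rp)

lemma rp_id: "x \<in> cyl w ==> rp w w x = x"
 by (auto simp: rp_def fun_eq_iff cyl_nth)

lemma rp_append:
 assumes x: "x \<in> cyl (w @ p)" shows "rp (w @ p) (v @ p) x = rp w v x"
proof
 fix i
 consider "i < length v" | "length v \<le> i" "i < length (v @ p)" | "length (v @ p) \<le> i"
  by linarith
 then show "rp (w @ p) (v @ p) x i = rp w v x i"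
 proof cases
  case 2
  then have "x (i - length v + length w) = (w @ p) ! (length w + (i - length v))"
   using cyl_nth[OF x, of "length w + (i - length v)"] by (simp add: add.commute)
  then have "x (i - length v + length w) = p ! (i - length v)"
   by (simp only: nth_append_length_plus)
  with 2 show ?thesis by (simp add: rp_def nth_append)
 next
  case 3
  then have "i - length (v @ p) + length (w @ p) = i - length v + length w" by simp
  with 3 show ?thesis by (simp add: rp_def)
 qed (simp add: rp_def nth_append)
qed

lemma rp_image:
 assumes "v \<in> words" "w \<in> words" "last w = last v"
 shows "rp w v ` cyl w = cyl v"
proof
 show "rp w v ` cyl w \<subseteq> cyl v" using assms rp_in_cyl by (metis image_subsetI words_nonempty)
 show "cyl v \<subseteq> rp w v ` cyl w"
 proof
  fix y assume y: "y \<in> cyl v"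
  moreover have "v ~= []" using assms by auto
  ultimately have "rp v w y \<in> cyl w" "rp w v (rp v w y) = y"
   using assms rp_in_cyl[of w v y] by (auto simp: rp_trans rp_id)
  then show "y \<in> rp w v ` cyl w" by force
 qed
qed

lemma rp_inj: "inj_on (rp w v) (cyl w)"
 by (metis inj_onI rp_id rp_trans)

lemma cyl_nonempty: "w \<in> words ==> cyl w ~= {}"
proof -
 assume w: "w \<in> words"
 obtain x where "x \<in> X" "x 0 = last w" using exists_path[OF last_in_arcs[OF w]] by auto
 then have "x \<in> cyl [last w]" by (simp add: cyl_def pfx_def)
 then show ?thesis using rp_in_cyl[OF w, of "[last w]" x] by auto
qed

text \<open>Translates prefix replacement into the equation between shifts that defines the arrows
  of the groupoid.\<close>

lemma rp_shift:
 assumes "y \<in> cyl v" "x \<in> X"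
 shows "x = rp v w y \<longleftrightarrow> pfx x (length w) = w & (shift ^^ length w) x = (shift ^^ length v) y"
proof
 assume "x = rp v w y"
 then show "pfx x (length w) = w & (shift ^^ length w) x = (shift ^^ length v) y"
  by (simp add: pfx_rp) (simp add: funpow_shift rp_def fun_eq_iff)
next
 assume a: "pfx x (length w) = w & (shift ^^ length w) x = (shift ^^ length v) y"
 show "x = rp v w y"
 proof
  fix i
  show "x i = rp v w y i"
  proof (cases "i < length w")
   case True
   then show ?thesis using a by (simp add: rp_def pfx_eq_iff)
  next
   case False
   then have "x i = (shift ^^ length w) x (i - length w)" by (simp add: funpow_shift)
   also have "\<dots> = y (i - length w + length v)" using a by (simp add: funpow_shift)
   finally show ?thesis using False by (simp add: rp_def)
  qed
 qed
qed

lemma cyl_children: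
 assumes "w \<in> words"
 shows "cyl w = (\<Union>u\<in>children w. cyl u)"
proof
 show "cyl w \<subseteq> (\<Union>u\<in>children w. cyl u)"
 proof
  fix x assume x: "x \<in> cyl w"
  let ?n = "length w"
  have w0: "w ~= []" using assms by auto
  have "x \<in> X" using x by (rule cyl_X)
  have "x (?n - 1) = last w" using cyl_nth[OF x, of "?n - 1"] w0 by (simp add: last_conv_nth)
  then have "x ?n \<in> nx (last w)"
   using \<open>x \<in> X\<close> w0 by (metis X_iff Suc_diff_1 length_greater_0_conv)
  moreover have "x \<in> cyl (w @ [x ?n])"
   using x \<open>x \<in> X\<close> by (auto simp: cyl_def pfx_Suc)
  ultimately show "x \<in> (\<Union>u\<in>children w. cyl u)" by (auto simp: children_def)
 qed
 show "(\<Union>u\<in>children w. cyl u) \<subseteq> cyl w"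
  using cyl_append_subset by (auto simp: children_def)
qed

lemma children_disjoint:
 "u \<in> children w ==> v \<in> children w ==> u ~= v ==> cyl u \<inter> cyl v = {}"
 by (rule cyl_same_length) (auto simp: children_def)

lemma sum_children: "(\<Sum>u\<in>children w. g u) = (\<Sum>f\<in>nx (last w). g (w @ [f]))"
 unfolding children_def by (subst sum.reindex) (auto simp: inj_on_def)

section \<open>The topology of the shift space\<close>

lemma openin_cyl: "openin (shift_space Q) (cyl w)"
proof -
 have "openin (product_topology (%_. discrete_topology (arcs Q)) UNIV)
     (PiE UNIV (%i. if i < length w then {w ! i} \<inter> arcs Q else arcs Q))"
  by (rule product_topology_basis) (auto simp: finite_subset[of _ "{..<length w}"] subset_iff)
 moreover have "cyl w = PiE UNIV (%i. if i < length w then {w ! i} \<inter> arcs Q else arcs Q)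
   \<inter> {x. \<forall>k. head Q (x k) = tail Q (x (Suc k))}"
  by (auto simp: cyl_def topspace_shift_space pfx_eq_iff PiE_iff split: if_splits) metis+
 ultimately show ?thesis
  unfolding shift_space_def openin_subtopology by blast
qed

lemma openin_shift_iff:
 "openin (shift_space Q) S \<longleftrightarrow> S \<subseteq> X & (\<forall>x\<in>S. \<exists>n. cyl (pfx x n) \<subseteq> S)"
proof (intro iffI conjI ballI)
 assume S: "openin (shift_space Q) S"
 then show "S \<subseteq> X" by (rule openin_subset)
 fix x assume x: "x \<in> S"
 from S obtain T where T: "openin (product_topology (%_. discrete_topology (arcs Q)) UNIV) T"
  "S = T \<inter> {x. \<forall>k. head Q (x k) = tail Q (x (Suc k))}"
  unfolding shift_space_def openin_subtopology by blast
 from product_topology_open_contains_basis[OF T(1), of x] x T(2)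
 obtain U where U: "x \<in> PiE UNIV U" "finite {i. U i ~= arcs Q}" "PiE UNIV U \<subseteq> T"
  by auto
 obtain n where n: "{i. U i ~= arcs Q} \<subseteq> {..<n}"
  using U(2) finite_nat_bounded by blast
 have "y \<in> S" if y: "y \<in> cyl (pfx x n)" for y
 proof -
  have "y i \<in> U i" for i
  proof (cases "i < n")
   case True
   then have "y i = x i" using cyl_nth[OF y, of i] by simp
   then show ?thesis using U(1) by (auto simp: PiE_iff)
  next
   case False
   then have "U i = arcs Q" using n by auto
   then show ?thesis using cyl_X[OF y] by (simp add: X_iff)
  qed
  then have "y \<in> T" using U(3) by (auto simp: PiE_iff)
  with cyl_X[OF y] show ?thesis by (auto simp: T(2) topspace_shift_space)
 qed
 then show "\<exists>n. cyl (pfx x n) \<subseteq> S" by blast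
next
 assume S: "S \<subseteq> X & (\<forall>x\<in>S. \<exists>n. cyl (pfx x n) \<subseteq> S)"
 then have "S = \<Union> {cyl w | w. cyl w \<subseteq> S}"
  using in_cyl_pfx by blast
 moreover have "openin (shift_space Q) (\<Union> {cyl w | w. cyl w \<subseteq> S})"
  using openin_cyl by (intro openin_Union) blast
 ultimately show "openin (shift_space Q) S" by simp
qed

lemma openin_shiftD: "openin (shift_space Q) S ==> x \<in> S ==> \<exists>n. cyl (pfx x n) \<subseteq> S"
 by (simp only: openin_shift_iff)

text \<open>A violation of the path condition at position \<open>k\<close> is decided by two
  letters, so \<open>X\<close> is closed in a product of finite discrete spaces.\<close>

lemma compact_shift_space: "compact_space (shift_space Q)"
proof -
 let ?P = "product_topology (%_. discrete_topology (arcs Q)) (UNIV :: nat set)"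
 let ?C = "{x. \<forall>k. head Q (x k) = tail Q (x (Suc k))}"
 have "compact_space ?P"
  by (simp add: compact_space_product_topology compact_space_discrete_topology finite_arcs)
 moreover have "closedin ?P (topspace ?P \<inter> ?C)"
 proof -
  have "openin ?P (topspace ?P - ?C)"
  proof (subst openin_subopen, intro ballI)
   fix x assume x: "x \<in> topspace ?P - ?C"
   then obtain k where k: "head Q (x k) ~= tail Q (x (Suc k))" by auto
   let ?U = "%i. if i < k + 2 then {x i} else arcs Q"
   have "openin ?P (PiE UNIV ?U)"
    using x by (intro product_topology_basis)
     (auto simp: PiE_iff finite_subset[of _ "{..<k+2}"] subset_iff)
   moreover have "x \<in> PiE UNIV ?U" using x by (auto simp: PiE_iff)
   moreover have "PiE UNIV ?U \<subseteq> topspace ?P - ?C"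
   proof
    fix y assume y: "y \<in> PiE UNIV ?U"
    then have U: "y i \<in> ?U i" for i by (auto simp: PiE_iff)
    have "y i \<in> arcs Q" for i using U[of i] x by (auto split: if_splits)
    moreover
    from U[of k] U[of "Suc k"] have "y k = x k" "y (Suc k) = x (Suc k)" by auto
    ultimately show "y \<in> topspace ?P - ?C" using k by (auto intro!: exI[of _ k])
   qed
   ultimately show "\<exists>T. openin ?P T & x \<in> T & T \<subseteq> topspace ?P - ?C" by blast
  qed
  then show ?thesis by (simp add: closedin_def Diff_Int)
 qed
 ultimately have "compactin ?P (topspace ?P \<inter> ?C)" by (rule closedin_compact_space)
 then have "compact_space (subtopology ?P (topspace ?P \<inter> ?C))"
  by (simp add: compact_space_subtopology)
 moreover have "shift_space Q = subtopology ?P (topspace ?P \<inter> ?C)"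
  unfolding shift_space_def by (rule subtopology_restrict [symmetric])
 ultimately show ?thesis by (simp only:)
qed

text \<open>Finitely many good cylinders cover \<open>X\<close> by compactness, and any length
  beyond those of their words works for all sequences. Uniform tables and levels of clopen sets come
  from this.\<close>

lemma uniform_prefix:
 assumes ex: "!!x. x \<in> X ==> \<exists>n. P (pfx x n)"
  and mono: "!!w p. P w ==> P (w @ p)"
 shows "\<exists>L. \<forall>x\<in>X. \<forall>n\<ge>L. P (pfx x n)"
proof -
 define \<C> where "\<C> = {cyl w | w. P w}"
 have op: "!!C. C \<in> \<C> ==> openin (shift_space Q) C" using openin_cyl by (auto simp: \<C>_def)
 have cov: "X \<subseteq> \<Union>\<C>"
 proof
  fix x assume x: "x \<in> X"
  then obtain n where "P (pfx x n)" using ex by auto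
  then have "cyl (pfx x n) \<in> \<C>" by (auto simp: \<C>_def)
  then show "x \<in> \<Union>\<C>" using in_cyl_pfx[OF x] by blast
 qed
 from compact_shift_space have "compactin (shift_space Q) X" by (simp add: compact_space_def)
 then have "\<exists>\<F>. finite \<F> & \<F> \<subseteq> \<C> & X \<subseteq> \<Union>\<F>"
  using op cov unfolding compactin_def by (meson subset_eq)
 then obtain \<F> where \<F>: "finite \<F>" "\<F> \<subseteq> \<C>" "X \<subseteq> \<Union>\<F>" by auto
 have "\<F> \<subseteq> cyl ` {w. P w}" using \<F>(2) by (auto simp: \<C>_def)
 from finite_subset_image[OF \<F>(1) this] obtain V
  where V: "finite V" "\<F> = cyl ` V" "\<forall>w\<in>V. P w" by blast
 obtain L where L: "length ` V \<subseteq> {..<L}" using finite_nat_bounded[of "length ` V"] V(1) by auto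
 show ?thesis
 proof (intro exI[of _ L] ballI allI impI)
  fix x n assume "x \<in> X" and n: "L \<le> n"
  then obtain w where w: "w \<in> V" "x \<in> cyl w" using \<F>(3) V(2) by auto
  then have "prefix w (pfx x n)"
   using L n cyl_pfx[OF w(2)] prefix_pfx[of "length w" n x] by fastforce
  then show "P (pfx x n)" using V(3) w(1) mono by (auto simp: prefix_def)
 qed
qed

text \<open>A clopen set as a union of cylinders of words of length \<open>L\<close>;
  \<open>L \<ge> 1\<close> makes these prefixes words.\<close>

definition clop :: "(nat => 'e) set => nat => bool" where
 "clop S L \<longleftrightarrow> S \<subseteq> X & L \<ge> 1 & (\<forall>x\<in>S. cyl (pfx x L) \<subseteq> S)"

lemma clopen_level:
 assumes "openin (shift_space Q) S" "closedin (shift_space Q) S"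
 obtains L where "clop S L"
proof -
 have S: "S \<subseteq> X" using assms(1) by (rule openin_subset)
 define P where "P w \<longleftrightarrow> cyl w \<subseteq> S \<or> cyl w \<subseteq> X - S" for w
 have ex: "\<exists>n. P (pfx x n)" if x: "x \<in> X" for x
 proof (cases "x \<in> S")
  case True
  from openin_shiftD[OF assms(1) this] show ?thesis unfolding P_def by (elim exE) (rule exI, erule disjI1)
 next
  case False
  with x have "x \<in> X - S" by simp
  moreover have "openin (shift_space Q) (X - S)" using assms(2) by (simp add: closedin_def)
  ultimately have "\<exists>n. cyl (pfx x n) \<subseteq> X - S" by (intro openin_shiftD)
  then show ?thesis unfolding P_def by (elim exE) (rule exI, erule disjI2)
 qed
 have mono: "P (w @ p)" if "P w" for w p
  using that cyl_append_subset[of w p] unfolding P_def by blast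
 obtain L where L: "\<forall>x\<in>X. \<forall>n\<ge>L. P (pfx x n)"
  using uniform_prefix[of P, OF ex mono] by (rule exE)
 have "clop S (Suc L)" unfolding clop_def
 proof (intro conjI ballI)
  fix x assume x: "x \<in> S"
  then have "x \<in> cyl (pfx x (Suc L))" using S by auto
  moreover have "P (pfx x (Suc L))" using L[rule_format, OF subsetD[OF S x], of "Suc L"] by simp
  ultimately show "cyl (pfx x (Suc L)) \<subseteq> S" using x unfolding P_def by blast
 qed (use S in auto)
 then show ?thesis by (rule that)
qed

lemma clopD:
 assumes "clop S L" "x \<in> S" "y \<in> cyl (pfx x L)" shows "y \<in> S"
proof -
 have "\<forall>x\<in>S. cyl (pfx x L) \<subseteq> S" using assms(1) unfolding clop_def by (elim conjE)
 then have "cyl (pfx x L) \<subseteq> S" using assms(2) by (rule bspec)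
 then show ?thesis using assms(3) by (rule subsetD)
qed

lemma clopI:
 assumes "S \<subseteq> X" "L \<ge> 1" "!!x y. x \<in> S ==> y \<in> cyl (pfx x L) ==> y \<in> S"
 shows "clop S L"
 unfolding clop_def
proof (intro conjI ballI)
 show "cyl (pfx x L) \<subseteq> S" if "x \<in> S" for x using assms(3)[OF that] by (rule subsetI)
qed (use assms in auto)

lemma clop_X_level: "clop S L ==> S \<subseteq> X" "clop S L ==> L \<ge> 1"
 by (simp_all add: clop_def)

lemma clop_mono: "clop S L ==> L \<le> L' ==> clop S L'"
proof (rule clopI)
 fix x y assume "clop S L" "L \<le> L'" "x \<in> S" "y \<in> cyl (pfx x L')"
 then show "y \<in> S" using clopD[of S L x y] cyl_prefix[OF prefix_pfx[of L L' x]] by blast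
qed (auto simp: clop_def)

lemma clop_cyl: "w \<in> words ==> clop (cyl w) (length w)"
proof (rule clopI)
 assume "w \<in> words" then have "w ~= []" by auto
 then show "1 \<le> length w" by (simp add: Suc_le_eq)
qed (simp_all add: cyl_pfx cyl_subset_X)

lemma clop_X: "clop X 1"
 by (rule clopI) (simp_all add: cyl_X)

lemma clop_diff:
 assumes S: "clop S L" and T: "clop T L" shows "clop (S - T) L"
proof (rule clopI)
 fix x y assume x: "x \<in> S - T" and y: "y \<in> cyl (pfx x L)"
 have "pfx y L = pfx x L" using cyl_pfx[OF y] by simp
 then have "x \<in> cyl (pfx y L)" using x clop_X_level(1)[OF S] by (auto simp: cyl_def)
 then show "y \<in> S - T" using clopD[OF T, of y x] clopD[OF S, of x y] x y by blast
qed (use clop_X_level[OF S] in auto)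

lemma clop_Un: "clop S L ==> clop T L ==> clop (S \<union> T) L"
proof (rule clopI)
 fix x y assume "clop S L" "clop T L" "x \<in> S \<union> T" "y \<in> cyl (pfx x L)"
 then show "y \<in> S \<union> T" using clopD[of S L x y] clopD[of T L x y] by blast
qed (simp_all add: clop_def)

end

section \<open>Groups of table maps\<close>

context sft
begin

definition tb :: "((nat => 'e) => nat => 'e) => 'e list => 'e list => bool" where
 "tb a w v \<longleftrightarrow> w \<in> words & v \<in> words & last w = last v & (\<forall>x\<in>cyl w. a x = rp w v x)"

lemma tbD: assumes "tb a w v"
 shows "w \<in> words" "v \<in> words" "last w = last v" "!!x. x \<in> cyl w ==> a x = rp w v x"
 using assms by (auto simp: tb_def)

lemma tb_in_cyl: "tb a w v ==> x \<in> cyl w ==> a x \<in> cyl v"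
 using rp_in_cyl[of v w x] by (metis tb_def words_nonempty)

lemma tb_image: "tb a w v ==> a ` cyl w = cyl v"
 using rp_image[of v w] by (simp add: tb_def)

lemma tb_append: "tb a w v ==> w @ p \<in> words ==> tb a (w @ p) (v @ p)"
 using words_append_last[of w v p] cyl_append_subset[of w p] rp_append[of _ w p v]
 by (auto simp: tb_def)

lemma tb_comp: assumes "tb a w v" "tb b v u" shows "tb (b \<circ> a) w u"
 using assms tb_in_cyl[OF assms(1)] by (auto simp: tb_def rp_trans)

lemma tb_id: "w \<in> words ==> tb id w w"
 by (simp add: tb_def rp_id)

lemma tb_cong: "tb a w v ==> (!!x. x \<in> cyl w ==> b x = a x) ==> tb b w v"
 by (simp add: tb_def)

lemma tb_fix: "w \<in> words ==> (!!x. x \<in> cyl w ==> b x = x) ==> tb b w w"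
 by (simp add: tb_def rp_id)

lemma tb_rp: "w \<in> words ==> v \<in> words ==> last w = last v ==> tb (rp w v) w v"
 by (simp add: tb_def)

lemma tb_inverse:
 assumes "tb a w v" "!!x. x \<in> cyl w ==> b (a x) = x" shows "tb b v w"
proof -
 have "b y = rp v w y" if y: "y \<in> cyl v" for y
 proof -
  have "rp v w y \<in> cyl w" using assms(1) y rp_in_cyl[of w v y] by (metis tb_def words_nonempty)
  moreover have "rp w v (rp v w y) = y" using y by (simp add: rp_trans rp_id)
  ultimately show ?thesis using assms by (metis tb_def)
 qed
 then show ?thesis using assms(1) by (auto simp: tb_def)
qed

lemma tb_refine:
 assumes "tb a w v" "x \<in> cyl w" "a x \<in> cyl (v @ p)" "v @ p \<in> words"
 shows "x \<in> cyl (w @ p)" "tb a (w @ p) (v @ p)"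
proof -
 have wp: "w @ p \<in> words" "last (w @ p) = last (v @ p)"
  using assms(1,4) words_append_last[of w v p] by (auto simp: tb_def)
 have "rp (v @ p) (w @ p) (a x) \<in> cyl (w @ p)"
  using rp_in_cyl[of "w @ p" "v @ p" "a x"] wp assms(3,4) by (metis words_nonempty)
 moreover have "rp (v @ p) (w @ p) (a x) = x"
  using assms(1-3) by (simp add: rp_append tb_def rp_trans rp_id)
 ultimately show "x \<in> cyl (w @ p)" by simp
 show "tb a (w @ p) (v @ p)" using assms(1) wp(1) by (rule tb_append)
qed

text \<open>Homeomorphisms of \<open>S\<close> are represented by bijections of all sequences that are the identity
 outside \<open>S\<close>, so that the groups for different \<open>S\<close> are contained in each other.\<close>

definition Gam :: "(nat => 'e) set => ((nat => 'e) => nat => 'e) set" where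
 "Gam S = {a. bij a & (\<forall>x. x \<notin> S --> a x = x) & (\<forall>x\<in>X. \<exists>n>0. \<exists>v. tb a (pfx x n) v)}"

definition GG :: "(nat => 'e) set => ((nat => 'e) => nat => 'e) monoid" where
 "GG S = \<lparr>carrier = Gam S, monoid.mult = (\<circ>), one = id\<rparr>"

lemma GamD: assumes "a \<in> Gam S"
 shows "bij a" "!!x. x \<notin> S ==> a x = x"
 using assms by (auto simp: Gam_def)

lemma Gam_inj: "a \<in> Gam S ==> a x = a y \<longleftrightarrow> x = y"
 by (auto simp: Gam_def bij_def inj_eq)

lemma Gam_mono: "S \<subseteq> T ==> Gam S \<subseteq> Gam T"
 by (auto simp: Gam_def)

lemma Gam_restrict: "a \<in> Gam S ==> (!!x. x \<in> C ==> a x = x) ==> a \<in> Gam (S - C)"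
 by (auto simp: Gam_def)

lemma Gam_tb:
 assumes "a \<in> Gam S" "x \<in> X"
 obtains n v where "n > 0" "n \<ge> N" "length v \<ge> N" "tb a (pfx x n) v"
proof -
 obtain n v where n: "n > 0" "tb a (pfx x n) v" using assms by (auto simp: Gam_def)
 define p where "p = pfx (%i. x (n + i)) N"
 have e: "pfx x (n + N) = pfx x n @ p" by (simp add: pfx_add p_def)
 have "tb a (pfx x (n + N)) (v @ p)"
  unfolding e by (rule tb_append[OF n(2)]) (use pfx_words[of x "n + N"] assms n(1) e in auto)
 then show ?thesis using n(1) by (intro that[of "n + N" "v @ p"]) (auto simp: p_def)
qed

lemma Gam_X: "a \<in> Gam S ==> x \<in> X ==> a x \<in> X"
 by (metis Gam_tb in_cyl_pfx tb_in_cyl cyl_X)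

lemma Gam_maps: "a \<in> Gam S ==> a x \<in> S \<longleftrightarrow> x \<in> S"
 by (metis GamD(2) Gam_inj)

lemma Gam_image: "a \<in> Gam S ==> a ` S = S"
 using Gam_maps[of a S] by (auto dest!: GamD(1)) (metis bij_pointE imageI)

lemma id_Gam [simp]: "id \<in> Gam S"
 unfolding Gam_def using pfx_words tb_id by fastforce

lemma comp_Gam:
 assumes a: "a \<in> Gam S" and b: "b \<in> Gam S" shows "b \<circ> a \<in> Gam S"
 unfolding Gam_def
proof (intro CollectI conjI allI impI ballI)
 show "bij (b \<circ> a)" using a b by (auto intro: bij_comp GamD)
 show "(b \<circ> a) x = x" if "x \<notin> S" for x using that a b by (simp add: GamD)
 fix x assume x: "x \<in> X"
 obtain n v where n: "n > 0" "tb a (pfx x n) v" using a x by (auto simp: Gam_def)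
 obtain m u where m: "m > 0" "m \<ge> length v" "tb b (pfx (a x) m) u"
  using Gam_tb[OF b Gam_X[OF a x], of "length v"] by blast
 have ax: "a x \<in> cyl v" using tb_in_cyl[OF n(2), of x] x by simp
 \<comment> \<open>\<open>m\<close> was chosen at least \<open>length v\<close>, so the prefix on
   which \<open>b\<close> is given extends \<open>v\<close>, and the excess \<open>p\<close> can be
   pulled back through \<open>a\<close>.\<close>
 have "prefix v (pfx (a x) m)" using m(2) cyl_pfx[OF ax] prefix_pfx by metis
 then obtain p where p: "pfx (a x) m = v @ p" by (auto simp: prefix_def)
 have "a x \<in> cyl (v @ p)" "v @ p \<in> words"
  using Gam_X[OF a x] tbD(1)[OF m(3)] by (simp_all flip: p)
 from tb_refine[OF n(2) _ this] x
 have "x \<in> cyl (pfx x n @ p)" "tb a (pfx x n @ p) (v @ p)" by auto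
 moreover from this(1) have "pfx x n @ p = pfx x (n + length p)" using cyl_pfx by fastforce
 ultimately have "tb (b \<circ> a) (pfx x (n + length p)) u" using m(3) p tb_comp by metis
 then show "\<exists>n>0. \<exists>v. tb (b \<circ> a) (pfx x n) v" using n(1) by (metis trans_less_add1)
qed

lemma inv_Gam:
 assumes a: "a \<in> Gam S" and S: "S \<subseteq> X" shows "inv_into UNIV a \<in> Gam S"
 unfolding Gam_def
proof (intro CollectI conjI allI impI ballI)
 have ba: "bij a" using a by (rule GamD)
 show "bij (inv_into UNIV a)" using ba by (rule bij_imp_bij_inv)
 show "inv_into UNIV a x = x" if "x \<notin> S" for x
  using that a GamD(2)[OF a] ba by (metis bij_inv_eq_iff)
 fix y assume y: "y \<in> X"
 define x where "x = inv_into UNIV a y"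
 have ax: "a x = y" using ba by (simp add: x_def bij_is_surj surj_f_inv_f)
 have x: "x \<in> X" using y S ax GamD(2)[OF a, of x] by (metis subsetD)
 obtain n v where n: "n > 0" "tb a (pfx x n) v" using a x by (auto simp: Gam_def)
 have "tb (inv_into UNIV a) v (pfx x n)"
  by (rule tb_inverse[OF n(2)]) (use ba in \<open>simp add: bij_is_inj\<close>)
 moreover have "v = pfx y (length v)" using tb_in_cyl[OF n(2)] x ax cyl_pfx by fastforce
 moreover have "length v > 0" using tbD(2)[OF n(2)] by (cases v) auto
 ultimately show "\<exists>n>0. \<exists>v. tb (inv_into UNIV a) (pfx y n) v" by metis
qed

lemma GG_simps [simp]:
 "carrier (GG S) = Gam S" "monoid.mult (GG S) = (\<circ>)" "one (GG S) = id"
 by (simp_all add: GG_def)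

lemma group_GG: "S \<subseteq> X ==> group (GG S)"
proof (rule groupI)
 assume S: "S \<subseteq> X"
 fix a assume a: "a \<in> carrier (GG S)"
 then show "\<exists>b\<in>carrier (GG S). b \<otimes>\<^bsub>GG S\<^esub> a = \<one>\<^bsub>GG S\<^esub>"
  using inv_Gam[of a S] S GamD(1)[of a S] by (auto intro!: bexI[of _ "inv_into UNIV a"] inv_o_cancel bij_is_inj)
qed (auto simp: comp_Gam o_assoc)

lemma inv_GG: "S \<subseteq> X ==> a \<in> Gam S ==> m_inv (GG S) a = inv_into UNIV a"
 using group.inv_equality[OF group_GG, of S "inv_into UNIV a" a] inv_Gam[of a S] GamD(1)[of a S]
 by (auto simp: inv_o_cancel bij_is_inj)

text \<open>Compactness makes the depth of the table uniform. The lower bound \<open>N\<close> on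
  the image words later lets image partitions refine a given partition, or feed into a second
  table.\<close>

lemma Gam_level:
 assumes a: "a \<in> Gam S"
 shows "\<exists>L. \<forall>x\<in>X. \<forall>n\<ge>L. \<exists>v. N \<le> length v & tb a (pfx x n) v"
proof -
 \<comment> \<open>Quantifying over all extensions makes \<open>P\<close> pass to extensions, as
   \<open>uniform_prefix\<close> requires.\<close>
 define P where "P w \<longleftrightarrow> w ~= [] & (\<forall>p. w @ p \<in> words --> (\<exists>v. N \<le> length v & tb a (w @ p) v))" for w
 have ex: "\<exists>n. P (pfx x n)" if x: "x \<in> X" for x
 proof -
  obtain n v where n: "n > 0" "N \<le> length v" "tb a (pfx x n) v" using Gam_tb[OF a x, of N] by metis
  have "\<exists>v. N \<le> length v & tb a (pfx x n @ p) v" if "pfx x n @ p \<in> words" for p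
   using tb_append[OF n(3) that] n(2) by (intro exI[of _ "v @ p"]) simp
  then have "P (pfx x n)" using n(1) by (simp add: P_def)
  then show ?thesis ..
 qed
 have mono: "P (w @ p)" if "P w" for w p using that by (auto simp: P_def)
 obtain L where L: "\<forall>x\<in>X. \<forall>n\<ge>L. P (pfx x n)"
  using uniform_prefix[of P, OF ex mono] by (rule exE)
 show ?thesis
 proof (intro exI[of _ L] ballI allI impI)
  fix x n assume x: "x \<in> X" and n: "L \<le> n"
  have "P (pfx x n)" using L x n by simp
  then have "n > 0" "\<forall>p. pfx x n @ p \<in> words --> (\<exists>v. N \<le> length v & tb a (pfx x n @ p) v)"
   unfolding P_def by simp_all
  then show "\<exists>v. N \<le> length v & tb a (pfx x n) v" using pfx_words[OF x] by (metis append_Nil2)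
 qed
qed

section \<open>Open sets and the involution of a partial map\<close>

definition opn :: "(nat => 'e) set => bool" where
 "opn S \<longleftrightarrow> (\<forall>x\<in>S. \<exists>n. cyl (pfx x n) \<subseteq> S)"

lemma opnD: "opn S ==> x \<in> S ==> \<exists>n. cyl (pfx x n) \<subseteq> S"
 by (simp only: opn_def)

lemma opn_clop: "clop S L ==> opn S"
 unfolding opn_def clop_def by (elim conjE) (intro ballI exI, erule bspec)

lemma opn_compl: "clop S L ==> opn (X - S)"
proof (rule opn_clop)
 assume "clop S L"
 moreover from this have "clop X L" using clop_mono[OF clop_X] by (simp add: clop_def)
 ultimately show "clop (X - S) L" by (intro clop_diff)
qed

lemma opn_Int: assumes "opn S" "opn T" shows "opn (S \<inter> T)"
 unfolding opn_def
proof
 fix x assume "x \<in> S \<inter> T"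
 then obtain m n where "cyl (pfx x m) \<subseteq> S" "cyl (pfx x n) \<subseteq> T"
  using opnD[OF assms(1), of x] opnD[OF assms(2), of x] by blast
 then have "cyl (pfx x (max m n)) \<subseteq> S \<inter> T"
  using cyl_prefix[OF prefix_pfx[of m "max m n" x]] cyl_prefix[OF prefix_pfx[of n "max m n" x]]
  by auto
 then show "\<exists>n. cyl (pfx x n) \<subseteq> S \<inter> T" ..
qed

lemma opn_tb:
 assumes "opn S" "S \<subseteq> X" and a: "!!x. x \<in> S ==> \<exists>n>0. \<exists>v. tb a (pfx x n) v" and x: "x \<in> S"
 obtains n v where "n > 0" "n \<ge> N" "tb a (pfx x n) v" "cyl (pfx x n) \<subseteq> S"
proof -
 obtain n v where n: "n > 0" "tb a (pfx x n) v" using a[OF x] by auto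
 obtain m where m: "cyl (pfx x m) \<subseteq> S" using opnD assms(1) x by meson
 define p where "p = pfx (%i. x (n + i)) (m + N)"
 have e: "pfx x (n + (m + N)) = pfx x n @ p" by (simp add: pfx_add p_def)
 have xX: "x \<in> X" using x assms(2) by auto
 have "tb a (pfx x (n + (m + N))) (v @ p)"
  unfolding e by (rule tb_append[OF n(2)]) (use pfx_words[OF xX, of "n + (m + N)"] n(1) e in auto)
 moreover have "cyl (pfx x (n + (m + N))) \<subseteq> S"
  using m cyl_prefix[OF prefix_pfx[of m "n + (m + N)" x]] by auto
 ultimately show ?thesis using n(1) by (intro that[of "n + (m + N)" "v @ p"]) auto
qed

lemma opn_image:
 assumes "opn S" "S \<subseteq> X" and a: "!!x. x \<in> S ==> \<exists>n>0. \<exists>v. tb a (pfx x n) v"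
 shows "opn (a ` S)"
 unfolding opn_def
proof
 fix y assume "y \<in> a ` S"
 then obtain x where x: "x \<in> S" "y = a x" by auto
 obtain n v where n: "n > 0" "tb a (pfx x n) v" "cyl (pfx x n) \<subseteq> S"
  using opn_tb[OF assms x(1)] by metis
 have "y \<in> cyl v" using x tb_in_cyl[OF n(2), of x] assms(2) by auto
 then have "cyl (pfx y (length v)) = a ` cyl (pfx x n)" using tb_image[OF n(2)] by (simp add: cyl_pfx)
 then show "\<exists>n. cyl (pfx y n) \<subseteq> a ` S" using n(3) by (metis image_mono)
qed

text \<open>The involution that exchanges \<open>S\<close> with its image under \<open>f\<close>,
  used both for transpositions of cylinders and for splitting an arbitrary element.\<close>

definition swp :: "(nat => 'e) set => ((nat => 'e) => nat => 'e) => (nat => 'e) => nat => 'e" where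
 "swp S f x = (if x \<in> S then f x else if x \<in> f ` S then inv_into S f x else x)"

lemma swp_swp:
 assumes "inj_on f S" "f ` S \<inter> S = {}" shows "swp S f (swp S f x) = x"
 using assms by (auto simp: swp_def)

lemma swp_image:
 assumes "inj_on f S" "f ` S \<inter> S = {}" "x \<in> S" shows "swp S f (f x) = x"
proof -
 have "f x \<notin> S" using assms by blast
 then show ?thesis using assms by (simp add: swp_def inv_into_f_f)
qed

lemma swp_Gam:
 assumes inj: "inj_on f S" and dis: "f ` S \<inter> S = {}"
  and S: "opn S" "S \<subseteq> X" and f: "!!x. x \<in> S ==> \<exists>n>0. \<exists>v. tb f (pfx x n) v"
  and compl: "opn (X - (S \<union> f ` S))"
 shows "swp S f \<in> Gam (S \<union> f ` S)"
 unfolding Gam_def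
proof (intro CollectI conjI allI impI ballI)
 have "swp S f \<circ> swp S f = id" using swp_swp[OF inj dis] by auto
 then show "bij (swp S f)" using o_bij by blast
 show "swp S f x = x" if "x \<notin> S \<union> f ` S" for x using that by (auto simp: swp_def)
 fix x assume x: "x \<in> X"
 consider "x \<in> S" | y where "y \<in> S" "x = f y" | "x \<in> X - (S \<union> f ` S)" using x by auto
 then show "\<exists>n>0. \<exists>v. tb (swp S f) (pfx x n) v"
 proof cases
  case 1
  obtain n v where n: "n > 0" "tb f (pfx x n) v" "cyl (pfx x n) \<subseteq> S"
   using opn_tb[OF S f 1] by metis
  have "tb (swp S f) (pfx x n) v" by (rule tb_cong[OF n(2)]) (use n(3) in \<open>auto simp: swp_def\<close>)
  then show ?thesis using n(1) by blast
 next
  case 2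
  obtain n v where n: "n > 0" "tb f (pfx y n) v" "cyl (pfx y n) \<subseteq> S"
   using opn_tb[OF S f 2(1)] by metis
  have "tb (swp S f) v (pfx y n)"
   by (rule tb_inverse[OF n(2)]) (rule swp_image[OF inj dis subsetD[OF n(3)]])
  moreover have "x \<in> cyl v" using tb_in_cyl[OF n(2), of y] 2 S by auto
  moreover have "length v > 0" using tbD(2)[OF n(2)] by (cases v) auto
  ultimately show ?thesis using cyl_pfx by metis
 next
  case 3
  then obtain n where n: "cyl (pfx x n) \<subseteq> X - (S \<union> f ` S)" using opnD[OF compl] by meson
  have "tb (swp S f) (pfx x (Suc n)) (pfx x (Suc n))"
  proof (rule tb_fix)
   show "pfx x (Suc n) \<in> words" using x by (simp add: pfx_words)
   fix z assume "z \<in> cyl (pfx x (Suc n))"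
   then have "z \<in> cyl (pfx x n)" using cyl_prefix[OF prefix_pfx[of n "Suc n" x]] by auto
   then show "swp S f z = z" using n by (auto simp: swp_def)
  qed
  then show ?thesis by blast
 qed
qed

definition tr :: "'e list => 'e list => (nat => 'e) => nat => 'e" where
 "tr w v x = (if x \<in> cyl w then rp w v x else if x \<in> cyl v then rp v w x else x)"

definition swappable :: "'e list => 'e list => bool" where
 "swappable w v \<longleftrightarrow> w \<in> words & v \<in> words & last w = last v & cyl w \<inter> cyl v = {}"

lemma tr_Gam:
 assumes "swappable w v" shows "tr w v \<in> Gam (cyl w \<union> cyl v)"
proof -
 have wv: "w \<in> words" "v \<in> words" "last w = last v" "cyl w \<inter> cyl v = {}"
  using assms by (auto simp: swappable_def)
 have im: "rp w v ` cyl w = cyl v" using wv by (intro rp_image) auto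
 have "tr w v = swp (cyl w) (rp w v)"
 proof
  fix x
  have "inv_into (cyl w) (rp w v) x = rp v w x" if "x \<in> cyl v"
  proof (rule inv_into_f_eq)
   show "rp v w x \<in> cyl w" using that wv by (metis rp_in_cyl words_nonempty)
   show "rp w v (rp v w x) = x" using that by (simp add: rp_trans rp_id)
  qed (rule rp_inj)
  then show "tr w v x = swp (cyl w) (rp w v) x" by (simp add: tr_def swp_def im)
 qed
 moreover have "swp (cyl w) (rp w v) \<in> Gam (cyl w \<union> rp w v ` cyl w)"
 proof (rule swp_Gam)
  show "opn (X - (cyl w \<union> rp w v ` cyl w))"
  proof -
   have "clop (cyl w \<union> cyl v) (max (length w) (length v))"
    using clop_mono[OF clop_cyl[OF wv(1)]] clop_mono[OF clop_cyl[OF wv(2)]]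
    by (intro clop_Un) auto
   then show ?thesis unfolding im by (rule opn_compl)
  qed
  show "\<exists>n>0. \<exists>u. tb (rp w v) (pfx x n) u" if "x \<in> cyl w" for x
   using that wv tb_rp by (metis cyl_pfx length_greater_0_conv words_nonempty)
 qed (use wv im cyl_subset_X opn_clop[OF clop_cyl[OF wv(1)]] in \<open>auto simp: rp_inj\<close>)
 ultimately show ?thesis using im by simp
qed

lemma tr_simps:
 "x \<in> cyl w ==> tr w v x = rp w v x"
 "swappable w v ==> x \<in> cyl v ==> tr w v x = rp v w x"
 "x \<notin> cyl w ==> x \<notin> cyl v ==> tr w v x = x"
 by (auto simp: tr_def swappable_def)

lemma tb_tr:
 assumes "swappable w v" shows "tb (tr w v) w v" "tb (tr w v) v w"
 using assms tr_simps[where w=w and v=v] by (auto simp: tb_def swappable_def)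

lemma tr_tr: "swappable w v ==> tr w v (tr w v x) = x"
 using tb_in_cyl[OF tb_tr(1), of w v x] tb_in_cyl[OF tb_tr(2), of w v x]
 by (cases "x \<in> cyl w \<or> x \<in> cyl v") (auto simp: tr_simps rp_trans rp_id)

lemma conj_Gam:
 assumes a: "a \<in> Gam S" and b: "b \<in> Gam T" and "T \<subseteq> S" "S \<subseteq> X"
 shows "a \<circ> b \<circ> inv_into UNIV a \<in> Gam (a ` T)"
proof -
 have "a \<circ> b \<circ> inv_into UNIV a \<in> Gam S"
  using assms Gam_mono[of T S] by (intro comp_Gam inv_Gam) auto
 moreover have "(a \<circ> b \<circ> inv_into UNIV a) x = x" if "x \<notin> a ` T" for x
 proof -
  have ax: "a (inv_into UNIV a x) = x" using GamD(1)[OF a] by (simp add: bij_is_surj surj_f_inv_f)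
  then have "inv_into UNIV a x \<notin> T" using that by force
  then show ?thesis using ax b by (simp add: GamD)
 qed
 ultimately show ?thesis by (auto simp: Gam_def)
qed

lemma Gam_commute:
 assumes a: "a \<in> Gam S" and b: "b \<in> Gam T" and "S \<inter> T = {}" shows "a \<circ> b = b \<circ> a"
proof
 fix x
 show "(a \<circ> b) x = (b \<circ> a) x"
  using disjoint_iff[THEN iffD1, rule_format, OF assms(3), of x]
   disjoint_iff[THEN iffD1, rule_format, OF assms(3), of "a x"]
   disjoint_iff[THEN iffD1, rule_format, OF assms(3), of "b x"] Gam_maps[OF a, of x] Gam_maps[OF b, of x]
   GamD(2)[OF a, of x] GamD(2)[OF b, of x] GamD(2)[OF a, of "b x"] GamD(2)[OF b, of "a x"]
  by (cases "x \<in> S"; cases "x \<in> T") auto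
qed

text \<open>\<open>x\<close> and \<open>a x\<close> differ at some position \<open>i\<close>; once
  source and image prefixes reach beyond \<open>i\<close>, all their points share this
  difference.\<close>

lemma Gam_moves:
 assumes a: "a \<in> Gam S" and "a x ~= x" "x \<in> X"
 obtains n where "n \<ge> N" "n > 0" "a ` cyl (pfx x n) \<inter> cyl (pfx x n) = {}"
proof -
 obtain i where i: "a x i ~= x i" using assms(2) by auto
 obtain n v where n: "n > 0" "n \<ge> Suc i + N" "length v \<ge> Suc i + N" "tb a (pfx x n) v"
  using Gam_tb[OF a assms(3), of "Suc i + N"] by metis
 have "z i = a x i" if "z \<in> cyl v" for z
 proof -
  have "a x \<in> cyl v" using tb_in_cyl[OF n(4)] assms(3) by simp
  then show ?thesis using n(3) cyl_nth[OF that, of i] cyl_nth[of "a x" v i] by simp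
 qed
 moreover have "z i = x i" if "z \<in> cyl (pfx x n)" for z
  using that n(2) cyl_nth[of z "pfx x n" i] by simp
 ultimately have "cyl v \<inter> cyl (pfx x n) = {}" using i by fastforce
 then show ?thesis using n tb_image[OF n(4)] by (intro that[of n]) auto
qed

end

section \<open>Normal subgroups\<close>

lemma (in group) conj_commute_cancel:
 assumes x: "x \<in> carrier G" and y: "y \<in> carrier G" and t: "t \<in> carrier G"
  and eq: "(t \<otimes> x \<otimes> inv t) \<otimes> (t \<otimes> y \<otimes> inv t) = (t \<otimes> y \<otimes> inv t) \<otimes> (t \<otimes> x \<otimes> inv t)"
 shows "x \<otimes> y = y \<otimes> x"
proof -
 have i: "inv t \<otimes> (t \<otimes> z) = z" if "z \<in> carrier G" for z
  using that t by (simp flip: m_assoc)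
 have "t \<otimes> ((x \<otimes> y) \<otimes> inv t) = t \<otimes> ((y \<otimes> x) \<otimes> inv t)"
  using eq x y t by (simp add: m_assoc i)
 then show ?thesis using x y t by simp
qed

context sft
begin

section \<open>Splitting and compressing cylinders\<close>

lemma extend_to:
 assumes w: "w \<in> words" and e: "e \<in> arcs Q"
 obtains p where "w @ p \<in> words" "last (w @ p) = e"
proof -
 have "(last w, e) \<in> {(a, b). a \<in> arcs Q & b \<in> arcs Q & tail Q b = head Q a}\<^sup>+"
  using arcs_connected last_in_arcs[OF w] e by blast
 then have "\<exists>p. w @ p \<in> words & last (w @ p) = e"
 proof (induction rule: trancl_induct)
  case (base f)
  then have "w @ [f] \<in> words" using w by (simp add: words_snoc nx_def)
  then show ?case by (intro exI[of _ "[f]"]) simp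
 next
  case (step f g)
  then obtain p where p: "w @ p \<in> words" "last (w @ p) = f" by blast
  then have "(w @ p) @ [g] \<in> words" using step(2) by (subst words_snoc) (simp_all add: nx_def)
  then show ?case by (intro exI[of _ "p @ [g]"]) simp
 qed
 then show ?thesis using that by blast
qed

lemma disjoint_mono: "A \<inter> B = {} ==> A' \<subseteq> A ==> B' \<subseteq> B ==> A' \<inter> B' = {}"
 by blast

text \<open>Continue \<open>w\<close> to an arc with two successors, branch there, and steer both
  branches to the type \<open>e\<close>. This room inside every cylinder is the source of the later
  constructions.\<close>

lemma split_word:
 assumes w: "w \<in> words" and e: "e \<in> arcs Q"
 obtains u v where "u \<in> words" "v \<in> words" "prefix w u" "prefix w v" "cyl u \<inter> cyl v = {}" "last u = e"
  "last v = e" "length w < length u" "length w < length v"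
proof -
 obtain b f g where b: "b \<in> arcs Q" "f \<in> nx b" "g \<in> nx b" "f ~= g"
  using branching by (auto simp: nx_def)
 obtain p where p: "w @ p \<in> words" "last (w @ p) = b" using extend_to[OF w b(1)] .
 have f: "(w @ p) @ [f] \<in> words" using p b by (subst words_snoc) auto
 have g: "(w @ p) @ [g] \<in> words" using p b by (subst words_snoc) auto
 obtain q where q: "((w @ p) @ [f]) @ q \<in> words" "last (((w @ p) @ [f]) @ q) = e"
  using extend_to[OF f e] .
 obtain r where r: "((w @ p) @ [g]) @ r \<in> words" "last (((w @ p) @ [g]) @ r) = e"
  using extend_to[OF g e] .
 have "cyl (((w @ p) @ [f]) @ q) \<inter> cyl (((w @ p) @ [g]) @ r) = {}"
 proof (rule disjoint_mono)
  show "cyl ((w @ p) @ [f]) \<inter> cyl ((w @ p) @ [g]) = {}" using b(4) by (intro cyl_same_length) auto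
 qed (rule cyl_append_subset)+
 then show ?thesis using q r by (intro that[of "((w @ p) @ [f]) @ q" "((w @ p) @ [g]) @ r"]) auto
qed

definition pdis :: "'e list set => bool" where
 "pdis P \<longleftrightarrow> (\<forall>w\<in>P. \<forall>v\<in>P. w ~= v --> cyl w \<inter> cyl v = {})"

lemma pdisD: "pdis P ==> w \<in> P ==> v \<in> P ==> x \<in> cyl w ==> x \<in> cyl v ==> w = v"
 unfolding pdis_def by blast

text \<open>Each step splits the leftover word, gives one half the next type and keeps the other
  half. The final leftover \<open>u\<close> is returned because later arguments need a cylinder that
  nothing touches.\<close>

lemma stock:
 assumes "w \<in> words" "set es \<subseteq> arcs Q"
 obtains ws u where "map last ws = es" "distinct ws" "set ws \<subseteq> words" "pdis (set ws)"
  "!!v. v \<in> set ws ==> cyl v \<subseteq> cyl w" "u \<in> words" "cyl u \<subseteq> cyl w"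
  "!!v. v \<in> set ws ==> cyl u \<inter> cyl v = {}"
proof -
 have "\<exists>ws u. map last ws = es & distinct ws & set ws \<subseteq> words & pdis (set ws) &
   (\<forall>v\<in>set ws. cyl v \<subseteq> cyl w) & u \<in> words & cyl u \<subseteq> cyl w & (\<forall>v\<in>set ws. cyl u \<inter> cyl v = {})"
  using assms(2)
 proof (induction es)
  case Nil
  then show ?case using assms(1) by (intro exI[of _ "[]"] exI[of _ w]) (simp add: pdis_def)
 next
  case (Cons e es)
  then obtain ws u where ws: "map last ws = es" "distinct ws" "set ws \<subseteq> words" "pdis (set ws)"
   "\<forall>v\<in>set ws. cyl v \<subseteq> cyl w" "u \<in> words" "cyl u \<subseteq> cyl w" "\<forall>v\<in>set ws. cyl u \<inter> cyl v = {}"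
   by auto
  have "e \<in> arcs Q" using Cons.prems by simp
  then obtain u1 u2 where u: "u1 \<in> words" "u2 \<in> words" "prefix u u1" "prefix u u2"
   "cyl u1 \<inter> cyl u2 = {}" "last u1 = e" using split_word[OF ws(6)] by metis
  have sub: "cyl u1 \<subseteq> cyl u" "cyl u2 \<subseteq> cyl u" using u cyl_prefix by auto
  have dis: "cyl u1 \<inter> cyl v = {}" "cyl u2 \<inter> cyl v = {}" if "v \<in> set ws" for v
   using ws(8) sub that by blast+
  have "u1 \<notin> set ws" using dis(1)[of u1] cyl_nonempty[OF u(1)] by auto
  moreover have "pdis (set (u1 # ws))" using ws(4) dis(1) unfolding pdis_def by auto
  moreover have "\<forall>v\<in>set (u1 # ws). cyl u2 \<inter> cyl v = {}" using dis(2) u(5) by auto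
  moreover have "\<forall>v\<in>set (u1 # ws). cyl v \<subseteq> cyl w" using ws(5,7) sub by auto
  moreover have "cyl u2 \<subseteq> cyl w" using ws(7) sub by auto
  ultimately show ?case using ws(1,2,3) u
   by (intro exI[of _ "u1 # ws"] exI[of _ u2]) simp
 qed
 then show ?thesis using that by blast
qed

definition part :: "'e list set => (nat => 'e) set => bool" where
 "part P S \<longleftrightarrow> finite P & P \<subseteq> words & pdis P & (\<Union>w\<in>P. cyl w) = S"

lemma partD: assumes "part P S"
 shows "finite P" "P \<subseteq> words" "pdis P" "(\<Union>w\<in>P. cyl w) = S" "w \<in> P ==> cyl w \<subseteq> S" "S \<subseteq> X"
 using assms cyl_subset_X unfolding part_def by blast+

lemma finite_words_length: "finite {w \<in> words. length w = n}"
 by (rule finite_subset[OF _ finite_lists_length_eq[OF finite_arcs, of n]]) (auto simp: words_def)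

lemma part_level:
 assumes S: "clop S L" shows "part ((%x. pfx x L) ` S) S"
 unfolding part_def
proof (intro conjI)
 have X: "S \<subseteq> X" "L \<ge> 1" using clop_X_level[OF S] by auto
 show w: "(%x. pfx x L) ` S \<subseteq> words" using X by (auto intro!: pfx_words)
 have "(%x. pfx x L) ` S \<subseteq> {w \<in> words. length w = L}" using w by auto
 then show "finite ((%x. pfx x L) ` S)" using finite_words_length finite_subset by blast
 show "pdis ((%x. pfx x L) ` S)" unfolding pdis_def by (auto intro!: cyl_same_length)
 show "(\<Union>w\<in>(%x. pfx x L) ` S. cyl w) = S"
 proof
  show "(\<Union>w\<in>(%x. pfx x L) ` S. cyl w) \<subseteq> S" using clopD[OF S] by auto
  show "S \<subseteq> (\<Union>w\<in>(%x. pfx x L) ` S. cyl w)" using X in_cyl_pfx by fastforce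
 qed
qed

text \<open>One half of \<open>u\<close> receives \<open>w\<close> by a transposition, and the other
  half receives the remaining words by induction.\<close>

lemma compress_into:
 assumes "finite P" "P \<subseteq> words" "pdis P" "u \<in> words" "cyl u \<inter> (\<Union>w\<in>P. cyl w) = {}"
 shows "\<exists>g\<in>Gam ((\<Union>w\<in>P. cyl w) \<union> cyl u). g ` (\<Union>w\<in>P. cyl w) \<subseteq> cyl u"
 using assms
proof (induction P arbitrary: u rule: finite_induct)
 case empty
 show ?case by (intro bexI[of _ id]) auto
next
 case (insert w P)
 let ?B = "\<Union>w\<in>P. cyl w"
 have w: "w \<in> words" using insert.prems by simp
 obtain u1 u2 where u: "u1 \<in> words" "u2 \<in> words" "prefix u u1" "prefix u u2"
  "cyl u1 \<inter> cyl u2 = {}" "last u1 = last w"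
  using split_word[OF insert.prems(3) last_in_arcs[OF w]] by metis
 have sub: "cyl u1 \<subseteq> cyl u" "cyl u2 \<subseteq> cyl u" using u cyl_prefix by auto
 have "\<exists>g\<in>Gam (?B \<union> cyl u2). g ` ?B \<subseteq> cyl u2"
 proof (rule insert.IH)
  show "P \<subseteq> words" "pdis P" using insert.prems(1,2) unfolding pdis_def by auto
  show "cyl u2 \<inter> ?B = {}" using insert.prems(4) sub by auto
 qed (rule u(2))
 then obtain g where g: "g \<in> Gam (?B \<union> cyl u2)" "g ` ?B \<subseteq> cyl u2" by blast
 have sw: "swappable w u1" using w u insert.prems(4) sub by (auto simp: swappable_def)
 have wB: "cyl w \<inter> ?B = {}" using insert.prems(2) insert.hyps(2) unfolding pdis_def by auto
 have "tr w u1 \<circ> g \<in> Gam ((\<Union>w\<in>insert w P. cyl w) \<union> cyl u)"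
 proof (rule comp_Gam)
  show "g \<in> Gam ((\<Union>w\<in>insert w P. cyl w) \<union> cyl u)"
   by (rule subsetD[OF Gam_mono g(1)]) (use sub in auto)
  show "tr w u1 \<in> Gam ((\<Union>w\<in>insert w P. cyl w) \<union> cyl u)"
   by (rule subsetD[OF Gam_mono tr_Gam[OF sw]]) (use sub in auto)
 qed
 moreover have "(tr w u1 \<circ> g) x \<in> cyl u" if "x \<in> (\<Union>w\<in>insert w P. cyl w)" for x
 proof (cases "x \<in> ?B")
  case True
  then have gx: "g x \<in> cyl u2" using g(2) by blast
  then have "g x \<notin> cyl w" "g x \<notin> cyl u1" using insert.prems(4) sub u(5) by auto
  then show ?thesis using gx sub by (auto simp: tr_simps)
 next
  case False
  then have x: "x \<in> cyl w" using that by auto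
  then have "x \<notin> cyl u2" using insert.prems(4) sub by auto
  then have "g x = x" using False GamD(2)[OF g(1), of x] by auto
  then show ?thesis using x tb_in_cyl[OF tb_tr(1)[OF sw] x] sub by auto
 qed
 ultimately show ?case by blast
qed

text \<open>\<open>B\<close> may overlap \<open>cyl u\<close>, so a direct swap is impossible:
  \<open>B\<close> first goes into a word \<open>r'\<close> outside \<open>B\<close>, and
  \<open>r'\<close> then goes into a disjoint part \<open>p'\<close> of \<open>u\<close>.\<close>

lemma compress:
 assumes Y: "clop Y L" and B: "clop B L" "B \<subseteq> Y" "B ~= Y" and u: "u \<in> words" "cyl u \<subseteq> Y"
 obtains g where "g \<in> Gam Y" "g ` B \<subseteq> cyl u"
proof -
 have YB: "clop (Y - B) L" using Y B(1) by (rule clop_diff)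
 obtain x where x: "x \<in> Y - B" using B by auto
 define u1 where "u1 = pfx x L"
 have u1: "u1 \<in> words" "cyl u1 \<subseteq> Y - B"
  using x clopD[OF YB x] clop_X_level[OF Y] by (auto simp: u1_def intro!: pfx_words)
 have e: "last u \<in> arcs Q" using last_in_arcs[OF u(1)] .
 obtain p q where pq: "p \<in> words" "q \<in> words" "prefix u p" "prefix u q" "cyl p \<inter> cyl q = {}"
  using split_word[OF u(1) e] by metis
 obtain r s where rs: "r \<in> words" "s \<in> words" "prefix u1 r" "prefix u1 s" "cyl r \<inter> cyl s = {}"
  using split_word[OF u1(1) e] by metis
 \<comment> \<open>If \<open>cyl r\<close> and \<open>cyl p\<close> meet, one contains the other,
   and the disjoint partner of the larger one is disjoint from the smaller one.\<close>
 have "\<exists>r'\<in>{r, s}. \<exists>p'\<in>{p, q}. cyl r' \<inter> cyl p' = {}"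
  using cyl_disjoint_iff[OF rs(1) pq(1)] cyl_prefix[of r p] cyl_prefix[of p r] pq(5) rs(5) by blast
 then obtain r' p' where rp': "r' \<in> {r, s}" "p' \<in> {p, q}" "cyl r' \<inter> cyl p' = {}" by blast
 have rp: "r' \<in> words" "p' \<in> words" "cyl r' \<subseteq> cyl u1" "cyl p' \<subseteq> cyl u" "cyl r' \<inter> cyl p' = {}"
  using rp' pq rs cyl_prefix[of u1 r'] cyl_prefix[of u p'] by auto
 note P = part_level[OF B(1)]
 have dis: "cyl r' \<inter> B = {}" using rp(3) u1(2) by blast
 have "\<exists>g\<in>Gam (B \<union> cyl r'). g ` B \<subseteq> cyl r'"
  using compress_into[of "(%x. pfx x L) ` B" r'] partD(1-3)[OF P] rp(1) dis
  unfolding partD(4)[OF P] by blast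
 then obtain g where g: "g \<in> Gam (B \<union> cyl r')" "g ` B \<subseteq> cyl r'" by blast
 have "\<exists>h\<in>Gam (cyl r' \<union> cyl p'). h ` cyl r' \<subseteq> cyl p'"
  using compress_into[of "{r'}" p'] rp by (auto simp: pdis_def Int_commute)
 then obtain h where h: "h \<in> Gam (cyl r' \<union> cyl p')" "h ` cyl r' \<subseteq> cyl p'" by blast
 show ?thesis
 proof (rule that)
  show "h \<circ> g \<in> Gam Y"
  proof (rule comp_Gam)
   have "cyl r' \<subseteq> Y" "cyl p' \<subseteq> Y" using rp u1(2) u(2) by auto
   then show "g \<in> Gam Y" "h \<in> Gam Y"
    using subsetD[OF Gam_mono g(1), of Y] subsetD[OF Gam_mono h(1), of Y] B(2) by auto
  qed
  show "(h \<circ> g) ` B \<subseteq> cyl u" using g(2) h(2) rp(4) by auto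
 qed
qed

text \<open>A nontrivial \<open>n\<close> in \<open>N\<close> moves a cylinder \<open>u\<close> off
  itself and is trivial modulo \<open>N\<close>, so elements supported in \<open>u\<close> commute
  modulo \<open>N\<close>. Conjugation extends this to pairs that fix a common cylinder. Since
  \<open>a\<close> and \<open>b\<close> need not fix anything, each is split into two factors such
  that every factor of \<open>a\<close> shares a fixed cylinder with every factor of
  \<open>b\<close>.\<close>

lemma normal_GG_commute:
 assumes N: "N \<lhd> GG Y" and Y: "clop Y L" and nt: "N ~= {id}"
  and a: "a \<in> Gam Y" and b: "b \<in> Gam Y"
 defines "h \<equiv> %a. N #>\<^bsub>GG Y\<^esub> a"
 shows "h a \<otimes>\<^bsub>GG Y Mod N\<^esub> h b = h b \<otimes>\<^bsub>GG Y Mod N\<^esub> h a"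
proof -
 note YX = clop_X_level(1)[OF Y]
 interpret G: group "GG Y" using YX by (rule group_GG)
 interpret N: normal N "GG Y" by (rule N)
 interpret K: group "GG Y Mod N" by (rule N.factorgroup_is_group)
 let ?K = "GG Y Mod N"
 interpret h: group_hom "GG Y" ?K h
  unfolding h_def by unfold_locales (rule N.r_coset_hom_Mod)
 have h_comp: "h (f \<circ> g) = h f \<otimes>\<^bsub>?K\<^esub> h g" if "f \<in> Gam Y" "g \<in> Gam Y" for f g
  using h.hom_mult[of f g] that by simp
 have h_in [simp]: "h f \<in> carrier ?K" if "f \<in> Gam Y" for f using h.hom_closed[of f] that by simp
 have h_inv: "h (inv_into UNIV f) = inv\<^bsub>?K\<^esub> h f" if "f \<in> Gam Y" for f
  using h.hom_inv[of f] that YX by (simp add: inv_GG)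
 have inv_Y: "inv_into UNIV f \<in> Gam Y" if "f \<in> Gam Y" for f using inv_Gam[OF that YX] .
 obtain n where n: "n \<in> N" "n ~= id" using nt N.one_closed by auto
 have nY: "n \<in> Gam Y" using n(1) N.subset by auto
 have hn: "h n = \<one>\<^bsub>?K\<^esub>" using n(1) unfolding h_def by (simp add: FactGroup_def N.rcos_const)
 obtain x where x: "n x ~= x" using n(2) by (metis eq_id_iff)
 have xY: "x \<in> Y" using x GamD(2)[OF nY] by metis
 obtain k where k: "k \<ge> L" "k > 0" "n ` cyl (pfx x k) \<inter> cyl (pfx x k) = {}"
  using Gam_moves[OF nY x] xY YX by (metis subsetD)
 define u where "u = pfx x k"
 have u: "u \<in> words" "cyl u \<subseteq> Y" "n ` cyl u \<inter> cyl u = {}"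
  using k xY YX clopD[OF clop_mono[OF Y k(1)] xY] by (auto simp: u_def intro!: pfx_words)
 \<comment> \<open>Conjugation by \<open>n\<close> does not change the class of \<open>f\<close> but
   moves its support off \<open>cyl u\<close>, where it commutes with \<open>g\<close>.\<close>
 have cu: "h f \<otimes>\<^bsub>?K\<^esub> h g = h g \<otimes>\<^bsub>?K\<^esub> h f" if f: "f \<in> Gam (cyl u)" and g: "g \<in> Gam (cyl u)" for f g
 proof -
  have fg: "f \<in> Gam Y" "g \<in> Gam Y" using f g Gam_mono[OF u(2)] by auto
  let ?f = "n \<circ> f \<circ> inv_into UNIV n"
  have f': "?f \<in> Gam (n ` cyl u)" using conj_Gam[OF nY f u(2) YX] .
  have fY: "?f \<in> Gam Y" using nY fg inv_Y by (intro comp_Gam) auto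
  have "h ?f = h n \<otimes>\<^bsub>?K\<^esub> h f \<otimes>\<^bsub>?K\<^esub> inv\<^bsub>?K\<^esub> h n"
   using nY fg inv_Y by (simp add: h_comp comp_Gam h_inv del: one_FactGroup mult_FactGroup)
  also have "\<dots> = h f" unfolding hn using fg by (simp del: one_FactGroup mult_FactGroup)
  finally have "h ?f = h f" .
  moreover have "?f \<circ> g = g \<circ> ?f" using Gam_commute[OF f' g u(3)] .
  ultimately show ?thesis using h_comp[OF fY fg(2)] h_comp[OF fg(2) fY] by simp
 qed
 \<comment> \<open>The complement of the common fixed cylinder \<open>c\<close> is a proper clopen
   subset, so it can be compressed into \<open>cyl u\<close>.\<close>
 have cc: "h f \<otimes>\<^bsub>?K\<^esub> h g = h g \<otimes>\<^bsub>?K\<^esub> h f"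
  if c: "c \<in> words" "cyl c \<subseteq> Y" and f: "f \<in> Gam (Y - cyl c)" and g: "g \<in> Gam (Y - cyl c)" for c f g
 proof -
  have fg: "f \<in> Gam Y" "g \<in> Gam Y" using f g Gam_mono[of "Y - cyl c" Y] by auto
  let ?M = "max L (length c)"
  have "clop (Y - cyl c) ?M"
   using clop_mono[OF Y] clop_mono[OF clop_cyl[OF c(1)]] by (intro clop_diff) auto
  moreover have "Y - cyl c ~= Y" using c cyl_nonempty by auto
  ultimately obtain t where t: "t \<in> Gam Y" "t ` (Y - cyl c) \<subseteq> cyl u"
   using compress[of Y ?M "Y - cyl c" u] clop_mono[OF Y, of ?M] u by (metis Diff_subset max.cobounded1)
  have cj: "t \<circ> f' \<circ> inv_into UNIV t \<in> Gam (cyl u)" if "f' \<in> Gam (Y - cyl c)" for f'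
   using conj_Gam[OF t(1) that _ YX] Gam_mono[OF t(2)] by auto
  have hcj: "h (t \<circ> f' \<circ> inv_into UNIV t) = h t \<otimes>\<^bsub>?K\<^esub> h f' \<otimes>\<^bsub>?K\<^esub> inv\<^bsub>?K\<^esub> h t"
   if "f' \<in> Gam Y" for f' using that t(1) inv_Y by (simp add: h_comp comp_Gam h_inv)
  have "(h t \<otimes>\<^bsub>?K\<^esub> h f \<otimes>\<^bsub>?K\<^esub> inv\<^bsub>?K\<^esub> h t) \<otimes>\<^bsub>?K\<^esub> (h t \<otimes>\<^bsub>?K\<^esub> h g \<otimes>\<^bsub>?K\<^esub> inv\<^bsub>?K\<^esub> h t)
    = (h t \<otimes>\<^bsub>?K\<^esub> h g \<otimes>\<^bsub>?K\<^esub> inv\<^bsub>?K\<^esub> h t) \<otimes>\<^bsub>?K\<^esub> (h t \<otimes>\<^bsub>?K\<^esub> h f \<otimes>\<^bsub>?K\<^esub> inv\<^bsub>?K\<^esub> h t)"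
   using cu[OF cj[OF f] cj[OF g]] fg by (simp only: hcj)
  then show ?thesis by (rule K.conj_commute_cancel[rotated 3]) (use fg t(1) in auto)
 qed
 \<comment> \<open>Below any word lies one on which \<open>f\<close> is the identity or whose
   cylinder \<open>f\<close> displaces entirely; both alternatives pass to subwords, so one
   \<open>v\<close> serves \<open>a\<close> and \<open>b\<close>.\<close>
 have stay: "\<exists>w'. w' \<in> words & cyl w' \<subseteq> cyl w & ((\<forall>x\<in>cyl w'. f x = x) \<or> f ` cyl w' \<inter> cyl w' = {})"
  if w: "w \<in> words" and f: "f \<in> Gam Y" for w f
 proof (cases "\<forall>x\<in>cyl w. f x = x")
  case True
  then show ?thesis using w by auto
 next
  case False
  then obtain x where x: "x \<in> cyl w" "f x ~= x" by blast
  obtain k where k: "k \<ge> length w" "k > 0" "f ` cyl (pfx x k) \<inter> cyl (pfx x k) = {}"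
   using Gam_moves[OF f x(2) cyl_X[OF x(1)]] by metis
  moreover have "cyl (pfx x k) \<subseteq> cyl w"
   using cyl_prefix[OF prefix_pfx[OF k(1), of x]] cyl_pfx[OF x(1)] by simp
  ultimately show ?thesis using pfx_words[OF cyl_X[OF x(1)] k(2)] by blast
 qed
 obtain w where w: "w \<in> words" "cyl w \<subseteq> cyl u"
  "(\<forall>x\<in>cyl w. a x = x) \<or> a ` cyl w \<inter> cyl w = {}" using stay[OF u(1) a] by blast
 obtain v where v: "v \<in> words" "cyl v \<subseteq> cyl w"
  "(\<forall>x\<in>cyl v. b x = x) \<or> b ` cyl v \<inter> cyl v = {}" using stay[OF w(1) b] by blast
 have va: "(\<forall>x\<in>cyl v. a x = x) \<or> a ` cyl v \<inter> cyl v = {}" using w(3) v(2) by blast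
 have vY: "cyl v \<subseteq> Y" using v w u by auto
 have e: "last v \<in> arcs Q" using last_in_arcs[OF v(1)] .
 have "set [last v, last v, last v] \<subseteq> arcs Q" using e by simp
 then obtain ws s where ws': "map last ws = [last v, last v, last v]" and
  ws: "distinct ws" "set ws \<subseteq> words" "pdis (set ws)"
  "!!z. z \<in> set ws ==> cyl z \<subseteq> cyl v" "s \<in> words" "cyl s \<subseteq> cyl v"
  "!!z. z \<in> set ws ==> cyl s \<inter> cyl z = {}"
  by (rule stock[OF v(1)]) (rule that)
 have "length ws = 3" using arg_cong[OF ws', of length] by simp
 then obtain p q r where pqr: "ws = [p, q, r]"
  by (auto simp: numeral_3_eq_3 length_Suc_conv)
 have W: "p \<in> words" "q \<in> words" "r \<in> words" "cyl p \<subseteq> cyl v" "cyl q \<subseteq> cyl v" "cyl r \<subseteq> cyl v"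
  "cyl p \<inter> cyl q = {}" "cyl p \<inter> cyl r = {}" "cyl q \<inter> cyl r = {}"
  "cyl s \<inter> cyl p = {}" "cyl s \<inter> cyl q = {}" "cyl s \<inter> cyl r = {}"
  using ws pqr by (auto simp: pdis_def)
 text \<open>Modulo a swap supported near \<open>Z\<close>, every element fixes \<open>Z\<close> pointwise.\<close>
 have decomp: "\<exists>t f'. t \<in> Gam (Z \<union> f ` Z) & f' \<in> Gam (Y - Z) & f = t \<circ> f' &
   (f ` Z = Z \<or> f ` Z \<inter> cyl v = {})"
  if f: "f \<in> Gam Y" and vf: "(\<forall>x\<in>cyl v. f x = x) \<or> f ` cyl v \<inter> cyl v = {}"
   and Z: "Z \<subseteq> cyl v" "clop Z k" for f Z k
  using vf
 proof
  assume fx: "\<forall>x\<in>cyl v. f x = x"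
  then have "f \<in> Gam (Y - Z)" using Gam_restrict[OF f, of Z] Z by auto
  moreover have "f ` Z = (%x. x) ` Z" by (rule image_cong) (use fx Z(1) in auto)
  ultimately show ?thesis by (intro exI[of _ id] exI[of _ f]) simp
 next
  assume d: "f ` cyl v \<inter> cyl v = {}"
  have inj: "inj f" using GamD(1)[OF f] by (simp add: bij_is_inj)
  have tbf: "\<exists>n>0. \<exists>v. tb f (pfx x n) v" if "x \<in> X" for x using f that by (auto simp: Gam_def)
  have OX: "Z \<subseteq> X" using Z(1) cyl_subset_X by blast
  have oO: "opn Z" using opn_clop[OF Z(2)] .
  have "X - (Z \<union> f ` Z) = (X - Z) \<inter> f ` (X - Z)"
  proof -
   have "f ` X = X" using Gam_image[of f X] f Gam_mono[OF YX] by auto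
   then have "f ` (X - Z) = X - f ` Z" using inj by (simp add: image_set_diff)
   then show ?thesis by auto
  qed
  moreover have "opn (f ` (X - Z))"
   by (rule opn_image) (use tbf opn_compl[OF Z(2)] in auto)
  ultimately have "opn (X - (Z \<union> f ` Z))" using opn_Int[OF opn_compl[OF Z(2)]] by simp
  moreover have dO: "f ` Z \<inter> Z = {}" using d Z(1) by blast
  moreover have iO: "inj_on f Z" using inj by (rule inj_on_subset) simp
  ultimately have t: "swp Z f \<in> Gam (Z \<union> f ` Z)"
   using oO OX tbf by (intro swp_Gam) auto
  have fO: "f ` Z \<subseteq> Y" using Gam_image[OF f] Z(1) vY by blast
  have tY: "swp Z f \<in> Gam Y" using t Gam_mono[of "Z \<union> f ` Z" Y] fO Z(1) vY by auto
  have "(swp Z f \<circ> f) x = x" if "x \<in> Z" for x using swp_image[OF iO dO that] by simp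
  then have "swp Z f \<circ> f \<in> Gam (Y - Z)" using Gam_restrict[OF comp_Gam[OF f tY], of Z] by auto
  moreover have "f = swp Z f \<circ> (swp Z f \<circ> f)" using swp_swp[OF iO dO] by auto
  moreover have "f ` Z \<inter> cyl v = {}" using d Z(1) by blast
  ultimately show ?thesis using t by blast
 qed
 \<comment> \<open>The two sets overlap in \<open>p\<close> only. The factors \<open>t\<close> and
   \<open>t'\<close> both fix \<open>s\<close>; \<open>t\<close> and \<open>b'\<close> fix
   \<open>r\<close>; \<open>a'\<close> and \<open>t'\<close> fix \<open>q\<close>; \<open>a'\<close>
   and \<open>b'\<close> fix \<open>p\<close>.\<close>
 let ?O1 = "cyl p \<union> cyl q" and ?O2 = "cyl p \<union> cyl r"
 let ?k = "max (length p) (max (length q) (length r))"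
 have "clop (cyl p) ?k" "clop (cyl q) ?k" "clop (cyl r) ?k"
  using clop_mono[OF clop_cyl[OF W(1)]] clop_mono[OF clop_cyl[OF W(2)]] clop_mono[OF clop_cyl[OF W(3)]]
  by auto
 then have Z: "clop ?O1 ?k" "clop ?O2 ?k" by (auto intro: clop_Un)
 have v1: "?O1 \<subseteq> cyl v" "?O2 \<subseteq> cyl v" using W by auto
 obtain t a' where t: "t \<in> Gam (?O1 \<union> a ` ?O1)" "a' \<in> Gam (Y - ?O1)" "a = t \<circ> a'"
  "a ` ?O1 = ?O1 \<or> a ` ?O1 \<inter> cyl v = {}"
  using decomp[OF a va v1(1) Z(1)] by blast
 obtain t' b' where t': "t' \<in> Gam (?O2 \<union> b ` ?O2)" "b' \<in> Gam (Y - ?O2)" "b = t' \<circ> b'"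
  "b ` ?O2 = ?O2 \<or> b ` ?O2 \<inter> cyl v = {}"
  using decomp[OF b v(3) v1(2) Z(2)] by blast
 have sub: "?O1 \<union> a ` ?O1 \<subseteq> Y" "?O2 \<union> b ` ?O2 \<subseteq> Y"
 proof -
  have y1: "?O1 \<subseteq> Y" "?O2 \<subseteq> Y" using v1 vY by blast+
  have "a ` ?O1 \<subseteq> Y" "b ` ?O2 \<subseteq> Y"
   using image_mono[OF y1(1), of a] image_mono[OF y1(2), of b] Gam_image[OF a] Gam_image[OF b] by simp_all
  with y1 show "?O1 \<union> a ` ?O1 \<subseteq> Y" "?O2 \<union> b ` ?O2 \<subseteq> Y" by (simp_all only: Un_least)
 qed
 have off: "(A \<union> B) \<inter> C = {}" if "A \<inter> C = {}" "C \<subseteq> cyl v" "B = A \<or> B \<inter> cyl v = {}" for A B C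
  using that by blast
 have M: "f \<in> Gam (Y - cyl c)" if "f \<in> Gam T" "T \<subseteq> Y" "T \<inter> cyl c = {}" for f T c
  using that Gam_mono[of T "Y - cyl c"] by blast
 have o1: "?O1 \<inter> cyl s = {}" and o2: "?O1 \<inter> cyl r = {}"
  and o3: "?O2 \<inter> cyl s = {}" and o4: "?O2 \<inter> cyl q = {}" using W by auto
 have s1: "(?O1 \<union> a ` ?O1) \<inter> cyl s = {}" "(?O1 \<union> a ` ?O1) \<inter> cyl r = {}" using off[OF o1 ws(6) t(4)] off[OF o2 W(6) t(4)] .
 have s2: "(?O2 \<union> b ` ?O2) \<inter> cyl s = {}" "(?O2 \<union> b ` ?O2) \<inter> cyl q = {}" using off[OF o3 ws(6) t'(4)] off[OF o4 W(5) t'(4)] .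
 have cY: "cyl p \<subseteq> Y" "cyl q \<subseteq> Y" "cyl r \<subseteq> Y" "cyl s \<subseteq> Y" using W ws(6) vY by auto
 have 1: "h t \<otimes>\<^bsub>?K\<^esub> h t' = h t' \<otimes>\<^bsub>?K\<^esub> h t"
  by (rule cc[OF ws(5) cY(4)]) (use M[OF t(1)] M[OF t'(1)] sub s1 s2 in auto)
 have 2: "h t \<otimes>\<^bsub>?K\<^esub> h b' = h b' \<otimes>\<^bsub>?K\<^esub> h t"
  by (rule cc[OF W(3) cY(3)]) (use M[OF t(1)] M[OF t'(2)] sub s1 in auto)
 have 3: "h a' \<otimes>\<^bsub>?K\<^esub> h t' = h t' \<otimes>\<^bsub>?K\<^esub> h a'"
  by (rule cc[OF W(2) cY(2)]) (use M[OF t(2)] M[OF t'(1)] sub s2 in auto)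
 have 4: "h a' \<otimes>\<^bsub>?K\<^esub> h b' = h b' \<otimes>\<^bsub>?K\<^esub> h a'"
  by (rule cc[OF W(1) cY(1)]) (use M[OF t(2)] M[OF t'(2)] in auto)
 have inY: "t \<in> Gam Y" "t' \<in> Gam Y" "a' \<in> Gam Y" "b' \<in> Gam Y"
  using t t' Gam_mono[OF sub(1)] Gam_mono[OF sub(2)] Gam_mono[of "Y - ?O1" Y] Gam_mono[of "Y - ?O2" Y] by auto
 have c1: "h t \<otimes>\<^bsub>?K\<^esub> (h t' \<otimes>\<^bsub>?K\<^esub> h b') = (h t' \<otimes>\<^bsub>?K\<^esub> h b') \<otimes>\<^bsub>?K\<^esub> h t"
  using inY by (metis 1 2 K.m_assoc h_in)
 have c2: "h a' \<otimes>\<^bsub>?K\<^esub> (h t' \<otimes>\<^bsub>?K\<^esub> h b') = (h t' \<otimes>\<^bsub>?K\<^esub> h b') \<otimes>\<^bsub>?K\<^esub> h a'"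
  using inY by (metis 3 4 K.m_assoc h_in)
 have "h a = h t \<otimes>\<^bsub>?K\<^esub> h a'" "h b = h t' \<otimes>\<^bsub>?K\<^esub> h b'"
  using t(3) t'(3) h_comp inY by auto
 then show ?thesis using inY c1 c2 by (metis K.m_assoc K.m_closed h_in)
qed

lemma derived_subset_normal:
 assumes N: "N \<lhd> GG Y" and Y: "clop Y L" and nt: "N ~= {id}"
 shows "derived (GG Y) (Gam Y) \<subseteq> N"
proof -
 note YX = clop_X_level(1)[OF Y]
 interpret G: group "GG Y" using YX by (rule group_GG)
 interpret N: normal N "GG Y" by (rule N)
 interpret K: group "GG Y Mod N" by (rule N.factorgroup_is_group)
 interpret h: group_hom "GG Y" "GG Y Mod N" "%a. N #>\<^bsub>GG Y\<^esub> a"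
  by unfold_locales (rule N.r_coset_hom_Mod)
 have "a \<otimes>\<^bsub>GG Y\<^esub> b \<otimes>\<^bsub>GG Y\<^esub> inv\<^bsub>GG Y\<^esub> a \<otimes>\<^bsub>GG Y\<^esub> inv\<^bsub>GG Y\<^esub> b \<in> N"
  if a: "a \<in> carrier (GG Y)" and b: "b \<in> carrier (GG Y)" for a b
 proof -
  let ?h = "%a. N #>\<^bsub>GG Y\<^esub> a" and ?K = "GG Y Mod N"
  let ?c = "a \<otimes>\<^bsub>GG Y\<^esub> b \<otimes>\<^bsub>GG Y\<^esub> inv\<^bsub>GG Y\<^esub> a \<otimes>\<^bsub>GG Y\<^esub> inv\<^bsub>GG Y\<^esub> b"
  have c: "?c \<in> carrier (GG Y)" using a b by (intro G.m_closed G.inv_closed)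
  have "?h ?c = ?h a \<otimes>\<^bsub>?K\<^esub> ?h b \<otimes>\<^bsub>?K\<^esub> inv\<^bsub>?K\<^esub> ?h a \<otimes>\<^bsub>?K\<^esub> inv\<^bsub>?K\<^esub> ?h b"
   using a b by (simp only: h.hom_mult h.hom_inv G.m_closed G.inv_closed)
  also have "?h a \<otimes>\<^bsub>?K\<^esub> ?h b = ?h b \<otimes>\<^bsub>?K\<^esub> ?h a"
   using normal_GG_commute[OF N Y nt, of a b] a b by simp
  also have "?h b \<otimes>\<^bsub>?K\<^esub> ?h a \<otimes>\<^bsub>?K\<^esub> inv\<^bsub>?K\<^esub> ?h a \<otimes>\<^bsub>?K\<^esub> inv\<^bsub>?K\<^esub> ?h b = \<one>\<^bsub>?K\<^esub>"
   using h.hom_closed[OF a] h.hom_closed[OF b] by (simp only: K.m_assoc K.r_inv K.r_one K.inv_closed K.m_closed)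
  finally have "N #>\<^bsub>GG Y\<^esub> ?c = N" by (simp only: one_FactGroup)
  then show ?thesis using c G.rcos_self[OF _ N.subgroup_axioms] by metis
 qed
 then have "derived_set (GG Y) (carrier (GG Y)) \<subseteq> N" by blast
 then show ?thesis unfolding derived_def using G.generate_subgroup_incl[OF _ N.subgroup_axioms] by simp
qed

end

section \<open>Products of transpositions\<close>

context sft
begin

inductive_set TT :: "(nat => 'e) set => ((nat => 'e) => nat => 'e) set" for S where
 TT_id: "id \<in> TT S"
| TT_tr: "a \<in> TT S ==> swappable w v ==> cyl w \<subseteq> S ==> cyl v \<subseteq> S ==> tr w v \<circ> a \<in> TT S"

lemma TT_Gam: "a \<in> TT S ==> a \<in> Gam S"
proof (induction rule: TT.induct)
 case (TT_tr a w v)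
 then show ?case using tr_Gam[of w v] Gam_mono[of "cyl w \<union> cyl v" S] by (intro comp_Gam) auto
qed (rule id_Gam)

lemma TT_single: "swappable w v ==> cyl w \<subseteq> S ==> cyl v \<subseteq> S ==> tr w v \<in> TT S"
 using TT_tr[OF TT_id, of w v S] by simp

lemma TT_comp: assumes "a \<in> TT S" "b \<in> TT S" shows "a \<circ> b \<in> TT S"
 using assms(1)
proof (induction rule: TT.induct)
 case (TT_tr a w v)
 have "tr w v \<circ> (a \<circ> b) \<in> TT S" by (rule TT.TT_tr) (fact TT_tr)+
 then show ?case by (simp only: o_assoc)
qed (simp only: id_o assms(2))

lemma TT_mono: assumes "S \<subseteq> T" shows "TT S \<subseteq> TT T"
proof
 fix a assume "a \<in> TT S" then show "a \<in> TT T"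
 proof (induction rule: TT.induct)
  case (TT_tr a w v)
  show ?case by (rule TT.TT_tr) (use TT_tr assms in auto)
 qed (rule TT_id)
qed

lemma TT_inv: "a \<in> TT S ==> inv_into UNIV a \<in> TT S"
proof (induction rule: TT.induct)
 case (TT_tr a w v)
 have t: "tr w v \<circ> tr w v = id" using tr_tr[OF TT_tr.hyps(2)] by auto
 have "bij (tr w v)" using t o_bij by blast
 moreover have "bij a" using TT_Gam[OF TT_tr.hyps(1)] by (rule GamD)
 ultimately have "inv_into UNIV (tr w v \<circ> a) = inv_into UNIV a \<circ> inv_into UNIV (tr w v)"
  by (rule o_inv_distrib)
 also have "inv_into UNIV (tr w v) = tr w v" using t by (intro inv_unique_comp)
 finally show ?case using TT_comp[OF TT_tr.IH TT_single[OF TT_tr.hyps(2-4)]] by (simp only:)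
qed (simp only: inv_id TT_id)

definition tbs :: "((nat => 'e) => nat => 'e) => 'e list set => 'e list set => bool" where
 "tbs a P P' \<longleftrightarrow> (\<forall>w\<in>P. \<exists>v\<in>P'. tb a w v)"

lemma tbsD: "tbs a P P' ==> w \<in> P ==> \<exists>v\<in>P'. tb a w v"
 by (simp add: tbs_def)

lemma tbs_comp: assumes "tbs a P P'" "tbs b P' P''" shows "tbs (b \<circ> a) P P''"
 unfolding tbs_def
proof
 fix w assume "w \<in> P"
 then obtain v where v: "v \<in> P'" "tb a w v" using tbsD[OF assms(1)] by blast
 then obtain u where u: "u \<in> P''" "tb b v u" using tbsD[OF assms(2)] by blast
 then show "\<exists>u\<in>P''. tb (b \<circ> a) w u" using tb_comp[OF v(2) u(2)] by blast
qed

lemma pdis_apart: "pdis P ==> w \<in> P ==> v \<in> P ==> w ~= v ==> cyl w \<inter> cyl v = {}"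
 unfolding pdis_def by blast

lemma part_point: "part P S ==> x \<in> S ==> \<exists>w\<in>P. x \<in> cyl w"
 using partD(4)[of P S] by blast

lemma tb_Gam_in:
 assumes a: "a \<in> Gam S" and "tb a w v" "cyl w \<subseteq> S" shows "cyl v \<subseteq> S"
 using tb_image[OF assms(2)] Gam_image[OF a] assms(3) by blast

lemma tbs_inv:
 assumes a: "a \<in> Gam S" and P: "part P S" and C: "part C S" and t: "tbs a P C"
 shows "tbs (inv_into UNIV a) C P"
 unfolding tbs_def
proof
 fix v assume v: "v \<in> C"
 have ba: "bij a" using a by (rule GamD)
 have vw: "v \<in> words" using v partD(2)[OF C] by auto
 obtain y where y: "y \<in> cyl v" using cyl_nonempty[OF vw] by auto
 then have yS: "y \<in> S" using partD(5)[OF C v] by auto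
 obtain x where x: "y = a x" "x \<in> S" using Gam_image[OF a] yS by blast
 obtain w where w: "w \<in> P" "x \<in> cyl w" using part_point[OF P x(2)] by blast
 obtain v' where v': "v' \<in> C" "tb a w v'" using tbsD[OF t w(1)] by blast
 have "y \<in> cyl v'" using tb_in_cyl[OF v'(2) w(2)] x by simp
 then have "v' = v" using pdisD[OF partD(3)[OF C] v'(1) v] y by blast
 then have "tb (inv_into UNIV a) v w"
  using tb_inverse[OF v'(2), of "inv_into UNIV a"] ba by (simp add: bij_is_inj)
 then show "\<exists>w\<in>P. tb (inv_into UNIV a) v w" using w(1) by blast
qed

text \<open>Sorting by transpositions: composing with the swap of \<open>w\<close> and its image
  \<open>v\<close> makes \<open>w\<close> fixed and moves no word that was fixed before, so the
  number of moved words drops.\<close>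

lemma permutation_TT:
 assumes P: "part P S" and a: "a \<in> Gam S" and t: "tbs a P P"
 shows "a \<in> TT S"
 using a t
proof (induction "card {w \<in> P. \<exists>x\<in>cyl w. a x ~= x}" arbitrary: a rule: less_induct)
 case less
 let ?F = "%a. {w \<in> P. \<exists>x\<in>cyl w. a x ~= x}"
 have PS: "!!w. w \<in> P ==> w \<in> words" using partD(2)[OF P] by auto
 show ?case
 proof (cases "?F a = {}")
  case True
  have "a x = x" for x
  proof (cases "x \<in> S")
   case True
   then obtain w where "w \<in> P" "x \<in> cyl w" using part_point[OF P] by blast
   then show ?thesis using \<open>?F a = {}\<close> by blast
  qed (rule GamD(2)[OF less.prems(1)])
  then have "a = id" by auto
  then show ?thesis by (simp add: TT_id)
 next
  case False
  then obtain w x where w: "w \<in> P" "x \<in> cyl w" "a x ~= x" by blast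
  obtain v where v: "v \<in> P" "tb a w v" using tbsD[OF less.prems(2) w(1)] by blast
  have vw: "v ~= w" using w tbD(4)[OF v(2) w(2)] by (auto simp: rp_id)
  have sw: "swappable w v"
   using vw w v tbD[OF v(2)] partD(3)[OF P] unfolding swappable_def pdis_def by blast
  let ?b = "tr w v \<circ> a"
  have sub: "cyl w \<subseteq> S" "cyl v \<subseteq> S" using partD(5)[OF P] w v by auto
  have bG: "?b \<in> Gam S"
   using tr_Gam[OF sw] Gam_mono[of "cyl w \<union> cyl v" S] sub by (intro comp_Gam less.prems) auto
  have tP: "tbs (tr w v) P P" unfolding tbs_def
  proof
   fix u assume u: "u \<in> P"
   consider "u = w" | "u = v" | "u ~= w" "u ~= v" by blast
   then show "\<exists>u'\<in>P. tb (tr w v) u u'"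
   proof cases
    case 3
    have "tr w v z = z" if "z \<in> cyl u" for z
     using that 3 u w(1) v(1) pdisD[OF partD(3)[OF P] u] by (intro tr_simps(3)) blast+
    then show ?thesis using u PS tb_fix by blast
   qed (use tb_tr[OF sw] w v in auto)
  qed
  have bt: "tbs ?b P P" using less.prems(2) tP by (rule tbs_comp)
  have bw: "?b z = z" if "z \<in> cyl w" for z
   using that tbD(4)[OF v(2) that] tb_in_cyl[OF v(2) that] tr_simps(2)[OF sw, of "a z"]
   by (simp add: rp_trans rp_id)
  have sub2: "?F ?b \<subseteq> ?F a - {w}"
  proof
   fix u assume u: "u \<in> ?F ?b"
   then obtain z where z: "u \<in> P" "z \<in> cyl u" "?b z ~= z" by blast
   have "u ~= w" using z bw by blast
   moreover have "\<exists>z\<in>cyl u. a z ~= z"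
   proof (rule ccontr)
    assume "\<not> ?thesis"
    then have az: "a z = z" using z(2) by blast
    then have "z \<in> cyl w \<or> z \<in> cyl v" using z(3) tr_simps(3)[of z w v] by auto
    then have "z \<in> cyl v" using \<open>u ~= w\<close> pdisD[OF partD(3)[OF P] z(1) w(1) z(2)] by blast
    moreover obtain y where "y \<in> cyl w" "z = a y" using tb_image[OF v(2)] \<open>z \<in> cyl v\<close> by blast
    ultimately have "z \<in> cyl w" using az Gam_inj[OF less.prems(1)] by metis
    with \<open>z \<in> cyl v\<close> show False using sw by (auto simp: swappable_def)
   qed
   ultimately show "u \<in> ?F a - {w}" using z(1) by blast
  qed
  have "finite (?F a)" using partD(1)[OF P] by simp
  moreover have "w \<in> ?F a" using w by blast
  ultimately have "card (?F ?b) < card (?F a)" using sub2 by (intro psubset_card_mono) blast+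
  then have "?b \<in> TT S" using bG bt by (rule less.hyps)
  then have "tr w v \<circ> ?b \<in> TT S" using sw sub by (rule TT_tr)
  moreover have "tr w v \<circ> ?b = a" using tr_tr[OF sw] by auto
  ultimately show ?thesis by simp
 qed
qed

text \<open>The multiset keeps only the types of the expanded words. Order and location of the
  expansions are forgotten, which makes partitions with equal multisets interchangeable.\<close>

inductive reach :: "'e list set => 'e list set => 'e multiset => bool" for B where
 reach_refl: "reach B B {#}"
| reach_step: "reach B P ms ==> w \<in> P ==> reach B (P - {w} \<union> children w) (add_mset (last w) ms)"

lemma part_expand:
 assumes P: "part P S" and w: "w \<in> P" shows "part (P - {w} \<union> children w) S"
 unfolding part_def
proof (intro conjI)
 have ww: "w \<in> words" using partD(2)[OF P] w by auto
 show "finite (P - {w} \<union> children w)" using partD(1)[OF P] by simp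
 show "P - {w} \<union> children w \<subseteq> words" using partD(2)[OF P] children_words[OF ww] by auto
 have c: "cyl u \<subseteq> cyl w" if "u \<in> children w" for u using cyl_children[OF ww] that by auto
 have d: "cyl v \<inter> cyl w = {}" if "v \<in> P - {w}" for v
  using partD(3)[OF P] that w unfolding pdis_def by blast
 show "pdis (P - {w} \<union> children w)" unfolding pdis_def
 proof (intro ballI impI)
  fix u v assume uv: "u \<in> P - {w} \<union> children w" "v \<in> P - {w} \<union> children w" "u ~= v"
  consider "u \<in> P - {w}" "v \<in> P - {w}" | "u \<in> children w" "v \<in> children w"
   | "u \<in> children w" "v \<in> P - {w}" | "u \<in> P - {w}" "v \<in> children w" using uv by blast
  then show "cyl u \<inter> cyl v = {}"
  proof cases
   case 1 then show ?thesis using partD(3)[OF P] uv(3) unfolding pdis_def by blast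
  next
   case 2 then show ?thesis using children_disjoint uv(3) by blast
  next
   case 3 then show ?thesis using c[of u] d[of v] by blast
  next
   case 4 then show ?thesis using c[of v] d[of u] by blast
  qed
 qed
 have "(\<Union>u\<in>P. cyl u) = (\<Union>u\<in>P - {w}. cyl u) \<union> cyl w" using w by blast
 then show "(\<Union>u\<in>P - {w} \<union> children w. cyl u) = S"
  using partD(4)[OF P] cyl_children[OF ww] by (simp add: UN_Un)
qed

lemma reach_part: "reach B P ms ==> part B S ==> part P S"
 by (induction rule: reach.induct) (auto intro: part_expand)

lemma part_subset_eq:
 assumes "part P S" "part B S" "P \<subseteq> B" shows "P = B"
proof
 show "B \<subseteq> P"
 proof
  fix w assume w: "w \<in> B"
  then obtain x where x: "x \<in> cyl w" using cyl_nonempty partD(2)[OF assms(2)] by blast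
  then obtain v where v: "v \<in> P" "x \<in> cyl v"
   using part_point[OF assms(1)] partD(5)[OF assms(2) w] by blast
  then have "v = w" using pdisD[OF partD(3)[OF assms(2)] _ w v(2) x] assms(3) by blast
  then show "w \<in> P" using v by simp
 qed
qed (rule assms(3))

text \<open>The refinement is undone from the bottom: a longest word outside \<open>B\<close> has
  all its siblings in \<open>P\<close>, so they can be replaced by their parent, which lowers the
  total length.\<close>

lemma reach_exists:
 assumes B: "part B S" and P: "part P S" and ref: "!!v. v \<in> P ==> \<exists>w\<in>B. prefix w v"
 shows "\<exists>ms. reach B P ms"
 using P ref
proof (induction "\<Sum>v\<in>P. length v" arbitrary: P rule: less_induct)
 case less
 note P = less.prems(1)
 have fP: "finite P" using partD(1)[OF P] .
 have PW: "!!v. v \<in> P ==> v \<in> words" using partD(2)[OF P] by auto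
 show ?case
 proof (cases "P \<subseteq> B")
  case True
  then have "P = B" using part_subset_eq[OF P B] by simp
  then show ?thesis using reach_refl by blast
 next
  case False
  then have "P - B ~= {}" "finite (P - B)" using fP by auto
  then obtain v where v: "v \<in> P - B" "!!v'. v' \<in> P - B ==> length v' \<le> length v"
   using obtains_MAX[of "P - B" length] by (metis Max_ge finite_imageI imageI)
  obtain w where w: "w \<in> B" "prefix w v" using less.prems(2) v(1) by blast
  have wW: "w \<in> words" using partD(2)[OF B] w(1) by auto
  define u f where "u = butlast v" and "f = last v"
  have vu: "v = u @ [f]" using PW[of v] v(1) by (auto simp: u_def f_def intro: append_butlast_last_id[symmetric])
  have wu: "prefix w u" using w v(1) vu by (metis DiffD2 prefix_snoc)
  have "u ~= []" using wu wW by auto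
  then have uW: "u \<in> words" using PW[of v] v(1) vu words_appendD[of u "[f]"] by auto
  have fu: "f \<in> nx (last u)" using PW[of v] v(1) vu words_snoc[OF uW] by auto
  have vc: "v \<in> children u" using vu fu by (auto simp: children_def)
  \<comment> \<open>A word of \<open>P\<close> that meets the sibling \<open>z\<close> cannot be
    shorter, since its cylinder would then also contain that of \<open>v\<close>, and cannot be
    longer, since \<open>v\<close> is longest.\<close>
  have chP: "children u \<subseteq> P"
  proof
   fix z assume z: "z \<in> children u"
   then have zW: "z \<in> words" using children_words[OF uW] by auto
   obtain x where x: "x \<in> cyl z" using cyl_nonempty[OF zW] by auto
   have "prefix u z" using z by (auto simp: children_def)
   then have "x \<in> cyl w" using x cyl_prefix wu by blast
   then have "x \<in> S" using partD(5)[OF B w(1)] by auto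
   then obtain v' where v': "v' \<in> P" "x \<in> cyl v'" using part_point[OF P] by blast
   have lz: "length z = length v" using z vu by (auto simp: children_def)
   have "\<not> prefix v' u"
   proof
    assume p: "prefix v' u"
    then have "prefix v' v" using vu by (auto simp: prefix_def)
    then have "cyl v \<subseteq> cyl v'" by (rule cyl_prefix)
    then have "v' = v" using pdisD[OF partD(3)[OF P] v'(1), of v] cyl_nonempty[OF PW, of v] v(1) by blast
    then show False using p vu prefix_length_le[OF p] by simp
   qed
   then have l': "length z \<le> length v'"
    using cyl_meet[OF v'(2), of u] \<open>prefix u z\<close> cyl_prefix[of u z] x lz vu by fastforce
   then have "prefix z v'" using cyl_meet[OF x v'(2)] by simp
   have "v' \<notin> B"
   proof
    assume b: "v' \<in> B"
    have "v' = w" by (rule pdisD[OF partD(3)[OF B] b w(1) v'(2) \<open>x \<in> cyl w\<close>])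
    then show False using l' lz vu prefix_length_le[OF wu] by simp
   qed
   then have "length v' \<le> length v" using v v' by blast
   then have "z = v'" using \<open>prefix z v'\<close> lz by (auto simp: prefix_def)
   then show "z \<in> P" using v'(1) by simp
  qed
  define P0 where "P0 = insert u (P - children u)"
  have uP: "u \<notin> P"
  proof
   assume uP: "u \<in> P"
   have "cyl v \<subseteq> cyl u" using vu cyl_append_subset by auto
   then have "u = v" using pdisD[OF partD(3)[OF P] uP, of v] cyl_nonempty[OF PW, of v] v(1) by blast
   then show False using vu by simp
  qed
  have cu: "cyl u = (\<Union>z\<in>children u. cyl z)" using cyl_children[OF uW] .
  have P0: "part P0 S" unfolding part_def
  proof (intro conjI)
   show "finite P0" using fP by (simp add: P0_def)
   show "P0 \<subseteq> words" using PW uW by (auto simp: P0_def)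
   have d: "cyl u \<inter> cyl z = {}" if z: "z \<in> P - children u" for z
   proof -
    have "cyl y \<inter> cyl z = {}" if y: "y \<in> children u" for y
     using y z chP by (intro pdis_apart[OF partD(3)[OF P]]) auto
    then show ?thesis unfolding cu by auto
   qed
   show "pdis P0" unfolding pdis_def P0_def
   proof (intro ballI impI)
    fix y z assume "y \<in> insert u (P - children u)" "z \<in> insert u (P - children u)" "y ~= z"
    then show "cyl y \<inter> cyl z = {}"
     using d[of y] d[of z] partD(3)[OF P] unfolding pdis_def by (metis DiffD1 Int_commute insertE)
   qed
   have "(\<Union>z\<in>P. cyl z) = (\<Union>z\<in>children u. cyl z) \<union> (\<Union>z\<in>P - children u. cyl z)" using chP by blast
   then show "(\<Union>z\<in>P0. cyl z) = S" using partD(4)[OF P] by (simp add: P0_def cu)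
  qed
  have "(\<Sum>z\<in>P0. length z) < (\<Sum>z\<in>P. length z)"
  proof -
   have "(\<Sum>z\<in>P0. length z) = length u + (\<Sum>z\<in>P - children u. length z)"
    using fP uP by (simp add: P0_def)
   also have "length u < length v" using vu by simp
   also have "length v \<le> (\<Sum>z\<in>children u. length z)" using vc by (intro member_le_sum) auto
   also have "(\<Sum>z\<in>children u. length z) + (\<Sum>z\<in>P - children u. length z) = (\<Sum>z\<in>P. length z)"
    using sum.subset_diff[OF chP fP, of length] by simp
   finally show ?thesis by simp
  qed
  moreover have "\<exists>w\<in>B. prefix w z" if "z \<in> P0" for z
   using that less.prems(2) w(1) wu by (auto simp: P0_def)
  ultimately obtain ms where "reach B P0 ms" using less.hyps[OF _ P0] by blast
  then have "reach B (P0 - {u} \<union> children u) (add_mset (last u) ms)"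
   by (rule reach_step) (simp add: P0_def)
  moreover have "P0 - {u} \<union> children u = P" using uP chP by (auto simp: P0_def)
  ultimately show ?thesis by metis
 qed
qed

text \<open>Each expanded node is moved to a stock word of the same type, one transposition at a time.\<close>

lemma reach_canonical:
 assumes "reach B P ms" and B: "part B S"
  and "distinct ws" "set ws \<subseteq> words" "pdis (set ws)" "!!s. s \<in> set ws ==> cyl s \<inter> S = {}"
  and "mset (map last ws) = ms"
 shows "\<exists>t\<in>TT (S \<union> (\<Union>s\<in>set ws. cyl s)). tbs t (P \<union> set ws) (B \<union> (\<Union>s\<in>set ws. children s))"
 using assms(1,3-7)
proof (induction arbitrary: ws rule: reach.induct)
 case reach_refl
 have "tbs id B B" using partD(2)[OF B] tb_id unfolding tbs_def by blast
 moreover have "ws = []" using reach_refl.prems(5) by simp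
 ultimately have "tbs id (B \<union> set ws) (B \<union> (\<Union>s\<in>set ws. children s))"
  by (simp only: list.set(1) UN_empty Un_empty_right)
 then show ?case using TT_id by (rule bexI)
next
 case (reach_step P ms w)
 have P: "part P S" using reach_part[OF reach_step.hyps(1) B] .
 have wW: "w \<in> words" "cyl w \<subseteq> S" using partD[OF P] reach_step.hyps(2) by auto
 have "last w \<in># mset (map last ws)" using reach_step.prems(5) by simp
 then obtain s where s: "s \<in> set ws" "last s = last w" by auto
 define ws' where "ws' = remove1 s ws"
 have ws: "set ws = insert s (set ws')" "s \<notin> set ws'" "distinct ws'"
  using s reach_step.prems(1) by (auto simp: ws'_def set_remove1_eq)
 have sW: "s \<in> words" "cyl s \<inter> S = {}" using reach_step.prems s by auto
 have "mset ws = add_mset s (mset ws')" using s(1) by (simp add: ws'_def)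
 then have "mset (map last ws) = add_mset (last s) (mset (map last ws'))"
  by (metis image_mset_add_mset mset_map)
 then have ms': "mset (map last ws') = ms" using reach_step.prems(5) s(2) by simp
 have pd: "pdis (set ws')" "!!r. r \<in> set ws' ==> cyl s \<inter> cyl r = {}"
  using reach_step.prems(3) ws(1,2) unfolding pdis_def by auto
 let ?S' = "S \<union> (\<Union>s\<in>set ws'. cyl s)" and ?S = "S \<union> (\<Union>s\<in>set ws. cyl s)"
 obtain t where t: "t \<in> TT ?S'" "tbs t (P \<union> set ws') (B \<union> (\<Union>s\<in>set ws'. children s))"
  using reach_step.IH[of ws'] reach_step.prems(2,4) ws pd(1) ms' by auto
 have sw: "swappable w s" using wW sW s(2) by (auto simp: swappable_def)
 have tG: "t \<in> Gam ?S'" using TT_Gam[OF t(1)] .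
 have "t \<circ> tr w s \<in> TT ?S"
 proof (rule TT_comp)
  show "t \<in> TT ?S" using t(1) TT_mono[of ?S' ?S] ws(1) by auto
  show "tr w s \<in> TT ?S" by (rule TT_single[OF sw]) (use wW(2) s(1) in auto)
 qed
 \<comment> \<open>The children of \<open>w\<close> land on the children of \<open>s\<close>, which
   \<open>t\<close> leaves alone, while \<open>s\<close> takes the place of \<open>w\<close> in the
   old partition.\<close>
 moreover have "tbs (t \<circ> tr w s) (P - {w} \<union> children w \<union> set ws) (B \<union> (\<Union>s\<in>set ws. children s))"
  unfolding tbs_def
 proof
  fix u assume u: "u \<in> P - {w} \<union> children w \<union> set ws"
  consider "u \<in> children w" | "u = s" | "u \<in> P - {w} \<union> set ws'" using u ws(1) by auto
  then show "\<exists>v\<in>B \<union> (\<Union>s\<in>set ws. children s). tb (t \<circ> tr w s) u v"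
  proof cases
   case 1
   then obtain f where f: "u = w @ [f]" "f \<in> nx (last w)" by (auto simp: children_def)
   have uW: "w @ [f] \<in> words" using wW f by (simp add: words_snoc)
   have c: "s @ [f] \<in> children s" using f s(2) by (auto simp: children_def)
   have "tb (tr w s) (w @ [f]) (s @ [f])" using tb_append[OF tb_tr(1)[OF sw] uW] .
   moreover have "tb t (s @ [f]) (s @ [f])"
   proof (rule tb_fix)
    show "s @ [f] \<in> words" using c children_words[OF sW(1)] by auto
    fix x assume "x \<in> cyl (s @ [f])"
    then have "x \<in> cyl s" using cyl_append_subset by auto
    then have "x \<notin> ?S'" using sW(2) pd(2) by blast
    then show "t x = x" by (rule GamD(2)[OF tG])
   qed
   ultimately have "tb (t \<circ> tr w s) u (s @ [f])" unfolding f(1) by (rule tb_comp)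
   then show ?thesis using c s(1) by blast
  next
   case 2
   obtain v where v: "v \<in> B \<union> (\<Union>s\<in>set ws'. children s)" "tb t w v"
    using tbsD[OF t(2), of w] reach_step.hyps(2) by blast
   then show ?thesis using tb_comp[OF tb_tr(2)[OF sw] v(2)] 2 ws(1) by blast
  next
   case 3
   have uW: "u \<in> words" using 3 partD(2)[OF P] reach_step.prems(2) ws(1) by auto
   have "cyl u \<inter> cyl w = {}" "cyl u \<inter> cyl s = {}"
    using 3
   proof (atomize (full), elim UnE)
    assume u: "u \<in> P - {w}"
    then have "cyl u \<inter> cyl w = {}" using partD(3)[OF P] reach_step.hyps(2) unfolding pdis_def by blast
    moreover have "cyl u \<subseteq> S" using u partD(5)[OF P] by blast
    ultimately show "cyl u \<inter> cyl w = {} & cyl u \<inter> cyl s = {}" using sW(2) by blast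
   next
    assume u: "u \<in> set ws'"
    then have "cyl u \<inter> S = {}" using reach_step.prems(4) ws(1) by auto
    then show "cyl u \<inter> cyl w = {} & cyl u \<inter> cyl s = {}" using wW(2) pd(2)[OF u] by blast
   qed
   then have "tb (tr w s) u u" using uW by (intro tb_fix tr_simps(3)) auto
   moreover obtain v where v: "v \<in> B \<union> (\<Union>s\<in>set ws'. children s)" "tb t u v"
    using tbsD[OF t(2), of u] 3 by blast
   ultimately show ?thesis using tb_comp[of "tr w s" u u t v] ws(1) by blast
  qed
 qed
 ultimately show ?case by blast
qed

lemma part_image:
 assumes a: "a \<in> Gam S" and P: "part P S" and tb: "!!w. w \<in> P ==> tb a w (\<phi> w)"
 shows "part (\<phi> ` P) S" "inj_on \<phi> P"
proof -
 have inj: "cyl (\<phi> w) \<inter> cyl (\<phi> v) = {}" if "w \<in> P" "v \<in> P" "w ~= v" for w v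
 proof -
  have "cyl w \<inter> cyl v = {}" using partD(3)[OF P] that unfolding pdis_def by blast
  then have "a ` cyl w \<inter> a ` cyl v = {}" using Gam_inj[OF a] by auto
  then show ?thesis using tb_image[OF tb] that by simp
 qed
 show i: "inj_on \<phi> P"
 proof (rule inj_onI, rule ccontr)
  fix w v assume "w \<in> P" "v \<in> P" "\<phi> w = \<phi> v" "w ~= v"
  then show False using inj[of w v] cyl_nonempty[OF tbD(2)[OF tb]] by auto
 qed
 have "(\<Union>w\<in>\<phi> ` P. cyl w) = (\<Union>w\<in>P. a ` cyl w)" using tb_image[OF tb] by simp
 also have "\<dots> = a ` S" using partD(4)[OF P] by blast
 also have "\<dots> = S" using Gam_image[OF a] .
 finally show "part (\<phi> ` P) S"
  using partD(1)[OF P] tbD(2)[OF tb] inj unfolding part_def pdis_def by auto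
qed

text \<open>Equal multisets bring source and image partition, both enlarged by the same stock words,
  to one normal form by transpositions. What remains of \<open>a\<close> permutes the words of that
  form. The stock is taken from \<open>c\<close> outside \<open>S\<close>, and its leftover
  \<open>u\<close> stays free.\<close>

lemma equal_expansions_TT:
 assumes B: "part B S" and P: "part P S" and a: "a \<in> Gam S" and tb: "!!w. w \<in> P ==> tb a w (\<phi> w)"
  and r: "reach B P ms" "reach B (\<phi> ` P) ms" and c: "c \<in> words" "cyl c \<inter> S = {}"
 shows "\<exists>u\<in>words. cyl u \<subseteq> cyl c & a \<in> TT (S \<union> cyl c - cyl u)"
proof -
 obtain es where es: "mset es = ms" using ex_mset by blast
 have reach_arcs: "reach B P' ms' ==> part B S ==> set_mset ms' \<subseteq> arcs Q" for P' ms'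
 proof (induction rule: reach.induct)
  case (reach_step P ms w)
  then show ?case using partD(2)[OF reach_part[OF reach_step(1,4)]] last_in_arcs by auto
 qed simp
 have "set es \<subseteq> arcs Q" using reach_arcs[OF r(1) B] es by auto
 then obtain ws u where ws: "map last ws = es" "distinct ws" "set ws \<subseteq> words" "pdis (set ws)"
  "!!v. v \<in> set ws ==> cyl v \<subseteq> cyl c" "u \<in> words" "cyl u \<subseteq> cyl c"
  "!!v. v \<in> set ws ==> cyl u \<inter> cyl v = {}"
  by (rule stock[OF c(1)]) (rule that)
 let ?S = "S \<union> (\<Union>s\<in>set ws. cyl s)"
 let ?C = "B \<union> (\<Union>s\<in>set ws. children s)"
 have dis: "cyl s \<inter> S = {}" if "s \<in> set ws" for s using ws(5)[OF that] c(2) by blast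
 have ms: "mset (map last ws) = ms" using ws(1) es by simp
 obtain t1 where t1: "t1 \<in> TT ?S" "tbs t1 (P \<union> set ws) ?C"
  using reach_canonical[OF r(1) B ws(2-4) dis ms] by blast
 obtain t2 where t2: "t2 \<in> TT ?S" "tbs t2 (\<phi> ` P \<union> set ws) ?C"
  using reach_canonical[OF r(2) B ws(2-4) dis ms] by blast
 have part_Un: "part (P' \<union> R) ?S" if P': "part P' S"
  and R: "finite R" "R \<subseteq> words" "pdis R" "(\<Union>w\<in>R. cyl w) = (\<Union>s\<in>set ws. cyl s)" for P' R
 proof -
  have d: "cyl w \<inter> cyl v = {}" if "w \<in> P'" "v \<in> R" for w v
  proof -
   have "cyl v \<subseteq> (\<Union>s\<in>set ws. cyl s)" using that(2) R(4) by blast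
   moreover have "(\<Union>s\<in>set ws. cyl s) \<inter> S = {}" using dis by blast
   ultimately show ?thesis using partD(5)[OF P' that(1)] by blast
  qed
  have "pdis (P' \<union> R)" using partD(3)[OF P'] R(3) d unfolding pdis_def by (metis Int_commute Un_iff)
  then show ?thesis using partD[OF P'] R unfolding part_def by (auto simp: UN_Un)
 qed
 have Pws: "part (P \<union> set ws) ?S" "part (\<phi> ` P \<union> set ws) ?S"
  using part_Un[OF P] part_Un[OF part_image(1)[OF a P tb]] ws(3,4) by auto
 have chw: "cyl s = (\<Union>z\<in>children s. cyl z)" "children s \<subseteq> words" if "s \<in> set ws" for s
  using cyl_children[of s] children_words[of s] ws(3) that by auto
 have "part ?C ?S"
 proof (rule part_Un[OF B])
  show "pdis (\<Union>s\<in>set ws. children s)" unfolding pdis_def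
  proof (intro ballI impI)
   fix y z assume "y \<in> (\<Union>s\<in>set ws. children s)" "z \<in> (\<Union>s\<in>set ws. children s)" "y ~= z"
   then obtain s s' where s: "s \<in> set ws" "y \<in> children s" "s' \<in> set ws" "z \<in> children s'" by blast
   show "cyl y \<inter> cyl z = {}"
   proof (cases "s = s'")
    case True
    then show ?thesis using s children_disjoint[of y s z] \<open>y ~= z\<close> by blast
   next
    case False
    then have "cyl s \<inter> cyl s' = {}" using ws(4) s unfolding pdis_def by blast
    moreover have "cyl y \<subseteq> cyl s" "cyl z \<subseteq> cyl s'" using chw(1) s by auto
    ultimately show ?thesis by blast
   qed
  qed
  show "(\<Union>w\<in>\<Union>s\<in>set ws. children s. cyl w) = (\<Union>s\<in>set ws. cyl s)" using chw(1) by auto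
 qed (use chw(2) in auto)
 note C = this
 have aG: "a \<in> Gam ?S" using a Gam_mono[of S ?S] by auto
 have ta: "tbs a (P \<union> set ws) (\<phi> ` P \<union> set ws)" unfolding tbs_def
 proof
  fix w assume "w \<in> P \<union> set ws"
  then show "\<exists>v\<in>\<phi> ` P \<union> set ws. tb a w v"
  proof
   assume w: "w \<in> set ws"
   have "tb a w w" using w ws(3) dis[OF w] by (intro tb_fix GamD(2)[OF a]) auto
   then show ?thesis using w by blast
  qed (use tb in blast)
 qed
 have SX: "?S \<subseteq> X" using partD(6)[OF C] .
 have tG: "t1 \<in> Gam ?S" "t2 \<in> Gam ?S" using TT_Gam t1 t2 by auto
 \<comment> \<open>This is \<open>a\<close> read in the normal form: a permutation of the words of
   \<open>?C\<close>.\<close>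
 let ?b = "t2 \<circ> (a \<circ> inv_into UNIV t1)"
 have "tbs ?b ?C ?C"
  by (rule tbs_comp[OF tbs_comp[OF tbs_inv[OF tG(1) Pws(1) C t1(2)] ta] t2(2)])
 moreover have "?b \<in> Gam ?S" using tG aG SX by (intro comp_Gam inv_Gam)
 ultimately have b: "?b \<in> TT ?S" using permutation_TT[OF C] by blast
 have "inv_into UNIV t2 \<circ> ?b \<circ> t1 \<in> TT ?S" by (rule TT_comp[OF TT_comp[OF TT_inv[OF t2(1)] b] t1(1)])
 moreover have "inv_into UNIV t2 \<circ> ?b \<circ> t1 = a"
  using GamD(1)[OF tG(1)] GamD(1)[OF tG(2)] by (auto simp: bij_is_inj fun_eq_iff)
 moreover have "?S \<subseteq> S \<union> cyl c - cyl u" using ws(5,7,8) c(2) by blast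
 ultimately show ?thesis using TT_mono[of ?S "S \<union> cyl c - cyl u"] ws(6,7) by auto
qed

text \<open>Image words of length at least \<open>L\<close> ensure that the image partition, too,
  refines the partition of level \<open>L\<close>, so both arise from it by expansions.\<close>

lemma table_exists:
 assumes S: "clop S L" and a: "a \<in> Gam S"
 shows "\<exists>P \<phi> ms ms'. part P S & (\<forall>w\<in>P. tb a w (\<phi> w)) &
  reach ((%x. pfx x L) ` S) P ms & reach ((%x. pfx x L) ` S) (\<phi> ` P) ms'"
proof -
 obtain L' where L': "\<forall>x\<in>X. \<forall>n\<ge>L'. \<exists>v. L \<le> length v & tb a (pfx x n) v"
  using Gam_level[OF a, of L] by blast
 let ?n = "max L L'" and ?B = "(%x. pfx x L) ` S"
 let ?P = "(%x. pfx x ?n) ` S"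
 have SX: "S \<subseteq> X" using clop_X_level[OF S] by auto
 have B: "part ?B S" using part_level[OF S] .
 have P: "part ?P S" using part_level[OF clop_mono[OF S, of ?n]] by simp
 have "\<forall>w\<in>?P. \<exists>v. L \<le> length v & tb a w v" using L' SX by auto
 then obtain \<phi> where \<phi>: "\<forall>w\<in>?P. L \<le> length (\<phi> w) & tb a w (\<phi> w)" by metis
 have ref: "\<exists>w\<in>?B. prefix w v" if v: "v \<in> words" "cyl v \<subseteq> S" "L \<le> length v" for v
 proof -
  obtain x where x: "x \<in> cyl v" using cyl_nonempty[OF v(1)] by auto
  then have "prefix (pfx x L) v" using cyl_pfx[OF x] prefix_pfx[OF v(3), of x] by simp
  then show ?thesis using x v(2) by blast
 qed
 have "\<exists>ms. reach ?B ?P ms"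
 proof (rule reach_exists[OF B P])
  fix v assume v: "v \<in> ?P"
  then show "\<exists>w\<in>?B. prefix w v" using partD(2,5)[OF P] by (intro ref) auto
 qed
 moreover have "\<exists>ms'. reach ?B (\<phi> ` ?P) ms'"
 proof (rule reach_exists[OF B])
  show im: "part (\<phi> ` ?P) S" using \<phi> by (intro part_image[OF a P]) blast
  fix v assume v: "v \<in> \<phi> ` ?P"
  then show "\<exists>w\<in>?B. prefix w v" using partD(2,5)[OF im] \<phi> by (intro ref) auto
 qed
 ultimately show ?thesis using P \<phi> by blast
qed

definition TN :: "(nat => 'e) set => ((nat => 'e) => nat => 'e) set" where
 "TN Y = {a. \<exists>u\<in>words. \<exists>v\<in>words. cyl u \<subseteq> Y & cyl v \<subseteq> Y &
  (\<exists>b\<in>TT (Y - cyl u). \<exists>c\<in>TT (Y - cyl v). a = b \<circ> c)}"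

text \<open>Where \<open>a\<close> displaces a cylinder, one transposition undoes \<open>a\<close>
  on a small word \<open>w\<close>. Taking \<open>w\<close> in one half of the displaced cylinder
  leaves the other half free for the transposition.\<close>

lemma fix_cylinder:
 assumes Y: "clop Y L" "Y ~= {}" and a: "a \<in> Gam Y"
 shows "\<exists>u\<in>words. \<exists>c\<in>words. \<exists>t\<in>TT (Y - cyl u). cyl u \<subseteq> Y & cyl c \<subseteq> Y &
  t \<circ> a \<in> Gam (Y - cyl c) & t \<circ> t = id"
proof -
 have YX: "Y \<subseteq> X" "L \<ge> 1" using clop_X_level[OF Y(1)] by auto
 show ?thesis
 proof (cases "\<exists>x\<in>Y. a x ~= x")
  case False
  obtain x where x: "x \<in> Y" using Y by auto
  have c: "pfx x L \<in> words" "cyl (pfx x L) \<subseteq> Y" using x YX clopD[OF Y(1) x] by (auto intro!: pfx_words)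
  have "a \<in> Gam (Y - cyl (pfx x L))" using c False by (intro Gam_restrict[OF a]) auto
  then show ?thesis using c
   by (intro bexI[of _ "pfx x L"] bexI[of _ id]) (auto intro: TT_id)
 next
  case True
  then obtain x where x: "x \<in> Y" "a x ~= x" by blast
  then have xX: "x \<in> X" using YX by auto
  obtain n where n: "n \<ge> L" "n > 0" "a ` cyl (pfx x n) \<inter> cyl (pfx x n) = {}"
   using Gam_moves[OF a x(2) xX] by metis
  define c0 where "c0 = pfx x n"
  have c0: "c0 \<in> words" "cyl c0 \<subseteq> Y" "a ` cyl c0 \<inter> cyl c0 = {}"
   using n xX pfx_words clopD[OF clop_mono[OF Y(1) n(1)] x(1)] by (auto simp: c0_def)
  obtain c1 c2 where c: "c1 \<in> words" "c2 \<in> words" "prefix c0 c1" "prefix c0 c2" "cyl c1 \<inter> cyl c2 = {}"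
   using split_word[OF c0(1) last_in_arcs[OF c0(1)]] by metis
  have sub: "cyl c1 \<subseteq> cyl c0" "cyl c2 \<subseteq> cyl c0" using c cyl_prefix by auto
  obtain y where y: "y \<in> cyl c1" using cyl_nonempty[OF c(1)] by auto
  obtain m v where m: "m > 0" "m \<ge> length c1" "tb a (pfx y m) v"
   using Gam_tb[OF a cyl_X[OF y], of "length c1"] by metis
  define w where "w = pfx y m"
  have w: "tb a w v" "cyl w \<subseteq> cyl c1"
   using m(3) cyl_prefix[OF prefix_pfx[OF m(2), of y]] cyl_pfx[OF y] by (simp_all add: w_def)
  have cv: "cyl v = a ` cyl w" using tb_image[OF w(1)] by simp
  have "a ` cyl w \<subseteq> a ` cyl c0" using w(2) sub(1) by blast
  then have d: "cyl v \<inter> cyl c0 = {}" using c0(3) cv by blast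
  have sw: "swappable w v" using tbD[OF w(1)] d w(2) sub(1) by (auto simp: swappable_def)
  have vY: "cyl v \<subseteq> Y" using cv Gam_image[OF a] w(2) sub(1) c0(2) by blast
  have t: "tr w v \<in> TT (Y - cyl c2)"
   by (rule TT_single[OF sw]) (use w(2) c(5) sub c0(2) vY d in blast)+
  have wY: "cyl w \<subseteq> Y" using w(2) sub(1) c0(2) by blast
  have "tr w v \<in> Gam Y" using TT_Gam[OF t] Gam_mono[of "Y - cyl c2" Y] by auto
  then have "tr w v \<circ> a \<in> Gam Y" using a by (intro comp_Gam)
  moreover have "(tr w v \<circ> a) z = z" if "z \<in> cyl w" for z
   using tbD(4)[OF w(1) that] tb_in_cyl[OF w(1) that] tr_simps(2)[OF sw, of "a z"] that
   by (simp add: rp_trans rp_id)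
  ultimately have "tr w v \<circ> a \<in> Gam (Y - cyl w)" by (rule Gam_restrict)
  moreover have "tr w v \<circ> tr w v = id" using tr_tr[OF sw] by auto
  moreover have "cyl c2 \<subseteq> Y" using sub c0 by auto
  ultimately show ?thesis using t c(2) tbD(1)[OF w(1)] wY by blast
 qed
qed

end

section \<open>Signs\<close>

text \<open>Off-diagonal terms occur twice and cancel in characteristic two.\<close>

lemma sum_symmetric_bit:
 fixes g :: "'a => 'a => bit"
 assumes "finite P" "!!u v. u \<in> P ==> v \<in> P ==> g u v = g v u" "!!u. u \<in> P ==> g u u = 0"
 shows "(\<Sum>u\<in>P. \<Sum>v\<in>P. g u v) = 0"
 using assms
proof (induction P rule: finite_induct)
 case (insert a P)
 have "(\<Sum>u\<in>insert a P. \<Sum>v\<in>insert a P. g u v)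
   = (g a a + (\<Sum>v\<in>P. g a v)) + (\<Sum>u\<in>P. g u a + (\<Sum>v\<in>P. g u v))"
  by (simp only: sum.insert[OF insert.hyps])
 also have "(\<Sum>u\<in>P. g u a + (\<Sum>v\<in>P. g u v)) = (\<Sum>u\<in>P. g u a) + (\<Sum>u\<in>P. \<Sum>v\<in>P. g u v)"
  by (rule sum.distrib)
 also have "(\<Sum>u\<in>P. g u a) = (\<Sum>v\<in>P. g a v)" by (rule sum.cong) (use insert.prems in auto)
 also have "(\<Sum>u\<in>P. \<Sum>v\<in>P. g u v) = 0" by (rule insert.IH) (use insert.prems in auto)
 also have "g a a = 0" by (rule insert.prems(2)) simp
 also have "0 + s + (s + 0) = 0" for s :: bit by (cases s) simp_all
 finally show ?case .
qed simp

lemma bit_sum_eq_zeroD: "x + y + z = 0 ==> x = z + y" for x y z :: bit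
 by (cases x; cases y; cases z) simp_all

lemma sum_singleton: "(\<Sum>x\<in>{a}. f x) = f a"
 by simp

lemma double_sum_Un:
 fixes g :: "'a => 'a => 'b::comm_monoid_add"
 assumes "finite A" "finite C" "A \<inter> C = {}"
 shows "(\<Sum>u\<in>A \<union> C. \<Sum>v\<in>A \<union> C. g u v)
  = (\<Sum>u\<in>A. \<Sum>v\<in>A. g u v) + (\<Sum>u\<in>A. \<Sum>c\<in>C. g u c + g c u) + (\<Sum>u\<in>C. \<Sum>v\<in>C. g u v)"
proof -
 have "(\<Sum>u\<in>C. \<Sum>v\<in>A. g u v) = (\<Sum>u\<in>A. \<Sum>c\<in>C. g c u)" by (rule sum.swap)
 then show ?thesis using assms by (simp add: sum.union_disjoint sum.distrib ac_simps)
qed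

context sft
begin

section \<open>Lexicographic order on sequences and on disjoint cylinders\<close>

definition rk :: "'e => nat" where
 "rk = (SOME r. inj_on r (arcs Q))"

lemma rk_inj: "inj_on rk (arcs Q)"
proof -
 obtain r :: "'e => nat" where "inj_on r (arcs Q)"
  using finite_imp_inj_to_nat_seg[OF finite_arcs] by auto
 then show ?thesis unfolding rk_def by (rule someI[where P = "%r. inj_on r (arcs Q)"])
qed

definition lt :: "(nat => 'e) => (nat => 'e) => bool" where
 "lt x y \<longleftrightarrow> (\<exists>n. (\<forall>i<n. x i = y i) & rk (x n) < rk (y n))"

lemma lt_irrefl [simp]: "\<not> lt x x"
 by (simp add: lt_def)

lemma lt_asym: assumes "lt x y" shows "\<not> lt y x"
proof
 assume "lt y x"
 then obtain m where m: "\<forall>i<m. y i = x i" "rk (y m) < rk (x m)" by (auto simp: lt_def)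
 obtain n where n: "\<forall>i<n. x i = y i" "rk (x n) < rk (y n)" using assms by (auto simp: lt_def)
 show False using m n by (cases m n rule: linorder_cases) force+
qed

lemma lt_total: assumes "x \<in> X" "y \<in> X" "x ~= y" shows "lt x y \<or> lt y x"
proof -
 define n where "n = (LEAST n. x n ~= y n)"
 obtain k where "x k ~= y k" using assms(3) by auto
 then have n: "x n ~= y n" unfolding n_def by (rule LeastI)
 have m: "\<forall>i<n. x i = y i" unfolding n_def using not_less_Least by blast
 have "rk (x n) ~= rk (y n)" using n assms(1,2) rk_inj by (auto simp: X_iff inj_on_def)
 then consider "rk (x n) < rk (y n)" | "rk (y n) < rk (x n)" by linarith
 then show ?thesis
 proof cases
  case 1 then show ?thesis using m unfolding lt_def by blast
 next
  case 2 then show ?thesis using m unfolding lt_def by (intro disjI2 exI[of _ n]) auto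
 qed
qed

lemma lt_not: "x \<in> X ==> y \<in> X ==> x ~= y ==> lt y x \<longleftrightarrow> \<not> lt x y"
 using lt_total lt_asym by blast

text \<open>The first difference of \<open>x\<close> and \<open>y\<close> lies inside both words,
  since otherwise one point would belong to the other cylinder. Hence the order of disjoint
  cylinders does not depend on the chosen points.\<close>

lemma lt_cyl1:
 assumes w: "w \<in> words" "v \<in> words" "cyl w \<inter> cyl v = {}"
  and x: "x \<in> cyl w" "x' \<in> cyl w" and y: "y \<in> cyl v" "y' \<in> cyl v" and lt: "lt x y"
 shows "lt x' y'"
proof -
 obtain n where n: "\<forall>i<n. x i = y i" "rk (x n) < rk (y n)" using lt by (auto simp: lt_def)
 have "n < length w & n < length v"
 proof (rule ccontr)
  assume "\<not> ?thesis"
  then have "length w \<le> n \<or> length v \<le> n" by linarith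
  then show False
  proof
   assume "length w \<le> n"
   then have "pfx y (length w) = w" using n(1) cyl_pfx[OF x(1)] by (simp add: pfx_eq_iff)
   then have "y \<in> cyl w" using cyl_X[OF y(1)] by (rule cylI[rotated])
   then show False using w(3) y(1) by blast
  next
   assume "length v \<le> n"
   then have "pfx x (length v) = v" using n(1) cyl_pfx[OF y(1)] by (simp add: pfx_eq_iff)
   then have "x \<in> cyl v" using cyl_X[OF x(1)] by (rule cylI[rotated])
   then show False using w(3) x(1) by blast
  qed
 qed
 then have "x' i = x i & y' i = y i" if "i \<le> n" for i
  using that cyl_nth[OF x(1), of i] cyl_nth[OF x(2), of i] cyl_nth[OF y(1), of i] cyl_nth[OF y(2), of i]
  by simp
 then show ?thesis using n unfolding lt_def by (intro exI[of _ n]) simp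
qed

lemma lt_cyl:
 assumes "w \<in> words" "v \<in> words" "cyl w \<inter> cyl v = {}" "x \<in> cyl w" "x' \<in> cyl w" "y \<in> cyl v" "y' \<in> cyl v"
 shows "lt x y \<longleftrightarrow> lt x' y'"
 using lt_cyl1[OF assms] lt_cyl1[OF assms(1-3) assms(5,4,7,6)] by blast

text \<open>Two points of \<open>cyl w\<close> first differ beyond \<open>w\<close>, and prefix
  replacement merely shifts that position. Tables are thus increasing on each cylinder.\<close>

lemma lt_rp:
 assumes "x \<in> cyl w" "y \<in> cyl w" "lt x y" shows "lt (rp w v x) (rp w v y)"
proof -
 obtain n where n: "\<forall>i<n. x i = y i" "rk (x n) < rk (y n)" using assms(3) by (auto simp: lt_def)
 have "length w \<le> n"
 proof (rule ccontr)
  assume "\<not> ?thesis"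
  then have "x n = y n" using cyl_nth[OF assms(1), of n] cyl_nth[OF assms(2), of n] by simp
  then show False using n(2) by simp
 qed
 then show ?thesis using n unfolding lt_def
  by (intro exI[of _ "n - length w + length v"]) (auto simp: rp_def)
qed

definition pt :: "'e list => nat => 'e" where
 "pt w = (SOME x. x \<in> cyl w)"

lemma pt_in [simp]: "w \<in> words ==> pt w \<in> cyl w"
 unfolding pt_def using cyl_nonempty[of w] by (simp add: some_in_eq)

definition inverted :: "((nat => 'e) => nat => 'e) => 'e list => 'e list => bool" where
 "inverted a u v \<longleftrightarrow> lt (pt u) (pt v) & lt (a (pt v)) (a (pt u))"

text \<open>Inversions with respect to the lexicographic order are counted with weights. Harmonicity of
 the weights and the identity \<open>x\<^sup>2 = x\<close> for bits make the count independent of the partition.\<close>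

definition sgnP :: "('e => bit) => 'e list set => ((nat => 'e) => nat => 'e) => bit" where
 "sgnP \<chi> P a = (\<Sum>u\<in>P. \<Sum>v\<in>P. of_bool (inverted a u v) * (\<chi> (last u) * \<chi> (last v)))"

text \<open>On the arcs these functions are the homomorphisms from the zeroth homology group to the
  field of two elements, given by their values on cylinders of each type.\<close>

definition harmonic :: "('e => bit) => bool" where
 "harmonic \<chi> \<longleftrightarrow> (\<forall>e\<in>arcs Q. \<chi> e = (\<Sum>f\<in>nx e. \<chi> f))"

definition good :: "((nat => 'e) => nat => 'e) => 'e list set => bool" where
 "good a P \<longleftrightarrow> (\<forall>w\<in>P. \<exists>v. tb a w v)"

lemma inverted_iff:
 assumes a: "a \<in> Gam S" and t: "tb a u u'" "tb a v v'" and d: "cyl u \<inter> cyl v = {}"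
  and x: "x \<in> cyl u" and y: "y \<in> cyl v"
 shows "inverted a u v \<longleftrightarrow> lt x y & lt (a y) (a x)"
proof -
 note T = tbD[OF t(1)] tbD[OF t(2)]
 have "a ` cyl u \<inter> a ` cyl v = {}" using d Gam_inj[OF a] by auto
 then have d': "cyl v' \<inter> cyl u' = {}" using tb_image[OF t(1)] tb_image[OF t(2)] by blast
 have "lt (pt u) (pt v) \<longleftrightarrow> lt x y" using T d x y by (intro lt_cyl) auto
 moreover have "lt (a (pt v)) (a (pt u)) \<longleftrightarrow> lt (a y) (a x)"
  using T d' x y tb_in_cyl[OF t(1)] tb_in_cyl[OF t(2)] by (intro lt_cyl[of v' u']) auto
 ultimately show ?thesis by (simp add: inverted_def)
qed

lemma good_expand: assumes "good a P" "w \<in> P" shows "good a (P - {w} \<union> children w)"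
 unfolding good_def
proof
 fix u assume "u \<in> P - {w} \<union> children w"
 then show "\<exists>v. tb a u v"
 proof
  assume u: "u \<in> children w"
  obtain v where v: "tb a w v" using assms by (auto simp: good_def)
  have "u \<in> words" using u children_words tbD(1)[OF v] by blast
  then show ?thesis using u tb_append[OF v] by (auto simp: children_def)
 qed (use assms in \<open>auto simp: good_def\<close>)
qed

text \<open>No pair of children of \<open>w\<close> is inverted, because \<open>a\<close> is
  increasing on \<open>cyl w\<close>. Against any other word all children behave like
  \<open>w\<close>, and their weights add up to that of \<open>w\<close> by harmonicity.\<close>

lemma sgnP_expand:
 assumes a: "a \<in> Gam T" and P: "part P S" and g: "good a P" and w: "w \<in> P" and h: "harmonic \<chi>"
 shows "sgnP \<chi> (P - {w} \<union> children w) a = sgnP \<chi> P a"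
proof -
 let ?A = "P - {w}" and ?C = "children w"
 let ?g = "%u v. of_bool (inverted a u v) * (\<chi> (last u) * \<chi> (last v))"
 have wW: "w \<in> words" using partD(2)[OF P] w by auto
 have fin: "finite ?A" using partD(1)[OF P] by simp
 obtain w' where w': "tb a w w'" using g w by (auto simp: good_def)
 have csub: "cyl c \<subseteq> cyl w" if "c \<in> ?C" for c using cyl_children[OF wW] that by auto
 have cW: "c \<in> words" if "c \<in> ?C" for c using children_words[OF wW] that by auto
 have dis: "cyl u \<inter> cyl w = {}" if "u \<in> ?A" for u using partD(3)[OF P] that w unfolding pdis_def by blast
 have AC: "?A \<inter> ?C = {}"
 proof (rule ccontr)
  assume "\<not> ?thesis"
  then obtain c where "c \<in> ?A" "c \<in> ?C" by blast
  then show False using csub[of c] dis[of c] cyl_nonempty[OF cW] by blast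
 qed
 have gc: "\<exists>v. tb a c v" if "c \<in> ?C" for c
  using good_expand[OF g w] that by (auto simp: good_def)
 have inv1: "inverted a u c = inverted a u w" "inverted a c u = inverted a w u"
  if u: "u \<in> ?A" and c: "c \<in> ?C" for u c
 proof -
  obtain u' where u': "tb a u u'" using g u by (auto simp: good_def)
  obtain c' where c': "tb a c c'" using gc[OF c] by auto
  have pu: "pt u \<in> cyl u" "pt c \<in> cyl c" "pt c \<in> cyl w"
   using tbD(1)[OF u'] cW[OF c] csub[OF c] pt_in by blast+
  have d: "cyl u \<inter> cyl w = {}" "cyl w \<inter> cyl u = {}" "cyl u \<inter> cyl c = {}" "cyl c \<inter> cyl u = {}"
   using dis[OF u] csub[OF c] by blast+
  show "inverted a u c = inverted a u w"
   using inverted_iff[OF a u' c' d(3) pu(1,2)] inverted_iff[OF a u' w' d(1) pu(1,3)] by simp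
  show "inverted a c u = inverted a w u"
   using inverted_iff[OF a c' u' d(4) pu(2,1)] inverted_iff[OF a w' u' d(2) pu(3,1)] by simp
 qed
 have lc: "(\<Sum>c\<in>?C. \<chi> (last c)) = \<chi> (last w)"
  using h last_in_arcs[OF wW] by (simp add: sum_children harmonic_def)
 have "(\<Sum>u\<in>?C. \<Sum>v\<in>?C. ?g u v) = 0"
 proof (intro sum.neutral ballI)
  fix c c' assume c: "c \<in> ?C" "c' \<in> ?C"
  have p: "pt c \<in> cyl w" "pt c' \<in> cyl w" using c cW csub pt_in by blast+
  have "\<not> inverted a c c'"
  proof
   assume i: "inverted a c c'"
   then have "lt (rp w w' (pt c)) (rp w w' (pt c'))" using p by (auto simp: inverted_def intro: lt_rp)
   then have "lt (a (pt c)) (a (pt c'))" using tbD(4)[OF w'] p by simp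
   then show False using i lt_asym by (auto simp: inverted_def)
  qed
  then show "?g c c' = 0" by simp
 qed
 moreover have "(\<Sum>u\<in>?A. \<Sum>c\<in>?C. ?g u c + ?g c u) = (\<Sum>u\<in>?A. ?g u w + ?g w u)"
 proof (rule sum.cong[OF refl])
  fix u assume u: "u \<in> ?A"
  have "(\<Sum>c\<in>?C. ?g u c + ?g c u) = (\<Sum>c\<in>?C. \<chi> (last c) *
    (of_bool (inverted a u w) * \<chi> (last u) + of_bool (inverted a w u) * \<chi> (last u)))"
   by (rule sum.cong[OF refl]) (auto simp: inv1[OF u] algebra_simps)
  also have "\<dots> = ?g u w + ?g w u"
   unfolding sum_distrib_right[symmetric] lc
   by (cases "\<chi> (last u)"; cases "\<chi> (last w)") simp_all
  finally show "(\<Sum>c\<in>?C. ?g u c + ?g c u) = ?g u w + ?g w u" .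
 qed
 ultimately have "sgnP \<chi> (?A \<union> ?C) a = (\<Sum>u\<in>?A. \<Sum>v\<in>?A. ?g u v) + (\<Sum>u\<in>?A. ?g u w + ?g w u)"
  unfolding sgnP_def double_sum_Un[OF fin finite_children AC] by simp
 also have "\<dots> = sgnP \<chi> (?A \<union> {w}) a"
 proof -
  have "?A \<inter> {w} = {}" by auto
  moreover have "?g w w = 0" by (simp add: inverted_def)
  ultimately show ?thesis
   unfolding sgnP_def double_sum_Un[OF fin finite.intros(2)[OF finite.intros(1)] \<open>?A \<inter> {w} = {}\<close>] sum_singleton
   by (simp only: add_0_right)
 qed
 also have "?A \<union> {w} = P" using w by auto
 finally show ?thesis .
qed

lemma sgnP_reach:
 assumes "reach B P ms" "a \<in> Gam T" "part B S" "good a B" "harmonic \<chi>"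
 shows "sgnP \<chi> P a = sgnP \<chi> B a & good a P"
 using assms(1)
proof (induction rule: reach.induct)
 case (reach_step P ms w)
 then show ?case
  using sgnP_expand[OF assms(2) reach_part[OF reach_step(1) assms(3)] _ reach_step(2) assms(5)]
   good_expand[of a P w] by simp
qed (use assms in auto)

text \<open>Both partitions are expanded to the words of one common length.\<close>

lemma sgnP_independent:
 assumes a: "a \<in> Gam T" and S: "clop S L" and P: "part P S" "good a P" and P': "part P' S" "good a P'"
  and h: "harmonic \<chi>"
 shows "sgnP \<chi> P a = sgnP \<chi> P' a"
proof -
 obtain n where n: "L \<le> n" "!!w. w \<in> P \<union> P' ==> length w \<le> n"
 proof -
  have "finite (length ` (P \<union> P'))" using partD(1)[OF P(1)] partD(1)[OF P'(1)] by simp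
  then obtain m where "\<forall>k\<in>length ` (P \<union> P'). k \<le> m" using finite_nat_set_iff_bounded_le by blast
  then show ?thesis by (intro that[of "max L m"]) (auto simp: le_max_iff_disj)
 qed
 let ?R = "(%x. pfx x n) ` S"
 have R: "part ?R S" using part_level[OF clop_mono[OF S n(1)]] .
 have ref: "\<exists>ms. reach D ?R ms" if D: "part D S" "D \<subseteq> P \<union> P'" for D
 proof (rule reach_exists[OF D(1) R])
  fix v assume "v \<in> ?R"
  then obtain x where x: "x \<in> S" "v = pfx x n" by auto
  then obtain w where w: "w \<in> D" "x \<in> cyl w" using part_point[OF D(1)] by blast
  then have "length w \<le> n" using n(2) D(2) by blast
  then have "prefix w v" using cyl_pfx[OF w(2)] x(2) prefix_pfx by metis
  then show "\<exists>w\<in>D. prefix w v" using w(1) by blast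
 qed
 obtain ms ms' where "reach P ?R ms" "reach P' ?R ms'" using ref[OF P(1)] ref[OF P'(1)] by blast
 then show ?thesis using sgnP_reach[of P ?R ms a T S \<chi>] sgnP_reach[of P' ?R ms' a T S \<chi>] a P P' h by simp
qed

definition sgn_of :: "('e => bit) => (nat => 'e) set => ((nat => 'e) => nat => 'e) => bit" where
 "sgn_of \<chi> S a = sgnP \<chi> (SOME P. part P S & good a P) a"

lemma sgn_of_eq:
 assumes a: "a \<in> Gam T" and S: "clop S L" and P: "part P S" "good a P" and h: "harmonic \<chi>"
 shows "sgn_of \<chi> S a = sgnP \<chi> P a"
proof -
 have "part (SOME P. part P S & good a P) S & good a (SOME P. part P S & good a P)"
  by (rule someI[of _ P]) (use P in simp)
 then show ?thesis unfolding sgn_of_def by (intro sgnP_independent[OF a S _ _ P h]) auto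
qed

text \<open>A pair is reversed by the composite exactly if one of the two maps reverses it but not
  both. The weights agree because tables preserve the last arc.\<close>

lemma sgn_of_comp:
 assumes a: "a \<in> Gam S" and b: "b \<in> Gam S" and S: "clop S L" and h: "harmonic \<chi>"
 shows "sgn_of \<chi> S (b \<circ> a) = sgn_of \<chi> S b + sgn_of \<chi> S a"
proof -
 have SX: "S \<subseteq> X" using clop_X_level[OF S] by auto
 obtain L1 where L1: "\<forall>x\<in>X. \<forall>n\<ge>L1. \<exists>v. 0 \<le> length v & tb b (pfx x n) v"
  using Gam_level[OF b, of 0] by blast
 obtain L2 where L2: "\<forall>x\<in>X. \<forall>n\<ge>L2. \<exists>v. L1 \<le> length v & tb a (pfx x n) v"
  using Gam_level[OF a, of L1] by blast
 let ?n = "max L L2"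
 let ?P = "(%x. pfx x ?n) ` S"
 have P: "part ?P S" using part_level[OF clop_mono[OF S, of ?n]] by simp
 have "\<forall>w\<in>?P. \<exists>v. L1 \<le> length v & tb a w v" using L2 SX by auto
 then obtain \<phi> where \<phi>: "\<forall>w\<in>?P. L1 \<le> length (\<phi> w) & tb a w (\<phi> w)" by metis
 have P': "part (\<phi> ` ?P) S" "inj_on \<phi> ?P" using part_image[OF a P] \<phi> by blast+
 have ga: "good a ?P" using \<phi> unfolding good_def by blast
 have gb': "\<exists>v. tb b (\<phi> w) v" if w: "w \<in> ?P" for w
 proof -
  have t: "\<phi> w \<in> words" using \<phi> w tbD(2) by blast
  have p: "pt (\<phi> w) \<in> X" "pfx (pt (\<phi> w)) (length (\<phi> w)) = \<phi> w"
   using pt_in[OF t] cyl_X cyl_pfx by blast+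
  have "L1 \<le> length (\<phi> w)" using \<phi> w by blast
  from L1[rule_format, OF p(1) this] show ?thesis unfolding p(2) by blast
 qed
 have gb: "good b (\<phi> ` ?P)" using gb' by (auto simp: good_def)
 have gc: "good (b \<circ> a) ?P" unfolding good_def using gb' \<phi> tb_comp by blast
 have ba: "b \<circ> a \<in> Gam S" using a b by (rule comp_Gam)
 define K where "K u v = \<chi> (last u) * \<chi> (last v)" for u v :: "'e list"
 have inj: "pt u ~= pt v" if "u \<in> ?P" "v \<in> ?P" "u ~= v" for u v
 proof
  assume "pt u = pt v"
  moreover have "pt u \<in> cyl u" "pt v \<in> cyl v" using that(1,2) partD(2)[OF P] by (blast intro: pt_in)+
  ultimately show False using pdisD[OF partD(3)[OF P] that(1,2)] that(3) by metis
 qed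
 have ptX: "pt u \<in> X" if "u \<in> ?P" for u using that partD(2)[OF P] pt_in cyl_X by blast
 have last\<phi>: "last (\<phi> u) = last u" if "u \<in> ?P" for u using \<phi> that tbD(3) by metis
 have invb: "inverted b (\<phi> u) (\<phi> v) \<longleftrightarrow> lt (a (pt u)) (a (pt v)) & lt (b (a (pt v))) (b (a (pt u)))"
  if u: "u \<in> ?P" and v: "v \<in> ?P" for u v
 proof (cases "u = v")
  case True then show ?thesis by (simp add: inverted_def)
 next
  case False
  then have "\<phi> u ~= \<phi> v" using P'(2) u v by (auto dest: inj_onD)
  then have d: "cyl (\<phi> u) \<inter> cyl (\<phi> v) = {}" using partD(3)[OF P'(1)] u v unfolding pdis_def by blast
  obtain u' v' where t: "tb b (\<phi> u) u'" "tb b (\<phi> v) v'" using gb' u v by meson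
  have "a (pt u) \<in> cyl (\<phi> u)" "a (pt v) \<in> cyl (\<phi> v)"
   using \<phi> u v tb_in_cyl pt_in partD(2)[OF P] by (meson subsetD)+
  then show ?thesis using inverted_iff[OF b t d] by simp
 qed
 have "sgnP \<chi> (\<phi> ` ?P) b = (\<Sum>u\<in>?P. \<Sum>v\<in>?P. of_bool (inverted b (\<phi> u) (\<phi> v)) * K u v)"
  unfolding sgnP_def sum.reindex[OF P'(2)] o_def K_def
  by (intro sum.cong refl) (simp add: last\<phi>)
 also have "\<dots> = (\<Sum>u\<in>?P. \<Sum>v\<in>?P. of_bool (lt (a (pt u)) (a (pt v)) & lt (b (a (pt v))) (b (a (pt u)))) * K u v)"
  using invb by (intro sum.cong refl) simp
 finally have sb: "sgnP \<chi> (\<phi> ` ?P) b = \<dots>" .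
 \<comment> \<open>Each of the three terms sees only one ordering of a pair, but their sum is
   symmetric in \<open>u\<close> and \<open>v\<close>, so its double sum vanishes modulo
   two.\<close>
 define D where "D u v = of_bool (inverted (b \<circ> a) u v) * K u v + of_bool (inverted a u v) * K u v
  + of_bool (lt (a (pt u)) (a (pt v)) & lt (b (a (pt v))) (b (a (pt u)))) * K u v" for u v
 have "(\<Sum>u\<in>?P. \<Sum>v\<in>?P. D u v) = 0"
 proof (rule sum_symmetric_bit)
  show "finite ?P" using partD(1)[OF P] .
  show "D u u = 0" for u by (simp add: D_def inverted_def)
  fix u v assume uv: "u \<in> ?P" "v \<in> ?P"
  show "D u v = D v u"
  proof (cases "u = v")
   case False
   have n: "pt u ~= pt v" using inj[OF uv False] .
   have X: "pt u \<in> X" "pt v \<in> X" "a (pt u) \<in> X" "a (pt v) \<in> X" "b (a (pt u)) \<in> X" "b (a (pt v)) \<in> X"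
    using ptX uv Gam_X[OF a] Gam_X[OF b] by auto
   have n': "a (pt u) ~= a (pt v)" "b (a (pt u)) ~= b (a (pt v))"
    using n Gam_inj[OF a] Gam_inj[OF b] by auto
   have "lt (pt v) (pt u) \<longleftrightarrow> \<not> lt (pt u) (pt v)" "lt (a (pt v)) (a (pt u)) \<longleftrightarrow> \<not> lt (a (pt u)) (a (pt v))"
    "lt (b (a (pt v))) (b (a (pt u))) \<longleftrightarrow> \<not> lt (b (a (pt u))) (b (a (pt v)))"
    by (rule lt_not[OF X(1,2) n] lt_not[OF X(3,4) n'(1)] lt_not[OF X(5,6) n'(2)])+
   moreover have "K v u = K u v" by (simp add: K_def mult.commute)
   \<comment> \<open>Here \<open>p\<close>, \<open>q\<close> and \<open>r\<close> compare the pair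
     before \<open>a\<close>, after \<open>a\<close> and after \<open>b \<circ> a\<close>.\<close>
   moreover have "of_bool (p & \<not> r) * k + of_bool (p & \<not> q) * k + of_bool (q & \<not> r) * k
     = of_bool (\<not> p & r) * k + of_bool (\<not> p & q) * k + of_bool (\<not> q & r) * k" for p q r and k :: bit
    by (cases p; cases q; cases r) simp_all
   ultimately show ?thesis by (simp only: D_def inverted_def o_apply)
  qed simp
 qed
 then have "sgnP \<chi> ?P (b \<circ> a) + sgnP \<chi> ?P a + sgnP \<chi> (\<phi> ` ?P) b = 0"
  unfolding sb D_def sum.distrib by (simp add: sgnP_def K_def)
 then have "sgnP \<chi> ?P (b \<circ> a) = sgnP \<chi> (\<phi> ` ?P) b + sgnP \<chi> ?P a"
  by (rule bit_sum_eq_zeroD)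
 then show ?thesis
  using sgn_of_eq[OF ba S P gc h] sgn_of_eq[OF b S P'(1) gb h] sgn_of_eq[OF a S P ga h] by simp
qed

text \<open>The exchanged pair contributes the product of two equal weights, which is the weight
  itself since \<open>x * x = x\<close> for bits. Inversions with any third word come in cancelling
  pairs.\<close>

lemma sgn_of_tr:
 assumes sw: "swappable w v" and sub: "cyl w \<subseteq> S" "cyl v \<subseteq> S" and S: "clop S L" and h: "harmonic \<chi>"
 shows "sgn_of \<chi> S (tr w v) = \<chi> (last w)"
proof -
 have W: "w \<in> words" "v \<in> words" "last w = last v" "cyl w \<inter> cyl v = {}"
  using sw by (auto simp: swappable_def)
 have wv: "w ~= v" using W cyl_nonempty by blast
 let ?n = "max L (max (length w) (length v))"
 let ?S = "S - (cyl w \<union> cyl v)"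
 let ?A = "(%x. pfx x ?n) ` ?S"
 let ?P = "?A \<union> {w, v}"
 have "clop (cyl w \<union> cyl v) ?n"
  using clop_mono[OF clop_cyl[OF W(1)]] clop_mono[OF clop_cyl[OF W(2)]] by (intro clop_Un) auto
 then have "clop ?S ?n" using clop_mono[OF S] by (intro clop_diff) auto
 then have A: "part ?A ?S" by (rule part_level)
 have dA: "cyl u \<inter> cyl w = {}" "cyl u \<inter> cyl v = {}" if "u \<in> ?A" for u using partD(5)[OF A that] by blast+
 have P: "part ?P S" unfolding part_def
 proof (intro conjI)
  show "finite ?P" using partD(1)[OF A] by simp
  show "?P \<subseteq> words" using partD(2)[OF A] W by auto
  show "pdis ?P" unfolding pdis_def
  proof (intro ballI impI)
   fix y z assume "y \<in> ?P" "z \<in> ?P" "y ~= z"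
   then consider "y \<in> ?A" "z \<in> ?A" | "y \<in> ?A" "z \<in> {w, v}" | "y \<in> {w, v}" "z \<in> ?A"
    | "y \<in> {w, v}" "z \<in> {w, v}" by blast
   then show "cyl y \<inter> cyl z = {}"
   proof cases
    case 1 then show ?thesis using partD(3)[OF A] \<open>y ~= z\<close> unfolding pdis_def by blast
   next
    case 2 then show ?thesis using dA[of y] by auto
   next
    case 3 then show ?thesis using dA[of z] by auto
   next
    case 4 then show ?thesis using W(4) \<open>y ~= z\<close> by auto
   qed
  qed
  show "(\<Union>u\<in>?P. cyl u) = S" using partD(4)[OF A] sub by (simp add: UN_Un) blast
 qed
 have trG: "tr w v \<in> Gam (cyl w \<union> cyl v)" using tr_Gam[OF sw] .
 have trA: "tr w v (pt u) = pt u" if "u \<in> ?A" for u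
 proof -
  have "pt u \<in> cyl u" using that partD(2)[OF A] by auto
  then show ?thesis using dA[OF that] by (intro tr_simps(3)) auto
 qed
 have "good (tr w v) ?P" unfolding good_def
 proof
  fix u assume "u \<in> ?P"
  then show "\<exists>z. tb (tr w v) u z"
  proof
   assume u: "u \<in> ?A"
   have "tb (tr w v) u u" using u partD(2)[OF A] dA[OF u] by (intro tb_fix tr_simps(3)) auto
   then show ?thesis ..
  qed (use tb_tr[OF sw] in auto)
 qed
 then have "sgn_of \<chi> S (tr w v) = sgnP \<chi> ?P (tr w v)" by (rule sgn_of_eq[OF trG S P _ h])
 also have "\<dots> = \<chi> (last w)"
 proof -
  let ?g = "%u z. of_bool (inverted (tr w v) u z) * (\<chi> (last u) * \<chi> (last z))"
  have fA: "finite ?A" using partD(1)[OF A] .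
  have Awv: "?A \<inter> {w, v} = {}"
   using dA cyl_nonempty[OF W(1)] cyl_nonempty[OF W(2)] by fastforce
  have pw: "pt w \<in> cyl w" "pt v \<in> cyl v" using W by auto
  have tw: "tr w v (pt w) \<in> cyl v" "tr w v (pt v) \<in> cyl w"
   using tb_in_cyl[OF tb_tr(1)[OF sw] pw(1)] tb_in_cyl[OF tb_tr(2)[OF sw] pw(2)] .
  have g0: "?g u z = 0" if "u \<in> ?A" "z \<in> ?A" for u z
   using that trA lt_asym by (auto simp: inverted_def)
  \<comment> \<open>\<open>u\<close> is inverted with both \<open>w\<close> and \<open>v\<close> if
    it lies between them in the order, and with neither otherwise.\<close>
  have g1: "?g u w + ?g w u + (?g u v + ?g v u) = 0" if u: "u \<in> ?A" for u
  proof -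
   have uW: "u \<in> words" using partD(2)[OF A] u by auto
   have pu: "pt u \<in> cyl u" using uW by simp
   have d: "cyl v \<inter> cyl u = {}" "cyl w \<inter> cyl u = {}" using dA[OF u] by blast+
   have c: "lt (pt u) (tr w v (pt w)) = lt (pt u) (pt v)" "lt (pt u) (tr w v (pt v)) = lt (pt u) (pt w)"
    by (rule lt_cyl[OF uW W(2) dA(2)[OF u] pu pu tw(1) pw(2)] lt_cyl[OF uW W(1) dA(1)[OF u] pu pu tw(2) pw(1)])+
   have c': "lt (tr w v (pt w)) (pt u) = lt (pt v) (pt u)" "lt (tr w v (pt v)) (pt u) = lt (pt w) (pt u)"
    by (rule lt_cyl[OF W(2) uW d(1) tw(1) pw(2) pu pu] lt_cyl[OF W(1) uW d(2) tw(2) pw(1) pu pu])+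
   have "pt u ~= pt w" "pt u ~= pt v" using dA[OF u] pu pw by fastforce+
   then have n: "lt (pt w) (pt u) \<longleftrightarrow> \<not> lt (pt u) (pt w)" "lt (pt v) (pt u) \<longleftrightarrow> \<not> lt (pt u) (pt v)"
    using lt_not cyl_X pu pw by blast+
   show ?thesis unfolding inverted_def trA[OF u] c c' n W(3)
    by (cases "lt (pt u) (pt w)"; cases "lt (pt u) (pt v)") auto
  qed
  have "lt (tr w v (pt v)) (tr w v (pt w)) = lt (pt w) (pt v)"
   "lt (tr w v (pt w)) (tr w v (pt v)) = lt (pt v) (pt w)"
   by (rule lt_cyl[OF W(1,2,4) tw(2) pw(1) tw(1) pw(2)]
     lt_cyl[OF W(2,1) W(4)[unfolded Int_commute[of "cyl w"]] tw(1) pw(2) tw(2) pw(1)])+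
  moreover have "lt (pt v) (pt w) \<longleftrightarrow> \<not> lt (pt w) (pt v)"
  proof (rule lt_not)
   show "pt w ~= pt v" using pw W(4) by auto
  qed (use pw cyl_X in auto)
  ultimately have g2: "(\<Sum>u\<in>{w, v}. \<Sum>z\<in>{w, v}. ?g u z) = \<chi> (last w)"
   using wv W(3) by (simp add: inverted_def) (cases "\<chi> (last v)", auto)
  have "sgnP \<chi> ?P (tr w v) = (\<Sum>u\<in>?A. \<Sum>z\<in>?A. ?g u z) + (\<Sum>u\<in>?A. \<Sum>c\<in>{w, v}. ?g u c + ?g c u)
    + (\<Sum>u\<in>{w, v}. \<Sum>z\<in>{w, v}. ?g u z)"
   unfolding sgnP_def by (rule double_sum_Un[OF fA _ Awv]) simp
  also have "(\<Sum>u\<in>?A. \<Sum>z\<in>?A. ?g u z) = 0" using g0 by (intro sum.neutral ballI)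
  also have "(\<Sum>u\<in>?A. \<Sum>c\<in>{w, v}. ?g u c + ?g c u) = 0"
  proof (rule sum.neutral, rule ballI)
   fix u assume u: "u \<in> ?A"
   have "(\<Sum>c\<in>{w, v}. ?g u c + ?g c u) = ?g u w + ?g w u + (?g u v + ?g v u)"
    using wv by (simp only: sum.insert[of "{v}" w] sum.insert[of "{}" v] sum.empty finite.intros
      singleton_iff empty_iff add_0_right not_False_eq_True)
   then show "(\<Sum>c\<in>{w, v}. ?g u c + ?g c u) = 0" using g1[OF u] by (simp only:)
  qed
  finally show ?thesis using g2 by simp
 qed
 finally show ?thesis .
qed

end

section \<open>Vectors modulo two\<close>

definition bscale :: "bit => ('a \<Rightarrow>\<^sub>0 bit) => 'a \<Rightarrow>\<^sub>0 bit" where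
 "bscale c x = (if c = 0 then 0 else x)"

lemma bitvec_add_self [simp]: "x + x = (0 :: 'a \<Rightarrow>\<^sub>0 bit)"
 by (rule poly_mapping_eqI) (simp add: lookup_add)

interpretation bitvec: vector_space "bscale :: bit => ('a \<Rightarrow>\<^sub>0 bit) => 'a \<Rightarrow>\<^sub>0 bit"
proof
 fix a b :: bit and x y :: "'a \<Rightarrow>\<^sub>0 bit"
 show "bscale (a + b) x = bscale a x + bscale b x"
  by (cases a; cases b) (simp_all add: bscale_def)
qed (auto simp: bscale_def)

abbreviation bvec :: "'a => 'a \<Rightarrow>\<^sub>0 bit" where
 "bvec e \<equiv> Poly_Mapping.single e 1"

lemma bitvec_sum: "x = (\<Sum>e\<in>Poly_Mapping.keys x. bvec e)" for x :: "'a \<Rightarrow>\<^sub>0 bit"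
proof (rule poly_mapping_eqI)
 fix k
 have "(\<Sum>e\<in>Poly_Mapping.keys x. Poly_Mapping.lookup (bvec e) k) = (\<Sum>e\<in>Poly_Mapping.keys x. if e = k then 1 else (0 :: bit))"
  by (rule sum.cong) (simp_all add: lookup_single when_def)
 also have "\<dots> = (if k \<in> Poly_Mapping.keys x then 1 else 0)" by (rule sum.delta[OF finite_keys])
 also have "\<dots> = Poly_Mapping.lookup x k" by (cases "Poly_Mapping.lookup x k") (auto simp: in_keys_iff)
 finally show "Poly_Mapping.lookup x k = Poly_Mapping.lookup (\<Sum>e\<in>Poly_Mapping.keys x. bvec e) k" by (simp only: lookup_sum)
qed

lemma bitvec_induct [case_names zero add]:
 fixes x :: "'a \<Rightarrow>\<^sub>0 bit"
 assumes "P 0" "!!e x. P x ==> P (bvec e + x)" shows "P x"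
proof -
 have "P (\<Sum>e\<in>F. bvec e)" if "finite F" for F
  using that by (induction F rule: finite_induct) (use assms in auto)
 then show ?thesis using bitvec_sum[of x] finite_keys[of x] by metis
qed

text \<open>
 The quotient of the vector space of bit vectors by the relations that equate an arc with the sum
 of its successors is the tensor product of the zeroth homology group with the field of two
 elements. \<open>BB\<close> represents a basis of it and \<open>chi\<close> gives the dual coordinates.
\<close>

locale sft_basis = sft Q for Q :: "('v, 'e) pre_digraph" +
 fixes BB :: "('e \<Rightarrow>\<^sub>0 bit) set" and chi :: "('e \<Rightarrow>\<^sub>0 bit) => ('e \<Rightarrow>\<^sub>0 bit) => bit"
 assumes chi_add: "!!b x y. chi b (x + y) = chi b x + chi b y"
  and chi_rel: "!!b e. b \<in> BB ==> e \<in> arcs Q ==> chi b (bvec e + (\<Sum>f\<in>nx e. bvec f)) = 0"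
  and chi_out: "!!b e. b \<in> BB ==> e \<notin> arcs Q ==> chi b (bvec e) = 0"
  and chi_span: "!!x. (!!b. b \<in> BB ==> chi b x = 0) ==>
   x \<in> bitvec.span ({bvec e + (\<Sum>f\<in>nx e. bvec f) | e. e \<in> arcs Q} \<union> {bvec e | e. e \<notin> arcs Q})"
  and chi_dual: "!!b b'. b \<in> BB ==> b' \<in> BB ==> chi b b' = of_bool (b = b')"
  and chi_finite: "!!x. finite {b \<in> BB. chi b x ~= 0}"

text \<open>A basis \<open>B0\<close> of the span of the relations is extended to a basis
  \<open>B\<close> of all vectors. The added vectors represent a basis of the quotient, and the
  coordinates at them vanish on the relations.\<close>

lemma (in sft) exists_basis: "\<exists>BB chi. sft_basis Q BB chi"
proof -
 \<comment> \<open>Vectors are indexed by the whole type, so basis vectors outside the arcs are made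
   relations as well.\<close>
 define R where "R = {bvec e + (\<Sum>f\<in>nx e. bvec f) | e. e \<in> arcs Q} \<union> {bvec e | e. e \<notin> arcs Q}"
 obtain B0 where B0: "B0 \<subseteq> bitvec.span R" "bitvec.independent B0" "bitvec.span R \<subseteq> bitvec.span B0"
  using bitvec.maximal_independent_subset[of "bitvec.span R"] by metis
 obtain B where B: "B0 \<subseteq> B" "bitvec.independent B" "UNIV \<subseteq> bitvec.span B"
  using bitvec.maximal_independent_subset_extend[OF subset_UNIV B0(2)] by metis
 have sp: "x \<in> bitvec.span B" for x using B(3) by blast
 let ?chi = "%b x. bitvec.representation B x b"
 have zero: "?chi b x = 0" if "x \<in> bitvec.span R" "b \<in> B - B0" for b x
 proof -
  have "bitvec.representation B x = bitvec.representation B0 x"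
   by (rule bitvec.representation_extend[OF B(2) _ B(1)]) (use that B0(3) in blast)
  then show ?thesis using that(2) bitvec.representation_ne_zero[of B0 x b] by (metis DiffD2)
 qed
 have "sft_basis Q (B - B0) ?chi"
 proof unfold_locales
  show "?chi b (x + y) = ?chi b x + ?chi b y" for b x y
   using bitvec.representation_add[OF B(2) sp sp] by simp
  fix b assume b: "b \<in> B - B0"
  show "?chi b (bvec e + (\<Sum>f\<in>nx e. bvec f)) = 0" if "e \<in> arcs Q" for e
   by (rule zero[OF bitvec.span_base b]) (use that in \<open>auto simp: R_def\<close>)
  show "?chi b (bvec e) = 0" if "e \<notin> arcs Q" for e
   by (rule zero[OF bitvec.span_base b]) (use that in \<open>auto simp: R_def\<close>)
  show "?chi b b' = of_bool (b = b')" if "b' \<in> B - B0" for b'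
   using bitvec.representation_basis[OF B(2), of b'] that by auto
 next
  fix x
  show "finite {b \<in> B - B0. ?chi b x ~= 0}"
   by (rule finite_subset[OF _ bitvec.finite_representation[of B x]]) auto
  assume x: "!!b. b \<in> B - B0 ==> ?chi b x = 0"
  have "(\<Sum>b | ?chi b x ~= 0. bscale (?chi b x) b) = x"
   by (rule bitvec.sum_nonzero_representation_eq[OF B(2) sp])
  moreover have "(\<Sum>b | ?chi b x ~= 0. bscale (?chi b x) b) \<in> bitvec.span R"
  proof (intro bitvec.span_sum bitvec.span_scale)
   fix b assume "b \<in> {b. ?chi b x ~= 0}"
   then have "b \<in> B0" using x[of b] bitvec.representation_ne_zero[of B x b] by auto
   then show "b \<in> bitvec.span R" using B0(1) by blast
  qed
  ultimately show "x \<in> bitvec.span ({bvec e + (\<Sum>f\<in>nx e. bvec f) | e. e \<in> arcs Q} \<union> {bvec e | e. e \<notin> arcs Q})"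
   by (simp add: R_def)
 qed
 then show ?thesis by blast
qed

context sft_basis
begin

text \<open>A concrete model of the tensor product of the zeroth homology group with the cyclic
  group of order two: coordinate functions of finite support on \<open>BB\<close>.\<close>

definition EE :: "(('e \<Rightarrow>\<^sub>0 bit) => bit) monoid" where
 "EE = \<lparr>carrier = {g. (\<forall>b. b \<notin> BB --> g b = 0) & finite {b. g b ~= 0}},
  monoid.mult = (%g h b. g b + h b), one = (%_. 0)\<rparr>"

lemma EE_simps [simp]: "g \<otimes>\<^bsub>EE\<^esub> h = (%b. g b + h b)" "\<one>\<^bsub>EE\<^esub> = (%_. 0)"
 by (simp_all add: EE_def)

lemma comm_group_EE: "comm_group EE"
proof (rule comm_groupI)
 fix g h assume gh: "g \<in> carrier EE" "h \<in> carrier EE"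
 have "{b. g b + h b ~= 0} \<subseteq> {b. g b ~= 0} \<union> {b. h b ~= 0}" by auto
 moreover have "finite ({b. g b ~= 0} \<union> {b. h b ~= 0})" using gh by (simp add: EE_def)
 ultimately have "finite {b. g b + h b ~= 0}" by (rule finite_subset)
 then show "g \<otimes>\<^bsub>EE\<^esub> h \<in> carrier EE" using gh by (simp add: EE_def)
 show "\<exists>h\<in>carrier EE. h \<otimes>\<^bsub>EE\<^esub> g = \<one>\<^bsub>EE\<^esub>" using gh by (intro bexI[of _ g]) auto
qed (auto simp: EE_def ac_simps fun_eq_iff)

definition coord :: "('e \<Rightarrow>\<^sub>0 bit) => ('e \<Rightarrow>\<^sub>0 bit) => bit" where
 "coord x = (%b. if b \<in> BB then chi b x else 0)"

lemma chi_zero [simp]: "chi b 0 = 0"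
 using chi_add[of b 0 0] by simp

lemma chi_sum: "chi b (\<Sum>i\<in>I. f i) = (\<Sum>i\<in>I. chi b (f i))"
 by (induction I rule: infinite_finite_induct) (auto simp: chi_add)

lemma coord_add: "coord (x + y) = coord x \<otimes>\<^bsub>EE\<^esub> coord y"
 by (auto simp: coord_def chi_add)

lemma coord_zero: "coord 0 = \<one>\<^bsub>EE\<^esub>"
 by (auto simp: coord_def)

lemma coord_EE: "coord x \<in> carrier EE"
proof -
 have "{b. coord x b ~= 0} = {b \<in> BB. chi b x ~= 0}" by (auto simp: coord_def)
 then show ?thesis using chi_finite[of x] by (auto simp: EE_def coord_def)
qed

lemma coord_surj: assumes "g \<in> carrier EE" shows "\<exists>x. coord x = g"
proof -
 let ?x = "\<Sum>b | g b ~= 0. b"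
 have g: "finite {b. g b ~= 0}" "!!b. b \<notin> BB ==> g b = 0" using assms by (auto simp: EE_def)
 have "coord ?x b = g b" for b
 proof (cases "b \<in> BB")
  case True
  have "chi b ?x = (\<Sum>b' | g b' ~= 0. of_bool (b = b'))"
   unfolding chi_sum
  proof (rule sum.cong[OF refl])
   fix b' assume "b' \<in> {b'. g b' ~= 0}"
   then have "b' \<in> BB" using g(2)[of b'] by (cases "b' \<in> BB") auto
   then show "chi b b' = of_bool (b = b')" using True chi_dual by simp
  qed
  also have "\<dots> = (if b \<in> {b. g b ~= 0} then 1 else 0)"
   unfolding of_bool_def by (rule sum.delta'[OF g(1)])
  also have "\<dots> = g b" by (cases "g b") simp_all
  finally show ?thesis using True by (simp add: coord_def)
 qed (use g(2) in \<open>simp add: coord_def\<close>)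
 then show ?thesis by blast
qed

definition chr :: "('e \<Rightarrow>\<^sub>0 bit) => 'e => bit" where
 "chr b e = chi b (bvec e)"

lemma harmonic_chr: assumes b: "b \<in> BB" shows "harmonic (chr b)"
 unfolding harmonic_def
proof
 fix e assume e: "e \<in> arcs Q"
 have eq: "x + y = 0 ==> x = y" for x y :: bit by (cases x; cases y) simp_all
 have "chr b e + (\<Sum>f\<in>nx e. chr b f) = 0"
  using chi_rel[OF b e] by (simp only: chi_add chi_sum chr_def)
 then show "chr b e = (\<Sum>f\<in>nx e. chr b f)" by (rule eq)
qed

text \<open>Universal property of the quotient: elements \<open>c e\<close> with trivial squares
  that obey the relations extend to a homomorphism on vectors, whose kernel contains the span of the
  relations. It serves for classes of transpositions and for classes of cylinders.\<close>

lemma kernel_coord_trivial: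
 assumes K: "comm_group K" and c: "!!e. e \<in> arcs Q ==> c e \<in> carrier K"
  and c2: "!!e. e \<in> arcs Q ==> c e \<otimes>\<^bsub>K\<^esub> c e = \<one>\<^bsub>K\<^esub>"
  and rel: "!!e. e \<in> arcs Q ==> c e = finprod K c (nx e)"
 defines "C \<equiv> %x. finprod K (%e. if Poly_Mapping.lookup x e = 1 then c e else \<one>\<^bsub>K\<^esub>) (arcs Q)"
 shows "C x \<in> carrier K" "C (x + y) = C x \<otimes>\<^bsub>K\<^esub> C y" "C 0 = \<one>\<^bsub>K\<^esub>"
  "e \<in> arcs Q ==> C (bvec e) = c e" "coord x = \<one>\<^bsub>EE\<^esub> ==> C x = \<one>\<^bsub>K\<^esub>"
proof -
 interpret K: comm_group K by (rule K)
 have Ccl: "C x \<in> carrier K" for x unfolding C_def using c by (intro K.finprod_closed) auto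
 have Cadd: "C (x + y) = C x \<otimes>\<^bsub>K\<^esub> C y" for x y
 proof -
  have "C x \<otimes>\<^bsub>K\<^esub> C y = finprod K (%e. (if Poly_Mapping.lookup x e = 1 then c e else \<one>\<^bsub>K\<^esub>) \<otimes>\<^bsub>K\<^esub>
    (if Poly_Mapping.lookup y e = 1 then c e else \<one>\<^bsub>K\<^esub>)) (arcs Q)"
   unfolding C_def using c by (intro K.finprod_multf[symmetric]) auto
  also have "\<dots> = C (x + y)"
   unfolding C_def using c c2
   by (intro K.finprod_cong') (auto simp: lookup_add)
  finally show ?thesis by simp
 qed
 have C0: "C 0 = \<one>\<^bsub>K\<^esub>" unfolding C_def by (rule K.finprod_one_eqI) auto
 have Ce: "C (bvec e) = (if e \<in> arcs Q then c e else \<one>\<^bsub>K\<^esub>)" for e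
 proof (cases "e \<in> arcs Q")
  case True
  have "C (bvec e) = finprod K (%f. if e = f then c f else \<one>\<^bsub>K\<^esub>) (arcs Q)"
   unfolding C_def using c by (intro K.finprod_cong') (auto simp: lookup_single when_def)
  also have "\<dots> = c e" using True finite_arcs c by (intro K.finprod_singleton) auto
  finally show ?thesis using True by simp
 next
  case False
  then have "C (bvec e) = \<one>\<^bsub>K\<^esub>"
   unfolding C_def by (intro K.finprod_one_eqI) (auto simp: lookup_single when_def)
  then show ?thesis using False by simp
 qed
 have Csum: "C (\<Sum>f\<in>F. bvec f) = finprod K c F" if "F \<subseteq> arcs Q" for F
 proof -
  have "finite F" using that finite_arcs finite_subset by blast
  then show ?thesis using that
  proof (induction F rule: finite_induct)
   case (insert f F)
   then have "finprod K c (insert f F) = c f \<otimes>\<^bsub>K\<^esub> finprod K c F"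
    using c by (intro K.finprod_insert) auto
   then show ?case using insert by (simp add: Cadd Ce)
  qed (simp add: C0)
 qed
 show "C x \<in> carrier K" "C (x + y) = C x \<otimes>\<^bsub>K\<^esub> C y" "C 0 = \<one>\<^bsub>K\<^esub>" by (rule Ccl Cadd C0)+
 show "e \<in> arcs Q ==> C (bvec e) = c e" by (simp add: Ce)
 assume x: "coord x = \<one>\<^bsub>EE\<^esub>"
 let ?R = "{bvec e + (\<Sum>f\<in>nx e. bvec f) | e. e \<in> arcs Q} \<union> {bvec e | e. e \<notin> arcs Q}"
 have "x \<in> bitvec.span ?R"
  using x by (intro chi_span) (auto simp: coord_def fun_eq_iff split: if_splits)
 moreover have "bitvec.span ?R \<subseteq> {x. C x = \<one>\<^bsub>K\<^esub>}"
 proof (rule bitvec.span_minimal)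
  show "?R \<subseteq> {x. C x = \<one>\<^bsub>K\<^esub>}"
  proof
   fix r assume "r \<in> ?R"
   then consider e where "e \<in> arcs Q" "r = bvec e + (\<Sum>f\<in>nx e. bvec f)"
    | e where "e \<notin> arcs Q" "r = bvec e" by blast
   then show "r \<in> {x. C x = \<one>\<^bsub>K\<^esub>}"
   proof cases
    case 1
    have "C (\<Sum>f\<in>nx e. bvec f) = c e" using rel[OF 1(1)] Csum[of "nx e"] nx_arcs by auto
    then show ?thesis using 1 c2 by (simp add: Cadd Ce)
   next
    case 2
    then show ?thesis by (simp add: Ce)
   qed
  qed
  show "bitvec.subspace {x. C x = \<one>\<^bsub>K\<^esub>}"
   by (rule bitvec.subspaceI) (auto simp: C0 Cadd bscale_def)
 qed
 ultimately show "C x = \<one>\<^bsub>K\<^esub>" by blast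
qed

end

section \<open>Classes of transpositions modulo commutators\<close>

context sft
begin

lemma disjoint_subwords:
 assumes u: "u \<in> words" and v: "v \<in> words"
 obtains u' v' where "u' \<in> words" "v' \<in> words" "cyl u' \<subseteq> cyl u" "cyl v' \<subseteq> cyl v" "cyl u' \<inter> cyl v' = {}"
proof -
 note e = last_in_arcs[OF u]
 obtain p q where pq: "p \<in> words" "q \<in> words" "prefix u p" "prefix u q" "cyl p \<inter> cyl q = {}"
  using split_word[OF u e] by metis
 obtain r s where rs: "r \<in> words" "s \<in> words" "prefix v r" "prefix v s" "cyl r \<inter> cyl s = {}"
  using split_word[OF v e] by metis
 have "\<exists>r'\<in>{r, s}. \<exists>p'\<in>{p, q}. cyl r' \<inter> cyl p' = {}"
  using cyl_disjoint_iff[OF rs(1) pq(1)] cyl_prefix[of r p] cyl_prefix[of p r] pq(5) rs(5) by blast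
 then obtain r' p' where rp: "r' \<in> {r, s}" "p' \<in> {p, q}" "cyl r' \<inter> cyl p' = {}" by blast
 then show ?thesis
  using pq rs cyl_prefix[of v r'] cyl_prefix[of u p'] by (intro that[of p' r']) auto
qed

lemma exists_swappable:
 assumes "u \<in> words" "e \<in> arcs Q"
 obtains w v where "swappable w v" "last w = e" "cyl w \<subseteq> cyl u" "cyl v \<subseteq> cyl u"
 using split_word[OF assms] cyl_prefix unfolding swappable_def by metis

abbreviation "cls Y \<equiv> (%a. derived (GG Y) (Gam Y) #>\<^bsub>GG Y\<^esub> a)"
abbreviation "Kab Y \<equiv> GG Y Mod derived (GG Y) (Gam Y)"

lemma comm_group_Kab: "Y \<subseteq> X ==> comm_group (Kab Y)"
 using group.derived_quot_is_comm_group[OF group_GG] by simp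

lemma normal_derived: "Y \<subseteq> X ==> derived (GG Y) (Gam Y) \<lhd> GG Y"
 using group.derived_self_is_normal[OF group_GG] by simp

lemma cls_hom: "Y \<subseteq> X ==> cls Y \<in> hom (GG Y) (Kab Y)"
 using normal.r_coset_hom_Mod[OF normal_derived] .

lemma cls_comp:
 "Y \<subseteq> X ==> a \<in> Gam Y ==> b \<in> Gam Y ==> cls Y (a \<circ> b) = cls Y a \<otimes>\<^bsub>Kab Y\<^esub> cls Y b"
 using hom_mult[OF cls_hom, of Y a b] by (simp del: mult_FactGroup)

lemma cls_closed: "Y \<subseteq> X ==> a \<in> Gam Y ==> cls Y a \<in> carrier (Kab Y)"
 using hom_in_carrier[OF cls_hom, of Y a] by simp

lemma cls_id: "Y \<subseteq> X ==> cls Y id = \<one>\<^bsub>Kab Y\<^esub>"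
 using hom_one[OF cls_hom group_GG normal.factorgroup_is_group[OF normal_derived], of Y]
 by (simp del: one_FactGroup)

lemma cls_one: "Y \<subseteq> X ==> a \<in> Gam Y ==> cls Y a = \<one>\<^bsub>Kab Y\<^esub> ==> a \<in> derived (GG Y) (Gam Y)"
proof -
 assume Y: "Y \<subseteq> X" and a: "a \<in> Gam Y" and c: "cls Y a = \<one>\<^bsub>Kab Y\<^esub>"
 have "a \<in> cls Y a"
  using group.rcos_self[OF group_GG[OF Y] _ normal_imp_subgroup[OF normal_derived[OF Y]], of a] a by simp
 then show ?thesis using c by (simp add: FactGroup_def)
qed

lemma cls_conj:
 assumes Y: "Y \<subseteq> X" and g: "g \<in> Gam Y" and a: "a \<in> Gam Y" "b \<in> Gam Y" and eq: "g \<circ> a = b \<circ> g"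
 shows "cls Y a = cls Y b"
proof -
 interpret K: comm_group "Kab Y" by (rule comm_group_Kab[OF Y])
 note c = cls_closed[OF Y]
 have "cls Y g \<otimes>\<^bsub>Kab Y\<^esub> cls Y a = cls Y b \<otimes>\<^bsub>Kab Y\<^esub> cls Y g"
  using cls_comp[OF Y g a(1)] cls_comp[OF Y a(2) g] eq by simp
 then have "cls Y g \<otimes>\<^bsub>Kab Y\<^esub> cls Y a = cls Y g \<otimes>\<^bsub>Kab Y\<^esub> cls Y b"
  using K.m_comm[OF c[OF a(2)] c[OF g]] by (simp only:)
 then show ?thesis using c[OF g] c[OF a(1)] c[OF a(2)] by (simp del: mult_FactGroup)
qed

lemma tr_in_Gam: "swappable w v ==> cyl w \<subseteq> Y ==> cyl v \<subseteq> Y ==> tr w v \<in> Gam Y"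
 using tr_Gam[of w v] Gam_mono[of "cyl w \<union> cyl v" Y] by auto

text \<open>The product of the swaps of \<open>w\<close> with \<open>w'\<close> and of
  \<open>v\<close> with \<open>v'\<close> conjugates one transposition into the other.\<close>

lemma cls_tr_disjoint:
 assumes Y: "Y \<subseteq> X" and s: "swappable w v" "swappable w' v'" and l: "last w = last w'"
  and sub: "cyl w \<subseteq> Y" "cyl v \<subseteq> Y" "cyl w' \<subseteq> Y" "cyl v' \<subseteq> Y"
  and d: "(cyl w \<union> cyl v) \<inter> (cyl w' \<union> cyl v') = {}"
 shows "cls Y (tr w v) = cls Y (tr w' v')"
proof -
 have s': "swappable w w'" "swappable v v'" using s l d by (auto simp: swappable_def)
 let ?g = "tr w w' \<circ> tr v v'"
 have dd: "cyl w \<inter> cyl v = {}" "cyl w' \<inter> cyl v' = {}" "cyl w \<inter> cyl w' = {}" "cyl w \<inter> cyl v' = {}"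
  "cyl v \<inter> cyl w' = {}" "cyl v \<inter> cyl v' = {}" using s d by (auto simp: swappable_def)
 have W: "w \<in> words" "v \<in> words" "w' \<in> words" "v' \<in> words" "last v = last w" "last w' = last w" "last v' = last w"
  using s l by (auto simp: swappable_def)
 have r: "rp p q x \<in> cyl q" if "x \<in> cyl p" "p \<in> {w, v, w', v'}" "q \<in> {w, v, w', v'}" for p q x
  using that W by (intro rp_in_cyl) auto
 have "(?g \<circ> tr w v) x = (tr w' v' \<circ> ?g) x" for x
 proof -
  consider "x \<in> cyl w" | "x \<in> cyl v" | "x \<in> cyl w'" | "x \<in> cyl v'"
   | "x \<notin> cyl w" "x \<notin> cyl v" "x \<notin> cyl w'" "x \<notin> cyl v'" by blast
  then show ?thesis
  proof cases
   case 1
   then have n: "x \<notin> cyl v" "x \<notin> cyl w'" "x \<notin> cyl v'" using dd by blast+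
   have i: "rp w v x \<in> cyl v" "rp w v' x \<in> cyl v'" "rp w w' x \<in> cyl w'" using r[OF 1] by auto
   then have n': "rp w v' x \<notin> cyl w" "rp w v' x \<notin> cyl w'" using dd by blast+
   show ?thesis using 1 n i n' by (simp add: tr_def rp_trans)
  next
   case 2
   then have n: "x \<notin> cyl w" "x \<notin> cyl w'" "x \<notin> cyl v'" using dd by blast+
   have i: "rp v w x \<in> cyl w" "rp v v' x \<in> cyl v'" "rp v w' x \<in> cyl w'" using r[OF 2] by auto
   then have n': "rp v w x \<notin> cyl v" "rp v w x \<notin> cyl v'" "rp v v' x \<notin> cyl w" "rp v v' x \<notin> cyl w'"
    using dd by blast+
   show ?thesis using 2 n i n' by (simp add: tr_def rp_trans)
  next
   case 3
   then have n: "x \<notin> cyl w" "x \<notin> cyl v" "x \<notin> cyl v'" using dd by blast+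
   have i: "rp w' w x \<in> cyl w" using r[OF 3] by auto
   then have n': "rp w' w x \<notin> cyl w'" "rp w' w x \<notin> cyl v'" using dd by blast+
   show ?thesis using 3 n i n' by (simp add: tr_def rp_trans)
  next
   case 4
   then have n: "x \<notin> cyl w" "x \<notin> cyl v" "x \<notin> cyl w'" using dd by blast+
   have i: "rp v' v x \<in> cyl v" using r[OF 4] by auto
   then have n': "rp v' v x \<notin> cyl w" "rp v' v x \<notin> cyl w'" "rp v' v x \<notin> cyl v'" using dd by blast+
   show ?thesis using 4 n i n' by (simp add: tr_def rp_trans)
  qed (simp add: tr_def)
 qed
 then have "?g \<circ> tr w v = tr w' v' \<circ> ?g" by auto
 moreover have "?g \<in> Gam Y" using s' sub by (intro comp_Gam tr_in_Gam)
 ultimately show ?thesis using s sub by (intro cls_conj[OF Y]) (auto intro: tr_in_Gam)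
qed

text \<open>The supports may overlap, so the comparison passes through transpositions inside the two
  free cylinders, shrunk to disjoint words \<open>o1\<close> and \<open>o2\<close>.\<close>

lemma cls_tr_cong:
 assumes Y: "Y \<subseteq> X" and s: "swappable w v" "swappable w' v'" and l: "last w = last w'"
  and u: "u \<in> words" "cyl u \<subseteq> Y" and u': "u' \<in> words" "cyl u' \<subseteq> Y"
  and sub: "cyl w \<subseteq> Y - cyl u" "cyl v \<subseteq> Y - cyl u" "cyl w' \<subseteq> Y - cyl u'" "cyl v' \<subseteq> Y - cyl u'"
 shows "cls Y (tr w v) = cls Y (tr w' v')"
proof -
 obtain o1 o2 where oo: "o1 \<in> words" "o2 \<in> words" "cyl o1 \<subseteq> cyl u" "cyl o2 \<subseteq> cyl u'" "cyl o1 \<inter> cyl o2 = {}"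
  using disjoint_subwords[OF u(1) u'(1)] by metis
 have e: "last w \<in> arcs Q" using s(1) last_in_arcs by (auto simp: swappable_def)
 obtain p q where p: "swappable p q" "last p = last w" "cyl p \<subseteq> cyl o1" "cyl q \<subseteq> cyl o1"
  using exists_swappable[OF oo(1) e] by metis
 obtain p' q' where p': "swappable p' q'" "last p' = last w" "cyl p' \<subseteq> cyl o2" "cyl q' \<subseteq> cyl o2"
  using exists_swappable[OF oo(2) e] by metis
 have S: "cyl w \<subseteq> Y" "cyl v \<subseteq> Y" "cyl w' \<subseteq> Y" "cyl v' \<subseteq> Y" "cyl p \<subseteq> Y" "cyl q \<subseteq> Y" "cyl p' \<subseteq> Y" "cyl q' \<subseteq> Y"
  using sub p(3,4) p'(3,4) oo(3,4) u(2) u'(2) by blast+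
 have "cls Y (tr w v) = cls Y (tr p q)"
 proof (rule cls_tr_disjoint[OF Y s(1) p(1) p(2)[symmetric] S(1,2,5,6)])
  show "(cyl w \<union> cyl v) \<inter> (cyl p \<union> cyl q) = {}" using sub(1,2) p(3,4) oo(3) by blast
 qed
 also have "\<dots> = cls Y (tr p' q')"
 proof (rule cls_tr_disjoint[OF Y p(1) p'(1) _ S(5,6,7,8)])
  show "last p = last p'" using p(2) p'(2) by simp
  show "(cyl p \<union> cyl q) \<inter> (cyl p' \<union> cyl q') = {}" using p(3,4) p'(3,4) oo(5) by blast
 qed
 also have "\<dots> = cls Y (tr w' v')"
 proof (rule cls_tr_disjoint[OF Y p'(1) s(2) _ S(7,8,3,4)])
  show "last p' = last w'" using p'(2) l by simp
  show "(cyl p' \<union> cyl q') \<inter> (cyl w' \<union> cyl v') = {}" using sub(3,4) p'(3,4) oo(4) by blast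
 qed
 finally show ?thesis .
qed

definition trcls :: "(nat => 'e) set => 'e => ((nat => 'e) => nat => 'e) set" where
 "trcls Y e = (SOME c. \<exists>w v u. swappable w v & last w = e & u \<in> words & cyl u \<subseteq> Y &
  cyl w \<subseteq> Y - cyl u & cyl v \<subseteq> Y - cyl u & c = cls Y (tr w v))"

lemma trcls_eq:
 assumes Y: "Y \<subseteq> X" and s: "swappable w v" and u: "u \<in> words" "cyl u \<subseteq> Y"
  and sub: "cyl w \<subseteq> Y - cyl u" "cyl v \<subseteq> Y - cyl u"
 shows "trcls Y (last w) = cls Y (tr w v)"
 unfolding trcls_def
proof (rule some_equality)
 show "\<exists>w' v' u. swappable w' v' & last w' = last w & u \<in> words & cyl u \<subseteq> Y &
  cyl w' \<subseteq> Y - cyl u & cyl v' \<subseteq> Y - cyl u & cls Y (tr w v) = cls Y (tr w' v')"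
  using assms by blast
next
 fix c assume "\<exists>w' v' u. swappable w' v' & last w' = last w & u \<in> words & cyl u \<subseteq> Y &
  cyl w' \<subseteq> Y - cyl u & cyl v' \<subseteq> Y - cyl u & c = cls Y (tr w' v')"
 then obtain w' v' u' where w: "swappable w' v'" "last w' = last w" "u' \<in> words" "cyl u' \<subseteq> Y"
  "cyl w' \<subseteq> Y - cyl u'" "cyl v' \<subseteq> Y - cyl u'" "c = cls Y (tr w' v')" by blast
 show "c = cls Y (tr w v)" unfolding w(7)
  by (rule cls_tr_cong[OF Y w(1) s w(2) w(3,4) u w(5,6) sub])
qed

lemma trcls_exists:
 assumes Y: "Y \<subseteq> X" and o: "z \<in> words" "cyl z \<subseteq> Y" and e: "e \<in> arcs Q"
 obtains w v u where "swappable w v" "last w = e" "u \<in> words" "cyl u \<subseteq> Y"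
  "cyl w \<subseteq> Y - cyl u" "cyl v \<subseteq> Y - cyl u" "trcls Y e = cls Y (tr w v)"
proof -
 obtain u u' where u: "u \<in> words" "u' \<in> words" "cyl u \<subseteq> cyl z" "cyl u' \<subseteq> cyl z" "cyl u \<inter> cyl u' = {}"
  using disjoint_subwords[OF o(1) o(1)] by metis
 obtain w v where w: "swappable w v" "last w = e" "cyl w \<subseteq> cyl u'" "cyl v \<subseteq> cyl u'"
  using exists_swappable[OF u(2) e] by metis
 have s: "cyl u \<subseteq> Y" "cyl w \<subseteq> Y - cyl u" "cyl v \<subseteq> Y - cyl u" using u w o by blast+
 show ?thesis using trcls_eq[OF Y w(1) u(1) s] w u(1) s by (intro that[of w v u]) auto
qed

lemma trcls_square:
 assumes Y: "Y \<subseteq> X" and o: "z \<in> words" "cyl z \<subseteq> Y" and e: "e \<in> arcs Q"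
 shows "trcls Y e \<in> carrier (Kab Y)" "trcls Y e \<otimes>\<^bsub>Kab Y\<^esub> trcls Y e = \<one>\<^bsub>Kab Y\<^esub>"
proof -
 obtain w v u where w: "swappable w v" "cyl w \<subseteq> Y - cyl u" "cyl v \<subseteq> Y - cyl u" "trcls Y e = cls Y (tr w v)"
  using trcls_exists[OF assms] by metis
 have t: "tr w v \<in> Gam Y" using w by (intro tr_in_Gam) auto
 show "trcls Y e \<in> carrier (Kab Y)" using w(4) cls_closed[OF Y t] by simp
 have "tr w v \<circ> tr w v = id" using tr_tr[OF w(1)] by auto
 then show "trcls Y e \<otimes>\<^bsub>Kab Y\<^esub> trcls Y e = \<one>\<^bsub>Kab Y\<^esub>"
  using cls_comp[OF Y t t] cls_id[OF Y] w(4) by (simp only:)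
qed

text \<open>A transposition is the product of the commuting transpositions of its children, which
  inherit the free cylinder.\<close>

lemma trcls_children:
 assumes Y: "Y \<subseteq> X" and o: "z \<in> words" "cyl z \<subseteq> Y" and e: "e \<in> arcs Q"
 shows "trcls Y e = finprod (Kab Y) (trcls Y) (nx e)"
proof -
 interpret K: comm_group "Kab Y" by (rule comm_group_Kab[OF Y])
 obtain w v u where w: "swappable w v" "last w = e" "u \<in> words" "cyl u \<subseteq> Y"
  "cyl w \<subseteq> Y - cyl u" "cyl v \<subseteq> Y - cyl u" "trcls Y e = cls Y (tr w v)"
  using trcls_exists[OF assms] by metis
 have W: "w \<in> words" "v \<in> words" "last v = last w" "cyl w \<inter> cyl v = {}" using w(1) by (auto simp: swappable_def)
 \<comment> \<open>The partial product over \<open>F\<close> is described pointwise: it acts as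
   \<open>tr w v\<close> on the children already treated and trivially elsewhere.\<close>
 have "\<exists>a\<in>Gam Y. cls Y a = finprod (Kab Y) (trcls Y) F &
   (\<forall>x. a x = (if x \<in> (\<Union>f\<in>F. cyl (w @ [f]) \<union> cyl (v @ [f])) then tr w v x else x))"
  if "F \<subseteq> nx e" for F
 proof -
  have "finite F" using that finite_nx finite_subset by blast
  then show ?thesis using that
  proof (induction F rule: finite_induct)
   case empty
   have "cls Y id = finprod (Kab Y) (trcls Y) {}" using cls_id[OF Y] by (simp only: K.finprod_empty)
   moreover have "\<forall>x. id x = (if x \<in> (\<Union>f\<in>{}. cyl (w @ [f]) \<union> cyl (v @ [f])) then tr w v x else x)"
    by simp
   ultimately show ?case by (intro bexI[of _ id] conjI id_Gam)
  next
   case (insert f F)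
   then obtain a where a: "a \<in> Gam Y" "cls Y a = finprod (Kab Y) (trcls Y) F"
    "!!x. a x = (if x \<in> (\<Union>f\<in>F. cyl (w @ [f]) \<union> cyl (v @ [f])) then tr w v x else x)" by auto
   have f: "f \<in> nx e" using insert.prems by simp
   have fw: "w @ [f] \<in> words" "v @ [f] \<in> words" using W f w(2) by (simp_all add: words_snoc)
   have sub: "cyl (w @ [f]) \<subseteq> cyl w" "cyl (v @ [f]) \<subseteq> cyl v" by (rule cyl_append_subset)+
   have s: "swappable (w @ [f]) (v @ [f])" using fw W(4) sub by (auto simp: swappable_def)
   have c: "trcls Y f = cls Y (tr (w @ [f]) (v @ [f]))"
    using trcls_eq[OF Y s w(3,4)] w(5,6) sub by auto
   have t: "tr (w @ [f]) (v @ [f]) \<in> Gam Y" using s sub w(5,6) by (intro tr_in_Gam) auto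
   let ?b = "tr (w @ [f]) (v @ [f]) \<circ> a"
   have "cls Y ?b = trcls Y f \<otimes>\<^bsub>Kab Y\<^esub> finprod (Kab Y) (trcls Y) F"
    using cls_comp[OF Y t a(1)] c a(2) by (simp only:)
   also have "\<dots> = finprod (Kab Y) (trcls Y) (insert f F)"
    using insert.hyps insert.prems nx_arcs trcls_square(1)[OF Y o]
    by (intro K.finprod_insert[symmetric]) auto
   finally have 1: "cls Y ?b = finprod (Kab Y) (trcls Y) (insert f F)" .
   have dF: "x \<notin> cyl (w @ [f])" "x \<notin> cyl (v @ [f])"
    if x: "x \<in> cyl (w @ [g]) \<or> x \<in> cyl (v @ [g])" and g: "g \<in> F" for x g
   proof -
    have ne: "f ~= g" using g insert.hyps by auto
    have "cyl (w @ [f]) \<inter> cyl (w @ [g]) = {}" "cyl (v @ [f]) \<inter> cyl (v @ [g]) = {}"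
     using ne by (intro cyl_same_length; simp)+
    moreover have "cyl (w @ [g]) \<subseteq> cyl w" "cyl (v @ [g]) \<subseteq> cyl v" by (rule cyl_append_subset)+
    ultimately show "x \<notin> cyl (w @ [f])" "x \<notin> cyl (v @ [f])" using x sub W(4) by blast+
   qed
   have tg: "tr w v x \<in> cyl (w @ [g]) \<or> tr w v x \<in> cyl (v @ [g])"
    if x: "x \<in> cyl (w @ [g]) \<or> x \<in> cyl (v @ [g])" and g: "g \<in> nx e" for x g
   proof -
    have gw: "w @ [g] \<in> words" "v @ [g] \<in> words" using W g w(2) by (simp_all add: words_snoc)
    have "tb (tr w v) (w @ [g]) (v @ [g])" "tb (tr w v) (v @ [g]) (w @ [g])"
     using tb_append[OF tb_tr(1)[OF w(1)] gw(1)] tb_append[OF tb_tr(2)[OF w(1)] gw(2)] .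
    then show ?thesis using x tb_in_cyl by blast
   qed
   have "?b x = (if x \<in> (\<Union>g\<in>insert f F. cyl (w @ [g]) \<union> cyl (v @ [g])) then tr w v x else x)" for x
   proof -
    consider "x \<in> (\<Union>g\<in>F. cyl (w @ [g]) \<union> cyl (v @ [g]))"
     | "x \<notin> (\<Union>g\<in>F. cyl (w @ [g]) \<union> cyl (v @ [g]))" "x \<in> cyl (w @ [f])"
     | "x \<notin> (\<Union>g\<in>F. cyl (w @ [g]) \<union> cyl (v @ [g]))" "x \<notin> cyl (w @ [f])" "x \<in> cyl (v @ [f])"
     | "x \<notin> (\<Union>g\<in>F. cyl (w @ [g]) \<union> cyl (v @ [g]))" "x \<notin> cyl (w @ [f])" "x \<notin> cyl (v @ [f])" by blast
    then show ?thesis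
    proof cases
     case 1
     then obtain g where g: "g \<in> F" "x \<in> cyl (w @ [g]) \<or> x \<in> cyl (v @ [g])" by blast
     have "tr w v x \<in> cyl (w @ [g]) \<or> tr w v x \<in> cyl (v @ [g])"
      using tg[OF g(2)] g(1) insert.prems by auto
     from dF[OF this g(1)] have "tr (w @ [f]) (v @ [f]) (tr w v x) = tr w v x" by (rule tr_simps(3))
     then show ?thesis using 1 by (simp add: a(3))
    next
     case 2
     have "tr (w @ [f]) (v @ [f]) x = tr w v x"
      using 2 sub tr_simps(1)[OF 2(2), of "v @ [f]"] rp_append[OF 2(2), of v] tr_simps(1)[of x w v] by auto
     then show ?thesis using 2 by (simp add: a(3))
    next
     case 3
     have "tr (w @ [f]) (v @ [f]) x = tr w v x"
      using 3 sub tr_simps(2)[OF s 3(3)] rp_append[OF 3(3), of w] tr_simps(2)[OF w(1), of x] by auto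
     then show ?thesis using 3 by (simp add: a(3))
    next
     case 4
     then show ?thesis by (simp add: a(3) tr_simps(3))
    qed
   qed
   then show ?case using 1 comp_Gam[OF a(1) t] by blast
  qed
 qed
 from this[OF order_refl] obtain a where a: "a \<in> Gam Y" "cls Y a = finprod (Kab Y) (trcls Y) (nx e)"
  "!!x. a x = (if x \<in> (\<Union>f\<in>nx e. cyl (w @ [f]) \<union> cyl (v @ [f])) then tr w v x else x)" by blast
 have "(\<Union>f\<in>nx e. cyl (w @ [f]) \<union> cyl (v @ [f])) = cyl w \<union> cyl v"
  using cyl_children[OF W(1)] cyl_children[OF W(2)] W(3) w(2) by (auto simp: children_def)
 then have "a = tr w v" using a(3) tr_simps(3)[of _ w v] by (intro ext) auto
 then show ?thesis using a(2) w(7) by simp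
qed

end

context sft_basis
begin

definition Sg :: "(nat => 'e) set => ((nat => 'e) => nat => 'e) => ('e \<Rightarrow>\<^sub>0 bit) => bit" where
 "Sg Y a = (%b. if b \<in> BB then sgn_of (chr b) Y a else 0)"

text \<open>Only finitely many coordinates are nonzero on the finitely many types that occur in a
  table.\<close>

lemma Sg_EE: assumes Y: "clop Y L" and a: "a \<in> Gam Y" shows "Sg Y a \<in> carrier EE"
proof -
 obtain P \<phi> where P: "part P Y" "\<forall>w\<in>P. tb a w (\<phi> w)" using table_exists[OF Y a] by blast
 have g: "good a P" using P(2) by (auto simp: good_def)
 have "{b. Sg Y a b ~= 0} \<subseteq> (\<Union>u\<in>P. {b \<in> BB. chi b (bvec (last u)) ~= 0})"
 proof
  fix b assume "b \<in> {b. Sg Y a b ~= 0}"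
  then have b: "b \<in> BB" "sgn_of (chr b) Y a ~= 0" by (auto simp: Sg_def split: if_splits)
  then have "sgnP (chr b) P a ~= 0" using sgn_of_eq[OF a Y P(1) g harmonic_chr[OF b(1)]] by simp
  then obtain u v where "u \<in> P" "of_bool (inverted a u v) * (chr b (last u) * chr b (last v)) ~= 0"
   unfolding sgnP_def by (meson sum.neutral)
  then show "b \<in> (\<Union>u\<in>P. {b \<in> BB. chi b (bvec (last u)) ~= 0})" using b(1) by (auto simp: chr_def)
 qed
 moreover have "finite (\<Union>u\<in>P. {b \<in> BB. chi b (bvec (last u)) ~= 0})"
  using partD(1)[OF P(1)] chi_finite by blast
 ultimately have "finite {b. Sg Y a b ~= 0}" by (rule finite_subset)
 then show ?thesis by (auto simp: EE_def Sg_def)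
qed

lemma Sg_comp:
 assumes Y: "clop Y L" and a: "a \<in> Gam Y" and b: "b \<in> Gam Y"
 shows "Sg Y (a \<circ> b) = Sg Y a \<otimes>\<^bsub>EE\<^esub> Sg Y b"
 using sgn_of_comp[OF b a Y harmonic_chr] by (auto simp: Sg_def)

lemma Sg_hom: "clop Y L ==> Sg Y \<in> hom (GG Y) EE"
 by (rule homI) (auto simp: Sg_EE Sg_comp[simplified])

lemma Sg_id: assumes Y: "clop Y L" shows "Sg Y id = \<one>\<^bsub>EE\<^esub>"
proof -
 interpret E: comm_group EE by (rule comm_group_EE)
 have "Y \<subseteq> X" using Y by (simp add: clop_def)
 then show ?thesis using hom_one[OF Sg_hom[OF Y] group_GG E.is_group] by simp
qed

lemma Sg_tr:
 "clop Y L ==> swappable w v ==> cyl w \<subseteq> Y ==> cyl v \<subseteq> Y ==> Sg Y (tr w v) = coord (bvec (last w))"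
 using sgn_of_tr[of w v Y L "chr _", OF _ _ _ _ harmonic_chr] by (auto simp: Sg_def coord_def chr_def)

definition Cv :: "(nat => 'e) set => ('e \<Rightarrow>\<^sub>0 bit) => ((nat => 'e) => nat => 'e) set" where
 "Cv Y x = finprod (Kab Y) (%e. if Poly_Mapping.lookup x e = 1 then trcls Y e else \<one>\<^bsub>Kab Y\<^esub>) (arcs Q)"

lemma Cv_facts:
 assumes Y: "Y \<subseteq> X" and o: "z \<in> words" "cyl z \<subseteq> Y"
 shows "Cv Y x \<in> carrier (Kab Y)" "Cv Y (x + y) = Cv Y x \<otimes>\<^bsub>Kab Y\<^esub> Cv Y y" "Cv Y 0 = \<one>\<^bsub>Kab Y\<^esub>"
  "e \<in> arcs Q ==> Cv Y (bvec e) = trcls Y e" "coord x = \<one>\<^bsub>EE\<^esub> ==> Cv Y x = \<one>\<^bsub>Kab Y\<^esub>"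
 unfolding Cv_def
 using kernel_coord_trivial[OF comm_group_Kab[OF Y] trcls_square(1)[OF Y o] trcls_square(2)[OF Y o] trcls_children[OF Y o]]
 by (simp_all del: EE_simps mult_FactGroup one_FactGroup)

text \<open>One vector records the types of the transpositions modulo two and determines the class
  as well as the sign.\<close>

lemma TT_cls:
 assumes Y: "clop Y L" and u: "u \<in> words" "cyl u \<subseteq> Y" and a: "a \<in> TT (Y - cyl u)"
 shows "\<exists>x. cls Y a = Cv Y x & Sg Y a = coord x"
 using a
proof (induction rule: TT.induct)
 note YX = clop_X_level(1)[OF Y]
 case TT_id
 show ?case using cls_id[OF YX] Sg_id[OF Y] Cv_facts(3)[OF YX u] coord_zero by (intro exI[of _ 0]) (simp only:)
next
 note YX = clop_X_level(1)[OF Y]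
 case (TT_tr a w v)
 then obtain x where x: "cls Y a = Cv Y x" "Sg Y a = coord x" by blast
 have aY: "a \<in> Gam Y" using TT_Gam[OF TT_tr.hyps(1)] Gam_mono[of "Y - cyl u" Y] by auto
 have sub: "cyl w \<subseteq> Y" "cyl v \<subseteq> Y" using TT_tr.hyps by auto
 have tY: "tr w v \<in> Gam Y" using TT_tr.hyps sub by (intro tr_in_Gam)
 have e: "last w \<in> arcs Q" using TT_tr.hyps(2) last_in_arcs by (auto simp: swappable_def)
 have "cls Y (tr w v \<circ> a) = Cv Y (bvec (last w) + x)"
  using cls_comp[OF YX tY aY] trcls_eq[OF YX TT_tr.hyps(2) u TT_tr.hyps(3,4)] x(1)
   Cv_facts(2)[OF YX u, of "bvec (last w)" x] Cv_facts(4)[OF YX u e] by (simp only:)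
 moreover have "Sg Y (tr w v \<circ> a) = coord (bvec (last w) + x)"
  using Sg_comp[OF Y tY aY] Sg_tr[OF Y TT_tr.hyps(2) sub] x(2) coord_add[of "bvec (last w)" x] by (simp only:)
 ultimately show ?case by blast
qed

text \<open>Both factors of \<open>a\<close> have vectors. If the sign of \<open>a\<close> vanishes,
  so do the coordinates of their sum, and the class is trivial. On \<open>TN Y\<close> the sign thus
  loses nothing beyond commutators.\<close>

lemma kernel_Sg:
 assumes Y: "clop Y L" and a: "a \<in> TN Y" and s: "Sg Y a = \<one>\<^bsub>EE\<^esub>"
 shows "a \<in> derived (GG Y) (Gam Y)"
proof -
 note YX = clop_X_level(1)[OF Y]
 obtain u v b c where b: "u \<in> words" "v \<in> words" "cyl u \<subseteq> Y" "cyl v \<subseteq> Y"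
  "b \<in> TT (Y - cyl u)" "c \<in> TT (Y - cyl v)" "a = b \<circ> c" using a by (auto simp: TN_def)
 have bY: "b \<in> Gam Y" "c \<in> Gam Y"
  using TT_Gam[OF b(5)] TT_Gam[OF b(6)] Gam_mono[of "Y - cyl u" Y] Gam_mono[of "Y - cyl v" Y] by auto
 obtain x where x: "cls Y b = Cv Y x" "Sg Y b = coord x" using TT_cls[OF Y b(1,3,5)] by blast
 obtain y where y: "cls Y c = Cv Y y" "Sg Y c = coord y" using TT_cls[OF Y b(2,4,6)] by blast
 have "coord (x + y) = \<one>\<^bsub>EE\<^esub>"
  using s Sg_comp[OF Y bY] x(2) y(2) b(7) coord_add[of x y] by (simp only:)
 then have "Cv Y (x + y) = \<one>\<^bsub>Kab Y\<^esub>" by (rule Cv_facts(5)[OF YX b(1,3)])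
 then have "cls Y a = \<one>\<^bsub>Kab Y\<^esub>"
  using cls_comp[OF YX bY] x(1) y(1) b(7) Cv_facts(2)[OF YX b(1,3), of x y] by (simp only:)
 moreover have "a \<in> Gam Y" using comp_Gam[OF bY(2,1)] b(7) by simp
 ultimately show ?thesis by (intro cls_one[OF YX])
qed

text \<open>All transpositions are placed in one part \<open>v'\<close> of \<open>u\<close>, so that
  the disjoint part \<open>v\<close> stays free.\<close>

lemma Sg_surj:
 assumes Y: "clop Y L" and u: "u \<in> words" "cyl u \<subseteq> Y" and g: "g \<in> carrier EE"
 obtains a v where "v \<in> words" "cyl v \<subseteq> cyl u" "a \<in> TT (Y - cyl v)" "Sg Y a = g"
proof -
 obtain v v' where v: "v \<in> words" "v' \<in> words" "cyl v \<subseteq> cyl u" "cyl v' \<subseteq> cyl u" "cyl v \<inter> cyl v' = {}"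
  using disjoint_subwords[OF u(1) u(1)] by metis
 obtain x where x: "coord x = g" using coord_surj[OF g] by blast
 have "\<exists>a\<in>TT (Y - cyl v). Sg Y a = coord x" for x
 proof (induction x rule: bitvec_induct)
  case zero
  show ?case using Sg_id[OF Y] coord_zero TT_id by (intro bexI[of _ id]) (simp only:, rule TT_id)
 next
  case (add e x)
  then obtain a where a: "a \<in> TT (Y - cyl v)" "Sg Y a = coord x" by blast
  have aY: "a \<in> Gam Y" using TT_Gam[OF a(1)] Gam_mono[of "Y - cyl v" Y] by auto
  show ?case
  proof (cases "e \<in> arcs Q")
   case True
   obtain p q where p: "swappable p q" "last p = e" "cyl p \<subseteq> cyl v'" "cyl q \<subseteq> cyl v'"
    using exists_swappable[OF v(2) True] by metis
   have sub: "cyl p \<subseteq> Y - cyl v" "cyl q \<subseteq> Y - cyl v" using p v u(2) by blast+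
   have tY: "tr p q \<in> Gam Y" using p sub by (intro tr_in_Gam) auto
   have "Sg Y (tr p q) = coord (bvec e)" using Sg_tr[OF Y p(1)] sub p(2) by auto
   then have "Sg Y (tr p q \<circ> a) = coord (bvec e + x)"
    using Sg_comp[OF Y tY aY] a(2) coord_add[of "bvec e" x] by (simp only:)
   then show ?thesis using TT_tr[OF a(1) p(1) sub] by blast
  next
   case False
   have "coord (bvec e + x) = coord x" using chi_out[OF _ False] by (auto simp: coord_def chi_add)
   then show ?thesis using a by auto
  qed
 qed
 then obtain a where "a \<in> TT (Y - cyl v)" "Sg Y a = g" using x by blast
 then show ?thesis using v by (intro that)
qed

end

section \<open>Compactly supported integer functions\<close>

text \<open>Integer combinations of indicator functions, made inductive so that statements about
  chains reduce to base sets.\<close>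

inductive_set gen :: "'a set set => ('a => int) set" for \<B> where
 gen_zero: "(%x. 0) \<in> gen \<B>"
| gen_plus: "f \<in> gen \<B> ==> B \<in> \<B> ==> (%x. f x + indicator B x) \<in> gen \<B>"
| gen_minus: "f \<in> gen \<B> ==> B \<in> \<B> ==> (%x. f x - indicator B x) \<in> gen \<B>"

lemma gen_ind: "B \<in> \<B> ==> indicator B \<in> gen \<B>"
 by (drule gen_plus[OF gen_zero]) (simp only: add_0_left)

lemma gen_add: "f \<in> gen \<B> ==> g \<in> gen \<B> ==> (%x. f x + g x) \<in> gen \<B>"
proof (induction rule: gen.induct)
 case (gen_plus f B)
 then have "(%x. (f x + g x) + indicator B x) \<in> gen \<B>" by (intro gen.gen_plus)
 then show ?case by (simp add: algebra_simps)
next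
 case (gen_minus f B)
 then have "(%x. (f x + g x) - indicator B x) \<in> gen \<B>" by (intro gen.gen_minus)
 then show ?case by (simp add: algebra_simps)
qed simp

lemma gen_neg: "f \<in> gen \<B> ==> (%x. - f x) \<in> gen \<B>"
proof (induction rule: gen.induct)
 case gen_zero
 then show ?case using gen.gen_zero by simp
next
 case (gen_plus f B)
 then have "(%x. - f x - indicator B x) \<in> gen \<B>" by (intro gen.gen_minus)
 then show ?case by (simp add: algebra_simps)
next
 case (gen_minus f B)
 then have "(%x. - f x + indicator B x) \<in> gen \<B>" by (intro gen.gen_plus)
 then show ?case by (simp add: algebra_simps)
qed

lemma gen_diff: "f \<in> gen \<B> ==> g \<in> gen \<B> ==> (%x. f x - g x) \<in> gen \<B>"
 using gen_add[OF _ gen_neg, of f \<B> g] by simp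

lemma gen_induct [consumes 1, case_names zero ind diff]:
 assumes "f \<in> gen \<B>" and z: "P (%x. 0)" and i: "!!B. B \<in> \<B> ==> P (indicator B)"
  and d: "!!f g. f \<in> gen \<B> ==> g \<in> gen \<B> ==> P f ==> P g ==> P (%x. f x - g x)"
 shows "P f"
 using assms(1)
proof (induction rule: gen.induct)
 case (gen_plus f B)
 note B = gen_ind[OF gen_plus.hyps(2)] i[OF gen_plus.hyps(2)]
 from d[OF gen_plus.hyps(1) gen_diff[OF gen.gen_zero B(1)] gen_plus.IH d[OF gen.gen_zero B(1) z B(2)]]
 show ?case by simp
next
 case (gen_minus f B)
 then show ?case by (intro d gen_ind i)
qed (rule z)

lemma gen_scale: assumes f: "f \<in> gen \<B>" shows "(%x. c * f x) \<in> gen \<B>"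
proof -
 have n: "(%x. int n * f x) \<in> gen \<B>" for n
 proof (induction n)
  case (Suc n)
  then show ?case using gen_add[OF f Suc] by (simp add: algebra_simps)
 qed (simp add: gen_zero)
 show ?thesis
 proof (cases "c \<ge> 0")
  case True
  then show ?thesis using n[of "nat c"] by simp
 next
  case False
  then show ?thesis using gen_neg[OF n[of "nat (- c)"]] by simp
 qed
qed

lemma gen_sum: "(!!i. i \<in> I ==> f i \<in> gen \<B>) ==> (%x. \<Sum>i\<in>I. f i x) \<in> gen \<B>"
 by (induction I rule: infinite_finite_induct) (auto intro: gen_add gen_zero)

lemma gen_mono: assumes "\<B> \<subseteq> \<C>" shows "gen \<B> \<subseteq> gen \<C>"
proof
 fix f assume "f \<in> gen \<B>" then show "f \<in> gen \<C>"
  by (induction rule: gen.induct) (use assms in \<open>blast intro: gen.intros\<close>)+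
qed

text \<open>Subtracting the constant value on a maximal member \<open>B\<close> disposes of every
  member that meets \<open>B\<close>, because these lie inside \<open>B\<close>.\<close>

lemma gen_piecewise:
 assumes "finite \<F>" "\<F> \<subseteq> \<B>"
  and "!!A B. A \<in> \<B> ==> B \<in> \<B> ==> A \<inter> B = {} \<or> A \<subseteq> B \<or> B \<subseteq> A"
  and "!!x. x \<notin> \<Union>\<F> ==> f x = 0" and "!!B x y. B \<in> \<F> ==> x \<in> B ==> y \<in> B ==> f x = f y"
 shows "f \<in> gen \<B>"
 using assms(1,2,4,5)
proof (induction "card \<F>" arbitrary: \<F> f rule: less_induct)
 case less
 show ?case
 proof (cases "\<F> = {}")
  case True
  then have "f = (%x. 0)" using less.prems(3) by auto
  then show ?thesis by (simp add: gen_zero)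
 next
  case False
  then obtain B where B: "B \<in> \<F>" by blast
  have BB: "B \<in> \<B>" using B less.prems(2) by blast
  show ?thesis
  proof (cases "\<exists>B'\<in>\<F> - {B}. B \<subseteq> B'")
   case True
   show ?thesis
   proof (rule less.hyps[of "\<F> - {B}"])
    show "card (\<F> - {B}) < card \<F>" using B less.prems(1) by (intro psubset_card_mono) auto
    show "f x = 0" if "x \<notin> \<Union>(\<F> - {B})" for x using that True less.prems(3)[of x] by blast
    show "finite (\<F> - {B})" "\<F> - {B} \<subseteq> \<B>" using less.prems(1,2) by auto
    show "f x = f y" if "B' \<in> \<F> - {B}" "x \<in> B'" "y \<in> B'" for B' x y
     by (rule less.prems(4)[of B']) (use that in blast)+
   qed
  next
   case False
   let ?F = "{B' \<in> \<F>. B' \<inter> B = {}}"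
   define c where "c = (if B = {} then 0 else f (SOME x. x \<in> B))"
   have c: "f x = c" if "x \<in> B" for x
    using that less.prems(4)[OF B that, of "SOME x. x \<in> B"] by (auto simp: c_def some_in_eq)
   let ?g = "%x. f x - c * indicator B x"
   have "?g \<in> gen \<B>"
   proof (cases "B = {}")
    case True
    have "f \<in> gen \<B>"
    proof (rule less.hyps[of "\<F> - {B}"])
     show "card (\<F> - {B}) < card \<F>" using B less.prems(1) by (intro psubset_card_mono) auto
     show "f x = 0" if "x \<notin> \<Union>(\<F> - {B})" for x using that True less.prems(3)[of x] by blast
     show "finite (\<F> - {B})" "\<F> - {B} \<subseteq> \<B>" using less.prems(1,2) by auto
     show "f x = f y" if "B' \<in> \<F> - {B}" "x \<in> B'" "y \<in> B'" for B' x y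
      by (rule less.prems(4)[of B']) (use that in blast)+
    qed
    then show ?thesis using True by simp
   next
    case nB: False
    show ?thesis
    proof (rule less.hyps[of ?F])
     have "B \<notin> ?F" using nB by simp
     then show "card ?F < card \<F>" using B less.prems(1) by (intro psubset_card_mono) auto
     show "?g x = 0" if x: "x \<notin> \<Union>?F" for x
     proof (cases "x \<in> B")
      case True
      then show ?thesis using c by simp
     next
      case xB: False
      have "x \<notin> \<Union>\<F>"
      proof
       assume "x \<in> \<Union>\<F>"
       then obtain B' where B': "B' \<in> \<F>" "x \<in> B'" by blast
       then have "B' \<inter> B ~= {}" using x by blast
       moreover have "\<not> B' \<subseteq> B" using B' xB by blast
       moreover have "B' ~= B" using B' xB by blast
       ultimately show False using assms(3)[of B' B] B' less.prems(2) BB False by blast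
      qed
      then show ?thesis using xB less.prems(3) by simp
     qed
     show "?g x = ?g y" if "B' \<in> ?F" "x \<in> B'" "y \<in> B'" for B' x y
     proof -
      have "x \<notin> B" "y \<notin> B" "B' \<in> \<F>" using that by blast+
      then show ?thesis using less.prems(4)[of B' x y] that by simp
     qed
    qed (use less.prems(1,2) in auto)
   qed
   from gen_add[OF this gen_scale[OF gen_ind[OF BB], of c]] show ?thesis by simp
  qed
 qed
qed

section \<open>Integer functions on a space with a nested base\<close>

lemma continuous_discrete_iff:
 "continuous_map T (discrete_topology UNIV) f \<longleftrightarrow>
  (\<forall>x\<in>topspace T. \<exists>U. openin T U & x \<in> U & (\<forall>y\<in>U. f y = f x))" (is "?l \<longleftrightarrow> ?r")
proof
 assume l: ?l
 show ?r
 proof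
  fix x assume x: "x \<in> topspace T"
  have "openin T {y \<in> topspace T. f y \<in> {f x}}"
   using l by (rule openin_continuous_map_preimage) simp
  then show "\<exists>U. openin T U & x \<in> U & (\<forall>y\<in>U. f y = f x)"
   using x by (intro exI[of _ "{y \<in> topspace T. f y \<in> {f x}}"]) auto
 qed
next
 assume r: ?r
 show ?l unfolding continuous_map_def
 proof (intro conjI allI impI)
  fix U :: "'b set"
  show "openin T {x \<in> topspace T. f x \<in> U}"
  proof (subst openin_subopen, intro ballI)
   fix x assume x: "x \<in> {x \<in> topspace T. f x \<in> U}"
   then obtain V where V: "openin T V" "x \<in> V" "\<forall>y\<in>V. f y = f x" using r by auto
   have "V \<subseteq> {x \<in> topspace T. f x \<in> U}"
   proof
    fix y assume y: "y \<in> V"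
    have "f y = f x" using V(3) y by (rule bspec)
    then show "y \<in> {x \<in> topspace T. f x \<in> U}" using x y openin_subset[OF V(1)] by auto
   qed
   then show "\<exists>V. openin T V & x \<in> V & V \<subseteq> {x \<in> topspace T. f x \<in> U}" using V by blast
  qed
 qed simp
qed

text \<open>A base of compact open sets that are pairwise nested or disjoint, as cylinders are.
  Arrows, units and composable pairs each have one, and it turns compactly supported functions into
  integer combinations of indicators.\<close>

locale tree_base =
 fixes T :: "'a topology" and \<B> :: "'a set set"
 assumes base_open: "!!B. B \<in> \<B> ==> openin T B"
  and base_compact: "!!B. B \<in> \<B> ==> compactin T B"
  and base_ex: "!!U x. openin T U ==> x \<in> U ==> \<exists>B\<in>\<B>. x \<in> B & B \<subseteq> U"
  and base_nested: "!!A B. A \<in> \<B> ==> B \<in> \<B> ==> A \<inter> B = {} \<or> A \<subseteq> B \<or> B \<subseteq> A"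
  and base_sep: "!!x y. x \<in> topspace T ==> y \<in> topspace T ==> x ~= y ==> \<exists>B\<in>\<B>. x \<in> B & y \<notin> B"
begin

lemma base_topspace: "B \<in> \<B> ==> B \<subseteq> topspace T"
 using base_open openin_subset by blast

text \<open>A base set that contains a point outside \<open>B\<close> and misses a point of
  \<open>B\<close> can only be disjoint from \<open>B\<close>.\<close>

lemma base_closed: assumes B: "B \<in> \<B>" shows "closedin T B"
proof -
 have "openin T (topspace T - B)"
 proof (subst openin_subopen, intro ballI)
  fix x assume x: "x \<in> topspace T - B"
  show "\<exists>U. openin T U & x \<in> U & U \<subseteq> topspace T - B"
  proof (cases "B = {}")
   case True
   then show ?thesis using x by (intro exI[of _ "topspace T"]) auto
  next
   case False
   then obtain y where y: "y \<in> B" by blast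
   then obtain A where A: "A \<in> \<B>" "x \<in> A" "y \<notin> A"
    using base_sep[of x y] x base_topspace[OF B] by blast
   then have "A \<inter> B = {}" using base_nested[OF A(1) B] x y by blast
   then show ?thesis using base_open[OF A(1)] base_topspace[OF A(1)] A(2) by (intro exI[of _ A]) auto
  qed
 qed
 then show ?thesis using base_topspace[OF B] by (simp add: closedin_def)
qed

lemma Cc_subset_gen: "carrier (Cc T) \<subseteq> gen \<B>"
proof
 fix f assume "f \<in> carrier (Cc T)"
 then have f: "continuous_map T (discrete_topology UNIV) f"
  "compactin T (T closure_of {x \<in> topspace T. f x ~= 0})" "!!x. x \<notin> topspace T ==> f x = 0"
  by (auto simp: Cc_def)
 let ?S = "{x \<in> topspace T. f x ~= 0}"
 have "closedin T {x \<in> topspace T. f x \<in> - {0}}"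
  using f(1) by (rule closedin_continuous_map_preimage) simp
 then have S: "compactin T ?S" using f(2) by (simp add: closure_of_closedin)
 let ?\<U> = "{B \<in> \<B>. \<forall>x\<in>B. \<forall>y\<in>B. f x = f y}"
 have cov: "?S \<subseteq> \<Union>?\<U>"
 proof
  fix x assume x: "x \<in> ?S"
  then obtain U where U: "openin T U" "x \<in> U" "\<forall>y\<in>U. f y = f x"
   using f(1) unfolding continuous_discrete_iff by blast
  then obtain B where B: "B \<in> \<B>" "x \<in> B" "B \<subseteq> U" using base_ex by blast
  have "f z = f x" if "z \<in> B" for z using U(3) subsetD[OF B(3) that] by (rule bspec)
  then have "\<forall>z\<in>B. \<forall>y\<in>B. f z = f y" by metis
  then show "x \<in> \<Union>?\<U>" using B(1,2) by blast
 qed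
 have "\<exists>\<F>. finite \<F> & \<F> \<subseteq> ?\<U> & ?S \<subseteq> \<Union>\<F>"
  using S cov base_open unfolding compactin_def by (metis (mono_tags, lifting) mem_Collect_eq)
 then obtain \<F> where F: "finite \<F>" "\<F> \<subseteq> ?\<U>" "?S \<subseteq> \<Union>\<F>" by blast
 show "f \<in> gen \<B>"
 proof (rule gen_piecewise[OF F(1)])
  show "f x = 0" if "x \<notin> \<Union>\<F>" for x using that F(3) f(3)[of x] by blast
 qed (use F(2) base_nested in blast)+
qed

lemma gen_subset_Cc: "gen \<B> \<subseteq> carrier (Cc T)"
proof
 have step: "(%x. f x + c * indicator B x) \<in> carrier (Cc T)"
  if f: "f \<in> carrier (Cc T)" and B: "B \<in> \<B>" for f B and c :: int
 proof -
  let ?g = "%x. f x + c * indicator B x"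
  have f': "continuous_map T (discrete_topology UNIV) f"
   "compactin T (T closure_of {x \<in> topspace T. f x ~= 0})" "!!x. x \<notin> topspace T ==> f x = 0"
   using f by (auto simp: Cc_def)
  have "continuous_map T (discrete_topology UNIV) ?g"
   unfolding continuous_discrete_iff
  proof
   fix x assume x: "x \<in> topspace T"
   then obtain U where U: "openin T U" "x \<in> U" "\<forall>y\<in>U. f y = f x"
    using f'(1) unfolding continuous_discrete_iff by blast
   define V where "V = (if x \<in> B then B else topspace T - B)"
   have "openin T V" using base_open[OF B] base_closed[OF B] by (simp add: V_def closedin_def)
   moreover have "indicator B y = (indicator B x :: int)" if "y \<in> V" for y
    using that by (auto simp: V_def indicator_def split: if_splits)
   moreover have "x \<in> V" using x by (simp add: V_def)
   ultimately have V: "openin T V" "!!y. y \<in> V ==> indicator B y = (indicator B x :: int)" "x \<in> V"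
    by blast+
   have "?g y = ?g x" if y: "y \<in> U \<inter> V" for y
   proof -
    have "f y = f x" using U(3) y by blast
    then show ?thesis using V(2)[of y] y by simp
   qed
   then show "\<exists>U. openin T U & x \<in> U & (\<forall>y\<in>U. ?g y = ?g x)"
    using openin_Int[OF U(1) V(1)] U(2) V(3) by blast
  qed
  moreover have "compactin T (T closure_of {x \<in> topspace T. ?g x ~= 0})"
  proof (rule closed_compactin)
   let ?K = "T closure_of {x \<in> topspace T. f x ~= 0} \<union> B"
   show "compactin T ?K" using f'(2) base_compact[OF B] by (rule compactin_Un)
   have "closedin T ?K" using base_closed[OF B] by (intro closedin_Un) auto
   moreover have "{x \<in> topspace T. ?g x ~= 0} \<subseteq> ?K"
    using closure_of_subset[of "{x \<in> topspace T. f x ~= 0}" T] by (auto simp: indicator_def)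
   ultimately show "T closure_of {x \<in> topspace T. ?g x ~= 0} \<subseteq> ?K" by (intro closure_of_minimal)
  qed simp
  moreover have "?g x = 0" if "x \<notin> topspace T" for x
   using that f'(3) base_topspace[OF B] by (auto simp: indicator_def)
  ultimately show ?thesis by (simp add: Cc_def)
 qed
 fix f assume "f \<in> gen \<B>"
 then show "f \<in> carrier (Cc T)"
 proof (induction rule: gen.induct)
  case gen_zero
  then show ?case by (simp add: Cc_def)
 next
  case (gen_plus f B)
  then show ?case using step[of f B 1] by simp
 next
  case (gen_minus f B)
  then show ?case using step[of f B "- 1"] by simp
 qed
qed

lemma carrier_Cc: "carrier (Cc T) = gen \<B>"
 using Cc_subset_gen gen_subset_Cc by blast

lemma comm_group_Cc: "comm_group (Cc T)"
proof (rule comm_groupI)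
 fix f assume "f \<in> carrier (Cc T)"
 then have "(%x. - f x) \<in> carrier (Cc T)" unfolding carrier_Cc by (rule gen_neg)
 then show "\<exists>g\<in>carrier (Cc T). g \<otimes>\<^bsub>Cc T\<^esub> f = \<one>\<^bsub>Cc T\<^esub>"
  by (intro bexI[of _ "%x. - f x"]) (simp_all add: Cc_def)
next
 fix f g assume "f \<in> carrier (Cc T)" "g \<in> carrier (Cc T)"
 then have "(%x. f x + g x) \<in> carrier (Cc T)" unfolding carrier_Cc by (rule gen_add)
 then show "f \<otimes>\<^bsub>Cc T\<^esub> g \<in> carrier (Cc T)" by (simp add: Cc_def)
next
 show "\<one>\<^bsub>Cc T\<^esub> \<in> carrier (Cc T)" using gen_zero unfolding carrier_Cc by (simp add: Cc_def)
qed (simp_all add: Cc_def ac_simps)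

end

lemma Cc_simps: "f \<otimes>\<^bsub>Cc T\<^esub> g = (%x. f x + g x)" "\<one>\<^bsub>Cc T\<^esub> = (%x. 0)"
 by (simp_all add: Cc_def)

section \<open>Pushforwards of integer combinations of indicators\<close>

lemma pushforward_add:
 assumes "!!z. finite {y \<in> topspace T. p y = z & f y ~= 0}" "!!z. finite {y \<in> topspace T. p y = z & g y ~= 0}"
 shows "pushforward T p (%x. f x + g x) z = pushforward T p f z + pushforward T p g z"
proof -
 let ?F = "%f. {y \<in> topspace T. p y = z & f y ~= (0::int)}"
 let ?U = "?F f \<union> ?F g"
 have fin: "finite ?U" using assms by simp
 have ext: "(\<Sum>y\<in>?F h. h y) = (\<Sum>y\<in>?U. h y)" if "?F h \<subseteq> ?U" for h
  by (rule sum.mono_neutral_left[OF fin that]) auto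
 have "?F (%x. f x + g x) \<subseteq> ?U" by auto
 from ext[OF this] ext[of f] ext[of g] show ?thesis unfolding pushforward_def by (simp add: sum.distrib)
qed

lemma pushforward_ind:
 assumes "B \<subseteq> topspace T" "inj_on p B"
 shows "finite {y \<in> topspace T. p y = z & (indicator B y :: int) ~= 0}"
  "pushforward T p (indicator B) z = indicator (p ` B) z"
proof -
 have e: "{y \<in> topspace T. p y = z & (indicator B y :: int) ~= 0} = {y \<in> B. p y = z}"
  using assms(1) by (auto simp: indicator_def)
 have s: "{y \<in> B. p y = z} \<subseteq> {y}" if "y \<in> B" "p y = z" for y using assms(2) that by (auto dest: inj_onD)
 then show "finite {y \<in> topspace T. p y = z & (indicator B y :: int) ~= 0}"
  unfolding e by (cases "{y \<in> B. p y = z} = {}") (auto intro: finite_subset)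
 show "pushforward T p (indicator B) z = indicator (p ` B) z"
 proof (cases "\<exists>y\<in>B. p y = z")
  case True
  then obtain y where "y \<in> B" "p y = z" by blast
  then have "{y \<in> B. p y = z} = {y}" using s[of y] by blast
  then show ?thesis using \<open>y \<in> B\<close> \<open>p y = z\<close> unfolding pushforward_def e by auto
 next
  case False
  then have "{y \<in> B. p y = z} = {}" by blast
  then have "(\<Sum>y\<in>{y \<in> B. p y = z}. indicator B y :: int) = 0" by (simp only: sum.empty)
  then show ?thesis using False unfolding pushforward_def e by (auto simp: indicator_def)
 qed
qed

lemma pushforward_zero: "pushforward T p (%x. 0) = (%x. 0)"
 by (simp add: pushforward_def fun_eq_iff)

text \<open>Finiteness of the relevant part of each fibre is what makes the pushforward additive. A
  base set meets a fibre at most once, and a combination involves finitely many base sets.\<close>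

lemma pushforward_gen_finite:
 assumes B: "!!B. B \<in> \<B> ==> B \<subseteq> topspace T & inj_on p B" and f: "f \<in> gen \<B>"
 shows "finite {y \<in> topspace T. p y = z & f y ~= 0}"
 using f
proof (induction rule: gen.induct)
 case (gen_plus f B)
 have "finite ({y \<in> topspace T. p y = z & f y ~= 0} \<union> {y \<in> topspace T. p y = z & (indicator B y :: int) ~= 0})"
  using gen_plus B pushforward_ind(1)[of B T p z] by simp
 then show ?case by (rule rev_finite_subset) (auto simp: indicator_def)
next
 case (gen_minus f B)
 have "finite ({y \<in> topspace T. p y = z & f y ~= 0} \<union> {y \<in> topspace T. p y = z & (indicator B y :: int) ~= 0})"
  using gen_minus B pushforward_ind(1)[of B T p z] by simp
 then show ?case by (rule rev_finite_subset) (auto simp: indicator_def)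
qed simp

lemma pushforward_gen_add:
 assumes "!!B. B \<in> \<B> ==> B \<subseteq> topspace T & inj_on p B" and "f \<in> gen \<B>" "g \<in> gen \<B>"
 shows "pushforward T p (%x. f x + g x) = (%z. pushforward T p f z + pushforward T p g z)"
 using pushforward_add[of T p f g] pushforward_gen_finite[OF assms(1,2)] pushforward_gen_finite[OF assms(1,3)]
 by blast

section \<open>The groupoid of a shift of finite type\<close>

lemma src_reduction [simp]: "src (reduction G S) = src G"
 and rng_reduction [simp]: "rng (reduction G S) = rng G"
 and gmult_reduction [simp]: "gmult (reduction G S) = gmult G"
 by (auto simp: src_def rng_def reduction_def fun_eq_iff)

lemma gmult_sft [simp]: "gmult (sft_groupoid Q) (x, n, y) (y', n', z) = (x, n + n', z)"
 by (simp add: sft_groupoid_def)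

lemma inj_sft_unit [simp]: "sft_unit x = sft_unit y \<longleftrightarrow> x = y"
 by (simp add: sft_unit_def)

context sft
begin

abbreviation "GQ \<equiv> sft_groupoid Q"
abbreviation "srcQ \<equiv> src GQ"
abbreviation "rngQ \<equiv> rng GQ"
abbreviation "GR Y \<equiv> reduction GQ (sft_unit ` Y)"

definition arr :: "(nat => 'e) set => 'e sft_arrow set" where
 "arr Y = {(x, n, y). x \<in> Y & y \<in> Y & (\<exists>k l. n = int k - int l & (shift ^^ k) x = (shift ^^ l) y)}"

lemma shift_eq_add: "(shift ^^ k) x = (shift ^^ l) y ==> (shift ^^ (k + m)) x = (shift ^^ (l + m)) y"
 by (simp only: add.commute[of _ m] funpow_add o_apply)

lemma shift_eq_nth: "(shift ^^ k) x = (shift ^^ l) y ==> x (k + i) = y (l + i)"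
 by (drule fun_cong[of _ _ i]) (simp add: funpow_shift add.commute)

lemma topspace_GR: assumes "Y \<subseteq> X" shows "topspace (gtop (GR Y)) = arr Y"
proof -
 have "(\<exists>k\<ge>1. \<exists>l\<ge>1. n = int k - int l & (shift ^^ k) x = (shift ^^ l) y) \<longleftrightarrow>
   (\<exists>k l. n = int k - int l & (shift ^^ k) x = (shift ^^ l) y)" for n and x y :: "nat => 'e"
 proof
  assume "\<exists>k l. n = int k - int l & (shift ^^ k) x = (shift ^^ l) y"
  then obtain k l where "n = int k - int l" "(shift ^^ k) x = (shift ^^ l) y" by blast
  \<comment> \<open>Shifting both sides once more makes the exponents positive without changing
    their difference.\<close>
  then show "\<exists>k\<ge>1. \<exists>l\<ge>1. n = int k - int l & (shift ^^ k) x = (shift ^^ l) y"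
   using shift_eq_add[of k x l y 1] by (intro exI[of _ "k + 1"] conjI exI[of _ "l + 1"]) auto
 qed blast
 then show ?thesis using assms
  by (auto simp: reduction_def topspace_sft_groupoid arr_def)
qed

lemma units_GR: assumes "Y \<subseteq> X" shows "units (GR Y) = sft_unit ` Y"
proof -
 have "sft_unit y \<in> arr Y" if "y \<in> Y" for y
  using that by (auto simp: arr_def sft_unit_def intro!: exI[of _ 0])
 moreover have "rngQ g \<in> sft_unit ` Y" if "g \<in> arr Y" for g
  using that by (auto simp: arr_def)
 moreover have "rngQ (sft_unit y) = sft_unit y" for y
  by (simp add: sft_unit_def)
 ultimately show ?thesis unfolding units_def topspace_GR[OF assms] by (auto simp: image_iff) metis+
qed

text \<open>The arrows along which the prefix \<open>w\<close> is replaced by \<open>v\<close>,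
  parametrized by the source. For words of the same type this is a compact open
  \<open>G\<close>-set.\<close>

definition Ub :: "'e list => 'e list => 'e sft_arrow set" where
 "Ub v w = (%x. (rp w v x, int (length v) - int (length w), x)) ` cyl w"

abbreviation iU :: "'e list => 'e list => 'e sft_arrow => int" where
 "iU v w \<equiv> indicator (Ub v w)"

text \<open>Composable pairs that replace \<open>w\<close> by \<open>v\<close> and then
  \<open>v\<close> by \<open>u\<close>, again parametrized by the source of the second arrow. All
  three face maps are injective on such a set.\<close>

definition Wb :: "'e list => 'e list => 'e list => ('e sft_arrow \<times> 'e sft_arrow) set" where
 "Wb u v w = (%x. ((rp w u x, int (length u) - int (length v), rp w v x),
  (rp w v x, int (length v) - int (length w), x))) ` cyl w"

definition same :: "'e list => 'e list => bool" where
 "same v w \<longleftrightarrow> v \<in> words & w \<in> words & last v = last w"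

definition BU :: "(nat => 'e) set => 'e sft_arrow set set" where
 "BU Y = {Ub v w | v w. same v w & cyl v \<subseteq> Y & cyl w \<subseteq> Y}"

definition B0 :: "(nat => 'e) set => 'e sft_arrow set set" where
 "B0 Y = {Ub w w | w. w \<in> words & cyl w \<subseteq> Y}"

definition BW :: "(nat => 'e) set => ('e sft_arrow \<times> 'e sft_arrow) set set" where
 "BW Y = {Wb u v w | u v w. same u v & same v w & cyl u \<subseteq> Y & cyl v \<subseteq> Y & cyl w \<subseteq> Y}"

lemma BU_I: "same v w ==> cyl v \<subseteq> Y ==> cyl w \<subseteq> Y ==> Ub v w \<in> BU Y"
 by (auto simp: BU_def)

lemma B0_I: "w \<in> words ==> cyl w \<subseteq> Y ==> Ub w w \<in> B0 Y"
 by (auto simp: B0_def)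

lemma BW_I:
 "same u v ==> same v w ==> cyl u \<subseteq> Y ==> cyl v \<subseteq> Y ==> cyl w \<subseteq> Y ==> Wb u v w \<in> BW Y"
 unfolding BW_def by blast

lemma same_append: "same v w ==> v @ p \<in> words \<or> w @ p \<in> words ==> same (v @ p) (w @ p)"
 using words_append_last[of v w p] by (auto simp: same_def)

lemma same_sym: "same v w ==> same w v"
 by (simp add: same_def)

lemma same_refl: "w \<in> words ==> same w w"
 by (simp add: same_def)

lemma same_rp: "same v w ==> x \<in> cyl w ==> rp w v x \<in> cyl v"
 using rp_in_cyl[of v w x] by (metis same_def words_nonempty)

lemma in_Ub: assumes "same v w"
 shows "(x, n, y) \<in> Ub v w \<longleftrightarrow> x \<in> cyl v & y \<in> cyl w & n = int (length v) - int (length w)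
  & (shift ^^ length v) x = (shift ^^ length w) y"
proof
 assume "(x, n, y) \<in> Ub v w"
 then have y: "y \<in> cyl w" "x = rp w v y" "n = int (length v) - int (length w)" by (auto simp: Ub_def)
 then have x: "x \<in> cyl v" using same_rp[OF assms] by simp
 show "x \<in> cyl v & y \<in> cyl w & n = int (length v) - int (length w)
  & (shift ^^ length v) x = (shift ^^ length w) y"
  using x y rp_shift[OF y(1) cyl_X[OF x], of v] by auto
next
 assume a: "x \<in> cyl v & y \<in> cyl w & n = int (length v) - int (length w)
  & (shift ^^ length v) x = (shift ^^ length w) y"
 then have "x = rp w v y" using rp_shift[of y w x v] cyl_X cyl_pfx by blast
 then show "(x, n, y) \<in> Ub v w" using a by (auto simp: Ub_def)
qed

lemma Ub_append: "Ub (v @ p) (w @ p) \<subseteq> Ub v w"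
 using cyl_append_subset[of w p] rp_append[of _ w p v] by (auto simp: Ub_def)

lemma Ub_extend:
 assumes s: "same v w" and g: "(x, n, y) \<in> Ub v w"
 obtains p where "length p = m" "same (v @ p) (w @ p)" "(x, n, y) \<in> Ub (v @ p) (w @ p)"
  "v @ p = pfx x (length v + m)" "w @ p = pfx y (length w + m)"
proof -
 have G: "x \<in> cyl v" "y \<in> cyl w" "n = int (length v) - int (length w)"
  "(shift ^^ length v) x = (shift ^^ length w) y" using g in_Ub[OF s] by auto
 define p where "p = pfx (%i. x (length v + i)) m"
 have v: "v @ p = pfx x (length v + m)" using cyl_pfx[OF G(1)] by (simp add: pfx_add p_def)
 have w: "w @ p = pfx y (length w + m)"
  using cyl_pfx[OF G(2)] shift_eq_nth[OF G(4)] by (simp add: pfx_add p_def)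
 have "w ~= []" using s by (auto simp: same_def)
 then have "w @ p \<in> words" using pfx_words[OF cyl_X[OF G(2)], of "length w + m"] w by auto
 then have s': "same (v @ p) (w @ p)" using same_append[OF s] by blast
 have "x \<in> cyl (v @ p)" "y \<in> cyl (w @ p)" unfolding v w using G cyl_X by auto
 then have "(x, n, y) \<in> Ub (v @ p) (w @ p)"
  using in_Ub[OF s'] G shift_eq_add[OF G(4), of "length p"] by simp
 then show ?thesis using s' v w by (intro that[of p]) (simp_all add: p_def)
qed

text \<open>A common arrow has one degree, so \<open>v'\<close> and \<open>w'\<close> exceed
  \<open>v\<close> and \<open>w\<close> by the same length, and equality of the tails makes the
  excess the same word.\<close>

lemma Ub_meet:
 assumes s: "same v w" "same v' w'" and g: "g \<in> Ub v w" "g \<in> Ub v' w'" and l: "length w \<le> length w'"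
 obtains p where "v' = v @ p" "w' = w @ p"
proof -
 obtain x n y where gx: "g = (x, n, y)" by (cases g)
 have G: "x \<in> cyl v" "y \<in> cyl w" "n = int (length v) - int (length w)"
  using g(1) in_Ub[OF s(1)] gx by auto
 have G': "x \<in> cyl v'" "y \<in> cyl w'" "n = int (length v') - int (length w')"
  using g(2) in_Ub[OF s(2)] gx by auto
 obtain p where p: "v @ p = pfx x (length v + (length w' - length w))"
  "w @ p = pfx y (length w + (length w' - length w))"
  using Ub_extend[OF s(1), of x n y "length w' - length w"] g(1) gx by metis
 have "w @ p = w'" using p(2) l cyl_pfx[OF G'(2)] by simp
 moreover have "length v + (length w' - length w) = length v'" using G(3) G'(3) l by linarith
 then have "v @ p = v'" using p(1) cyl_pfx[OF G'(1)] by simp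
 ultimately show ?thesis using that by metis
qed

lemma Ub_nested:
 assumes "same v w" "same v' w'"
 shows "Ub v w \<inter> Ub v' w' = {} \<or> Ub v w \<subseteq> Ub v' w' \<or> Ub v' w' \<subseteq> Ub v w"
proof (cases "Ub v w \<inter> Ub v' w' = {}")
 case False
 then obtain g where g: "g \<in> Ub v w" "g \<in> Ub v' w'" by blast
 show ?thesis
 proof (cases "length w \<le> length w'")
  case True
  then obtain p where "v' = v @ p" "w' = w @ p" using Ub_meet[OF assms g] by metis
  then show ?thesis using Ub_append by blast
 next
  case False
  then obtain p where "v = v' @ p" "w = w' @ p" using Ub_meet[OF assms(2,1) g(2,1)] by (metis nle_le)
  then show ?thesis using Ub_append by blast
 qed
qed simp

lemma arr_Ub:
 assumes Y: "clop Y L" and g: "(x, n, y) \<in> arr Y"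
 obtains v w where "same v w" "cyl v \<subseteq> Y" "cyl w \<subseteq> Y" "length v \<ge> N" "length w \<ge> N" "(x, n, y) \<in> Ub v w"
  "v = pfx x (length v)" "w = pfx y (length w)"
proof -
 have YX: "Y \<subseteq> X" "L \<ge> 1" using clop_X_level[OF Y] by auto
 obtain k l where kl: "x \<in> Y" "y \<in> Y" "n = int k - int l" "(shift ^^ k) x = (shift ^^ l) y"
  using g by (auto simp: arr_def)
 \<comment> \<open>\<open>L\<close> puts both cylinders inside \<open>Y\<close>, \<open>N\<close>
   gives the demanded length, and the successor adds one letter from the common tail, which becomes
   the common last arc.\<close>
 let ?M = "Suc (N + L)"
 let ?v = "pfx x (k + ?M)" and ?w = "pfx y (l + ?M)"
 have xy: "x \<in> X" "y \<in> X" using kl YX by auto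
 have "x (k + (N + L)) = y (l + (N + L))" using shift_eq_nth[OF kl(4)] .
 then have s: "same ?v ?w" using xy by (auto simp: same_def last_pfx intro!: pfx_words)
 have "(x, n, y) \<in> Ub ?v ?w"
  using in_Ub[OF s] kl xy shift_eq_add[OF kl(4), of ?M] by simp
 moreover have "cyl ?v \<subseteq> Y" "cyl ?w \<subseteq> Y"
  using clopD[OF clop_mono[OF Y, of "k + ?M"] kl(1)] clopD[OF clop_mono[OF Y, of "l + ?M"] kl(2)] by auto
 ultimately show ?thesis using s by (intro that[of ?v ?w]) auto
qed

lemma Ub_arr: assumes s: "same v w" and c: "cyl v \<subseteq> Y" "cyl w \<subseteq> Y" shows "Ub v w \<subseteq> arr Y"
proof
 fix g assume "g \<in> Ub v w"
 then obtain x n y where "g = (x, n, y)" "(x, n, y) \<in> Ub v w" by (cases g) auto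
 then show "g \<in> arr Y" using in_Ub[OF s] c unfolding arr_def by blast
qed

lemma Ub_basic: "same v w ==> Ub v w = sft_basic_open (cyl v) (cyl w) (length v) (length w)"
 using in_Ub[of v w] by (auto simp: sft_basic_open_def) 

lemma openin_Ub: assumes s: "same v w" shows "openin (gtop GQ) (Ub v w)"
proof -
 have "v ~= []" "w ~= []" using s by (auto simp: same_def)
 then have "length v \<ge> 1" "length w \<ge> 1" by (simp_all add: Suc_le_eq)
 then have "Ub v w \<in> {sft_basic_open A B k l | A B k l.
   openin (shift_space Q) A & openin (shift_space Q) B & k \<ge> 1 & l \<ge> 1}"
  unfolding Ub_basic[OF s] using openin_cyl[of v] openin_cyl[of w] by blast
 then show ?thesis by (simp only: sft_groupoid_def top_groupoid.simps) (rule topology_generated_by_Basis)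
qed

lemma sft_basic_contains_Ub:
 assumes A: "openin (shift_space Q) A" and B: "openin (shift_space Q) B" and g: "g \<in> sft_basic_open A B k l"
 shows "\<exists>v w. same v w & g \<in> Ub v w & Ub v w \<subseteq> sft_basic_open A B k l"
proof -
 obtain x y where xy: "g = (x, int k - int l, y)" "x \<in> A" "y \<in> B" "(shift ^^ k) x = (shift ^^ l) y"
  using g by (auto simp: sft_basic_open_def)
 obtain m1 where m1: "cyl (pfx x m1) \<subseteq> A" using openin_shiftD[OF A xy(2)] by blast
 obtain m2 where m2: "cyl (pfx y m2) \<subseteq> B" using openin_shiftD[OF B xy(3)] by blast
 let ?M = "Suc (m1 + m2)"
 let ?v = "pfx x (k + ?M)" and ?w = "pfx y (l + ?M)"
 have XY: "x \<in> X" "y \<in> X" using xy openin_subset[OF A] openin_subset[OF B] by auto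
 have "x (k + (m1 + m2)) = y (l + (m1 + m2))" using shift_eq_nth[OF xy(4)] .
 then have s: "same ?v ?w" using XY by (auto simp: same_def last_pfx intro!: pfx_words)
 have "g \<in> Ub ?v ?w" using in_Ub[OF s] XY shift_eq_add[OF xy(4), of ?M] xy(1) by simp
 moreover have "Ub ?v ?w \<subseteq> sft_basic_open A B k l"
 proof
  fix h assume h: "h \<in> Ub ?v ?w"
  obtain x' n y' where hx: "h = (x', n, y')" by (cases h)
  have H: "x' \<in> cyl ?v" "y' \<in> cyl ?w" "n = int k - int l" "(shift ^^ (k + ?M)) x' = (shift ^^ (l + ?M)) y'"
   using h in_Ub[OF s] hx by auto
  have "x' \<in> A" "y' \<in> B"
   using H(1,2) m1 m2 cyl_prefix[OF prefix_pfx[of m1 "k + ?M" x]] cyl_prefix[OF prefix_pfx[of m2 "l + ?M" y]]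
   by auto
  moreover have "(shift ^^ k) x' = (shift ^^ l) y'"
  proof
   fix i
   show "(shift ^^ k) x' i = (shift ^^ l) y' i"
   proof (cases "i < ?M")
    case True
    then have "x' (k + i) = x (k + i)" "y' (l + i) = y (l + i)"
     using cyl_nth[OF H(1), of "k + i"] cyl_nth[OF H(2), of "l + i"] by auto
    then show ?thesis using shift_eq_nth[OF xy(4), of i] by (simp add: funpow_shift add.commute)
   next
    case False
    then have e: "k + ?M + (i - ?M) = k + i" "l + ?M + (i - ?M) = l + i" by auto
    show ?thesis using shift_eq_nth[OF H(4), of "i - ?M"] unfolding e
     by (simp add: funpow_shift add.commute)
   qed
  qed
  ultimately show "h \<in> sft_basic_open A B k l" using H(3) hx by (auto simp: sft_basic_open_def)
 qed
 ultimately show ?thesis using s by blast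
qed

lemma openin_gtop_Ub:
 assumes "openin (gtop GQ) U" "g \<in> U"
 shows "\<exists>v w. same v w & g \<in> Ub v w & Ub v w \<subseteq> U"
proof -
 have "generate_topology_on {sft_basic_open A B k l | A B k l.
   openin (shift_space Q) A & openin (shift_space Q) B & k \<ge> 1 & l \<ge> 1} U"
  using assms(1) by (simp add: sft_groupoid_def openin_topology_generated_by_iff)
 then show ?thesis using assms(2)
 proof (induction arbitrary: g rule: generate_topology_on.induct)
  case (Int a b)
  obtain v w where 1: "same v w" "g \<in> Ub v w" "Ub v w \<subseteq> a" using Int.IH(1)[of g] Int.prems by blast
  obtain v' w' where 2: "same v' w'" "g \<in> Ub v' w'" "Ub v' w' \<subseteq> b" using Int.IH(2)[of g] Int.prems by blast
  show ?case using Ub_nested[OF 1(1) 2(1)] 1 2 by blast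
 next
  case (UN K)
  then obtain k where k: "k \<in> K" "g \<in> k" by blast
  then obtain v w where "same v w" "g \<in> Ub v w" "Ub v w \<subseteq> k" using UN.IH[of k g] by blast
  then show ?case using k(1) by blast
 next
  case (Basis s)
  then show ?case using sft_basic_contains_Ub by blast
 qed simp
qed

lemma gtop_GR: "gtop (GR Y) = subtopology (gtop GQ)
  {g. rngQ g \<in> sft_unit ` Y & srcQ g \<in> sft_unit ` Y}"
 by (simp add: reduction_def)

lemma openin_Ub_GR:
 assumes s: "same v w" and c: "cyl v \<subseteq> Y" "cyl w \<subseteq> Y" shows "openin (gtop (GR Y)) (Ub v w)"
proof -
 have "Ub v w \<subseteq> {g. rngQ g \<in> sft_unit ` Y & srcQ g \<in> sft_unit ` Y}"
  using Ub_arr[OF assms] by (auto simp: arr_def)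
 then show ?thesis unfolding gtop_GR openin_subtopology using openin_Ub[OF s] by blast
qed

lemma openin_GR_Ub:
 assumes Y: "clop Y L" and U: "openin (gtop (GR Y)) U" and g: "(x, n, y) \<in> U"
 shows "\<exists>v w. same v w & cyl v \<subseteq> Y & cyl w \<subseteq> Y & (x, n, y) \<in> Ub v w & Ub v w \<subseteq> U &
  v = pfx x (length v) & w = pfx y (length w)"
proof -
 note YX = clop_X_level(1)[OF Y]
 obtain U' where U': "openin (gtop GQ) U'" "U = U' \<inter>
   {g. rngQ g \<in> sft_unit ` Y & srcQ g \<in> sft_unit ` Y}"
  using U unfolding gtop_GR openin_subtopology by blast
 obtain v w where v: "same v w" "(x, n, y) \<in> Ub v w" "Ub v w \<subseteq> U'"
  using openin_gtop_Ub[OF U'(1), of "(x, n, y)"] g U'(2) by blast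
 have "(x, n, y) \<in> arr Y" using openin_subset[OF U] g topspace_GR[OF YX] by auto
 then obtain v' w' where v': "same v' w'" "cyl v' \<subseteq> Y" "cyl w' \<subseteq> Y" "length w' \<ge> length w" "(x, n, y) \<in> Ub v' w'"
  "v' = pfx x (length v')" "w' = pfx y (length w')" using arr_Ub[OF Y, of x n y "length w"] by metis
 obtain p where "v' = v @ p" "w' = w @ p" using Ub_meet[OF v(1) v'(1) v(2) v'(5,4)] by metis
 then have "Ub v' w' \<subseteq> U'" using Ub_append v(3) by blast
 moreover have "Ub v' w' \<subseteq> {g. rngQ g \<in> sft_unit ` Y & srcQ g \<in> sft_unit ` Y}"
  using Ub_arr[OF v'(1-3)] by (auto simp: arr_def)
 ultimately show ?thesis using v' U'(2) by (intro exI[of _ v'] exI[of _ w'] conjI) auto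
qed

text \<open>Makes \<open>Ub\<close> and \<open>Wb\<close> continuous images of a cylinder, hence
  compact.\<close>

lemma continuous_arrow:
 assumes Y: "clop Y L" and s: "same u w" "same v w" and c: "cyl u \<subseteq> Y" "cyl v \<subseteq> Y"
 shows "continuous_map (subtopology (shift_space Q) (cyl w)) (gtop (GR Y))
  (%x. (rp w u x, int (length u) - int (length v), rp w v x))" (is "continuous_map ?S _ ?f")
 unfolding continuous_map_def
proof (intro conjI allI impI)
 note YX = clop_X_level(1)[OF Y]
 have tS: "topspace ?S = cyl w" using cyl_subset_X by (auto simp: topspace_subtopology)
 have suv: "same u v" using s by (simp add: same_def)
 have f: "?f x \<in> Ub u v" if "x \<in> cyl w" for x
  using same_rp[OF s(2) that] by (auto simp: Ub_def rp_trans image_iff)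
 show "?f \<in> topspace ?S \<rightarrow> topspace (gtop (GR Y))"
  unfolding tS topspace_GR[OF YX] using f Ub_arr[OF suv c] by blast
 fix U assume U: "openin (gtop (GR Y)) U"
 have "openin (shift_space Q) {x \<in> cyl w. ?f x \<in> U}"
  unfolding openin_shift_iff
 proof (intro conjI ballI)
  show "{x \<in> cyl w. ?f x \<in> U} \<subseteq> X" using cyl_subset_X by blast
  fix x assume x: "x \<in> {x \<in> cyl w. ?f x \<in> U}"
  then have "?f x \<in> U" by blast
  from openin_GR_Ub[OF Y U this] obtain v' w' where v': "same v' w'" "?f x \<in> Ub v' w'" "Ub v' w' \<subseteq> U"
   by blast
  have xw: "x \<in> cyl w" using x by blast
  define q where "q = pfx (%i. x (length w + i)) (length w')"
  have wq: "w @ q = pfx x (length w + length w')" using cyl_pfx[OF xw] by (simp add: pfx_add q_def)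
  have "w ~= []" using s by (auto simp: same_def)
  then have wqW: "w @ q \<in> words" unfolding wq using cyl_X[OF xw] by (intro pfx_words) auto
  have sq: "same (u @ q) (w @ q)" "same (v @ q) (w @ q)" using same_append[OF s(1)] same_append[OF s(2)] wqW by blast+
  have suq: "same (u @ q) (v @ q)" using sq by (simp add: same_def)
  have fq: "?f z \<in> Ub (u @ q) (v @ q)" if z: "z \<in> cyl (w @ q)" for z
  proof -
   have "rp (w @ q) (v @ q) z \<in> cyl (v @ q)" using same_rp[OF sq(2) z] .
   then have "rp w v z \<in> cyl (v @ q)" using rp_append[OF z] by simp
   then show ?thesis unfolding Ub_def
    by (intro image_eqI[of _ _ "rp w v z"]) (auto simp: rp_append rp_trans)
  qed
  have xq: "x \<in> cyl (w @ q)" unfolding wq using cyl_X[OF xw] by simp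
  have "length w' \<le> length (v @ q)" by (simp add: q_def)
  then obtain p where "u @ q = v' @ p" "v @ q = w' @ p" using Ub_meet[OF v'(1) suq v'(2) fq[OF xq]] by metis
  then have "Ub (u @ q) (v @ q) \<subseteq> Ub v' w'" using Ub_append[of v' p w'] by simp
  then have "Ub (u @ q) (v @ q) \<subseteq> U" using v'(3) by (rule subset_trans)
  then have "cyl (w @ q) \<subseteq> {x \<in> cyl w. ?f x \<in> U}" using fq cyl_append_subset[of w q] by blast
  then show "\<exists>n. cyl (pfx x n) \<subseteq> {x \<in> cyl w. ?f x \<in> U}" unfolding wq by blast
 qed
 then show "openin ?S {x \<in> topspace ?S. ?f x \<in> U}"
  unfolding tS openin_subtopology by (intro exI[of _ "{x \<in> cyl w. ?f x \<in> U}"]) auto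
qed

lemma compactin_cyl: "compactin (shift_space Q) (cyl w)"
proof -
 have "openin (shift_space Q) (X - cyl w)"
  unfolding openin_shift_iff
 proof (intro conjI ballI)
  fix x assume x: "x \<in> X - cyl w"
  have "y \<notin> cyl w" if "y \<in> cyl (pfx x (length w))" for y
   using that x by (auto simp: cyl_def)
  then show "\<exists>n. cyl (pfx x n) \<subseteq> X - cyl w" using cyl_subset_X by blast
 qed auto
 then have "closedin (shift_space Q) (cyl w)" using cyl_subset_X by (simp add: closedin_def)
 then show ?thesis using compact_shift_space by (rule closedin_compact_space[rotated])
qed

lemma compactin_sub_cyl: "compactin (subtopology (shift_space Q) (cyl w)) (cyl w)"
 using compactin_cyl by (simp add: compactin_subtopology)

lemma compactin_Ub:
 assumes Y: "clop Y L" and s: "same v w" and c: "cyl v \<subseteq> Y" "cyl w \<subseteq> Y"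
 shows "compactin (gtop (GR Y)) (Ub v w)"
proof -
 have "w \<in> words" using s by (simp add: same_def)
 then have "continuous_map (subtopology (shift_space Q) (cyl w)) (gtop (GR Y))
   (%x. (rp w v x, int (length v) - int (length w), rp w w x))"
  by (intro continuous_arrow[OF Y s _ c] same_refl)
 from image_compactin[OF compactin_sub_cyl this] show ?thesis
  by (simp add: Ub_def rp_id cong: image_cong)
qed

lemma Ub_separate:
 assumes Y: "clop Y L" and g: "g \<in> arr Y" and h: "h ~= g"
 shows "\<exists>v w. same v w & cyl v \<subseteq> Y & cyl w \<subseteq> Y & g \<in> Ub v w & h \<notin> Ub v w"
proof -
 obtain x n y x' n' y' where gh: "g = (x, n, y)" "h = (x', n', y')" by (cases g, cases h)
 obtain N where N: "n = n' ==> (\<exists>i<N. x i ~= x' i) \<or> (\<exists>i<N. y i ~= y' i)"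
 proof (cases "n = n'")
  case True
  then have "x ~= x' \<or> y ~= y'" using h gh by auto
  then obtain i where "x i ~= x' i \<or> y i ~= y' i" by auto
  then show ?thesis by (intro that[of "Suc i"]) auto
 qed (use that in blast)
 obtain v w where v: "same v w" "cyl v \<subseteq> Y" "cyl w \<subseteq> Y" "length v \<ge> N" "length w \<ge> N" "(x, n, y) \<in> Ub v w"
  "v = pfx x (length v)" "w = pfx y (length w)" using arr_Ub[OF Y, of x n y N] g gh by metis
 have "h \<notin> Ub v w"
 proof
  assume "h \<in> Ub v w"
  then have H: "x' \<in> cyl v" "y' \<in> cyl w" "n' = int (length v) - int (length w)" using in_Ub[OF v(1)] gh by auto
  have G: "x \<in> cyl v" "y \<in> cyl w" "n = int (length v) - int (length w)" using in_Ub[OF v(1)] v(6) by auto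
  have "x i = x' i" "y i = y' i" if "i < N" for i
   using that v(4,5) cyl_nth[OF H(1), of i] cyl_nth[OF G(1), of i] cyl_nth[OF H(2), of i] cyl_nth[OF G(2), of i] by auto
  then show False using N H(3) G(3) by auto
 qed
 then show ?thesis using v(1,2,3,6) gh by blast
qed

section \<open>Nested bases for arrows, units and composable pairs\<close>

lemma tree_base_gtop:
 assumes Y: "clop Y L" shows "tree_base (gtop (GR Y)) (BU Y)"
proof
 note YX = clop_X_level(1)[OF Y]
 fix A B assume A: "A \<in> BU Y" and B: "B \<in> BU Y"
 show "openin (gtop (GR Y)) B" using B by (auto simp: BU_def intro: openin_Ub_GR)
 show "compactin (gtop (GR Y)) B" using B by (auto simp: BU_def intro: compactin_Ub[OF Y])
 show "A \<inter> B = {} \<or> A \<subseteq> B \<or> B \<subseteq> A" using A B Ub_nested unfolding BU_def by blast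
next
 fix U g assume U: "openin (gtop (GR Y)) U" and g: "g \<in> U"
 obtain x n y where gx: "g = (x, n, y)" by (cases g)
 from openin_GR_Ub[OF Y U g[unfolded gx]] obtain v w
  where v: "same v w" "cyl v \<subseteq> Y" "cyl w \<subseteq> Y" "(x, n, y) \<in> Ub v w" "Ub v w \<subseteq> U" by blast
 show "\<exists>B\<in>BU Y. g \<in> B & B \<subseteq> U"
  by (rule bexI[OF _ BU_I[OF v(1-3)]]) (simp add: gx v(4,5))
next
 note YX = clop_X_level(1)[OF Y]
 fix g h assume "g \<in> topspace (gtop (GR Y))" "h \<in> topspace (gtop (GR Y))" "g ~= h"
 then have "g \<in> arr Y" "h ~= g" unfolding topspace_GR[OF YX] by blast+
 from Ub_separate[OF Y this] obtain v w
  where v: "same v w" "cyl v \<subseteq> Y" "cyl w \<subseteq> Y" "g \<in> Ub v w" "h \<notin> Ub v w" by blast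
 show "\<exists>B\<in>BU Y. g \<in> B & h \<notin> B"
  by (rule bexI[OF _ BU_I[OF v(1-3)]]) (simp add: v(4,5))
qed

lemma Ub_unit: "Ub w w = sft_unit ` cyl w"
 by (auto simp: Ub_def sft_unit_def rp_id)

lemma unit_top_GR: "Y \<subseteq> X ==> unit_top (GR Y) = subtopology (gtop (GR Y)) (sft_unit ` Y)"
 by (simp add: unit_top_def units_GR)

lemma topspace_unit_GR: assumes "Y \<subseteq> X" shows "topspace (unit_top (GR Y)) = sft_unit ` Y"
proof -
 have "sft_unit y \<in> arr Y" if "y \<in> Y" for y
  using that by (auto simp: arr_def sft_unit_def intro!: exI[of _ 0])
 then show ?thesis by (auto simp: unit_top_GR[OF assms] topspace_subtopology topspace_GR[OF assms])
qed

lemma openin_unit_ex: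
 assumes Y: "clop Y L" and U: "openin (unit_top (GR Y)) U" and x: "sft_unit x \<in> U"
 shows "\<exists>w. w \<in> words & cyl w \<subseteq> Y & x \<in> cyl w & sft_unit ` cyl w \<subseteq> U"
proof -
 note YX = clop_X_level(1)[OF Y]
 obtain U' where U': "openin (gtop (GR Y)) U'" "U = U' \<inter> sft_unit ` Y"
  using U unfolding unit_top_GR[OF YX] openin_subtopology by blast
 have "(x, 0, x) \<in> U'" using x U'(2) by (simp add: sft_unit_def)
 from openin_GR_Ub[OF Y U'(1) this] obtain v w where v: "same v w" "cyl v \<subseteq> Y" "cyl w \<subseteq> Y"
  "(x, 0, x) \<in> Ub v w" "Ub v w \<subseteq> U'" "v = pfx x (length v)" "w = pfx x (length w)" by blast
 have "length v = length w" using v(4) in_Ub[OF v(1)] by auto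
 then have "v = w" using v(6,7) by metis
 then have "sft_unit ` cyl w \<subseteq> U" using v(3,5) U'(2) unfolding Ub_unit[symmetric] by (auto simp: Ub_unit)
 moreover have "x \<in> cyl w" using v(4) in_Ub[OF v(1)] by auto
 moreover have "w \<in> words" using v(1) by (simp add: same_def)
 ultimately show ?thesis using v(3) by blast
qed

lemma openin_unit_cyl:
 assumes Y: "Y \<subseteq> X" and w: "w \<in> words" "cyl w \<subseteq> Y" shows "openin (unit_top (GR Y)) (sft_unit ` cyl w)"
 unfolding unit_top_GR[OF Y] openin_subtopology
 using openin_Ub_GR[OF same_refl[OF w(1)] w(2,2)] w(2) unfolding Ub_unit by blast

lemma tree_base_unit:
 assumes Y: "clop Y L" shows "tree_base (unit_top (GR Y)) (B0 Y)"
proof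
 note YX = clop_X_level(1)[OF Y]
 fix A B assume A: "A \<in> B0 Y" and B: "B \<in> B0 Y"
 obtain w where w: "w \<in> words" "cyl w \<subseteq> Y" "B = Ub w w" using B by (auto simp: B0_def)
 show "openin (unit_top (GR Y)) B" using w openin_unit_cyl[OF YX] by (simp add: Ub_unit)
 show "compactin (unit_top (GR Y)) B"
  unfolding unit_top_GR[OF YX] compactin_subtopology w(3)
  using compactin_Ub[OF Y same_refl[OF w(1)] w(2,2)] w(2) by (auto simp: Ub_unit)
 show "A \<inter> B = {} \<or> A \<subseteq> B \<or> B \<subseteq> A" using A B Ub_nested same_refl unfolding B0_def by blast
next
 note YX = clop_X_level(1)[OF Y]
 have ex: "\<exists>B\<in>B0 Y. g \<in> B & B \<subseteq> U" if U: "openin (unit_top (GR Y)) U" and g: "g \<in> U" for U g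
 proof -
  have "g \<in> sft_unit ` Y" using openin_subset[OF U] g topspace_unit_GR[OF YX] by blast
  then obtain x where x: "g = sft_unit x" by blast
  from openin_unit_ex[OF Y U g[unfolded x]] obtain w
   where w: "w \<in> words" "cyl w \<subseteq> Y" "x \<in> cyl w" "sft_unit ` cyl w \<subseteq> U" by blast
  show ?thesis by (rule bexI[OF _ B0_I[OF w(1,2)]]) (simp add: x Ub_unit w(3,4))
 qed
 show "\<exists>B\<in>B0 Y. g \<in> B & B \<subseteq> U" if "openin (unit_top (GR Y)) U" "g \<in> U" for U g using ex that .
 fix g h assume gh: "g \<in> topspace (unit_top (GR Y))" "h \<in> topspace (unit_top (GR Y))" "g ~= h"
 then have "g \<in> arr Y" by (simp add: unit_top_GR[OF YX] topspace_subtopology topspace_GR[OF YX])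
 from Ub_separate[OF Y this, of h] gh(3) obtain v w
  where v: "same v w" "cyl v \<subseteq> Y" "cyl w \<subseteq> Y" "g \<in> Ub v w" "h \<notin> Ub v w" by blast
 have "openin (unit_top (GR Y)) (Ub v w \<inter> sft_unit ` Y)"
  unfolding unit_top_GR[OF YX] openin_subtopology using openin_Ub_GR[OF v(1-3)] by blast
 moreover have "g \<in> Ub v w \<inter> sft_unit ` Y" using v(4) gh(1) topspace_unit_GR[OF YX] by blast
 ultimately show "\<exists>B\<in>B0 Y. g \<in> B & h \<notin> B" using ex v(5) by blast
qed

lemma topspace_pairs:
 assumes "Y \<subseteq> X"
 shows "topspace (pairs_top (GR Y)) = {(g, h). g \<in> arr Y & h \<in> arr Y & srcQ g = rngQ h}"
 by (auto simp: pairs_top_def topspace_subtopology topspace_GR[OF assms])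

lemma Wb_in: assumes "same u v" "same v w" "cyl u \<subseteq> Y" "cyl v \<subseteq> Y" "cyl w \<subseteq> Y"
 shows "Wb u v w = (Ub u v \<times> Ub v w) \<inter> {(g, h). srcQ g = rngQ h}"
proof
 show "Wb u v w \<subseteq> (Ub u v \<times> Ub v w) \<inter> {(g, h). srcQ g = rngQ h}"
 proof
  fix z assume "z \<in> Wb u v w"
  then obtain x where x: "x \<in> cyl w" "z = ((rp w u x, int (length u) - int (length v), rp w v x),
   (rp w v x, int (length v) - int (length w), x))" by (auto simp: Wb_def)
  have "rp w v x \<in> cyl v" using same_rp[OF assms(2) x(1)] .
  then have "(rp v u (rp w v x), int (length u) - int (length v), rp w v x) \<in> Ub u v" by (auto simp: Ub_def)
  then show "z \<in> (Ub u v \<times> Ub v w) \<inter> {(g, h). srcQ g = rngQ h}"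
   using x by (auto simp: rp_trans Ub_def)
 qed
 show "(Ub u v \<times> Ub v w) \<inter> {(g, h). srcQ g = rngQ h} \<subseteq> Wb u v w"
 proof
  fix z assume z: "z \<in> (Ub u v \<times> Ub v w) \<inter> {(g, h). srcQ g = rngQ h}"
  then obtain x y where xy: "y \<in> cyl v" "x \<in> cyl w" "z = ((rp v u y, int (length u) - int (length v), y),
   (rp w v x, int (length v) - int (length w), x))" by (auto simp: Ub_def)
  then have "y = rp w v x" using z by simp
  then show "z \<in> Wb u v w" using xy by (auto simp: Wb_def rp_trans)
 qed
qed

lemma Wb_meet:
 assumes s: "same u v" "same v w" "same u' v'" "same v' w'" and z: "z \<in> Wb u v w" "z \<in> Wb u' v' w'"
  and l: "length w \<le> length w'"
 shows "Wb u' v' w' \<subseteq> Wb u v w"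
proof -
 have z': "fst z \<in> Ub u v" "snd z \<in> Ub v w" "fst z \<in> Ub u' v'" "snd z \<in> Ub v' w'"
  using z Wb_in[of u v w X] Wb_in[of u' v' w' X] s cyl_subset_X by auto
 obtain p where p: "v' = v @ p" "w' = w @ p" using Ub_meet[OF s(2,4) z'(2,4) l] by metis
 obtain q where q: "u' = u @ q" "v' = v @ q" using Ub_meet[OF s(1,3) z'(1,3)] p by auto
 have "q = p" using p q by simp
 show ?thesis
 proof
  fix y assume "y \<in> Wb u' v' w'"
  then obtain x where x: "x \<in> cyl (w @ p)" "y = ((rp (w @ p) (u @ p) x, int (length (u @ p)) - int (length (v @ p)), rp (w @ p) (v @ p) x),
   (rp (w @ p) (v @ p) x, int (length (v @ p)) - int (length (w @ p)), x))"
   using p q \<open>q = p\<close> by (auto simp: Wb_def)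
  then have "x \<in> cyl w" "y = ((rp w u x, int (length u) - int (length v), rp w v x),
   (rp w v x, int (length v) - int (length w), x))"
   using cyl_append_subset[of w p] by (auto simp: rp_append)
  then show "y \<in> Wb u v w" by (auto simp: Wb_def)
 qed
qed

lemma openin_pairs_ex:
 assumes Y: "clop Y L" and U: "openin (pairs_top (GR Y)) U" and z: "z \<in> U"
 shows "\<exists>B\<in>BW Y. z \<in> B & B \<subseteq> U"
proof -
 note YX = clop_X_level(1)[OF Y]
 obtain U' where U': "openin (prod_topology (gtop (GR Y)) (gtop (GR Y))) U'"
  "U = U' \<inter> {(g, h). srcQ g = rngQ h}"
  using U unfolding pairs_top_def openin_subtopology by auto
 obtain x n y y' n' x' where zx: "z = ((x, n, y), (y', n', x'))" by (metis surj_pair)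
 have yy: "y' = y" using z U'(2) zx by simp
 obtain V V' where V: "openin (gtop (GR Y)) V" "openin (gtop (GR Y)) V'" "(x, n, y) \<in> V" "(y, n', x') \<in> V'" "V \<times> V' \<subseteq> U'"
 proof -
  have "((x, n, y), (y, n', x')) \<in> U'" using z U'(2) zx yy by simp
  then show ?thesis using U'(1)[unfolded openin_prod_topology_alt] that by meson
 qed
 obtain u v where u: "same u v" "cyl u \<subseteq> Y" "cyl v \<subseteq> Y" "(x, n, y) \<in> Ub u v" "Ub u v \<subseteq> V"
  using openin_GR_Ub[OF Y V(1,3)] by blast
 obtain v' w where w: "same v' w" "cyl v' \<subseteq> Y" "cyl w \<subseteq> Y" "(y, n', x') \<in> Ub v' w" "Ub v' w \<subseteq> V'"
  using openin_GR_Ub[OF Y V(2,4)] by blast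
 \<comment> \<open>\<open>p\<close> is as long as \<open>v'\<close> and \<open>q\<close> as long as
   \<open>v\<close>, so both middle words become the prefix of \<open>y\<close> of length
   \<open>length v + length v'\<close>.\<close>
 obtain p where p: "same (u @ p) (v @ p)" "(x, n, y) \<in> Ub (u @ p) (v @ p)" "v @ p = pfx y (length v + length v')"
  using Ub_extend[OF u(1,4), of "length v'"] by metis
 obtain q where q: "same (v' @ q) (w @ q)" "(y, n', x') \<in> Ub (v' @ q) (w @ q)" "v' @ q = pfx y (length v' + length v)"
  using Ub_extend[OF w(1,4), of "length v"] by metis
 have e: "v' @ q = v @ p" using p(3) q(3) by (simp add: add.commute)
 have sub: "cyl (u @ p) \<subseteq> Y" "cyl (v @ p) \<subseteq> Y" "cyl (w @ q) \<subseteq> Y"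
  using u(2,3) w(3) cyl_append_subset by blast+
 have W: "Wb (u @ p) (v @ p) (w @ q) = (Ub (u @ p) (v @ p) \<times> Ub (v @ p) (w @ q)) \<inter>
   {(g, h). srcQ g = rngQ h}"
  by (rule Wb_in[OF p(1) _ sub]) (use q(1) e in simp)
 have "z \<in> Wb (u @ p) (v @ p) (w @ q)" unfolding W using p(2) q(2) e zx yy by simp
 moreover have "Wb (u @ p) (v @ p) (w @ q) \<subseteq> U"
 proof -
  have "Ub (u @ p) (v @ p) \<subseteq> V" "Ub (v @ p) (w @ q) \<subseteq> V'"
   using Ub_append[of u p v] Ub_append[of v' q w] u(5) w(5) e by auto
  then show ?thesis unfolding W U'(2) using V(5) by blast
 qed
 moreover have "Wb (u @ p) (v @ p) (w @ q) \<in> BW Y" using p(1) q(1) e sub by (intro BW_I) simp_all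
 ultimately show ?thesis by blast
qed

lemma tree_base_pairs:
 assumes Y: "clop Y L" shows "tree_base (pairs_top (GR Y)) (BW Y)"
proof
 note YX = clop_X_level(1)[OF Y]
 let ?c = "{(g, h). srcQ g = rngQ h}"
 fix A B assume A: "A \<in> BW Y" and B: "B \<in> BW Y"
 obtain u v w where w: "same u v" "same v w" "cyl u \<subseteq> Y" "cyl v \<subseteq> Y" "cyl w \<subseteq> Y" "B = Wb u v w"
  using B by (auto simp: BW_def)
 have Bc: "B = (Ub u v \<times> Ub v w) \<inter> ?c" using Wb_in[OF w(1-5)] w(6) by simp
 have op: "openin (prod_topology (gtop (GR Y)) (gtop (GR Y))) (Ub u v \<times> Ub v w)"
  using openin_Ub_GR w by (auto simp: openin_prod_Times_iff)
 then show "openin (pairs_top (GR Y)) B"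
  unfolding pairs_top_def openin_subtopology Bc by auto
 show "compactin (pairs_top (GR Y)) B"
 proof -
  let ?f = "%x. ((rp w u x, int (length u) - int (length v), rp w v x), (rp w v x, int (length v) - int (length w), rp w w x))"
  have s: "same u w" "same w w" using w by (auto simp: same_def)
  have "continuous_map (subtopology (shift_space Q) (cyl w)) (prod_topology (gtop (GR Y)) (gtop (GR Y))) ?f"
   by (intro continuous_map_pairedI continuous_arrow[OF Y] s w)
  then have "compactin (prod_topology (gtop (GR Y)) (gtop (GR Y))) (?f ` cyl w)"
   using image_compactin[OF compactin_sub_cyl] by blast
  moreover have "?f ` cyl w = B" unfolding w(6) Wb_def by (rule image_cong) (auto simp: rp_id)
  ultimately show ?thesis unfolding pairs_top_def compactin_subtopology using Bc by auto
 qed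
 obtain u' v' w' where w': "same u' v'" "same v' w'" "A = Wb u' v' w'" using A by (auto simp: BW_def)
 show "A \<inter> B = {} \<or> A \<subseteq> B \<or> B \<subseteq> A"
  using Wb_meet[OF w(1,2) w'(1,2)] Wb_meet[OF w'(1,2) w(1,2)] w(6) w'(3) nle_le by blast
next
 fix U z assume "openin (pairs_top (GR Y)) U" "z \<in> U"
 then show "\<exists>B\<in>BW Y. z \<in> B & B \<subseteq> U" by (rule openin_pairs_ex[OF Y])
next
 note YX = clop_X_level(1)[OF Y]
 let ?c = "{(g, h). srcQ g = rngQ h}"
 fix z z' assume z: "z \<in> topspace (pairs_top (GR Y))" "z' \<in> topspace (pairs_top (GR Y))" "z ~= z'"
 obtain g h g' h' where gh: "z = (g, h)" "z' = (g', h')" by (cases z, cases z')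
 have zz: "g \<in> arr Y" "h \<in> arr Y" "z \<in> ?c" using z(1) gh topspace_pairs[OF YX] by auto
 have T: "openin (gtop (GR Y)) (arr Y)" using openin_topspace[of "gtop (GR Y)"] topspace_GR[OF YX] by simp
 have "\<exists>V V'. openin (gtop (GR Y)) V & openin (gtop (GR Y)) V' & z \<in> V \<times> V' & z' \<notin> V \<times> V'"
 proof (cases "g = g'")
  case False
  then obtain v w where "same v w" "cyl v \<subseteq> Y" "cyl w \<subseteq> Y" "g \<in> Ub v w" "g' \<notin> Ub v w"
   using Ub_separate[OF Y zz(1), of g'] by blast
  then show ?thesis using gh zz T openin_Ub_GR by (intro exI[of _ "Ub v w"] exI[of _ "arr Y"]) auto
 next
  case True
  then have "h' ~= h" using z(3) gh by auto
  then obtain v w where "same v w" "cyl v \<subseteq> Y" "cyl w \<subseteq> Y" "h \<in> Ub v w" "h' \<notin> Ub v w"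
   using Ub_separate[OF Y zz(2), of h'] by blast
  then show ?thesis using gh zz T openin_Ub_GR by (intro exI[of _ "arr Y"] exI[of _ "Ub v w"]) auto
 qed
 then obtain V V' where V: "openin (gtop (GR Y)) V" "openin (gtop (GR Y)) V'" "z \<in> V \<times> V'" "z' \<notin> V \<times> V'" by blast
 have "openin (pairs_top (GR Y)) ((V \<times> V') \<inter> ?c)"
  unfolding pairs_top_def openin_subtopology using V(1,2) by (intro exI[of _ "V \<times> V'"]) (simp add: openin_prod_Times_iff)
 then obtain B where "B \<in> BW Y" "z \<in> B" "B \<subseteq> (V \<times> V') \<inter> ?c" using openin_pairs_ex[OF Y] V(3) zz(3) by blast
 then show "\<exists>B\<in>BW Y. z \<in> B & z' \<notin> B" using V(4) by blast
qed

end

section \<open>Chains, boundaries and homology\<close>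

text \<open>A surjection onto a group with trivial squares whose kernel consists of squares is
  already the passage from \<open>A\<close> to its tensor product with the cyclic group of order
  two.\<close>

lemma tensor_mod_two:
 assumes A: "comm_group A" and E: "comm_group E" and q: "q \<in> hom A E"
  and surj: "q ` carrier A = carrier E"
  and two: "!!a. a \<in> carrier A ==> q a \<otimes>\<^bsub>E\<^esub> q a = \<one>\<^bsub>E\<^esub>"
  and ker: "!!a. a \<in> carrier A ==> q a = \<one>\<^bsub>E\<^esub> ==> \<exists>b\<in>carrier A. a = b \<otimes>\<^bsub>A\<^esub> b"
 shows "E \<cong> tensor_group A (integer_mod_group 2)"
proof -
 interpret A: comm_group A by (rule A)
 interpret E: comm_group E by (rule E)
 let ?Z = "integer_mod_group 2"
 have Z: "carrier ?Z = {0, 1}" by (auto simp: carrier_integer_mod_group)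
 define F where "F = free_Abelian_group (carrier A \<times> carrier ?Z)"
 define R where "R = bilinear_relations A ?Z"
 interpret F: comm_group F unfolding F_def by (rule abelian_free_Abelian_group)
 \<comment> \<open>The bilinear map that sends \<open>(a, n)\<close> to the \<open>n\<close>-th
   power of \<open>q a\<close>.\<close>
 define f where "f = (%(a, n::int). if n = 1 then q a else \<one>\<^bsub>E\<^esub>)"
 have qc: "q a \<in> carrier E" if "a \<in> carrier A" for a using hom_in_carrier[OF q that] .
 have "f ` (carrier A \<times> carrier ?Z) \<subseteq> carrier E" using qc by (auto simp: f_def)
 then obtain h where h: "h \<in> hom F E" "!!x. x \<in> carrier A \<times> carrier ?Z ==> h (frag_of x) = f x"
  unfolding F_def using E.free_Abelian_group_universal[of f "carrier A \<times> carrier ?Z"] by blast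
 interpret h: group_hom F E h by unfold_locales (rule h(1))
 have Fm: "x \<otimes>\<^bsub>F\<^esub> y = x + y" "\<one>\<^bsub>F\<^esub> = 0" for x y by (simp_all add: F_def)
 have Fi: "inv\<^bsub>F\<^esub> x = - x" if "x \<in> carrier F" for x using that by (simp add: F_def)
 have Fd: "x - y \<in> carrier F" if "x \<in> carrier F" "y \<in> carrier F" for x y
  using F.m_closed[OF that(1) F.inv_closed[OF that(2)]] Fi[OF that(2)] by (simp add: Fm)
 have hd: "h (x - y) = h x \<otimes>\<^bsub>E\<^esub> inv\<^bsub>E\<^esub> h y" if "x \<in> carrier F" "y \<in> carrier F" for x y
  using h.hom_mult[OF that(1) F.inv_closed[OF that(2)]] h.hom_inv[OF that(2)] Fi[OF that(2)] by (simp add: Fm)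
 have Fo: "frag_of (a, n) \<in> carrier F" if "a \<in> carrier A" "n \<in> carrier ?Z" for a n
  using that unfolding F_def by simp
 have RF: "R \<subseteq> carrier F"
 proof -
  have "(n + n') mod 2 \<in> carrier ?Z" for n n' :: int by (auto simp: Z)
  then show ?thesis unfolding R_def bilinear_relations_def by (auto intro!: Fd Fo)
 qed
 define N where "N = generate F R"
 have Ns: "subgroup N F" unfolding N_def by (rule F.generate_is_subgroup[OF RF])
 have NR: "r \<in> N" if "r \<in> R" for r unfolding N_def using that by (rule generate.incl)
 have Nc: "x \<in> carrier F" if "x \<in> N" for x using subgroup.mem_carrier[OF Ns that] .
 have Na: "x + y \<in> N" if "x \<in> N" "y \<in> N" for x y using subgroup.m_closed[OF Ns that] by (simp add: Fm)
 have Nm: "- x \<in> N" if "x \<in> N" for x using subgroup.m_inv_closed[OF Ns that] Fi[OF Nc[OF that]] by simp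
 have Nd: "x - y \<in> N" if "x \<in> N" "y \<in> N" for x y using Na[OF that(1) Nm[OF that(2)]] by simp
 have r1: "frag_of (a \<otimes>\<^bsub>A\<^esub> a', n) - frag_of (a, n) - frag_of (a', n) \<in> N"
  if "a \<in> carrier A" "a' \<in> carrier A" "n \<in> carrier ?Z" for a a' n
  by (rule NR) (use that in \<open>auto simp: R_def bilinear_relations_def\<close>)
 have r2: "frag_of (a, (n + n') mod 2) - frag_of (a, n) - frag_of (a, n') \<in> N"
  if "a \<in> carrier A" "n \<in> carrier ?Z" "n' \<in> carrier ?Z" for a n n'
 proof (rule NR)
  have "(n + n') mod 2 = n \<otimes>\<^bsub>?Z\<^esub> n'" by simp
  then show "frag_of (a, (n + n') mod 2) - frag_of (a, n) - frag_of (a, n') \<in> R"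
   unfolding R_def bilinear_relations_def
   by (intro UnI2 CollectI exI[of _ a] exI[of _ n] exI[of _ n'] conjI that) simp
 qed
 have hR: "h r = \<one>\<^bsub>E\<^esub>" if "r \<in> R" for r
 proof -
  have fz: "f (a, n) \<in> carrier E" if "a \<in> carrier A" for a n using qc that by (simp add: f_def)
  consider a a' n where "a \<in> carrier A" "a' \<in> carrier A" "n \<in> carrier ?Z"
    "r = frag_of (a \<otimes>\<^bsub>A\<^esub> a', n) - frag_of (a, n) - frag_of (a', n)"
   | a n n' where "a \<in> carrier A" "n \<in> carrier ?Z" "n' \<in> carrier ?Z"
    "r = frag_of (a, (n + n') mod 2) - frag_of (a, n) - frag_of (a, n')"
   using \<open>r \<in> R\<close> unfolding R_def bilinear_relations_def by auto
  then show ?thesis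
  proof cases
   case 1
   have "h r = f (a \<otimes>\<^bsub>A\<^esub> a', n) \<otimes>\<^bsub>E\<^esub> inv\<^bsub>E\<^esub> f (a, n) \<otimes>\<^bsub>E\<^esub> inv\<^bsub>E\<^esub> f (a', n)"
    unfolding 1(4) using 1(1-3) by (simp add: hd Fd Fo h(2))
   also have "f (a \<otimes>\<^bsub>A\<^esub> a', n) = f (a', n) \<otimes>\<^bsub>E\<^esub> f (a, n)"
    using hom_mult[OF q 1(1,2)] E.m_comm qc 1(1,2) by (simp add: f_def)
   finally show ?thesis using fz 1(1,2) by (simp add: E.m_assoc)
  next
   case 2
   have m: "(n + n') mod 2 \<in> carrier ?Z" using 2(2,3) by (auto simp: Z)
   have "h r = f (a, (n + n') mod 2) \<otimes>\<^bsub>E\<^esub> inv\<^bsub>E\<^esub> f (a, n) \<otimes>\<^bsub>E\<^esub> inv\<^bsub>E\<^esub> f (a, n')"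
    unfolding 2(4) using 2(1-3) m by (simp add: hd Fd Fo h(2))
   also have "f (a, (n + n') mod 2) = f (a, n') \<otimes>\<^bsub>E\<^esub> f (a, n)"
    using 2(2,3) two[OF 2(1)] qc[OF 2(1)] by (auto simp: Z f_def)
   finally show ?thesis using fz 2(1) by (simp add: E.m_assoc)
  qed
 qed
 have "N \<subseteq> kernel F E h"
  unfolding N_def by (rule F.generate_subgroup_incl[OF _ h.subgroup_kernel]) (use hR RF in \<open>auto simp: kernel_def\<close>)
 moreover have "kernel F E h \<subseteq> N"
 proof
  \<comment> \<open>Modulo the relations every element is represented by a single pair with second
    entry \<open>1\<close>.\<close>
  have rep: "\<exists>a\<in>carrier A. z - frag_of (a, 1) \<in> N" if "z \<in> carrier F" for z
  proof -
   have "Poly_Mapping.keys z \<subseteq> carrier A \<times> carrier ?Z" using that by (simp add: F_def)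
   then show ?thesis
   proof (induction rule: frag_induction)
    case zero
    have "frag_of (\<one>\<^bsub>A\<^esub>, 1) - frag_of (\<one>\<^bsub>A\<^esub>, 1) - frag_of (\<one>\<^bsub>A\<^esub>, 1) \<in> N"
     using r1[of "\<one>\<^bsub>A\<^esub>" "\<one>\<^bsub>A\<^esub>" 1] Z by simp
    then show ?case by (intro bexI[of _ "\<one>\<^bsub>A\<^esub>"]) simp_all
   next
    case (one x)
    then obtain a n where x: "x = (a, n)" "a \<in> carrier A" "n \<in> {0, 1}" using Z by auto
    show ?case
    proof (cases "n = 1")
     case True
     then show ?thesis using x subgroup.one_closed[OF Ns] by (intro bexI[of _ a]) (simp_all add: Fm)
    next
     case False
     then have "n = 0" using x(3) by auto
     have "- (frag_of (a, 0) - frag_of (a, 0) - frag_of (a, 0)) \<in> N"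
      using r2[of a 0 0] x(2) Z by (intro Nm) simp
     moreover have "frag_of (\<one>\<^bsub>A\<^esub>, 1) - frag_of (\<one>\<^bsub>A\<^esub>, 1) - frag_of (\<one>\<^bsub>A\<^esub>, 1) \<in> N"
      using r1[of "\<one>\<^bsub>A\<^esub>" "\<one>\<^bsub>A\<^esub>" 1] Z by simp
     ultimately have "frag_of (a, 0) - frag_of (\<one>\<^bsub>A\<^esub>, 1) \<in> N"
      using Na by fastforce
     then show ?thesis using x(1) \<open>n = 0\<close> by blast
    qed
   next
    case (diff z z')
    then obtain a a' where a: "a \<in> carrier A" "z - frag_of (a, 1) \<in> N" "a' \<in> carrier A" "z' - frag_of (a', 1) \<in> N"
     by blast
    let ?b = "a \<otimes>\<^bsub>A\<^esub> inv\<^bsub>A\<^esub> a'"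
    have "frag_of (?b \<otimes>\<^bsub>A\<^esub> a', 1) - frag_of (?b, 1) - frag_of (a', 1) \<in> N"
     using a Z by (intro r1) auto
    moreover have "?b \<otimes>\<^bsub>A\<^esub> a' = a" using a by (simp add: A.m_assoc)
    ultimately have "frag_of (a, 1) - frag_of (?b, 1) - frag_of (a', 1) \<in> N" by simp
    from Na[OF Nd[OF a(2,4)] this] have "z - z' - frag_of (?b, 1) \<in> N" by (simp add: algebra_simps)
    then show ?case using a by blast
   qed
  qed
  fix z assume z: "z \<in> kernel F E h"
  then have zF: "z \<in> carrier F" "h z = \<one>\<^bsub>E\<^esub>" by (auto simp: kernel_def)
  obtain a where a: "a \<in> carrier A" "z - frag_of (a, 1) \<in> N" using rep[OF zF(1)] by blast
  have "h (z - frag_of (a, 1)) = \<one>\<^bsub>E\<^esub>" using \<open>N \<subseteq> kernel F E h\<close> a(2) by (auto simp: kernel_def)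
  then have "inv\<^bsub>E\<^esub> q a = \<one>\<^bsub>E\<^esub>"
   using hd[OF zF(1) Fo[OF a(1), of 1]] h(2)[of "(a, 1)"] zF(2) a(1) qc[OF a(1)] Z by (simp add: f_def)
  then have "q a = \<one>\<^bsub>E\<^esub>" using qc[OF a(1)] by (metis E.inv_inv E.inv_one)
  then obtain b where b: "b \<in> carrier A" "a = b \<otimes>\<^bsub>A\<^esub> b" using ker[OF a(1)] by blast
  \<comment> \<open>Modulo the relations, the pair of the square of \<open>b\<close> with
    \<open>1\<close> is twice \<open>(b, 1)\<close>, which is \<open>(b, 0)\<close> because
    \<open>1 + 1\<close> is zero modulo two, and \<open>(b, 0)\<close> vanishes.\<close>
  have "frag_of (a, 1) - frag_of (b, 1) - frag_of (b, 1) \<in> N" using r1[of b b 1] b Z by simp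
  moreover have "frag_of (b, 0) - frag_of (b, 1) - frag_of (b, 1) \<in> N" using r2[of b 1 1] b Z by simp
  moreover have "- (frag_of (b, 0) - frag_of (b, 0) - frag_of (b, 0)) \<in> N" using r2[of b 0 0] b Z by (intro Nm) simp
  ultimately have "(frag_of (a, 1) - frag_of (b, 1) - frag_of (b, 1)) - (frag_of (b, 0) - frag_of (b, 1) - frag_of (b, 1))
    + - (frag_of (b, 0) - frag_of (b, 0) - frag_of (b, 0)) \<in> N" using Na Nd by blast
  then have "frag_of (a, 1) \<in> N" by simp
  from Na[OF a(2) this] show "z \<in> N" by simp
 qed
 ultimately have K: "kernel F E h = N" by blast
 have "h ` carrier F = carrier E"
 proof
  show "carrier E \<subseteq> h ` carrier F"
  proof
   fix e assume "e \<in> carrier E"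
   then obtain a where a: "a \<in> carrier A" "e = q a" using surj by blast
   have "h (frag_of (a, 1)) = e" using h(2)[of "(a, 1)"] a Z by (simp add: f_def)
   then show "e \<in> h ` carrier F" using Fo[OF a(1), of 1] Z by blast
  qed
 qed (use h.hom_closed in blast)
 then have "F Mod kernel F E h \<cong> E" by (rule h.FactGroup_iso)
 then have "E \<cong> F Mod kernel F E h"
  by (rule group.iso_sym[OF normal.factorgroup_is_group[OF h.normal_kernel]])
 then show ?thesis unfolding K by (simp add: tensor_group_def F_def N_def R_def Let_def)
qed

context sft
begin

section \<open>Boundary maps on generators\<close>

lemma Ub_topspace: "clop Y L ==> B \<in> BU Y ==> B \<subseteq> topspace (gtop (GR Y))"
 using tree_base.base_topspace[OF tree_base_gtop] .

lemma Ub_inj: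
 assumes "B \<in> BU Y" shows "inj_on (srcQ) B" "inj_on (rngQ) B"
proof -
 obtain v w where B: "B = Ub v w" using assms by (auto simp: BU_def)
 show "inj_on (srcQ) B" unfolding B Ub_def by (auto simp: inj_on_def)
 show "inj_on (rngQ) B" unfolding B Ub_def
  using rp_inj[of w v] by (auto simp: inj_on_def)
qed

lemma src_Ub: "srcQ ` Ub v w = Ub w w"
 by (simp add: Ub_unit image_image) (simp add: Ub_def image_image)

lemma rng_Ub: "same v w ==> rngQ ` Ub v w = Ub v v"
 unfolding Ub_unit using rp_image[of v w] by (simp add: Ub_def image_image same_def) (metis image_image)

lemma delta1_zero: "delta1 (GR Y) (%x. 0) = (%x. 0)"
 by (simp add: delta1_def pushforward_zero)

lemma delta1_add:
 assumes Y: "clop Y L" and f: "f \<in> gen (BU Y)" and g: "g \<in> gen (BU Y)"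
 shows "delta1 (GR Y) (%x. f x + g x) = (%z. delta1 (GR Y) f z + delta1 (GR Y) g z)"
 unfolding delta1_def src_reduction rng_reduction
 using pushforward_gen_add[of "BU Y" _ "srcQ" f g] pushforward_gen_add[of "BU Y" _ "rngQ" f g]
  Ub_topspace[OF Y] Ub_inj f g by (auto simp: fun_eq_iff)

lemma delta1_Ub:
 assumes Y: "clop Y L" and s: "same v w" "cyl v \<subseteq> Y" "cyl w \<subseteq> Y"
 shows "delta1 (GR Y) (iU v w) = (%z. iU w w z - iU v v z)"
proof -
 have B: "Ub v w \<in> BU Y" using s by (auto simp: BU_def)
 show ?thesis unfolding delta1_def src_reduction rng_reduction
  using pushforward_ind(2)[OF Ub_topspace[OF Y B] Ub_inj(1)[OF B]]
   pushforward_ind(2)[OF Ub_topspace[OF Y B] Ub_inj(2)[OF B]] src_Ub rng_Ub[OF s(1)] by simp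
qed

lemma delta1_neg:
 assumes Y: "clop Y L" and f: "f \<in> gen (BU Y)"
 shows "delta1 (GR Y) (%x. - f x) = (%z. - delta1 (GR Y) f z)"
proof
 fix z
 have "delta1 (GR Y) (%x. f x + - f x) z = delta1 (GR Y) f z + delta1 (GR Y) (%x. - f x) z"
  using fun_cong[OF delta1_add[OF Y f gen_neg[OF f]], of z] by simp
 then show "delta1 (GR Y) (%x. - f x) z = - delta1 (GR Y) f z"
  using fun_cong[OF delta1_zero[of Y], of z] by simp
qed

lemma delta1_diff:
 assumes Y: "clop Y L" and f: "f \<in> gen (BU Y)" and g: "g \<in> gen (BU Y)"
 shows "delta1 (GR Y) (%x. f x - g x) = (%z. delta1 (GR Y) f z - delta1 (GR Y) g z)"
 using delta1_add[OF Y f gen_neg[OF g]] delta1_neg[OF Y g] by simp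

lemma ind_Ub_gen: "same v w ==> cyl v \<subseteq> Y ==> cyl w \<subseteq> Y ==> iU v w \<in> gen (BU Y)"
 by (rule gen_ind) (rule BU_I)

lemma ind_unit_gen: "w \<in> words ==> cyl w \<subseteq> Y ==> iU w w \<in> gen (B0 Y)"
 by (rule gen_ind) (rule B0_I)

lemma delta1_gen: assumes Y: "clop Y L" and f: "f \<in> gen (BU Y)" shows "delta1 (GR Y) f \<in> gen (B0 Y)"
 using f
proof (induction rule: gen_induct)
 case zero
 show ?case unfolding delta1_zero by (rule gen.gen_zero)
next
 case (ind B)
 then obtain v w where v: "same v w" "cyl v \<subseteq> Y" "cyl w \<subseteq> Y" "B = Ub v w" by (auto simp: BU_def)
 show ?case unfolding v(4) delta1_Ub[OF Y v(1-3)]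
  using v by (intro gen_diff ind_unit_gen) (auto simp: same_def)
next
 case (diff f g)
 show ?case unfolding delta1_diff[OF Y diff.hyps] by (rule gen_diff[OF diff.IH])
qed

lemma Wb_projections:
 assumes "B \<in> BW Y"
 shows "inj_on (%(g, h). h) B" "inj_on (%(g, h). gmult GQ g h) B" "inj_on (%(g, h). g) B"
proof -
 obtain u v w where B: "B = Wb u v w" "same v w" using assms by (auto simp: BW_def)
 show "inj_on (%(g, h). h) B" "inj_on (%(g, h). gmult GQ g h) B"
  unfolding B Wb_def by (auto simp: inj_on_def)
 show "inj_on (%(g, h). g) B" unfolding B Wb_def using rp_inj[of w v] by (auto simp: inj_on_def)
qed

lemma Wb_images:
 assumes "same u v" "same v w"
 shows "(%(g, h). h) ` Wb u v w = Ub v w" "(%(g, h). gmult GQ g h) ` Wb u v w = Ub u w"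
  "(%(g, h). g) ` Wb u v w = Ub u v"
proof -
 show "(%(g, h). h) ` Wb u v w = Ub v w" "(%(g, h). gmult GQ g h) ` Wb u v w = Ub u w"
  unfolding Wb_def Ub_def image_image by auto
 have "(%(g, h). g) ` Wb u v w = (%x. (rp v u x, int (length u) - int (length v), x)) ` (rp w v ` cyl w)"
  unfolding Wb_def image_image by (simp add: rp_trans)
 also have "rp w v ` cyl w = cyl v" using assms by (intro rp_image) (auto simp: same_def)
 finally show "(%(g, h). g) ` Wb u v w = Ub u v" by (simp add: Ub_def)
qed

lemma delta2_zero: "delta2 (GR Y) (%x. 0) = (%x. 0)"
 by (simp add: delta2_def pushforward_zero)

lemma delta2_add:
 assumes Y: "clop Y L" and f: "f \<in> gen (BW Y)" and g: "g \<in> gen (BW Y)"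
 shows "delta2 (GR Y) (%x. f x + g x) = (%z. delta2 (GR Y) f z + delta2 (GR Y) g z)"
proof -
 have T: "B \<subseteq> topspace (pairs_top (GR Y))" if "B \<in> BW Y" for B
  using tree_base.base_topspace[OF tree_base_pairs[OF Y] that] .
 note p = pushforward_gen_add[of "BW Y" "pairs_top (GR Y)" _ f g, OF _ f g]
 show ?thesis unfolding delta2_def gmult_reduction
  using p[of "%(g, h). h"] p[of "%(g, h). gmult GQ g h"] p[of "%(g, h). g"] T Wb_projections
  by (auto simp: fun_eq_iff)
qed

lemma delta2_Wb:
 assumes Y: "clop Y L" and s: "same u v" "same v w" "cyl u \<subseteq> Y" "cyl v \<subseteq> Y" "cyl w \<subseteq> Y"
 shows "delta2 (GR Y) (indicator (Wb u v w)) =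
  (%z. iU v w z - iU u w z + iU u v z)"
proof -
 have B: "Wb u v w \<in> BW Y" using s by (intro BW_I)
 have T: "Wb u v w \<subseteq> topspace (pairs_top (GR Y))"
  using tree_base.base_topspace[OF tree_base_pairs[OF Y] B] .
 note P = Wb_projections[OF B] and I = Wb_images[OF s(1,2)]
 show ?thesis unfolding delta2_def gmult_reduction
  using pushforward_ind(2)[OF T P(1)] pushforward_ind(2)[OF T P(2)] pushforward_ind(2)[OF T P(3)]
  unfolding I by simp
qed

lemma delta2_neg:
 assumes Y: "clop Y L" and f: "f \<in> gen (BW Y)"
 shows "delta2 (GR Y) (%x. - f x) = (%z. - delta2 (GR Y) f z)"
proof
 fix z
 have "delta2 (GR Y) (%x. f x + - f x) z = delta2 (GR Y) f z + delta2 (GR Y) (%x. - f x) z"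
  using fun_cong[OF delta2_add[OF Y f gen_neg[OF f]], of z] by simp
 then show "delta2 (GR Y) (%x. - f x) z = - delta2 (GR Y) f z"
  using fun_cong[OF delta2_zero[of Y], of z] by simp
qed

section \<open>Boundaries, cycles and the first homology group\<close>

abbreviation "Bd Y \<equiv> boundaries1 (GR Y)"

lemma Bd_eq: "clop Y L ==> Bd Y = delta2 (GR Y) ` gen (BW Y)"
 by (simp add: boundaries1_def tree_base.carrier_Cc[OF tree_base_pairs])

lemma Bd_zero: "clop Y L ==> (%x. 0) \<in> Bd Y"
 unfolding Bd_eq by (rule image_eqI[of _ _ "%x. 0"]) (simp_all add: delta2_zero gen_zero)

lemma Bd_add: assumes Y: "clop Y L" and "f \<in> Bd Y" "g \<in> Bd Y" shows "(%x. f x + g x) \<in> Bd Y"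
proof -
 obtain f' g' where fg: "f' \<in> gen (BW Y)" "f = delta2 (GR Y) f'" "g' \<in> gen (BW Y)" "g = delta2 (GR Y) g'"
  using assms(2,3) unfolding Bd_eq[OF Y] by (elim imageE)
 show ?thesis unfolding Bd_eq[OF Y]
  by (rule image_eqI[OF _ gen_add[OF fg(1,3)]]) (simp add: delta2_add[OF Y fg(1,3)] fg(2,4))
qed

lemma Bd_neg: assumes Y: "clop Y L" and "f \<in> Bd Y" shows "(%x. - f x) \<in> Bd Y"
proof -
 obtain f' where f: "f' \<in> gen (BW Y)" "f = delta2 (GR Y) f'"
  using assms(2) unfolding Bd_eq[OF Y] by (elim imageE)
 show ?thesis unfolding Bd_eq[OF Y]
  by (rule image_eqI[OF _ gen_neg[OF f(1)]]) (simp add: delta2_neg[OF Y f(1)] f(2))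
qed

lemma Bd_diff: assumes "clop Y L" "f \<in> Bd Y" "g \<in> Bd Y" shows "(%x. f x - g x) \<in> Bd Y"
 using Bd_add[OF assms(1,2) Bd_neg[OF assms(1,3)]] by simp

text \<open>In homology the composition of prefix replacements becomes addition; by
  \<open>Bd_induct\<close> these relations generate all boundaries.\<close>

lemma Bd_Ub:
 assumes Y: "clop Y L" and s: "same u v" "same v w" "cyl u \<subseteq> Y" "cyl v \<subseteq> Y" "cyl w \<subseteq> Y"
 shows "(%z. iU v w z - iU u w z + iU u v z) \<in> Bd Y"
proof -
 have B: "indicator (Wb u v w) \<in> gen (BW Y)" using s by (intro gen_ind BW_I)
 show ?thesis unfolding Bd_eq[OF Y] by (rule image_eqI[OF _ B]) (simp add: delta2_Wb[OF Y s])
qed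

lemma Bd_induct [consumes 2, case_names zero triple diff]:
 assumes Y: "clop Y L" and f: "f \<in> Bd Y" and z: "P (%x. 0)"
  and t: "!!u v w. same u v ==> same v w ==> cyl u \<subseteq> Y ==> cyl v \<subseteq> Y ==> cyl w \<subseteq> Y ==>
   P (%x. iU v w x - iU u w x + iU u v x)"
  and d: "!!f g. f \<in> Bd Y ==> g \<in> Bd Y ==> P f ==> P g ==> P (%x. f x - g x)"
 shows "P f"
proof -
 have "delta2 (GR Y) h \<in> Bd Y & P (delta2 (GR Y) h)" if "h \<in> gen (BW Y)" for h
  using that
 proof (induction rule: gen_induct)
  case zero
  show ?case unfolding delta2_zero using z Bd_zero[OF Y] by simp
 next
  case (ind B)
  then obtain u v w where B: "same u v" "same v w" "cyl u \<subseteq> Y" "cyl v \<subseteq> Y" "cyl w \<subseteq> Y" "B = Wb u v w"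
   by (auto simp: BW_def)
  show ?case unfolding B(6) delta2_Wb[OF Y B(1-5)] using t[OF B(1-5)] Bd_Ub[OF Y B(1-5)] by (rule conjI[rotated])
 next
  case (diff h g)
  have e: "delta2 (GR Y) (%x. h x - g x) = (%x. delta2 (GR Y) h x - delta2 (GR Y) g x)"
   using delta2_add[OF Y diff.hyps(1) gen_neg[OF diff.hyps(2)]] delta2_neg[OF Y diff.hyps(2)] by simp
  have h: "delta2 (GR Y) h \<in> Bd Y" "delta2 (GR Y) g \<in> Bd Y" "P (delta2 (GR Y) h)" "P (delta2 (GR Y) g)"
   using diff.IH by blast+
  show ?case unfolding e using Bd_diff[OF Y h(1,2)] d[OF h] by (rule conjI)
 qed
 then show ?thesis using f unfolding Bd_eq[OF Y] by blast
qed

lemma Bd_cycle: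
 assumes Y: "clop Y L" and f: "f \<in> Bd Y"
 shows "f \<in> gen (BU Y) & delta1 (GR Y) f = (%x. 0)"
 using Y f
proof (induction rule: Bd_induct)
 case zero
 show ?case using gen_zero delta1_zero by simp
next
 case (triple u v w)
 have uw: "same u w" using triple by (auto simp: same_def)
 have "(%x. iU v w x - iU u w x + iU u v x) \<in> gen (BU Y)"
  using triple uw by (intro gen_add gen_diff ind_Ub_gen)
 then show ?case
  using delta1_add[OF Y gen_diff[OF ind_Ub_gen ind_Ub_gen] ind_Ub_gen, of v w u w u v] triple uw
   delta1_diff[OF Y ind_Ub_gen ind_Ub_gen, of v w u w] delta1_Ub[OF Y] by simp
next
 case (diff f g)
 then show ?case by (simp add: gen_diff delta1_diff[OF Y])
qed

definition Zc :: "(nat => 'e) set => ('e sft_arrow => int) set" where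
 "Zc Y = {f \<in> gen (BU Y). delta1 (GR Y) f = (%x. 0)}"

lemma cycles1_simps:
 "clop Y L ==> carrier (cycles1 (GR Y)) = Zc Y"
 "f \<otimes>\<^bsub>cycles1 (GR Y)\<^esub> g = (%x. f x + g x)" "\<one>\<^bsub>cycles1 (GR Y)\<^esub> = (%x. 0)"
 by (auto simp: cycles1_def kernel_def Zc_def tree_base.carrier_Cc[OF tree_base_gtop] Cc_simps)

lemma Zc_zero: "(%x. 0) \<in> Zc Y"
 by (simp add: Zc_def gen_zero delta1_zero)

lemma Zc_add: "clop Y L ==> f \<in> Zc Y ==> g \<in> Zc Y ==> (%x. f x + g x) \<in> Zc Y"
 by (simp add: Zc_def gen_add delta1_add)

lemma Zc_neg: "clop Y L ==> f \<in> Zc Y ==> (%x. - f x) \<in> Zc Y"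
 by (simp add: Zc_def gen_neg delta1_neg)

lemma comm_group_cycles1: assumes Y: "clop Y L" shows "comm_group (cycles1 (GR Y))"
proof (rule comm_groupI)
 fix f assume "f \<in> carrier (cycles1 (GR Y))"
 then show "\<exists>g\<in>carrier (cycles1 (GR Y)). g \<otimes>\<^bsub>cycles1 (GR Y)\<^esub> f = \<one>\<^bsub>cycles1 (GR Y)\<^esub>"
  using Zc_neg[OF Y] by (intro bexI[of _ "%x. - f x"]) (simp_all add: cycles1_simps(1)[OF Y] cycles1_simps)
qed (auto simp: cycles1_simps(1)[OF Y] cycles1_simps Zc_add[OF Y] Zc_zero ac_simps)

lemma inv_cycles1:
 assumes Y: "clop Y L" and f: "f \<in> Zc Y" shows "inv\<^bsub>cycles1 (GR Y)\<^esub> f = (%x. - f x)"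
 by (rule group.inv_equality[OF comm_group.axioms(2)[OF comm_group_cycles1[OF Y]]])
  (use Zc_neg[OF Y f] f in \<open>simp_all add: cycles1_simps(1)[OF Y] cycles1_simps\<close>)

lemma Bd_subgroup: assumes Y: "clop Y L" shows "subgroup (Bd Y) (cycles1 (GR Y))"
proof -
 have sub: "Bd Y \<subseteq> Zc Y" using Bd_cycle[OF Y] by (auto simp: Zc_def)
 show ?thesis
 proof (rule group.subgroupI[OF comm_group.axioms(2)[OF comm_group_cycles1[OF Y]]])
  show "Bd Y \<subseteq> carrier (cycles1 (GR Y))" using sub by (simp add: cycles1_simps(1)[OF Y])
  show "Bd Y ~= {}" using Bd_zero[OF Y] by blast
  show "inv\<^bsub>cycles1 (GR Y)\<^esub> f \<in> Bd Y" if "f \<in> Bd Y" for f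
   using inv_cycles1[OF Y, of f] Bd_neg[OF Y that] that sub by auto
  show "f \<otimes>\<^bsub>cycles1 (GR Y)\<^esub> g \<in> Bd Y" if "f \<in> Bd Y" "g \<in> Bd Y" for f g
   using Bd_add[OF Y that] by (simp add: cycles1_simps)
 qed
qed

lemma Bd_normal: "clop Y L ==> Bd Y \<lhd> cycles1 (GR Y)"
 using comm_group.subgroup_imp_normal[OF comm_group_cycles1 Bd_subgroup] .

lemma comm_group_H1: "clop Y L ==> comm_group (H1 (GR Y))"
 unfolding H1_def using comm_group.abelian_FactGroup[OF comm_group_cycles1 Bd_subgroup] .

abbreviation "hcl Y \<equiv> (%f. Bd Y #>\<^bsub>cycles1 (GR Y)\<^esub> f)"

lemma hcl_hom: "clop Y L ==> hcl Y \<in> hom (cycles1 (GR Y)) (H1 (GR Y))"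
 unfolding H1_def using normal.r_coset_hom_Mod[OF Bd_normal] .

lemma hcl_add:
 "clop Y L ==> f \<in> Zc Y ==> g \<in> Zc Y ==> hcl Y (%x. f x + g x) = hcl Y f \<otimes>\<^bsub>H1 (GR Y)\<^esub> hcl Y g"
 using hom_mult[OF hcl_hom, of Y L f g] by (simp add: cycles1_simps)

lemma hcl_eq_iff:
 assumes Y: "clop Y L" and f: "f \<in> Zc Y" and g: "g \<in> Zc Y"
 shows "hcl Y f = hcl Y g \<longleftrightarrow> (%x. f x - g x) \<in> Bd Y"
proof -
 interpret Z: comm_group "cycles1 (GR Y)" by (rule comm_group_cycles1[OF Y])
 interpret N: normal "Bd Y" "cycles1 (GR Y)" by (rule Bd_normal[OF Y])
 have c: "f \<in> carrier (cycles1 (GR Y))" "g \<in> carrier (cycles1 (GR Y))" using f g by (simp_all add: cycles1_simps(1)[OF Y])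
 show ?thesis
 proof
  assume "hcl Y f = hcl Y g"
  then have "f \<in> hcl Y g" using Z.rcos_self[OF c(1) N.subgroup_axioms] by simp
  then obtain b where "b \<in> Bd Y" "f = (%x. b x + g x)" by (auto simp: r_coset_def cycles1_simps)
  then show "(%x. f x - g x) \<in> Bd Y" by simp
 next
  assume b: "(%x. f x - g x) \<in> Bd Y"
  have "f \<in> hcl Y g" unfolding r_coset_def
   using b by (auto simp: cycles1_simps intro!: bexI[of _ "%x. f x - g x"])
  then show "hcl Y f = hcl Y g" using Z.repr_independence[OF _ c(2) N.subgroup_axioms] by metis
 qed
qed

lemma hcl_one_iff:
 assumes Y: "clop Y L" and f: "f \<in> Zc Y" shows "hcl Y f = \<one>\<^bsub>H1 (GR Y)\<^esub> \<longleftrightarrow> f \<in> Bd Y"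
proof -
 have "hcl Y (%x. 0) = \<one>\<^bsub>H1 (GR Y)\<^esub>"
  using hom_one[OF hcl_hom[OF Y] comm_group.axioms(2)[OF comm_group_cycles1[OF Y]] comm_group.axioms(2)[OF comm_group_H1[OF Y]]]
  by (simp add: cycles1_simps)
 then show ?thesis using hcl_eq_iff[OF Y f Zc_zero] by simp
qed

lemma H1_surj: "clop Y L ==> c \<in> carrier (H1 (GR Y)) ==> \<exists>f\<in>Zc Y. c = hcl Y f"
 by (auto simp: H1_def carrier_FactGroup cycles1_simps(1))

end

section \<open>The homology group in degree zero\<close>

context tree_base
begin

lemma inv_Cc: assumes f: "f \<in> gen \<B>" shows "inv\<^bsub>Cc T\<^esub> f = (%x. - f x)"
 by (rule group.inv_equality[OF comm_group.axioms(2)[OF comm_group_Cc]])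
  (use gen_neg[OF f] f in \<open>simp_all add: carrier_Cc Cc_simps\<close>)

lemma subgroup_Cc:
 assumes "S \<subseteq> gen \<B>" "(%x. 0) \<in> S" "!!f g. f \<in> S ==> g \<in> S ==> (%x. f x + g x) \<in> S"
  "!!f. f \<in> S ==> (%x. - f x) \<in> S"
 shows "subgroup S (Cc T)"
proof (rule group.subgroupI[OF comm_group.axioms(2)[OF comm_group_Cc]])
 show "S \<subseteq> carrier (Cc T)" "S ~= {}" using assms(1,2) by (auto simp: carrier_Cc)
 show "inv\<^bsub>Cc T\<^esub> f \<in> S" if "f \<in> S" for f
  using assms(4)[OF that] inv_Cc[of f] assms(1) that by auto
 show "f \<otimes>\<^bsub>Cc T\<^esub> g \<in> S" if "f \<in> S" "g \<in> S" for f g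
  using assms(3)[OF that] by (simp add: Cc_simps)
qed

lemma coset_Cc_eq_iff:
 assumes S: "subgroup S (Cc T)" and f: "f \<in> gen \<B>" and g: "g \<in> gen \<B>"
 shows "S #>\<^bsub>Cc T\<^esub> f = S #>\<^bsub>Cc T\<^esub> g \<longleftrightarrow> (%x. f x - g x) \<in> S"
proof -
 interpret Z: comm_group "Cc T" by (rule comm_group_Cc)
 have c: "f \<in> carrier (Cc T)" "g \<in> carrier (Cc T)" using f g by (simp_all add: carrier_Cc)
 show ?thesis
 proof
  assume "S #>\<^bsub>Cc T\<^esub> f = S #>\<^bsub>Cc T\<^esub> g"
  then have "f \<in> S #>\<^bsub>Cc T\<^esub> g" using Z.rcos_self[OF c(1) S] by simp
  then obtain b where "b \<in> S" "f = (%x. b x + g x)" by (auto simp: r_coset_def Cc_simps)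
  then show "(%x. f x - g x) \<in> S" by simp
 next
  assume b: "(%x. f x - g x) \<in> S"
  have "f \<in> S #>\<^bsub>Cc T\<^esub> g" unfolding r_coset_def
   using b by (auto simp: Cc_simps intro!: bexI[of _ "%x. f x - g x"])
  then show "S #>\<^bsub>Cc T\<^esub> f = S #>\<^bsub>Cc T\<^esub> g" using Z.repr_independence[OF _ c(2) S] by metis
 qed
qed

end

context sft
begin

text \<open>Lets every result about reductions apply to the whole groupoid.\<close>

lemma GR_X: "GR X = GQ"
proof -
 have "topspace (gtop GQ) \<subseteq>
   {g. rngQ g \<in> sft_unit ` X & srcQ g \<in> sft_unit ` X}"
  by (auto simp: topspace_sft_groupoid)
 then show ?thesis unfolding reduction_def by (simp add: subtopology_superset)
qed

lemma Ub_children: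
 assumes s: "same v w"
 shows "(iU v w z :: int) = (\<Sum>f\<in>nx (last w). iU (v @ [f]) (w @ [f]) z)"
proof (cases "z \<in> Ub v w")
 case False
 then have "z \<notin> Ub (v @ [f]) (w @ [f])" for f using Ub_append[of v "[f]" w] by blast
 then show ?thesis using False by simp
next
 case True
 obtain x n y where z: "z = (x, n, y)" by (cases z)
 obtain p where p: "length p = 1" "same (v @ p) (w @ p)" "(x, n, y) \<in> Ub (v @ p) (w @ p)"
  using Ub_extend[OF s, of x n y 1] True z by metis
 obtain f where f: "p = [f]" using p(1) by (cases p) auto
 have w: "w \<in> words" using s by (simp add: same_def)
 have fn: "f \<in> nx (last w)" using p(2) words_snoc[OF w] by (simp add: f same_def)
 have "z \<in> Ub (v @ [f']) (w @ [f']) \<longleftrightarrow> f' = f" if "f' \<in> nx (last w)" for f'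
 proof
  assume a: "z \<in> Ub (v @ [f']) (w @ [f'])"
  have "w @ [f'] \<in> words" using words_snoc[OF w] that by simp
  then have s': "same (v @ [f']) (w @ [f'])" using same_append[OF s] by blast
  have "y \<in> cyl (w @ [f'])" "y \<in> cyl (w @ [f])"
   using in_Ub[OF s'] in_Ub[OF p(2)] p(3) a z f by auto
  then show "f' = f" using cyl_pfx[of y "w @ [f']"] cyl_pfx[of y "w @ [f]"] by simp
 qed (use p(3) z f in simp)
 then have "(\<Sum>f\<in>nx (last w). (iU (v @ [f]) (w @ [f]) z :: int)) = (\<Sum>f'\<in>nx (last w). if f' = f then 1 else 0)"
  by (intro sum.cong) (simp_all add: indicator_def)
 then show ?thesis using True fn by (simp add: sum.delta)
qed

text \<open>A weighted sum of the values of \<open>f\<close> at sample points, one for each word of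
  length \<open>L\<close>. On unit chains with harmonic weights it is eventually constant in
  \<open>L\<close>, and the eventual value is a homomorphism that vanishes on boundaries.\<close>

definition levsum :: "('e => bit) => nat => ('e sft_arrow => int) => bit" where
 "levsum \<chi> L f = (\<Sum>w | w \<in> words & length w = L. of_int (f (sft_unit (pt w))) * \<chi> (last w))"

lemma words_Suc:
 assumes "L \<ge> 1"
 shows "{w \<in> words. length w = Suc L} = (\<Union>w\<in>{w \<in> words. length w = L}. children w)"
proof
 show "{w \<in> words. length w = Suc L} \<subseteq> (\<Union>w\<in>{w \<in> words. length w = L}. children w)"
 proof
  fix u assume u: "u \<in> {w \<in> words. length w = Suc L}"
  then obtain w f where wf: "u = w @ [f]" "length w = L" by (cases u rule: rev_cases) auto
  have "w ~= []" using wf(2) assms by auto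
  then have w: "w \<in> words" using words_appendD[of w "[f]"] u wf by auto
  then have "f \<in> nx (last w)" using words_snoc[OF w] u wf by simp
  then show "u \<in> (\<Union>w\<in>{w \<in> words. length w = L}. children w)"
   using w wf by (auto simp: children_def)
 qed
 show "(\<Union>w\<in>{w \<in> words. length w = L}. children w) \<subseteq> {w \<in> words. length w = Suc L}"
  using children_words by (auto simp: children_def)
qed

lemma sum_words_Suc:
 assumes "L \<ge> 1"
 shows "(\<Sum>w | w \<in> words & length w = Suc L. g w) =
  (\<Sum>w | w \<in> words & length w = L. \<Sum>f\<in>nx (last w). g (w @ [f]))"
 unfolding words_Suc[OF assms]
 by (subst sum.UNION_disjoint[OF finite_words_length]) (auto simp: sum_children, auto simp: children_def)

lemma pt_indicator:
 assumes "w \<in> words" "v \<in> words" "length w \<le> length v"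
 shows "(iU w w (sft_unit (pt v)) :: int) = (if prefix w v then 1 else 0)"
proof -
 have "sft_unit (pt v) \<in> Ub w w \<longleftrightarrow> pt v \<in> cyl w" by (auto simp: Ub_unit)
 also have "\<dots> \<longleftrightarrow> prefix w v"
  using cyl_meet[of "pt v" w v] pt_in[OF assms(2)] assms(3) cyl_prefix[of w v] by blast
 finally show ?thesis by (simp add: indicator_def)
qed

lemma levsum_add: "levsum \<chi> L (%x. f x + g x) = levsum \<chi> L f + levsum \<chi> L g"
 unfolding levsum_def by (simp only: of_int_add distrib_right sum.distrib)

lemma levsum_diff: "levsum \<chi> L (%x. f x - g x) = levsum \<chi> L f + levsum \<chi> L g"
proof -
 have "a - b = a + b" for a b :: bit by (cases a; cases b) simp_all
 then show ?thesis unfolding levsum_def by (simp only: of_int_diff distrib_right sum.distrib)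
qed

lemma levsum_zero: "levsum \<chi> L (%x. 0) = 0"
 unfolding levsum_def by (rule sum.neutral) simp

text \<open>At the length of \<open>w\<close> only \<open>w\<close> contributes. Passing to the next
  length replaces each weight by the sum over successors, which harmonicity leaves
  unchanged.\<close>

lemma levsum_Ub:
 assumes h: "harmonic \<chi>" and w: "w \<in> words" and L: "length w \<le> L"
 shows "levsum \<chi> L (iU w w) = \<chi> (last w)"
 using L
proof (induction L rule: dec_induct)
 case base
 have "levsum \<chi> (length w) (iU w w) =
   (\<Sum>v | v \<in> words & length v = length w. if v = w then \<chi> (last v) else 0)"
  unfolding levsum_def
 proof (rule sum.cong[OF refl])
  fix v assume v: "v \<in> {v. v \<in> words & length v = length w}"
  then have "prefix w v \<longleftrightarrow> v = w" by (auto simp: prefix_def)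
  then show "of_int (iU w w (sft_unit (pt v))) * \<chi> (last v) = (if v = w then \<chi> (last v) else 0)"
   using pt_indicator[OF w, of v] v by (cases "v = w") simp_all
 qed
 also have "\<dots> = \<chi> (last w)" using w by (subst sum.delta[OF finite_words_length]) simp
 finally show ?case .
next
 case (step n)
 have n: "n \<ge> 1" using step(1) w by (cases w) auto
 have "levsum \<chi> (Suc n) (iU w w) = (\<Sum>v | v \<in> words & length v = n. \<Sum>f\<in>nx (last v).
   of_int (iU w w (sft_unit (pt (v @ [f])))) * \<chi> (last (v @ [f])))"
  unfolding levsum_def by (rule sum_words_Suc[OF n])
 also have "\<dots> = (\<Sum>v | v \<in> words & length v = n. of_int (iU w w (sft_unit (pt v))) * \<chi> (last v))"
 proof (rule sum.cong[OF refl])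
  fix v assume v: "v \<in> {v. v \<in> words & length v = n}"
  then have vw: "v \<in> words" by blast
  have "(\<Sum>f\<in>nx (last v). of_int (iU w w (sft_unit (pt (v @ [f])))) * \<chi> (last (v @ [f]))) =
    (\<Sum>f\<in>nx (last v). of_int (iU w w (sft_unit (pt v))) * \<chi> f)"
  proof (rule sum.cong[OF refl])
   fix f assume f: "f \<in> nx (last v)"
   then have vf: "v @ [f] \<in> words" using words_snoc[OF vw] by simp
   have "prefix w (v @ [f]) \<longleftrightarrow> prefix w v" using v step(1) by auto
   then have "(iU w w (sft_unit (pt (v @ [f]))) :: int) = iU w w (sft_unit (pt v))"
    using pt_indicator[OF w vf] pt_indicator[OF w vw] v step(1) by simp
   then show "of_int (iU w w (sft_unit (pt (v @ [f])))) * \<chi> (last (v @ [f])) =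
     of_int (iU w w (sft_unit (pt v))) * \<chi> f" by (simp only: last_snoc)
  qed
  also have "\<dots> = of_int (iU w w (sft_unit (pt v))) * \<chi> (last v)"
   using h last_in_arcs[OF vw] unfolding harmonic_def by (simp only: sum_distrib_left)
  finally show "(\<Sum>f\<in>nx (last v). of_int (iU w w (sft_unit (pt (v @ [f])))) * \<chi> (last (v @ [f]))) =
    of_int (iU w w (sft_unit (pt v))) * \<chi> (last v)" .
 qed
 finally show ?case using step.IH by (simp only: levsum_def)
qed

definition qlim :: "('e => bit) => ('e sft_arrow => int) => bit" where
 "qlim \<chi> f = (THE c. \<exists>N. \<forall>L\<ge>N. levsum \<chi> L f = c)"

lemma qlim_eq: assumes "!!L. L \<ge> N ==> levsum \<chi> L f = c" shows "qlim \<chi> f = c"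
 unfolding qlim_def
proof (rule the_equality)
 fix d assume "\<exists>N. \<forall>L\<ge>N. levsum \<chi> L f = d"
 then obtain M where "\<forall>L\<ge>M. levsum \<chi> L f = d" by blast
 then show "d = c" using assms[of "max M N"] by simp
qed (use assms in blast)

lemma qlim_Ub: "harmonic \<chi> ==> w \<in> words ==> qlim \<chi> (iU w w) = \<chi> (last w)"
 using levsum_Ub by (intro qlim_eq) auto

lemma qlim_zero: "qlim \<chi> (%x. 0) = 0"
 using levsum_zero by (intro qlim_eq) auto

lemma levsum_eventually:
 assumes h: "harmonic \<chi>" and f: "f \<in> gen (B0 Y)"
 shows "\<exists>N. \<forall>L\<ge>N. levsum \<chi> L f = qlim \<chi> f"
proof -
 have "\<exists>N c. \<forall>L\<ge>N. levsum \<chi> L f = c" using f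
 proof (induction rule: gen_induct)
  case zero
  then show ?case using levsum_zero by (intro exI[of _ 0]) simp
 next
  case (ind B)
  then obtain w where w: "w \<in> words" "B = Ub w w" by (auto simp: B0_def)
  have "\<forall>L\<ge>length w. levsum \<chi> L (indicator B) = \<chi> (last w)" using levsum_Ub[OF h w(1)] w(2) by blast
  then show ?case by (intro exI)
 next
  case (diff f g)
  then obtain N c M d where "\<forall>L\<ge>N. levsum \<chi> L f = c" "\<forall>L\<ge>M. levsum \<chi> L g = d" by (elim exE)
  then have "\<forall>L\<ge>max N M. levsum \<chi> L (%x. f x - g x) = c + d" by (simp add: levsum_diff)
  then show ?case by (intro exI)
 qed
 then obtain N c where N: "\<forall>L\<ge>N. levsum \<chi> L f = c" by blast
 then have "qlim \<chi> f = c" by (intro qlim_eq[of N]) simp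
 then show ?thesis using N by blast
qed

lemma qlim_add:
 assumes h: "harmonic \<chi>" and f: "f \<in> gen (B0 Y)" and g: "g \<in> gen (B0 Y)"
 shows "qlim \<chi> (%x. f x + g x) = qlim \<chi> f + qlim \<chi> g"
  and "qlim \<chi> (%x. f x - g x) = qlim \<chi> f + qlim \<chi> g"
proof -
 obtain N where "\<forall>L\<ge>N. levsum \<chi> L f = qlim \<chi> f" using levsum_eventually[OF h f] by (elim exE)
 moreover obtain M where "\<forall>L\<ge>M. levsum \<chi> L g = qlim \<chi> g" using levsum_eventually[OF h g] by (elim exE)
 ultimately show "qlim \<chi> (%x. f x + g x) = qlim \<chi> f + qlim \<chi> g" "qlim \<chi> (%x. f x - g x) = qlim \<chi> f + qlim \<chi> g"
  by (intro qlim_eq[of "max N M"]; simp add: levsum_add levsum_diff)+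
qed

end

context sft_basis
begin

definition Qm :: "('e sft_arrow => int) => ('e \<Rightarrow>\<^sub>0 bit) => bit" where
 "Qm f = (%b. if b \<in> BB then qlim (chr b) f else 0)"

lemma Qm_Ub: "w \<in> words ==> Qm (iU w w) = coord (bvec (last w))"
 by (auto simp: Qm_def coord_def qlim_Ub harmonic_chr chr_def)

lemma Qm_zero: "Qm (%x. 0) = \<one>\<^bsub>EE\<^esub>"
 by (auto simp: Qm_def qlim_zero)

lemma Qm_add:
 assumes "f \<in> gen (B0 Y)" "g \<in> gen (B0 Y)"
 shows "Qm (%x. f x + g x) = Qm f \<otimes>\<^bsub>EE\<^esub> Qm g" "Qm (%x. f x - g x) = Qm f \<otimes>\<^bsub>EE\<^esub> Qm g"
 using qlim_add[OF harmonic_chr assms] unfolding Qm_def EE_simps by (simp_all only: fun_eq_iff) simp_all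

lemma EE_square: "g \<otimes>\<^bsub>EE\<^esub> g = \<one>\<^bsub>EE\<^esub>"
proof -
 have "x + x = 0" for x :: bit by (cases x) simp_all
 then show ?thesis by (simp only: EE_simps)
qed

section \<open>Unit chains modulo boundaries and doubles\<close>

abbreviation "A0 \<equiv> Cc (unit_top (GR X))"

lemma carrier_A0: "carrier A0 = gen (B0 X)"
 by (rule tree_base.carrier_Cc[OF tree_base_unit[OF clop_X]])

definition d_img :: "('e sft_arrow => int) set" where
 "d_img = delta1 (GR X) ` gen (BU X)"

text \<open>Dividing by boundaries and doubles at once gives the zeroth homology group modulo
  two.\<close>

definition d2_img :: "('e sft_arrow => int) set" where
 "d2_img = {%x. d x + (h x + h x) | d h. d \<in> d_img & h \<in> gen (B0 X)}"

lemma d_img_ops: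
 "(%x. 0) \<in> d_img" "d \<in> d_img ==> d' \<in> d_img ==> (%x. d x + d' x) \<in> d_img"
 "d \<in> d_img ==> (%x. - d x) \<in> d_img" "d_img \<subseteq> gen (B0 X)"
proof -
 show "(%x. 0) \<in> d_img" unfolding d_img_def
  by (rule image_eqI[of _ _ "%x. 0"]) (simp_all add: delta1_zero gen.gen_zero)
 show "d_img \<subseteq> gen (B0 X)" unfolding d_img_def using delta1_gen[OF clop_X] by blast
 {
  assume "d \<in> d_img"
  then obtain f where f: "f \<in> gen (BU X)" "d = delta1 (GR X) f" unfolding d_img_def by (elim imageE)
  show "(%x. - d x) \<in> d_img" unfolding d_img_def
   by (rule image_eqI[OF _ gen_neg[OF f(1)]]) (simp add: delta1_neg[OF clop_X f(1)] f(2))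
  assume "d' \<in> d_img"
  then obtain g where g: "g \<in> gen (BU X)" "d' = delta1 (GR X) g" unfolding d_img_def by (elim imageE)
  show "(%x. d x + d' x) \<in> d_img" unfolding d_img_def
   by (rule image_eqI[OF _ gen_add[OF f(1) g(1)]]) (simp add: delta1_add[OF clop_X f(1) g(1)] f(2) g(2))
 }
qed

lemma subgroup_d_img: "subgroup d_img A0"
 by (rule tree_base.subgroup_Cc[OF tree_base_unit[OF clop_X]]) (fact d_img_ops)+

lemma d2_imgI: "d \<in> d_img ==> h \<in> gen (B0 X) ==> (%x. d x + (h x + h x)) \<in> d2_img"
 unfolding d2_img_def by blast

lemma d2_imgE:
 assumes "f \<in> d2_img" obtains d h where "d \<in> d_img" "h \<in> gen (B0 X)" "f = (%x. d x + (h x + h x))"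
 using assms unfolding d2_img_def by blast

lemma subgroup_d2_img: "subgroup d2_img A0"
proof (rule tree_base.subgroup_Cc[OF tree_base_unit[OF clop_X]])
 show "d2_img \<subseteq> gen (B0 X)"
 proof
  fix f assume "f \<in> d2_img"
  then obtain d h where dh: "d \<in> d_img" "h \<in> gen (B0 X)" "f = (%x. d x + (h x + h x))" by (rule d2_imgE)
  have "d \<in> gen (B0 X)" using dh(1) d_img_ops(4) by (rule rev_subsetD)
  then show "f \<in> gen (B0 X)" unfolding dh(3) using dh(2) by (intro gen_add)
 qed
 show "(%x. 0) \<in> d2_img" using d2_imgI[OF d_img_ops(1) gen.gen_zero] by simp
 fix f assume "f \<in> d2_img"
 then obtain d h where f: "d \<in> d_img" "h \<in> gen (B0 X)" "f = (%x. d x + (h x + h x))" by (rule d2_imgE)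
 show "(%x. - f x) \<in> d2_img"
  using d2_imgI[OF d_img_ops(3)[OF f(1)] gen_neg[OF f(2)]] unfolding f(3) by (simp add: algebra_simps)
 fix g assume "g \<in> d2_img"
 then obtain d' h' where g: "d' \<in> d_img" "h' \<in> gen (B0 X)" "g = (%x. d' x + (h' x + h' x))" by (rule d2_imgE)
 show "(%x. f x + g x) \<in> d2_img"
  using d2_imgI[OF d_img_ops(2)[OF f(1) g(1)] gen_add[OF f(2) g(2)]] unfolding f(3) g(3)
  by (simp add: algebra_simps)
qed

lemma ind_equivalent:
 assumes "same v w" shows "(%x. iU w w x - iU v v x) \<in> d_img"
 unfolding d_img_def
 by (rule image_eqI[OF _ ind_Ub_gen[OF assms cyl_subset_X cyl_subset_X]])
  (simp add: delta1_Ub[OF clop_X assms cyl_subset_X cyl_subset_X])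

abbreviation "Kd \<equiv> A0 Mod d2_img"
abbreviation "kcl \<equiv> (%f. d2_img #>\<^bsub>A0\<^esub> f)"

lemma comm_group_A0: "comm_group A0"
 by (rule tree_base.comm_group_Cc[OF tree_base_unit[OF clop_X]])

lemma normal_d2: "d2_img \<lhd> A0"
 using comm_group.subgroup_imp_normal[OF comm_group_A0 subgroup_d2_img] .

lemma comm_group_Kd: "comm_group Kd"
 using comm_group.abelian_FactGroup[OF comm_group_A0 subgroup_d2_img] .

lemma kcl_hom: "kcl \<in> hom A0 Kd"
 using normal.r_coset_hom_Mod[OF normal_d2] .

lemma kcl_add:
 "f \<in> gen (B0 X) ==> g \<in> gen (B0 X) ==> kcl (%x. f x + g x) = kcl f \<otimes>\<^bsub>Kd\<^esub> kcl g"
 using hom_mult[OF kcl_hom, of f g] by (simp add: carrier_A0 Cc_simps del: mult_FactGroup)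

lemma kcl_closed: "f \<in> gen (B0 X) ==> kcl f \<in> carrier Kd"
 using hom_in_carrier[OF kcl_hom, of f] by (simp add: carrier_A0)

lemma kcl_eq_iff:
 "f \<in> gen (B0 X) ==> g \<in> gen (B0 X) ==> kcl f = kcl g \<longleftrightarrow> (%x. f x - g x) \<in> d2_img"
 using tree_base.coset_Cc_eq_iff[OF tree_base_unit[OF clop_X] subgroup_d2_img] .

lemma kcl_zero: "kcl (%x. 0) = \<one>\<^bsub>Kd\<^esub>"
 using hom_one[OF kcl_hom comm_group.axioms(2)[OF comm_group_A0] comm_group.axioms(2)[OF comm_group_Kd]]
 by (simp add: Cc_simps del: one_FactGroup)

lemma ind_B0: "w \<in> words ==> iU w w \<in> gen (B0 X)"
 by (rule ind_unit_gen) (simp_all add: cyl_subset_X)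

lemma kcl_Ub: assumes "same v w" shows "kcl (iU v v) = kcl (iU w w)"
proof -
 have "(%x. iU v v x - iU w w x) \<in> d_img"
  using ind_equivalent[OF same_sym[OF assms]] .
 from d2_imgI[OF this gen.gen_zero] show ?thesis
  using assms by (subst kcl_eq_iff) (auto simp: same_def intro!: ind_B0)
qed

definition kc :: "'e => ('e sft_arrow => int) set" where
 "kc e = kcl (iU [e] [e])"

text \<open>The set \<open>Ub\<close> between two words with the same last arc has the difference of
  their cylinders as its boundary, so the class depends only on the type.\<close>

lemma kcl_word: "w \<in> words ==> kcl (iU w w) = kc (last w)"
 unfolding kc_def by (rule kcl_Ub) (auto simp: same_def intro: single_word last_in_arcs)

lemma kcl_sum:
 "finite I ==> (!!i. i \<in> I ==> f i \<in> gen (B0 X)) ==>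
  kcl (%x. \<Sum>i\<in>I. f i x) = finprod Kd (%i. kcl (f i)) I"
proof (induction I rule: finite_induct)
 case empty
 interpret K: comm_group Kd by (rule comm_group_Kd)
 show ?case using kcl_zero by (simp del: one_FactGroup)
next
 case (insert i I)
 interpret K: comm_group Kd by (rule comm_group_Kd)
 have "kcl (%x. f i x + (\<Sum>i\<in>I. f i x)) = kcl (f i) \<otimes>\<^bsub>Kd\<^esub> kcl (%x. \<Sum>i\<in>I. f i x)"
  using insert by (intro kcl_add gen_sum) auto
 then show ?case using insert by (simp add: K.finprod_insert kcl_closed Pi_def del: mult_FactGroup)
qed

lemma kc_facts:
 assumes e: "e \<in> arcs Q"
 shows "kc e \<in> carrier Kd" "kc e \<otimes>\<^bsub>Kd\<^esub> kc e = \<one>\<^bsub>Kd\<^esub>" "kc e = finprod Kd kc (nx e)"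
proof -
 let ?i = "iU [e] [e] :: 'e sft_arrow => int"
 have i: "?i \<in> gen (B0 X)" using single_word[OF e] by (rule ind_B0)
 show "kc e \<in> carrier Kd" unfolding kc_def by (rule kcl_closed[OF i])
 have "(%x. (?i x + ?i x) - 0) \<in> d2_img" using d2_imgI[OF d_img_ops(1) i] by simp
 then have "kcl (%x. ?i x + ?i x) = kcl (%x. 0)"
  using kcl_eq_iff[OF gen_add[OF i i] gen.gen_zero] by blast
 then show "kc e \<otimes>\<^bsub>Kd\<^esub> kc e = \<one>\<^bsub>Kd\<^esub>" unfolding kc_def using kcl_add[OF i i] kcl_zero by simp
 have w: "[e, f] \<in> words" if "f \<in> nx e" for f using words_snoc[OF single_word[OF e], of f] that by simp
 have "?i = (%x. \<Sum>f\<in>nx e. iU [e, f] [e, f] x)"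
  using Ub_children[OF same_refl[OF single_word[OF e]]] by (simp add: fun_eq_iff)
 then have "kc e = finprod Kd (%f. kcl (iU [e, f] [e, f])) (nx e)"
  unfolding kc_def using kcl_sum[of "nx e" "%f. iU [e, f] [e, f]"] w ind_B0 by simp
 also have "\<dots> = finprod Kd kc (nx e)"
 proof -
  interpret K: comm_group Kd by (rule comm_group_Kd)
  have k: "kcl (iU [e, f] [e, f]) = kc f" if "f \<in> nx e" for f using kcl_word[OF w[OF that]] by simp
  have "kc f \<in> carrier Kd" if "f \<in> nx e" for f
   unfolding kc_def using single_word[OF nx_arcs[OF that]] ind_B0 kcl_closed by blast
  then show ?thesis by (intro K.finprod_cong') (auto simp: k)
 qed
 finally show "kc e = finprod Kd kc (nx e)" .
qed

definition Ck :: "('e \<Rightarrow>\<^sub>0 bit) => ('e sft_arrow => int) set" where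
 "Ck x = finprod Kd (%e. if Poly_Mapping.lookup x e = 1 then kc e else \<one>\<^bsub>Kd\<^esub>) (arcs Q)"

lemma Ck_facts:
 "Ck x \<in> carrier Kd" "Ck (x + y) = Ck x \<otimes>\<^bsub>Kd\<^esub> Ck y" "Ck 0 = \<one>\<^bsub>Kd\<^esub>"
 "e \<in> arcs Q ==> Ck (bvec e) = kc e" "coord x = \<one>\<^bsub>EE\<^esub> ==> Ck x = \<one>\<^bsub>Kd\<^esub>"
 unfolding Ck_def using kernel_coord_trivial[OF comm_group_Kd kc_facts] by blast+

text \<open>As for transpositions, one vector determines both the class of a chain modulo boundaries
  and doubles and its coordinates.\<close>

lemma gen_B0_coord:
 assumes "f \<in> gen (B0 X)" shows "\<exists>x. kcl f = Ck x & Qm f = coord x"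
 using assms
proof (induction rule: gen_induct)
 case zero
 show ?case using kcl_zero Ck_facts(3) Qm_zero coord_zero by (intro exI[of _ 0]) simp
next
 case (ind B)
 then obtain w where w: "w \<in> words" "B = Ub w w" by (auto simp: B0_def)
 have "kcl (indicator B) = Ck (bvec (last w))"
  unfolding w(2) kcl_word[OF w(1)] Ck_facts(4)[OF last_in_arcs[OF w(1)]] ..
 then show ?case using Qm_Ub[OF w(1)] w(2) by blast
next
 case (diff f g)
 then obtain x y where x: "kcl f = Ck x" "Qm f = coord x" "kcl g = Ck y" "Qm g = coord y" by blast
 have "(%z. (f z - g z) - (f z + g z)) \<in> d2_img" using d2_imgI[OF d_img_ops(1) gen_neg[OF diff.hyps(2)]] by simp
 then have "kcl (%z. f z - g z) = kcl (%z. f z + g z)"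
  using kcl_eq_iff[OF gen_diff[OF diff.hyps] gen_add[OF diff.hyps]] by simp
 also have "\<dots> = Ck (x + y)" unfolding kcl_add[OF diff.hyps] x Ck_facts(2) ..
 finally have "kcl (%z. f z - g z) = Ck (x + y)" .
 moreover have "Qm (%z. f z - g z) = coord (x + y)" unfolding Qm_add(2)[OF diff.hyps] x coord_add ..
 ultimately show ?case by blast
qed

lemma Qm_hom: "Qm \<in> hom A0 EE"
proof (rule homI)
 fix f g assume fg: "f \<in> carrier A0" "g \<in> carrier A0"
 then show "Qm f \<in> carrier EE" using gen_B0_coord[of f] coord_EE by (auto simp: carrier_A0)
 show "Qm (f \<otimes>\<^bsub>A0\<^esub> g) = Qm f \<otimes>\<^bsub>EE\<^esub> Qm g"
  using Qm_add(1) fg unfolding carrier_A0 Cc_simps by blast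
qed

lemma Qm_kernel: assumes f: "f \<in> gen (B0 X)" and q: "Qm f = \<one>\<^bsub>EE\<^esub>" shows "f \<in> d2_img"
proof -
 obtain x where x: "kcl f = Ck x" "Qm f = coord x" using gen_B0_coord[OF f] by blast
 then have "kcl f = kcl (%x. 0)" using q Ck_facts(5)[of x] kcl_zero by simp
 then show ?thesis using kcl_eq_iff[OF f gen.gen_zero] by simp
qed

lemma Qm_d_img: assumes "d \<in> d_img" shows "Qm d = \<one>\<^bsub>EE\<^esub>"
proof -
 have "Qm (delta1 (GR X) f) = \<one>\<^bsub>EE\<^esub>" if "f \<in> gen (BU X)" for f using that
 proof (induction rule: gen_induct)
  case zero
  show ?case unfolding delta1_zero by (rule Qm_zero)
 next
  case (ind B)
  then obtain v w where v: "same v w" "cyl v \<subseteq> X" "cyl w \<subseteq> X" "B = Ub v w" by (auto simp: BU_def)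
  have vw: "v \<in> words" "w \<in> words" "last v = last w" using v by (auto simp: same_def)
  show ?case unfolding v(4) delta1_Ub[OF clop_X v(1-3)]
    Qm_add(2)[OF ind_B0[OF vw(2)] ind_B0[OF vw(1)]] Qm_Ub[OF vw(1)] Qm_Ub[OF vw(2)] vw(3)
   by (rule EE_square)
 next
  case (diff f g)
  show ?case unfolding delta1_diff[OF clop_X diff.hyps]
    Qm_add(2)[OF delta1_gen[OF clop_X diff.hyps(1)] delta1_gen[OF clop_X diff.hyps(2)]] diff.IH
   by (rule EE_square)
 qed
 then show ?thesis using assms unfolding d_img_def by (elim imageE) simp
qed

lemma Qm_surj: assumes "g \<in> carrier EE" shows "\<exists>f\<in>gen (B0 X). Qm f = g"
proof -
 have "\<exists>f\<in>gen (B0 X). Qm f = coord x" for x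
 proof (induction x rule: bitvec_induct)
  case zero
  show ?case by (rule bexI[OF _ gen.gen_zero]) (simp only: Qm_zero coord_zero)
 next
  case (add e x)
  then obtain f where f: "f \<in> gen (B0 X)" "Qm f = coord x" by blast
  show ?case
  proof (cases "e \<in> arcs Q")
   case True
   note i = ind_B0[OF single_word[OF True]]
   show ?thesis
    by (rule bexI[OF _ gen_add[OF i f(1)]])
     (simp only: Qm_add(1)[OF i f(1)] f(2) Qm_Ub[OF single_word[OF True]] coord_add last.simps if_True refl)
  next
   case False
   have "coord (bvec e) = \<one>\<^bsub>EE\<^esub>" using chi_out[OF _ False] by (auto simp: coord_def)
   interpret E: comm_group EE by (rule comm_group_EE)
   have "coord (bvec e + x) = coord x"
    unfolding coord_add \<open>coord (bvec e) = \<one>\<^bsub>EE\<^esub>\<close> by (rule E.l_one[OF coord_EE])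
   then show ?thesis using f by metis
  qed
 qed
 then show ?thesis using coord_surj[OF assms] by metis
qed

text \<open>\<open>Qm\<close> vanishes on boundaries and hence descends. Its kernel consists of sums
  of a boundary and a double, so a class in the kernel is a square in multiplicative
  notation.\<close>

lemma H0_EE:
 obtains q where "q \<in> hom (H0 GQ) EE" "q ` carrier (H0 GQ) = carrier EE"
  "!!a. a \<in> carrier (H0 GQ) ==> q a = \<one>\<^bsub>EE\<^esub> ==>
   \<exists>b\<in>carrier (H0 GQ). a = b \<otimes>\<^bsub>H0 GQ\<^esub> b"
  "comm_group (H0 GQ)"
proof -
 have "H0 (GR X) = A0 Mod d_img"
  unfolding H0_def d_img_def tree_base.carrier_Cc[OF tree_base_gtop[OF clop_X]] ..
 then have H: "H0 GQ = A0 Mod d_img" unfolding GR_X .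
 have N: "d_img \<lhd> A0" using comm_group.subgroup_imp_normal[OF comm_group_A0 subgroup_d_img] .
 note eq = tree_base.coset_Cc_eq_iff[OF tree_base_unit[OF clop_X] subgroup_d_img]
 have "Qm f = Qm g" if "f \<in> carrier A0" "g \<in> carrier A0" "d_img #>\<^bsub>A0\<^esub> f = d_img #>\<^bsub>A0\<^esub> g" for f g
 proof -
  have fg: "f \<in> gen (B0 X)" "g \<in> gen (B0 X)" using that by (simp_all add: carrier_A0)
  have d: "(%x. f x - g x) \<in> d_img" using eq[OF fg] that by blast
  have e: "f = (%x. g x + (f x - g x))" by simp
  interpret E: comm_group EE by (rule comm_group_EE)
  have "Qm f = Qm g \<otimes>\<^bsub>EE\<^esub> Qm (%x. f x - g x)"
   by (subst e) (rule Qm_add(1)[OF fg(2) gen_diff[OF fg]])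
  also have "\<dots> = Qm g" unfolding Qm_d_img[OF d]
   by (rule E.r_one[OF hom_in_carrier[OF Qm_hom that(2)]])
  finally show ?thesis .
 qed
 then obtain q where q: "q \<in> hom (A0 Mod d_img) EE" "!!f. f \<in> carrier A0 ==> q (d_img #>\<^bsub>A0\<^esub> f) = Qm f"
  using FactGroup_universal[OF Qm_hom N] by metis
 have c: "carrier (A0 Mod d_img) = (%f. d_img #>\<^bsub>A0\<^esub> f) ` gen (B0 X)"
  unfolding carrier_FactGroup carrier_A0 ..
 have cg: "comm_group (A0 Mod d_img)" using comm_group.abelian_FactGroup[OF comm_group_A0 subgroup_d_img] .
 show ?thesis
 proof (rule that[of q])
  show "q \<in> hom (H0 GQ) EE" unfolding H by (rule q(1))
  show "comm_group (H0 GQ)" unfolding H by (rule cg)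
  have "q ` carrier (A0 Mod d_img) = Qm ` gen (B0 X)"
   unfolding c image_image by (rule image_cong[OF refl]) (simp add: q(2) carrier_A0)
  also have "\<dots> = carrier EE"
  proof
   show "Qm ` gen (B0 X) \<subseteq> carrier EE" using hom_in_carrier[OF Qm_hom] unfolding carrier_A0 by blast
   show "carrier EE \<subseteq> Qm ` gen (B0 X)" using Qm_surj by blast
  qed
  finally show "q ` carrier (H0 GQ) = carrier EE" unfolding H .
  fix a assume a: "a \<in> carrier (H0 GQ)" "q a = \<one>\<^bsub>EE\<^esub>"
  then obtain f where f: "f \<in> gen (B0 X)" "a = d_img #>\<^bsub>A0\<^esub> f" unfolding H c by (elim imageE)
  have "Qm f = \<one>\<^bsub>EE\<^esub>" using q(2)[of f] f a(2) by (simp only: carrier_A0)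
  then have "f \<in> d2_img" using Qm_kernel[OF f(1)] by blast
  then obtain d h where dh: "d \<in> d_img" "h \<in> gen (B0 X)" "f = (%x. d x + (h x + h x))" by (rule d2_imgE)
  have hh: "(%x. h x + h x) \<in> gen (B0 X)" using gen_add[OF dh(2) dh(2)] .
  have "a = d_img #>\<^bsub>A0\<^esub> (%x. h x + h x)"
   unfolding f(2) eq[OF f(1) hh] using dh(1) unfolding dh(3) by simp
  also have "\<dots> = (d_img #>\<^bsub>A0\<^esub> h) \<otimes>\<^bsub>A0 Mod d_img\<^esub> (d_img #>\<^bsub>A0\<^esub> h)"
   using hom_mult[OF normal.r_coset_hom_Mod[OF N], of h h] dh(2) by (simp add: carrier_A0 Cc_simps del: mult_FactGroup)
  finally show "\<exists>b\<in>carrier (H0 GQ). a = b \<otimes>\<^bsub>H0 GQ\<^esub> b"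
   unfolding H c using dh(2) by blast
 qed
qed

lemma tensor_H0: "EE \<cong> tensor_group (H0 GQ) (integer_mod_group 2)"
proof (rule H0_EE)
 fix q assume q: "q \<in> hom (H0 GQ) EE" "q ` carrier (H0 GQ) = carrier EE"
  "!!a. a \<in> carrier (H0 GQ) ==> q a = \<one>\<^bsub>EE\<^esub> ==>
   \<exists>b\<in>carrier (H0 GQ). a = b \<otimes>\<^bsub>H0 GQ\<^esub> b"
  "comm_group (H0 GQ)"
 show ?thesis by (rule tensor_mod_two[OF q(4) comm_group_EE q(1,2) EE_square q(3)])
qed

lemma two_divisible_H0: "two_divisible (H0 GQ) \<longleftrightarrow> carrier EE = {\<one>\<^bsub>EE\<^esub>}"
proof (rule H0_EE)
 let ?H = "H0 GQ"
 fix q assume q: "q \<in> hom ?H EE" "q ` carrier ?H = carrier EE"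
  "!!a. a \<in> carrier ?H ==> q a = \<one>\<^bsub>EE\<^esub> ==> \<exists>b\<in>carrier ?H. a = b \<otimes>\<^bsub>?H\<^esub> b" "comm_group ?H"
 interpret H: comm_group ?H by (rule q(4))
 have sq: "b [^]\<^bsub>?H\<^esub> (2::nat) = b \<otimes>\<^bsub>?H\<^esub> b" if "b \<in> carrier ?H" for b
  using that by (simp add: numeral_2_eq_2)
 interpret E: comm_group EE by (rule comm_group_EE)
 show ?thesis
 proof
  assume "two_divisible ?H"
  then have s: "(%a. a \<otimes>\<^bsub>?H\<^esub> a) ` carrier ?H = carrier ?H"
   unfolding two_divisible_def by (simp only: sq cong: image_cong)
  have "g = \<one>\<^bsub>EE\<^esub>" if g: "g \<in> carrier EE" for g
  proof -
   obtain a where a: "a \<in> carrier ?H" "g = q a" using g q(2) by (metis imageE)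
   have "a \<in> (%a. a \<otimes>\<^bsub>?H\<^esub> a) ` carrier ?H" unfolding s by (rule a(1))
   then obtain b where b: "a = b \<otimes>\<^bsub>?H\<^esub> b" "b \<in> carrier ?H" by (rule imageE)
   show ?thesis unfolding a(2) b(1) hom_mult[OF q(1) b(2) b(2)] by (rule EE_square)
  qed
  then show "carrier EE = {\<one>\<^bsub>EE\<^esub>}" using E.one_closed by blast
 next
  assume E1: "carrier EE = {\<one>\<^bsub>EE\<^esub>}"
  have "carrier ?H \<subseteq> (%a. a [^]\<^bsub>?H\<^esub> (2::nat)) ` carrier ?H"
  proof
   fix a assume a: "a \<in> carrier ?H"
   have "q a = \<one>\<^bsub>EE\<^esub>" using hom_in_carrier[OF q(1) a] E1 by blast
   then obtain b where b: "b \<in> carrier ?H" "a = b \<otimes>\<^bsub>?H\<^esub> b" using q(3)[OF a] by blast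
   show "a \<in> (%a. a [^]\<^bsub>?H\<^esub> (2::nat)) ` carrier ?H"
    by (rule image_eqI[OF _ b(1)]) (simp only: sq[OF b(1)] b(2))
  qed
  then show "two_divisible ?H" unfolding two_divisible_def using H.nat_pow_closed by blast
 qed
qed

end

section \<open>The index map\<close>

lemma bij_betw_fibres:
 assumes "finite A" "finite B" "!!w. card {x \<in> A. f x = w} = card {x \<in> B. g x = w}"
 shows "\<exists>\<theta>. bij_betw \<theta> A B & (\<forall>x\<in>A. g (\<theta> x) = f x)"
proof -
 have "\<exists>h. bij_betw h {x \<in> A. f x = w} {x \<in> B. g x = w}" for w
  using assms finite_same_card_bij[of "{x \<in> A. f x = w}" "{x \<in> B. g x = w}"] by simp
 then obtain h where h: "!!w. bij_betw (h w) {x \<in> A. f x = w} {x \<in> B. g x = w}" by metis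
 let ?t = "%x. h (f x) x"
 have m: "?t x \<in> B" "g (?t x) = f x" if "x \<in> A" for x
  using bij_betwE[OF h[of "f x"]] that by auto
 have "inj_on ?t A"
 proof (rule inj_onI)
  fix x y assume xy: "x \<in> A" "y \<in> A" "?t x = ?t y"
  then have "f x = f y" using m(2)[of x] m(2)[of y] by simp
  then show "x = y" using xy bij_betw_imp_inj_on[OF h[of "f x"]] by (auto simp: inj_on_def)
 qed
 moreover have "?t ` A = B"
 proof
  show "B \<subseteq> ?t ` A"
  proof
   fix y assume y: "y \<in> B"
   have "y \<in> h (g y) ` {x \<in> A. f x = g y}" using bij_betw_imp_surj_on[OF h[of "g y"]] y by simp
   then obtain x where x: "x \<in> A" "f x = g y" "y = h (g y) x" by blast
   show "y \<in> ?t ` A" by (rule image_eqI[OF _ x(1)]) (use x(2,3) in simp)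
  qed
 qed (use m(1) in blast)
 ultimately show ?thesis using m(2) by (intro exI[of _ ?t]) (simp add: bij_betw_def)
qed

context sft
begin

lemma periodic_unique:
 fixes y y' :: "nat => 'e" and n d i :: nat
 assumes "!!i. i < n + d ==> y i = y' i" "!!i. y (n + d + i) = y (n + i)" "!!i. y' (n + d + i) = y' (n + i)" "d > 0"
 shows "y i = y' i"
proof (induction i rule: less_induct)
 case (less i)
 show ?case
 proof (cases "i < n + d")
  case False
  then have "i = n + d + (i - n - d)" "n + (i - n - d) < i" using assms(4) by auto
  then show ?thesis using assms(2,3)[of "i - n - d"] less by metis
 qed (rule assms(1))
qed

text \<open>If \<open>v\<close> were longer than \<open>u\<close> by \<open>d\<close>, every point
  of \<open>cyl w\<close> would be periodic with period \<open>d\<close> after \<open>w\<close>, and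
  its first period would be dictated by \<open>v\<close>. Then \<open>cyl w\<close> would be a
  single point, but it splits. This is essential principality in terms of words.\<close>

lemma rp_length_eq:
 assumes w: "w \<in> words" and eq: "!!x. x \<in> cyl w ==> rp w u x = rp w v x" shows "length v \<le> length u"
proof (rule ccontr)
 assume "\<not> length v \<le> length u"
 then obtain d where d: "length v = length u + d" "d > 0" using less_imp_add_positive by (metis not_le)
 have nth: "rp w u x (length u + i) = x (length w + i)" "rp w v x (length v + i) = x (length w + i)" for x i
  by (simp_all add: rp_def add.commute)
 have per: "x (length w + d + i) = x (length w + i)" if "x \<in> cyl w" for x i
  using nth(1)[of x "d + i"] nth(2)[of x i] eq[OF that] d(1) by (simp add: add.assoc)
 have ini: "x i = x' i" if xx: "x \<in> cyl w" "x' \<in> cyl w" "i < length w + d" for x x' i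
 proof (cases "i < length w")
  case True
  then show ?thesis using cyl_nth[OF xx(1)] cyl_nth[OF xx(2)] by simp
 next
  case False
  then have i: "i = length w + (i - length w)" "length u + (i - length w) < length v" using xx(3) d by auto
  have "y i = v ! (length u + (i - length w))" if "y \<in> cyl w" for y
  proof -
   have "y i = rp w u y (length u + (i - length w))" using nth(1)[of y "i - length w"] i(1) by simp
   also have "\<dots> = v ! (length u + (i - length w))" unfolding eq[OF that] using i(2) by (simp add: rp_def)
   finally show ?thesis .
  qed
  from this[OF xx(1)] this[OF xx(2)] show ?thesis by simp
 qed
 obtain u1 u2 where uu: "u1 \<in> words" "u2 \<in> words" "prefix w u1" "prefix w u2" "cyl u1 \<inter> cyl u2 = {}"
  using split_word[OF w last_in_arcs[OF w]] by metis
 have p: "pt u1 \<in> cyl w" "pt u2 \<in> cyl w" using uu pt_in cyl_prefix by blast+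
 have "pt u1 = pt u2"
  by (rule ext, rule periodic_unique[of "length w" d]) (use ini p per d(2) in auto)
 then show False using pt_in[OF uu(1)] pt_in[OF uu(2)] uu(5) by auto
qed

text \<open>The degree of \<open>a\<close> at \<open>x\<close>: the middle entry of the arrow that
  realizes \<open>a\<close> there. By \<open>dg_eq\<close> it does not depend on the chosen row of a
  table.\<close>

definition dg :: "((nat => 'e) => nat => 'e) => (nat => 'e) => int => bool" where
 "dg a x n \<longleftrightarrow> (\<exists>w v. tb a w v & x \<in> cyl w & n = int (length v) - int (length w))"

lemma dg_unique1:
 assumes "tb a w v" "x \<in> cyl w" "tb a w' v'" "x \<in> cyl w'" "length w \<le> length w'"
 shows "int (length v') - int (length w') = int (length v) - int (length w)"
proof -
 obtain p where p: "w' = w @ p" using cyl_meet[OF assms(2,4,5)] by (auto simp: prefix_def)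
 have w': "w' \<in> words" using tbD(1)[OF assms(3)] .
 have t: "tb a w' (v @ p)" using tb_append[OF assms(1)] w' p by simp
 have "rp w' (v @ p) y = rp w' v' y" if "y \<in> cyl w'" for y
  using tbD(4)[OF t that] tbD(4)[OF assms(3) that] by simp
 then have "length v' \<le> length (v @ p)" "length (v @ p) \<le> length v'"
  using rp_length_eq[OF w', of "v @ p" v'] rp_length_eq[OF w', of v' "v @ p"] by metis+
 then show ?thesis using p by simp
qed

lemma dg_eq: assumes "tb a w v" "x \<in> cyl w" shows "dg a x n \<longleftrightarrow> n = int (length v) - int (length w)"
proof
 assume "dg a x n"
 then obtain w' v' where w': "tb a w' v'" "x \<in> cyl w'" "n = int (length v') - int (length w')"
  by (auto simp: dg_def)
 show "n = int (length v) - int (length w)"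
  using dg_unique1[OF assms w'(1,2)] dg_unique1[OF w'(1,2) assms] w'(3) by (cases "length w \<le> length w'") auto
qed (use assms in \<open>auto simp: dg_def\<close>)

text \<open>The graph of \<open>a\<close> over \<open>Y\<close> lifted to the groupoid. For
  \<open>a\<close> in \<open>Gam Y\<close> it is later shown to be the only compact open
  \<open>G\<close>-set that represents \<open>a\<close>.\<close>

definition Us :: "(nat => 'e) set => ((nat => 'e) => nat => 'e) => 'e sft_arrow set" where
 "Us Y a = {(a x, n, x) | x n. x \<in> Y & dg a x n}"

lemma tb_same: "tb a w v ==> same v w"
 using tbD(1-3) by (auto simp: same_def)

lemma Us_Ub: assumes t: "tb a w v" and x: "x \<in> cyl w" "x \<in> Y"
 shows "(x', n, x) \<in> Us Y a \<longleftrightarrow> (x', n, x) \<in> Ub v w"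
proof -
 have "(x', n, x) \<in> Us Y a \<longleftrightarrow> x' = a x & n = int (length v) - int (length w)"
  using dg_eq[OF t x(1)] x(2) by (auto simp: Us_def)
 also have "\<dots> \<longleftrightarrow> (x', n, x) \<in> Ub v w" using tbD(4)[OF t x(1)] x(1) by (auto simp: Ub_def)
 finally show ?thesis .
qed

lemma Us_indicator:
 assumes P: "part P Y" and t: "!!w. w \<in> P ==> tb a w (\<phi> w)"
 shows "(indicator (Us Y a) z :: int) = (\<Sum>w\<in>P. iU (\<phi> w) w z)"
proof -
 obtain x' n x where z: "z = (x', n, x)" by (cases z)
 have no: "x \<in> cyl w" if "z \<in> Ub (\<phi> w) w" for w using that z by (auto simp: Ub_def)
 show ?thesis
 proof (cases "x \<in> Y")
  case False
  then have "z \<notin> Ub (\<phi> w) w" if "w \<in> P" for w using no partD(5)[OF P that] by blast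
  moreover have "z \<notin> Us Y a" using False z by (auto simp: Us_def)
  ultimately show ?thesis by simp
 next
  case True
  then obtain w where w: "w \<in> P" "x \<in> cyl w" using part_point[OF P] by blast
  have "z \<notin> Ub (\<phi> v) v" if "v \<in> P" "v ~= w" for v using no[of v] pdisD[OF partD(3)[OF P] that(1) w(1) _ w(2)] that(2) by blast
  then have "(\<Sum>v\<in>P. (iU (\<phi> v) v z :: int)) = (\<Sum>v\<in>P. if v = w then iU (\<phi> w) w z else 0)"
   by (intro sum.cong) auto
  also have "\<dots> = iU (\<phi> w) w z" using w(1) partD(1)[OF P] by (simp add: sum.delta)
  also have "\<dots> = indicator (Us Y a) z" using Us_Ub[OF t[OF w(1)] w(2) True] z by (simp add: indicator_def)
  finally show ?thesis by simp
 qed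
qed

lemma Bd_sum:
 assumes Y: "clop Y L" and "!!i. i \<in> I ==> f i \<in> Bd Y" shows "(%x. \<Sum>i\<in>I. f i x) \<in> Bd Y"
 using assms(2)
proof (induction I rule: infinite_finite_induct)
 case (insert i I)
 then have "(%x. f i x + (\<Sum>i\<in>I. f i x)) \<in> Bd Y" by (intro Bd_add[OF Y]) auto
 then show ?case using insert by simp
qed (simp_all add: Bd_zero[OF Y])

lemma Bd_unit: assumes Y: "clop Y L" and w: "w \<in> words" "cyl w \<subseteq> Y" shows "iU w w \<in> Bd Y"
 using Bd_Ub[OF Y same_refl[OF w(1)] same_refl[OF w(1)] w(2,2,2)] by simp

lemma Bd_inverse:
 assumes Y: "clop Y L" and s: "same v w" "cyl v \<subseteq> Y" "cyl w \<subseteq> Y"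
 shows "(%z. iU v w z + iU w v z) \<in> Bd Y"
proof -
 have w: "w \<in> words" using s by (simp add: same_def)
 show ?thesis
  using Bd_add[OF Y Bd_Ub[OF Y same_sym[OF s(1)] s(1) s(3,2,3)] Bd_unit[OF Y w s(3)]] by (simp add: algebra_simps)
qed

lemma Bd_subset: assumes Y: "clop Y L" and YY: "clop Y' L'" "Y \<subseteq> Y'" and f: "f \<in> Bd Y" shows "f \<in> Bd Y'"
 using Y f
proof (induction rule: Bd_induct)
 case (triple u v w)
 then have "cyl u \<subseteq> Y'" "cyl v \<subseteq> Y'" "cyl w \<subseteq> Y'" using YY(2) by auto
 then show ?case using triple by (intro Bd_Ub[OF YY(1)])
qed (rule Bd_zero[OF YY(1)], rule Bd_diff[OF YY(1)])

lemma delta1_sum: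
 assumes Y: "clop Y L" and "finite I" "!!i. i \<in> I ==> f i \<in> gen (BU Y)"
 shows "delta1 (GR Y) (%x. \<Sum>i\<in>I. f i x) = (%z. \<Sum>i\<in>I. delta1 (GR Y) (f i) z)"
 using assms(2,3)
proof (induction I rule: finite_induct)
 case empty
 show ?case by (simp add: delta1_zero)
next
 case (insert i I)
 have "delta1 (GR Y) (%x. f i x + (\<Sum>i\<in>I. f i x)) = (%z. delta1 (GR Y) (f i) z + delta1 (GR Y) (%x. \<Sum>i\<in>I. f i x) z)"
  using insert by (intro delta1_add[OF Y] gen_sum) auto
 then show ?case using insert by simp
qed

lemma Gam_table:
 assumes Y: "clop Y L" and a: "a \<in> Gam Y"
 shows "\<exists>P \<phi>. part P Y & (\<forall>w\<in>P. tb a w (\<phi> w) & N \<le> length (\<phi> w))"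
proof -
 obtain M where M: "\<forall>x\<in>X. \<forall>n\<ge>M. \<exists>v. N \<le> length v & tb a (pfx x n) v" using Gam_level[OF a, of N] by blast
 let ?P = "(%x. pfx x (max L M)) ` Y"
 have "\<forall>w\<in>?P. \<exists>v. tb a w v & N \<le> length v"
 proof
  fix w assume "w \<in> ?P"
  then obtain x where x: "x \<in> X" "w = pfx x (max L M)" using clop_X_level(1)[OF Y] by blast
  show "\<exists>v. tb a w v & N \<le> length v" using M[rule_format, OF x(1), of "max L M"] x(2) by auto
 qed
 then obtain \<phi> where "\<forall>w\<in>?P. tb a w (\<phi> w) & N \<le> length (\<phi> w)" by metis
 moreover have "part ?P Y" using part_level[OF clop_mono[OF Y, of "max L M"]] by simp
 ultimately show ?thesis by blast
qed

lemma part_indicator: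
 assumes P: "part P Y" shows "(\<Sum>w\<in>P. iU w w z) = indicator (Us Y id) z"
proof -
 have t: "tb id w w" if "w \<in> P" for w using tb_id partD(2)[OF P] that by blast
 show ?thesis by (rule Us_indicator[of P Y id "%w. w" z, OF P t, symmetric])
qed

text \<open>Sources and ranges of the pieces form two partitions of \<open>Y\<close>, so their
  indicator functions have the same sum.\<close>

lemma Us_Zc:
 assumes Y: "clop Y L" and a: "a \<in> Gam Y" shows "indicator (Us Y a) \<in> Zc Y"
proof -
 obtain P \<phi> where P: "part P Y" "\<forall>w\<in>P. tb a w (\<phi> w)" using Gam_table[OF Y a, of 0] by blast
 have t: "tb a w (\<phi> w)" if "w \<in> P" for w using P(2) that by blast
 have e: "indicator (Us Y a) = (%z. \<Sum>w\<in>P. (iU (\<phi> w) w z :: int))"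
  using Us_indicator[OF P(1) t] by (simp add: fun_eq_iff)
 have s: "same (\<phi> w) w" "cyl w \<subseteq> Y" "cyl (\<phi> w) \<subseteq> Y" if "w \<in> P" for w
  using tb_same[OF t[OF that]] partD(5)[OF P(1) that] tb_Gam_in[OF a t[OF that]] by blast+
 have g: "iU (\<phi> w) w \<in> gen (BU Y)" if "w \<in> P" for w using s[OF that] by (intro ind_Ub_gen)
 have im: "part (\<phi> ` P) Y" "inj_on \<phi> P" using part_image[OF a P(1) t] by blast+
 have "delta1 (GR Y) (indicator (Us Y a)) = (%z. \<Sum>w\<in>P. iU w w z - iU (\<phi> w) (\<phi> w) z)"
  unfolding e
 proof (subst delta1_sum[OF Y partD(1)[OF P(1)]])
  show "iU (\<phi> w) w \<in> gen (BU Y)" if "w \<in> P" for w using g[OF that] .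
  show "(%z. \<Sum>w\<in>P. delta1 (GR Y) (iU (\<phi> w) w) z) =
    (%z. \<Sum>w\<in>P. iU w w z - iU (\<phi> w) (\<phi> w) z)"
   by (intro ext sum.cong refl) (use delta1_Ub[OF Y] s in simp)
 qed
 also have "\<dots> = (%z. (\<Sum>w\<in>P. iU w w z) - (\<Sum>w\<in>\<phi> ` P. iU w w z))"
  by (simp add: sum_subtractf sum.reindex[OF im(2)])
 also have "\<dots> = (%z. 0)" unfolding part_indicator[OF P(1)] part_indicator[OF im(1)] by simp
 finally show ?thesis unfolding Zc_def using gen_sum[of P "%w. iU (\<phi> w) w"] g e by simp
qed

text \<open>On a table fine enough for \<open>a\<close> followed by \<open>b\<close>, every row
  gives one of the triple relations of \<open>Bd_Ub\<close>.\<close>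

lemma Us_comp:
 assumes Y: "clop Y L" and a: "a \<in> Gam Y" and b: "b \<in> Gam Y"
 shows "(%z. indicator (Us Y (b \<circ> a)) z - indicator (Us Y b) z - indicator (Us Y a) z) \<in> Bd Y"
proof -
 obtain L1 where L1: "\<forall>x\<in>X. \<forall>n\<ge>L1. \<exists>v. 0 \<le> length v & tb b (pfx x n) v"
  using Gam_level[OF b, of 0] by blast
 obtain P \<phi> where P: "part P Y" "\<forall>w\<in>P. tb a w (\<phi> w) & L1 \<le> length (\<phi> w)" using Gam_table[OF Y a, of L1] by blast
 have t: "tb a w (\<phi> w)" if "w \<in> P" for w using P(2) that by blast
 have "\<exists>v. tb b (\<phi> w) v" if w: "w \<in> P" for w
 proof -
  have "\<phi> w \<in> words" using t[OF w] tbD(2) by blast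
  then have p: "pt (\<phi> w) \<in> X" "pfx (pt (\<phi> w)) (length (\<phi> w)) = \<phi> w" using pt_in cyl_X cyl_pfx by blast+
  have "L1 \<le> length (\<phi> w)" using P(2) w by blast
  from L1[rule_format, OF p(1) this] show ?thesis unfolding p(2) by blast
 qed
 then obtain \<psi> where u: "!!w. w \<in> P ==> tb b (\<phi> w) (\<psi> w)" by metis
 have c: "tb (b \<circ> a) w (\<psi> w)" if "w \<in> P" for w using tb_comp[OF t[OF that] u[OF that]] .
 have im: "part (\<phi> ` P) Y" "inj_on \<phi> P" using part_image[OF a P(1) t] by blast+
 have u': "tb b v (\<psi> (inv_into P \<phi> v))" if "v \<in> \<phi> ` P" for v
  using u[of "inv_into P \<phi> v"] that inv_into_into[OF that] f_inv_into_f[OF that] by simp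
 have b': "indicator (Us Y b) z = (\<Sum>w\<in>P. (iU (\<psi> w) (\<phi> w) z :: int))" for z
 proof -
  have "(indicator (Us Y b) z :: int) = (\<Sum>v\<in>\<phi> ` P. iU (\<psi> (inv_into P \<phi> v)) v z)"
   by (rule Us_indicator[OF im(1) u'])
  then show ?thesis by (simp add: sum.reindex[OF im(2)] inv_into_f_f[OF im(2)])
 qed
 have a': "indicator (Us Y a) z = (\<Sum>w\<in>P. (iU (\<phi> w) w z :: int))" for z
  by (rule Us_indicator[OF P(1) t])
 have c': "indicator (Us Y (b \<circ> a)) z = (\<Sum>w\<in>P. (iU (\<psi> w) w z :: int))" for z
  by (rule Us_indicator[OF P(1) c])
 have e: "(%z. (indicator (Us Y (b \<circ> a)) z :: int) - indicator (Us Y b) z - indicator (Us Y a) z) =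
   (%z. - (\<Sum>w\<in>P. iU (\<phi> w) w z - iU (\<psi> w) w z + iU (\<psi> w) (\<phi> w) z))"
  unfolding a' b' c' by (rule ext) (simp add: sum.distrib sum_subtractf)
 show ?thesis unfolding e
 proof (intro Bd_neg[OF Y] Bd_sum[OF Y] Bd_Ub[OF Y])
  fix w assume w: "w \<in> P"
  show "same (\<psi> w) (\<phi> w)" "same (\<phi> w) w" using tb_same t u w by blast+
  show "cyl w \<subseteq> Y" using partD(5)[OF P(1) w] .
  then show "cyl (\<phi> w) \<subseteq> Y" using tb_Gam_in[OF a t[OF w]] by blast
  then show "cyl (\<psi> w) \<subseteq> Y" using tb_Gam_in[OF b u[OF w]] by blast
 qed
qed

text \<open>Outside \<open>K\<close> the element is the identity, and indicator functions of unit
  cylinders are boundaries.\<close>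

lemma Us_extend:
 assumes Y: "clop Y L" and K: "clop K L'" "K \<subseteq> Y" and a: "a \<in> Gam K"
 shows "(%z. indicator (Us Y a) z - indicator (Us K a) z) \<in> Bd Y"
proof -
 have c: "clop (Y - K) (max L L')"
  using clop_diff[OF clop_mono[OF Y, of "max L L'"] clop_mono[OF K(1), of "max L L'"]] by simp
 obtain P where P: "part P (Y - K)" using part_level[OF c] by blast
 have t: "tb a w w" if w: "w \<in> P" for w
 proof (rule tb_fix)
  show "w \<in> words" using partD(2)[OF P] w by blast
  show "a x = x" if "x \<in> cyl w" for x using GamD(2)[OF a] partD(5)[OF P w] that by blast
 qed
 have "(indicator (Us Y a) z :: int) - indicator (Us K a) z = indicator (Us (Y - K) a) z" for z
  using K(2) by (auto simp: Us_def indicator_def)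
 then have e: "(%z. (indicator (Us Y a) z :: int) - indicator (Us K a) z) = (%z. \<Sum>w\<in>P. iU w w z)"
  using Us_indicator[OF P, of a "%w. w"] t by simp
 show ?thesis unfolding e using partD(2)[OF P] partD(5)[OF P] by (intro Bd_sum[OF Y] Bd_unit[OF Y]) blast+
qed

text \<open>A prefix replacement and its inverse cancel in homology.\<close>

lemma Us_tr:
 assumes Y: "clop Y L" and s: "swappable w v" "cyl w \<subseteq> Y" "cyl v \<subseteq> Y"
 shows "indicator (Us Y (tr w v)) \<in> Bd Y"
proof -
 let ?K = "cyl w \<union> cyl v"
 have wv: "w \<in> words" "v \<in> words" "last w = last v" "cyl w \<inter> cyl v = {}" using s by (auto simp: swappable_def)
 have sm: "same v w" using wv by (simp add: same_def)
 have K: "clop ?K (max (length w) (length v))"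
  by (intro clop_Un clop_mono[OF clop_cyl[OF wv(1)]] clop_mono[OF clop_cyl[OF wv(2)]]) auto
 have ne: "w ~= v" using wv cyl_nonempty[OF wv(1)] by auto
 have P: "part {w, v} ?K" using wv by (auto simp: part_def pdis_def)
 have e: "indicator (Us ?K (tr w v)) = (%z. (iU v w z + iU w v z :: int))"
 proof
  fix z
  have t: "tb (tr w v) u (if u = w then v else w)" if "u \<in> {w, v}" for u using that tb_tr[OF s(1)] by auto
  show "(indicator (Us ?K (tr w v)) z :: int) = iU v w z + iU w v z"
   using Us_indicator[of "{w, v}" ?K "tr w v" "%u. if u = w then v else w" z, OF P t] ne by simp
 qed
 then have 1: "indicator (Us ?K (tr w v)) \<in> Bd Y" using Bd_inverse[OF Y sm s(3,2)] by (simp only: e)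
 have "(%z. indicator (Us Y (tr w v)) z - indicator (Us ?K (tr w v)) z) \<in> Bd Y"
  using s(2,3) by (intro Us_extend[OF Y K _ tr_Gam[OF s(1)]]) blast
 from Bd_add[OF Y this 1] show ?thesis by simp
qed

lemma Us_id: "clop Y L ==> indicator (Us Y id) \<in> Bd Y"
proof -
 assume Y: "clop Y L"
 note P = part_level[OF Y]
 show ?thesis unfolding part_indicator[OF P, symmetric, abs_def]
  using partD(2)[OF P] partD(5)[OF P] by (intro Bd_sum[OF Y] Bd_unit[OF Y]) blast+
qed

lemma Us_comp_Bd:
 assumes Y: "clop Y L" and a: "a \<in> Gam Y" "indicator (Us Y a) \<in> Bd Y" and b: "b \<in> Gam Y"
  and Z: "clop Z L'" "Y \<subseteq> Z"
 shows "indicator (Us Y (a \<circ> b)) \<in> Bd Z \<longleftrightarrow> indicator (Us Y b) \<in> Bd Z"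
proof -
 let ?d = "%z. (indicator (Us Y (a \<circ> b)) z - indicator (Us Y a) z - indicator (Us Y b) z :: int)"
 have 1: "?d \<in> Bd Z" using Bd_subset[OF Y Z Us_comp[OF Y b a(1)]] .
 have 2: "indicator (Us Y a) \<in> Bd Z" using Bd_subset[OF Y Z a(2)] .
 have 3: "(%z. ?d z + indicator (Us Y a) z) \<in> Bd Z" using Bd_add[OF Z(1) 1 2] .
 show ?thesis
 proof
  assume "indicator (Us Y b) \<in> Bd Z"
  from Bd_add[OF Z(1) 3 this] show "indicator (Us Y (a \<circ> b)) \<in> Bd Z" by simp
 next
  assume "indicator (Us Y (a \<circ> b)) \<in> Bd Z"
  from Bd_diff[OF Z(1) this 3] show "indicator (Us Y b) \<in> Bd Z" by simp
 qed
qed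

lemma Us_TT: assumes Y: "clop Y L" and a: "a \<in> TT Y" shows "indicator (Us Y a) \<in> Bd Y"
 using a
proof (induction rule: TT.induct)
 case TT_id
 show ?case using Us_id[OF Y] .
next
 case (TT_tr a w v)
 have "tr w v \<in> Gam Y" using tr_in_Gam[OF TT_tr.hyps(2-4)] .
 from Us_comp_Bd[OF Y this Us_tr[OF Y TT_tr.hyps(2-4)] TT_Gam[OF TT_tr.hyps(1)] Y] TT_tr.IH show ?case by blast
qed

lemma TN_Gam: assumes "a \<in> TN Y" shows "a \<in> TT Y"
proof -
 obtain u v b c where b: "b \<in> TT (Y - cyl u)" "c \<in> TT (Y - cyl v)" "a = b \<circ> c" using assms by (auto simp: TN_def)
 have "b \<in> TT Y" "c \<in> TT Y" using b TT_mono[of "Y - cyl u" Y] TT_mono[of "Y - cyl v" Y] by blast+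
 then show ?thesis unfolding b(3) by (rule TT_comp)
qed

section \<open>Surjectivity of the index\<close>

definition exts :: "'e list => nat => 'e list set" where
 "exts w m = {p. w @ p \<in> words & length p = m}"

lemma ext_0: "w \<in> words ==> exts w 0 = {[]}"
 by (auto simp: exts_def)

lemma finite_ext: "finite (exts w m)"
proof -
 have "(%p. w @ p) ` exts w m \<subseteq> {v \<in> words. length v = length w + m}" by (auto simp: exts_def)
 then have "finite ((%p. w @ p) ` exts w m)" by (rule finite_subset) (rule finite_words_length)
 then show ?thesis by (rule finite_imageD) (simp add: inj_on_def)
qed

lemma ext_same: assumes "same v w" shows "exts v m = exts w m"
 using words_append_last(1)[of v w] assms by (auto simp: exts_def same_def)

lemma ext_same_append: "same v w ==> p \<in> exts w m ==> same (v @ p) (w @ p)"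
 by (rule same_append) (auto simp: exts_def)

lemma ext_Suc:
 assumes w: "w \<in> words"
 shows "exts w (Suc m) = (\<Union>p\<in>exts w m. (%f. p @ [f]) ` nx (last (w @ p)))"
proof
 show "exts w (Suc m) \<subseteq> (\<Union>p\<in>exts w m. (%f. p @ [f]) ` nx (last (w @ p)))"
 proof
  fix q assume q: "q \<in> exts w (Suc m)"
  then obtain p f where pf: "q = p @ [f]" "length p = m" by (cases q rule: rev_cases) (auto simp: exts_def)
  have W: "(w @ p) @ [f] \<in> words" using q pf by (simp add: exts_def)
  have "w ~= []" using w by auto
  then have wp: "w @ p \<in> words" using words_appendD[OF W] by simp
  then show "q \<in> (\<Union>p\<in>exts w m. (%f. p @ [f]) ` nx (last (w @ p)))"
   using words_snoc[OF wp, of f] W pf by (auto simp: exts_def)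
 qed
 show "(\<Union>p\<in>exts w m. (%f. p @ [f]) ` nx (last (w @ p))) \<subseteq> exts w (Suc m)"
 proof
  fix q assume "q \<in> (\<Union>p\<in>exts w m. (%f. p @ [f]) ` nx (last (w @ p)))"
  then obtain p f where pf: "p \<in> exts w m" "f \<in> nx (last (w @ p))" "q = p @ [f]" by blast
  then have wp: "w @ p \<in> words" "length p = m" by (auto simp: exts_def)
  show "q \<in> exts w (Suc m)" using words_snoc[OF wp(1), of f] pf wp by (simp add: exts_def)
 qed
qed

lemma sum_ext_Suc:
 assumes "w \<in> words"
 shows "(\<Sum>p\<in>exts w (Suc m). g p) = (\<Sum>p\<in>exts w m. \<Sum>f\<in>nx (last (w @ p)). g (p @ [f]))"
 unfolding ext_Suc[OF assms]
 by (subst sum.UNION_disjoint[OF finite_ext]) (auto simp: sum.reindex inj_on_def exts_def)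

lemma Ub_ext:
 assumes s: "same v w"
 shows "(iU v w z :: int) = (\<Sum>p\<in>exts w m. iU (v @ p) (w @ p) z)"
proof (induction m)
 case 0
 have "w \<in> words" using s by (simp add: same_def)
 then show ?case by (simp add: ext_0)
next
 case (Suc m)
 have w: "w \<in> words" using s by (simp add: same_def)
 have "(\<Sum>p\<in>exts w m. (iU (v @ p) (w @ p) z :: int)) =
   (\<Sum>p\<in>exts w m. \<Sum>f\<in>nx (last (w @ p)). iU (v @ p @ [f]) (w @ p @ [f]) z)"
  by (rule sum.cong[OF refl]) (use Ub_children[OF ext_same_append[OF s]] in simp)
 then show ?case using Suc by (simp add: sum_ext_Suc[OF w])
qed

lemma part_clop: assumes P: "part P S" shows "\<exists>L. clop S L"
proof -
 define L where "L = Suc (Max (length ` P))"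
 have "clop S L"
 proof (rule clopI)
  show "S \<subseteq> X" using partD(6)[OF P] .
  show "1 \<le> L" by (simp add: L_def)
  fix x y assume x: "x \<in> S" and y: "y \<in> cyl (pfx x L)"
  obtain w where w: "w \<in> P" "x \<in> cyl w" using part_point[OF P x] by blast
  have "length w \<le> Max (length ` P)" using partD(1)[OF P] w(1) by (intro Max_ge) auto
  then have "length w \<le> L" by (simp add: L_def)
  then have "prefix w (pfx x L)" using prefix_pfx[of "length w" L x] cyl_pfx[OF w(2)] by simp
  then have "y \<in> cyl w" using cyl_prefix y by blast
  then show "y \<in> S" using partD(5)[OF P w(1)] by blast
 qed
 then show ?thesis by blast
qed

lemma table_Gam:
 assumes P: "part P S" and P': "part P' S" and \<beta>: "bij_betw \<beta> P P'"
  and l: "!!w. w \<in> P ==> last (\<beta> w) = last w"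
 shows "\<exists>a\<in>Gam S. \<forall>w\<in>P. tb a w (\<beta> w)"
proof -
 define wo where "wo x = (THE w. w \<in> P & x \<in> cyl w)" for x
 have wo: "wo x = w" if "w \<in> P" "x \<in> cyl w" for x w
  unfolding wo_def using that pdisD[OF partD(3)[OF P]] by (intro the_equality) blast+
 define a where "a x = (if x \<in> S then rp (wo x) (\<beta> (wo x)) x else x)" for x
 have bP: "\<beta> w \<in> P'" if "w \<in> P" for w using bij_betwE[OF \<beta>] that by blast
 have ww: "w \<in> words" "\<beta> w \<in> words" if "w \<in> P" for w using partD(2)[OF P] partD(2)[OF P'] bP that by blast+
 have aS: "a x = rp w (\<beta> w) x" if "w \<in> P" "x \<in> cyl w" for x w
  using partD(5)[OF P that(1)] that wo[OF that] by (auto simp: a_def)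
 have t: "tb a w (\<beta> w)" if "w \<in> P" for w using ww[OF that] l[OF that] aS[OF that] by (simp add: tb_def)
 have aC: "a x \<in> cyl (\<beta> w)" if "w \<in> P" "x \<in> cyl w" for x w using tb_in_cyl[OF t[OF that(1)] that(2)] .
 have SS: "a x \<in> S \<longleftrightarrow> x \<in> S" for x
 proof (cases "x \<in> S")
  case True
  then obtain w where "w \<in> P" "x \<in> cyl w" using part_point[OF P] by blast
  then show ?thesis using aC partD(5)[OF P' bP] True by blast
 qed (simp add: a_def)
 have "inj a"
 proof (rule injI)
  fix x y assume e: "a x = a y"
  show "x = y"
  proof (cases "x \<in> S")
   case False
   then have "y \<notin> S" using SS[of x] SS[of y] e by simp
   then show ?thesis using e False by (simp add: a_def)
  next
   case True
   then have "y \<in> S" using SS[of x] SS[of y] e by simp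
   then obtain w v where w: "w \<in> P" "x \<in> cyl w" "v \<in> P" "y \<in> cyl v" using True part_point[OF P] by meson
   have "\<beta> w = \<beta> v" using pdisD[OF partD(3)[OF P'] bP[OF w(1)] bP[OF w(3)] aC[OF w(1,2)]] aC[OF w(3,4)] e by simp
   then have "w = v" using bij_betw_imp_inj_on[OF \<beta>] w(1,3) by (meson inj_onD)
   then show ?thesis using aS[OF w(1,2)] aS[OF w(3,4)] e w rp_inj[of w "\<beta> w"] by (auto simp: inj_on_def)
  qed
 qed
 moreover have "surj a"
 proof -
  have "\<exists>x. a x = y" for y
  proof (cases "y \<in> S")
   case True
   then obtain w' where w': "w' \<in> P'" "y \<in> cyl w'" using part_point[OF P'] by blast
   then obtain w where w: "w \<in> P" "w' = \<beta> w" using bij_betw_imp_surj_on[OF \<beta>] by blast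
   have "y \<in> rp w (\<beta> w) ` cyl w" using rp_image[of "\<beta> w" w] ww[OF w(1)] l[OF w(1)] w' w(2) by simp
   then obtain x where "x \<in> cyl w" "y = rp w (\<beta> w) x" by blast
   then show ?thesis using aS[OF w(1)] by metis
  qed (use a_def in auto)
  then show ?thesis by (metis surj_def)
 qed
 ultimately have "bij a" by (simp add: bij_def)
 moreover have "\<exists>n>0. \<exists>v. tb a (pfx x n) v" if x: "x \<in> X" for x
 proof (cases "x \<in> S")
  case True
  then obtain w where w: "w \<in> P" "x \<in> cyl w" using part_point[OF P] by blast
  have "length w > 0" using ww(1)[OF w(1)] by auto
  then show ?thesis using t[OF w(1)] cyl_pfx[OF w(2)] by metis
 next
  case False
  obtain L where L: "clop S L" using part_clop[OF P] by blast
  have L1: "L \<ge> 1" using clop_X_level(2)[OF L] .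
  have "clop (X - S) L" using clop_diff[OF clop_mono[OF clop_X L1] L] .
  from clopD[OF this] have "y \<in> X - S" if "y \<in> cyl (pfx x L)" for y using x False that by blast
  then have "tb a (pfx x L) (pfx x L)" using pfx_words[OF x, of L] L1 by (intro tb_fix) (auto simp: a_def)
  then show ?thesis using L1 by (intro exI[of _ L]) auto
 qed
 moreover have "a x = x" if "x \<notin> S" for x using that by (simp add: a_def)
 ultimately have "a \<in> Gam S" by (simp add: Gam_def)
 then show ?thesis using t by blast
qed

text \<open>Negative terms are turned into positive ones, since minus \<open>Ub v w\<close> is
  homologous to \<open>Ub w v\<close>.\<close>

lemma gen_pairs:
 assumes "f \<in> gen (BU X)"
 shows "\<exists>(n::nat) \<nu> \<mu>. (\<forall>i<n. same (\<nu> i) (\<mu> i)) & (%z. f z - (\<Sum>i<n. iU (\<nu> i) (\<mu> i) z)) \<in> Bd X"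
 using assms
proof (induction rule: gen.induct)
 case gen_zero
 show ?case by (rule exI[of _ "0::nat"], rule exI, rule exI) (use Bd_zero[OF clop_X] in simp)
next
 case (gen_plus f B)
 then obtain n \<nu> \<mu> where h: "\<forall>i<(n::nat). same (\<nu> i) (\<mu> i)" "(%z. f z - (\<Sum>i<n. iU (\<nu> i) (\<mu> i) z)) \<in> Bd X"
  by blast
 obtain v w where v: "same v w" "B = Ub v w" using gen_plus by (auto simp: BU_def)
 have "(\<Sum>i<Suc n. iU ((\<nu>(n := v)) i) ((\<mu>(n := w)) i) z) =
   (\<Sum>i<n. iU (\<nu> i) (\<mu> i) z) + (indicator B z :: int)" for z using v(2) by simp
 then have "(%z. (f z + indicator B z) - (\<Sum>i<Suc n. iU ((\<nu>(n := v)) i) ((\<mu>(n := w)) i) z)) \<in> Bd X"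
  using h(2) by simp
 moreover have "\<forall>i<Suc n. same ((\<nu>(n := v)) i) ((\<mu>(n := w)) i)" using h(1) v(1) by (simp add: less_Suc_eq)
 ultimately show ?case by (intro exI conjI)
next
 case (gen_minus f B)
 then obtain n \<nu> \<mu> where h: "\<forall>i<(n::nat). same (\<nu> i) (\<mu> i)" "(%z. f z - (\<Sum>i<n. iU (\<nu> i) (\<mu> i) z)) \<in> Bd X"
  by blast
 obtain v w where v: "same v w" "B = Ub v w" using gen_minus by (auto simp: BU_def)
 have e: "(\<Sum>i<Suc n. iU ((\<nu>(n := w)) i) ((\<mu>(n := v)) i) z) =
   (\<Sum>i<n. iU (\<nu> i) (\<mu> i) z) + (iU w v z :: int)" for z by simp
 from Bd_diff[OF clop_X h(2) Bd_inverse[OF clop_X v(1) cyl_subset_X cyl_subset_X]]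
 have "(%z. (f z - indicator B z) - (\<Sum>i<Suc n. iU ((\<nu>(n := w)) i) ((\<mu>(n := v)) i) z)) \<in> Bd X"
  unfolding e v(2) by (simp add: algebra_simps)
 moreover have "\<forall>i<Suc n. same ((\<nu>(n := w)) i) ((\<mu>(n := v)) i)"
  using h(1) same_sym[OF v(1)] by (simp add: less_Suc_eq)
 ultimately show ?case by (intro exI conjI)
qed

lemma Sigma_cyl:
 assumes "!!i j. i < n ==> j < n ==> i ~= j ==> cyl (\<kappa> i) \<inter> cyl (\<kappa> j) = {}"
  and "(i, p) \<in> (SIGMA i:{..<n::nat}. exts (\<kappa> i) (m i))" "(j, q) \<in> (SIGMA i:{..<n}. exts (\<kappa> i) (m i))"
  and x: "x \<in> cyl (\<kappa> i @ p)" "x \<in> cyl (\<kappa> j @ q)"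
 shows "i = j & p = q"
proof -
 have "x \<in> cyl (\<kappa> i)" "x \<in> cyl (\<kappa> j)" using x cyl_append_subset by blast+
 then have ij: "i = j" using assms(1)[of i j] assms(2,3) by auto
 then have "length (\<kappa> i @ p) = length (\<kappa> j @ q)" using assms(2,3) by (simp add: exts_def)
 then have "\<kappa> i @ p = \<kappa> j @ q" using cyl_pfx[OF x(1)] cyl_pfx[OF x(2)] by metis
 then show ?thesis using ij by simp
qed

lemma part_Sigma:
 fixes m :: "nat => nat"
 assumes d: "!!i j. i < n ==> j < n ==> i ~= j ==> cyl (\<kappa> i) \<inter> cyl (\<kappa> j) = {}"
  and w: "!!i. i < n ==> \<kappa> i \<in> words"
 defines "I \<equiv> SIGMA i:{..<n::nat}. exts (\<kappa> i) (m i)" and "k \<equiv> %(i, p). \<kappa> i @ p"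
 shows "part (k ` I) (\<Union>i<n. cyl (\<kappa> i))" "inj_on k I" "finite I"
proof -
 have kw: "k x \<in> words" if "x \<in> I" for x using that by (auto simp: I_def k_def exts_def)
 have D: "x = y" if "x \<in> I" "y \<in> I" "z \<in> cyl (k x)" "z \<in> cyl (k y)" for x y z
 proof -
  obtain i p j q where xy: "x = (i, p)" "y = (j, q)" by (cases x, cases y)
  show ?thesis using Sigma_cyl[where \<kappa>=\<kappa> and m=m and n=n, OF d, of i p j q z] that
   unfolding xy I_def k_def by simp
 qed
 show fin: "finite I" unfolding I_def using finite_ext by blast
 show "inj_on k I"
 proof (rule inj_onI)
  fix x y assume "x \<in> I" "y \<in> I" "k x = k y"
  then show "x = y" using D[of x y "pt (k x)"] pt_in[OF kw] by metis
 qed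
 have U: "(\<Union>w\<in>k ` I. cyl w) = (\<Union>i<n. cyl (\<kappa> i))"
 proof
  show "(\<Union>w\<in>k ` I. cyl w) \<subseteq> (\<Union>i<n. cyl (\<kappa> i))"
  proof
   fix x assume "x \<in> (\<Union>w\<in>k ` I. cyl w)"
   then obtain i p where "i < n" "x \<in> cyl (\<kappa> i @ p)" by (auto simp: I_def k_def)
   then show "x \<in> (\<Union>i<n. cyl (\<kappa> i))" using cyl_append_subset by blast
  qed
  show "(\<Union>i<n. cyl (\<kappa> i)) \<subseteq> (\<Union>w\<in>k ` I. cyl w)"
  proof
   fix x assume "x \<in> (\<Union>i<n. cyl (\<kappa> i))"
   then obtain i where i: "i < n" "x \<in> cyl (\<kappa> i)" by blast
   define p where "p = pfx (%j. x (length (\<kappa> i) + j)) (m i)"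
   have e: "\<kappa> i @ p = pfx x (length (\<kappa> i) + m i)" using cyl_pfx[OF i(2)] by (simp add: pfx_add p_def)
   have "\<kappa> i ~= []" using w[OF i(1)] by auto
   then have "\<kappa> i @ p \<in> words" unfolding e using cyl_X[OF i(2)] by (intro pfx_words) auto
   then have "(i, p) \<in> I" using i(1) by (simp add: I_def exts_def p_def)
   moreover have "x \<in> cyl (k (i, p))" using e cyl_X[OF i(2)] by (simp add: k_def)
   ultimately show "x \<in> (\<Union>w\<in>k ` I. cyl w)" by blast
  qed
 qed
 have "pdis (k ` I)" unfolding pdis_def
 proof (intro ballI impI)
  fix v u assume vu: "v \<in> k ` I" "u \<in> k ` I" "v ~= u"
  then obtain x y where xy: "x \<in> I" "y \<in> I" "v = k x" "u = k y" by blast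
  then show "cyl v \<inter> cyl u = {}" using D[OF xy(1,2)] vu(3) by blast
 qed
 then show "part (k ` I) (\<Union>i<n. cyl (\<kappa> i))"
  unfolding part_def using fin kw U by blast
qed

text \<open>Both sides count the indices \<open>i\<close> for which \<open>\<mu> i\<close> is a
  prefix of \<open>w\<close>, since \<open>i\<close> determines the extension
  \<open>p\<close>.\<close>

lemma fibre_count:
 assumes w: "w \<in> words" "length w = N" and \<mu>: "!!i. i < n ==> \<mu> i \<in> words & length (\<mu> i) \<le> N"
 shows "int (card {x \<in> SIGMA i:{..<n::nat}. exts (\<mu> i) (N - length (\<mu> i)). (case x of (i, p) => \<mu> i @ p) = w}) =
  (\<Sum>i<n. iU (\<mu> i) (\<mu> i) (sft_unit (pt w)))"
proof -
 let ?A = "{x \<in> SIGMA i:{..<n}. exts (\<mu> i) (N - length (\<mu> i)). (case x of (i, p) => \<mu> i @ p) = w}"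
 have "inj_on fst ?A" by (auto simp: inj_on_def)
 moreover have "fst ` ?A = {i \<in> {..<n}. prefix (\<mu> i) w}"
 proof
  show "fst ` ?A \<subseteq> {i \<in> {..<n}. prefix (\<mu> i) w}" by (auto simp: prefix_def)
  show "{i \<in> {..<n}. prefix (\<mu> i) w} \<subseteq> fst ` ?A"
  proof
   fix i assume i: "i \<in> {i \<in> {..<n}. prefix (\<mu> i) w}"
   then obtain p where p: "w = \<mu> i @ p" by (auto simp: prefix_def)
   then have "(i, p) \<in> ?A" using i w by (auto simp: exts_def)
   then show "i \<in> fst ` ?A" by force
  qed
 qed
 ultimately have "card ?A = card {i \<in> {..<n}. prefix (\<mu> i) w}" using card_image[of fst ?A] by (simp only:)
 also have "int \<dots> = (\<Sum>i<n. if prefix (\<mu> i) w then 1 else 0)" by (simp add: sum.If_cases Int_def)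
 also have "\<dots> = (\<Sum>i<n. iU (\<mu> i) (\<mu> i) (sft_unit (pt w)))"
  by (rule sum.cong[OF refl]) (use pt_indicator[OF _ w(1)] \<mu> w(2) in simp)
 finally show ?thesis .
qed

text \<open>A cycle is a sum of indicator functions of sets \<open>Ub (\<nu> i) (\<mu> i)\<close>. Routing each of them through
 a word \<open>\<kappa> i\<close> inside \<open>Y\<close>, where these words are disjoint, turns the cycle into the graph of a
 single element.\<close>

lemma index_surj:
 assumes Y: "clop Y L" "Y ~= {}" and f: "f \<in> Zc X"
 shows "\<exists>a\<in>Gam Y. (%z. f z - indicator (Us Y a) z) \<in> Bd X"
proof -
 have f': "f \<in> gen (BU X)" "delta1 (GR X) f = (%x. 0)" using f by (auto simp: Zc_def)
 obtain n \<nu> \<mu> where h: "\<forall>i<(n::nat). same (\<nu> i) (\<mu> i)"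
  "(%z. f z - (\<Sum>i<n. iU (\<nu> i) (\<mu> i) z)) \<in> Bd X"
  using gen_pairs[OF f'(1)] by blast
 have s: "same (\<nu> i) (\<mu> i)" if "i < n" for i using h(1) that by blast
 obtain y where y: "y \<in> Y" using Y(2) by blast
 have yX: "y \<in> X" "L \<ge> 1" using y clop_X_level[OF Y(1)] by auto
 have z0: "pfx y L \<in> words" "cyl (pfx y L) \<subseteq> Y" using yX clopD[OF Y(1) y] by (auto intro: pfx_words)
 have arcs: "set (map (%i. last (\<nu> i)) [0..<n]) \<subseteq> arcs Q"
  using s last_in_arcs by (auto simp: same_def)
 obtain ws where ws: "map last ws = map (%i. last (\<nu> i)) [0..<n]" "distinct ws" "set ws \<subseteq> words" "pdis (set ws)"
  "!!v. v \<in> set ws ==> cyl v \<subseteq> cyl (pfx y L)" by (rule stock[OF z0(1) arcs]) (rule that)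
 define \<kappa> where "\<kappa> i = ws ! i" for i
 have len: "length ws = n" using ws(1) by (metis length_map length_upt minus_nat.diff_0)
 have \<kappa>: "\<kappa> i \<in> words" "cyl (\<kappa> i) \<subseteq> Y" "last (\<kappa> i) = last (\<nu> i)" if "i < n" for i
 proof -
  have m: "ws ! i \<in> set ws" using that len by simp
  show "\<kappa> i \<in> words" unfolding \<kappa>_def using m ws(3) by blast
  show "cyl (\<kappa> i) \<subseteq> Y" unfolding \<kappa>_def using ws(5)[OF m] z0(2) by blast
  have "map last ws ! i = map (%i. last (\<nu> i)) [0..<n] ! i" using ws(1) by simp
  then show "last (\<kappa> i) = last (\<nu> i)" using that len by (simp add: \<kappa>_def)
 qed
 have dis: "cyl (\<kappa> i) \<inter> cyl (\<kappa> j) = {}" if "i < n" "j < n" "i ~= j" for i j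
 proof (rule pdis_apart[OF ws(4)])
  show "\<kappa> i \<in> set ws" "\<kappa> j \<in> set ws" using that len by (simp_all add: \<kappa>_def)
  show "\<kappa> i ~= \<kappa> j" using that len ws(2) by (simp add: \<kappa>_def nth_eq_iff_index_eq)
 qed
 have s\<nu>: "same (\<kappa> i) (\<nu> i)" "same (\<kappa> i) (\<mu> i)" if "i < n" for i using s[OF that] \<kappa>[OF that] by (auto simp: same_def)
 \<comment> \<open>The sum of all lengths is a common bound, so that all sources and ranges can be
   extended to the same length.\<close>
 define N where "N = (\<Sum>i<n. length (\<nu> i) + length (\<mu> i))"
 have N: "length (\<nu> i) \<le> N" "length (\<mu> i) \<le> N" if "i < n" for i
 proof -
  have "length (\<nu> i) + length (\<mu> i) \<le> N" unfolding N_def using that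
   by (intro member_le_sum[of i "{..<n}" "%i. length (\<nu> i) + length (\<mu> i)"]) auto
  then show "length (\<nu> i) \<le> N" "length (\<mu> i) \<le> N" by auto
 qed
 define I1 where "I1 = (SIGMA i:{..<n}. exts (\<mu> i) (N - length (\<mu> i)))"
 define I2 where "I2 = (SIGMA i:{..<n}. exts (\<nu> i) (N - length (\<nu> i)))"
 define m1 where "m1 = (%(i, p). \<mu> i @ p)"
 define m2 where "m2 = (%(i, p). \<nu> i @ p)"
 define k where "k = (%(i, p). \<kappa> i @ p)"
 have I1: "I1 = (SIGMA i:{..<n}. exts (\<kappa> i) (N - length (\<mu> i)))" unfolding I1_def
  by (rule Sigma_cong[OF refl]) (use ext_same s\<nu>(2) in auto)
 have I2: "I2 = (SIGMA i:{..<n}. exts (\<kappa> i) (N - length (\<nu> i)))" unfolding I2_def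
  by (rule Sigma_cong[OF refl]) (use ext_same s\<nu>(1) in auto)
 define K where "K = (\<Union>i<n. cyl (\<kappa> i))"
 have p1: "part (k ` I1) K" "inj_on k I1" "finite I1"
  unfolding I1 k_def K_def by (rule part_Sigma[OF dis \<kappa>(1)]; assumption)+
 have p2: "part (k ` I2) K" "inj_on k I2" "finite I2"
  unfolding I2 k_def K_def by (rule part_Sigma[OF dis \<kappa>(1)]; assumption)+
 have s1: "same (k x) (m1 x)" if "x \<in> I1" for x
  using that ext_same_append[OF s\<nu>(2)] by (auto simp: I1_def k_def m1_def)
 have s2: "same (k x) (m2 x)" if "x \<in> I2" for x
  using that ext_same_append[OF s\<nu>(1)] by (auto simp: I2_def k_def m2_def)
 \<comment> \<open>Evaluated at a sample point of \<open>w\<close>, the cycle condition says that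
   \<open>w\<close> occurs equally often among the extended sources and among the extended
   ranges.\<close>
 have cards: "card {x \<in> I1. m1 x = w} = card {x \<in> I2. m2 x = w}" for w
 proof (cases "w \<in> words & length w = N")
  case False
  have "m1 x \<in> words & length (m1 x) = N" if "x \<in> I1" for x using that N by (auto simp: I1_def m1_def exts_def)
  moreover have "m2 x \<in> words & length (m2 x) = N" if "x \<in> I2" for x using that N by (auto simp: I2_def m2_def exts_def)
  ultimately have "{x \<in> I1. m1 x = w} = {}" "{x \<in> I2. m2 x = w} = {}" using False by blast+
  then show ?thesis by (simp only:)
 next
  case True
  let ?S = "%z. \<Sum>i<n. (iU (\<nu> i) (\<mu> i) z :: int)"
  have g: "iU (\<nu> i) (\<mu> i) \<in> gen (BU X)" if "i \<in> {..<n}" for i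
   using s that cyl_subset_X by (intro ind_Ub_gen) auto
  have "delta1 (GR X) ?S = (%z. \<Sum>i<n. delta1 (GR X) (iU (\<nu> i) (\<mu> i)) z)"
   by (rule delta1_sum[OF clop_X finite_lessThan g])
  also have "\<dots> = (%z. \<Sum>i<n. iU (\<mu> i) (\<mu> i) z - iU (\<nu> i) (\<nu> i) z)"
   by (intro ext sum.cong refl) (use delta1_Ub[OF clop_X s cyl_subset_X cyl_subset_X] in simp)
  finally have d1: "delta1 (GR X) ?S = \<dots>" .
  have gS: "?S \<in> gen (BU X)" using g by (intro gen_sum)
  have "delta1 (GR X) (%z. f z - ?S z) = (%x. 0)" using Bd_cycle[OF clop_X h(2)] by blast
  then have "(%z. - delta1 (GR X) ?S z) = (%x. 0)" using delta1_diff[OF clop_X f'(1) gS] f'(2) by simp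
  from fun_cong[OF this, of "sft_unit (pt w)"] have "delta1 (GR X) ?S (sft_unit (pt w)) = 0" by simp
  then have "(\<Sum>i<n. (iU (\<mu> i) (\<mu> i) (sft_unit (pt w)) :: int)) = (\<Sum>i<n. iU (\<nu> i) (\<nu> i) (sft_unit (pt w)))"
   unfolding d1 by (simp add: sum_subtractf)
  moreover have "int (card {x \<in> I1. m1 x = w}) = (\<Sum>i<n. iU (\<mu> i) (\<mu> i) (sft_unit (pt w)))"
   unfolding I1_def m1_def using True N s by (intro fibre_count) (auto simp: same_def)
  moreover have "int (card {x \<in> I2. m2 x = w}) = (\<Sum>i<n. iU (\<nu> i) (\<nu> i) (sft_unit (pt w)))"
   unfolding I2_def m2_def using True N s by (intro fibre_count) (auto simp: same_def)
  ultimately show ?thesis by linarith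
 qed
 \<comment> \<open>Each extended source is matched with an extended range that is the same word.
   Routed through \<open>\<kappa>\<close>, the matching becomes a table on \<open>K\<close>.\<close>
 obtain \<theta> where \<theta>: "bij_betw \<theta> I1 I2" "!!x. x \<in> I1 ==> m2 (\<theta> x) = m1 x"
  using bij_betw_fibres[OF p1(3) p2(3) cards] by blast
 have \<theta>I: "\<theta> x \<in> I2" if "x \<in> I1" for x using bij_betwE[OF \<theta>(1)] that by blast
 have skk: "same (k x) (k (\<theta> x))" "same (k (\<theta> x)) (m1 x)" if "x \<in> I1" for x
  using s1[OF that] s2[OF \<theta>I[OF that]] \<theta>(2)[OF that] by (auto simp: same_def)
 define \<beta> where "\<beta> = (%w. k (inv_into I1 \<theta> (inv_into I2 k w)))"
 have kb: "bij_betw k I2 (k ` I2)" "bij_betw k I1 (k ` I1)" using p1(2) p2(2) by (simp_all add: bij_betw_def)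
 have \<beta>k: "\<beta> (k (\<theta> x)) = k x" if "x \<in> I1" for x
  using that inv_into_f_f[OF p2(2) \<theta>I[OF that]] inv_into_f_f[OF bij_betw_imp_inj_on[OF \<theta>(1)] that] by (simp add: \<beta>_def)
 have \<beta>b: "bij_betw \<beta> (k ` I2) (k ` I1)"
  using bij_betw_trans[OF bij_betw_trans[OF bij_betw_inv_into[OF kb(1)] bij_betw_inv_into[OF \<theta>(1)]] kb(2)]
  by (simp add: \<beta>_def o_def)
 have ex: "\<exists>x\<in>I1. w = k (\<theta> x)" if "w \<in> k ` I2" for w
  using that bij_betw_imp_surj_on[OF \<theta>(1)] by blast
 have l: "last (\<beta> w) = last w" if w: "w \<in> k ` I2" for w
 proof -
  obtain x where x: "x \<in> I1" "w = k (\<theta> x)" using ex[OF w] by blast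
  then show ?thesis using \<beta>k[OF x(1)] skk(1)[OF x(1)] by (simp add: same_def)
 qed
 obtain a where a: "a \<in> Gam K" "\<forall>w\<in>k ` I2. tb a w (\<beta> w)" using table_Gam[OF p2(1) p1(1) \<beta>b l] by blast
 have KY: "K \<subseteq> Y" using \<kappa>(2) by (auto simp: K_def)
 obtain L' where L': "clop K L'" using part_clop[OF p1(1)] by blast
 have ktb: "bij_betw (%x. k (\<theta> x)) I1 (k ` I2)" using bij_betw_trans[OF \<theta>(1) kb(1)] by (simp add: o_def)
 have Usa: "(indicator (Us K a) z :: int) = (\<Sum>x\<in>I1. iU (k x) (k (\<theta> x)) z)" for z
 proof -
  have "(indicator (Us K a) z :: int) = (\<Sum>w\<in>k ` I2. iU (\<beta> w) w z)"
   using a(2) by (intro Us_indicator[OF p2(1)]) blast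
  also have "\<dots> = (\<Sum>x\<in>I1. iU (\<beta> (k (\<theta> x))) (k (\<theta> x)) z)"
   by (rule sum.reindex_bij_betw[OF ktb, symmetric])
  also have "\<dots> = (\<Sum>x\<in>I1. iU (k x) (k (\<theta> x)) z)" by (rule sum.cong[OF refl]) (simp add: \<beta>k)
  finally show ?thesis .
 qed
 have e1: "(\<Sum>i<n. (iU (\<kappa> i) (\<mu> i) z :: int)) = (\<Sum>x\<in>I1. iU (k x) (m1 x) z)" for z
 proof -
  have "(\<Sum>i<n. (iU (\<kappa> i) (\<mu> i) z :: int)) =
    (\<Sum>i<n. \<Sum>p\<in>exts (\<mu> i) (N - length (\<mu> i)). iU (\<kappa> i @ p) (\<mu> i @ p) z)"
   by (rule sum.cong[OF refl]) (use Ub_ext[OF s\<nu>(2)] in simp)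
  also have "\<dots> = (\<Sum>x\<in>I1. iU (k x) (m1 x) z)" unfolding I1_def
   by (subst sum.Sigma) (auto simp: finite_ext k_def m1_def intro!: sum.cong)
  finally show ?thesis .
 qed
 have e2: "(\<Sum>i<n. (iU (\<kappa> i) (\<nu> i) z :: int)) = (\<Sum>x\<in>I1. iU (k (\<theta> x)) (m1 x) z)" for z
 proof -
  have "(\<Sum>i<n. (iU (\<kappa> i) (\<nu> i) z :: int)) =
    (\<Sum>i<n. \<Sum>p\<in>exts (\<nu> i) (N - length (\<nu> i)). iU (\<kappa> i @ p) (\<nu> i @ p) z)"
   by (rule sum.cong[OF refl]) (use Ub_ext[OF s\<nu>(1)] in simp)
  also have "\<dots> = (\<Sum>x\<in>I2. iU (k x) (m2 x) z)" unfolding I2_def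
   by (subst sum.Sigma) (auto simp: finite_ext k_def m2_def intro!: sum.cong)
  also have "\<dots> = (\<Sum>x\<in>I1. iU (k (\<theta> x)) (m2 (\<theta> x)) z)"
   by (rule sum.reindex_bij_betw[OF \<theta>(1), symmetric])
  also have "\<dots> = (\<Sum>x\<in>I1. iU (k (\<theta> x)) (m1 x) z)" by (rule sum.cong[OF refl]) (simp add: \<theta>(2))
  finally show ?thesis .
 qed
 \<comment> \<open>Triple relations split each \<open>Ub (\<nu> i) (\<mu> i)\<close> into two legs
   through \<open>\<kappa> i\<close>; \<open>b2\<close> joins the legs again along the
   matching.\<close>
 have b1: "(%z. \<Sum>i<n. iU (\<nu> i) (\<mu> i) z - iU (\<kappa> i) (\<mu> i) z + iU (\<kappa> i) (\<nu> i) z) \<in> Bd X"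
  using s s\<nu>(1) by (intro Bd_sum[OF clop_X] Bd_Ub[OF clop_X] cyl_subset_X) auto
 have b2: "(%z. \<Sum>x\<in>I1. iU (k (\<theta> x)) (m1 x) z - iU (k x) (m1 x) z + iU (k x) (k (\<theta> x)) z) \<in> Bd X"
  using skk by (intro Bd_sum[OF clop_X] Bd_Ub[OF clop_X] cyl_subset_X) auto
 have b3: "(%z. indicator (Us Y a) z - indicator (Us K a) z) \<in> Bd X"
  using Bd_subset[OF Y(1) clop_X clop_X_level(1)[OF Y(1)] Us_extend[OF Y(1) L' KY a(1)]] .
 have "(%z. ((f z - (\<Sum>i<n. iU (\<nu> i) (\<mu> i) z)) +
   (\<Sum>i<n. iU (\<nu> i) (\<mu> i) z - iU (\<kappa> i) (\<mu> i) z + iU (\<kappa> i) (\<nu> i) z)) -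
   ((\<Sum>x\<in>I1. iU (k (\<theta> x)) (m1 x) z - iU (k x) (m1 x) z + iU (k x) (k (\<theta> x)) z) +
   (indicator (Us Y a) z - indicator (Us K a) z))) \<in> Bd X"
  by (rule Bd_diff[OF clop_X Bd_add[OF clop_X h(2) b1] Bd_add[OF clop_X b2 b3]])
 moreover have "((f z - (\<Sum>i<n. iU (\<nu> i) (\<mu> i) z)) +
   (\<Sum>i<n. iU (\<nu> i) (\<mu> i) z - iU (\<kappa> i) (\<mu> i) z + iU (\<kappa> i) (\<nu> i) z)) -
   ((\<Sum>x\<in>I1. iU (k (\<theta> x)) (m1 x) z - iU (k x) (m1 x) z + iU (k x) (k (\<theta> x)) z) +
   (indicator (Us Y a) z - indicator (Us K a) z)) = f z - indicator (Us Y a) z" for z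
  using e1[of z] e2[of z] Usa[of z] by (simp add: sum.distrib sum_subtractf)
 ultimately have "(%z. f z - indicator (Us Y a) z) \<in> Bd X" by simp
 moreover have "a \<in> Gam Y" using a(1) Gam_mono[OF KY] by blast
 ultimately show ?thesis by blast
qed

end

section \<open>The kernel of the index map\<close>

context sft
begin

text \<open>The adjacency operator of the arcs acting on weights; its fixed functions are the
  integer analogue of \<open>harmonic\<close>.\<close>

definition Aop :: "('e => int) => 'e => int" where
 "Aop \<chi> e = (\<Sum>f\<in>nx e. \<chi> f)"

text \<open>Expanding a word \<open>w\<close> adds \<open>(Aop ^^ N) \<chi> (last w)\<close> to the sum of \<open>psi N \<chi>\<close> over a partition,
 so that \<open>psi\<close> detects how often words of each type are expanded. The number \<open>N\<close> bounds the lengths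
 of words, because \<open>Aop\<close> need not be invertible.\<close>

definition psi :: "nat => ('e => int) => 'e list => int" where
 "psi N \<chi> w = (\<Sum>j<length w. (Aop ^^ (N - 1 - j)) \<chi> (last w))"

text \<open>Summing over the children raises every power of \<open>Aop\<close> by one. The extra
  letter contributes one more term, so after a shift of the index only the top power
  \<open>Aop ^^ N\<close> is new.\<close>

lemma psi_children:
 assumes "length w < N"
 shows "(\<Sum>f\<in>nx (last w). psi N \<chi> (w @ [f])) = psi N \<chi> w + (Aop ^^ N) \<chi> (last w)"
proof -
 have "(\<Sum>f\<in>nx (last w). psi N \<chi> (w @ [f])) =
   (\<Sum>f\<in>nx (last w). \<Sum>j<Suc (length w). (Aop ^^ (N - 1 - j)) \<chi> f)"
  by (simp only: psi_def last_snoc length_append_singleton)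
 also have "\<dots> = (\<Sum>j<Suc (length w). Aop ((Aop ^^ (N - 1 - j)) \<chi>) (last w))"
  unfolding Aop_def by (rule sum.swap)
 also have "\<dots> = (\<Sum>j<Suc (length w). (Aop ^^ (N - j)) \<chi> (last w))"
 proof (rule sum.cong[OF refl])
  fix j assume "j \<in> {..<Suc (length w)}"
  then have "N - j = Suc (N - 1 - j)" using assms by auto
  then show "Aop ((Aop ^^ (N - 1 - j)) \<chi>) (last w) = (Aop ^^ (N - j)) \<chi> (last w)" by simp
 qed
 also have "\<dots> = (Aop ^^ N) \<chi> (last w) + (\<Sum>j<length w. (Aop ^^ (N - Suc j)) \<chi> (last w))"
  by (subst sum.lessThan_Suc_shift) simp
 also have "(\<Sum>j<length w. (Aop ^^ (N - Suc j)) \<chi> (last w)) = psi N \<chi> w" unfolding psi_def by simp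
 finally show ?thesis by simp
qed

text \<open>Words of the same type gain the same term under expansion, so the difference is
  preserved by subdivision; by its form it is additive under composition. It acts as an integer
  cocycle on the sets \<open>Ub v w\<close>.\<close>

definition Dc :: "nat => ('e => int) => 'e list => 'e list => int" where
 "Dc N \<chi> v w = psi N \<chi> v - psi N \<chi> w"

lemma Dc_children:
 assumes "same v w" "length v < N" "length w < N"
 shows "(\<Sum>f\<in>nx (last w). Dc N \<chi> (v @ [f]) (w @ [f])) = Dc N \<chi> v w"
proof -
 have "last v = last w" using assms(1) by (simp add: same_def)
 then show ?thesis
  using psi_children[OF assms(2), of \<chi>] psi_children[OF assms(3), of \<chi>] by (simp add: Dc_def sum_subtractf)
qed

lemma Dc_ext:
 assumes s: "same v w" and "length v + m \<le> N" "length w + m \<le> N"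
 shows "(\<Sum>p\<in>exts w m. Dc N \<chi> (v @ p) (w @ p)) = Dc N \<chi> v w"
 using assms(2,3)
proof (induction m)
 case 0
 have "w \<in> words" using s by (simp add: same_def)
 then show ?case by (simp add: ext_0)
next
 case (Suc m)
 have w: "w \<in> words" using s by (simp add: same_def)
 have "(\<Sum>p\<in>exts w (Suc m). Dc N \<chi> (v @ p) (w @ p)) =
   (\<Sum>p\<in>exts w m. \<Sum>f\<in>nx (last (w @ p)). Dc N \<chi> ((v @ p) @ [f]) ((w @ p) @ [f]))"
  by (simp add: sum_ext_Suc[OF w])
 also have "\<dots> = (\<Sum>p\<in>exts w m. Dc N \<chi> (v @ p) (w @ p))"
 proof (rule sum.cong[OF refl])
  fix p assume p: "p \<in> exts w m"
  then have "length p = m" by (simp add: exts_def)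
  then show "(\<Sum>f\<in>nx (last (w @ p)). Dc N \<chi> ((v @ p) @ [f]) ((w @ p) @ [f])) = Dc N \<chi> (v @ p) (w @ p)"
   using Suc.prems by (intro Dc_children ext_same_append[OF s p]) auto
 qed
 finally show ?case using Suc by simp
qed

definition ptp :: "'e list => 'e list => 'e sft_arrow" where
 "ptp v w = (rp w v (pt w), int (length v) - int (length w), pt w)"

lemma ptp_in: "same v w ==> ptp v w \<in> Ub v w"
 using pt_in[of w] by (auto simp: ptp_def Ub_def same_def)

text \<open>The source words have length exactly \<open>L\<close>. A piece \<open>Ub v w\<close>
  with both words of length at most \<open>L\<close> is extended by at most \<open>L\<close>
  letters, whence the bound \<open>2 * L\<close> for the range words.\<close>

definition PR :: "nat => ('e list \<times> 'e list) set" where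
 "PR L = {(v, w). same v w & length w = L & length v \<le> 2 * L}"

lemma finite_PR: "finite (PR L)"
proof -
 have "PR L \<subseteq> (\<Union>n\<le>2 * L. {w \<in> words. length w = n}) \<times> {w \<in> words. length w = L}"
  by (auto simp: PR_def same_def)
 moreover have "finite ((\<Union>n\<le>2 * L. {w \<in> words. length w = n}) \<times> {w \<in> words. length w = L})"
  using finite_words_length by blast
 ultimately show ?thesis by (rule finite_subset)
qed

text \<open>Pairing of a chain with the cocycle \<open>Dc\<close>, read off at one sample arrow for
  each piece of level \<open>L\<close>. On a given piece \<open>Ub v w\<close> it is exact once
  \<open>L\<close> bounds the lengths of both words.\<close>

definition lev2 :: "('e => int) => nat => ('e sft_arrow => int) => int" where
 "lev2 \<chi> L f = (\<Sum>(v, w)\<in>PR L. f (ptp v w) * Dc (2 * L) \<chi> v w)"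

lemma lev2_add: "lev2 \<chi> L (%x. f x + g x) = lev2 \<chi> L f + lev2 \<chi> L g"
 by (simp add: lev2_def case_prod_unfold distrib_right sum.distrib)

lemma lev2_diff: "lev2 \<chi> L (%x. f x - g x) = lev2 \<chi> L f - lev2 \<chi> L g"
 by (simp add: lev2_def case_prod_unfold left_diff_distrib sum_subtractf)

lemma lev2_zero: "lev2 \<chi> L (%x. 0) = 0"
 by (simp add: lev2_def case_prod_unfold)

lemma lev2_sum: "lev2 \<chi> L (%x. \<Sum>i\<in>I. f i x) = (\<Sum>i\<in>I. lev2 \<chi> L (f i))"
 by (induction I rule: infinite_finite_induct) (simp_all add: lev2_zero lev2_add)

lemma lev2_Ub:
 assumes s: "same v w" and L: "length v \<le> L" "length w \<le> L"
 shows "lev2 \<chi> L (iU v w) = Dc (2 * L) \<chi> v w"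
proof -
 let ?m = "L - length w"
 let ?i = "%p. (v @ p, w @ p)"
 have sub: "?i ` exts w ?m \<subseteq> PR L"
  using ext_same_append[OF s] L by (auto simp: PR_def exts_def)
 have "lev2 \<chi> L (iU v w) =
   (\<Sum>x\<in>?i ` exts w ?m. case x of (v', w') => iU v w (ptp v' w') * Dc (2 * L) \<chi> v' w')"
  unfolding lev2_def
 proof (rule sum.mono_neutral_right[OF finite_PR sub], intro ballI)
  fix x assume x: "x \<in> PR L - ?i ` exts w ?m"
  obtain v' w' where vw: "x = (v', w')" by (cases x)
  have x': "same v' w'" "length w' = L" using x vw by (auto simp: PR_def)
  have "ptp v' w' \<notin> Ub v w"
  proof
   assume a: "ptp v' w' \<in> Ub v w"
   obtain p where p: "v' = v @ p" "w' = w @ p" using Ub_meet[OF s x'(1) a ptp_in[OF x'(1)]] L(2) x'(2) by auto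
   have "p \<in> exts w ?m" using x' p by (auto simp: exts_def same_def)
   then show False using x vw p by blast
  qed
  then show "(case x of (v', w') => iU v w (ptp v' w') * Dc (2 * L) \<chi> v' w') = 0" using vw by simp
 qed
 also have "\<dots> = (\<Sum>p\<in>exts w ?m. iU v w (ptp (v @ p) (w @ p)) * Dc (2 * L) \<chi> (v @ p) (w @ p))"
  by (subst sum.reindex) (auto simp: inj_on_def)
 also have "\<dots> = (\<Sum>p\<in>exts w ?m. Dc (2 * L) \<chi> (v @ p) (w @ p))"
 proof (rule sum.cong[OF refl])
  fix p assume p: "p \<in> exts w ?m"
  have "ptp (v @ p) (w @ p) \<in> Ub v w" using ptp_in[OF ext_same_append[OF s p]] Ub_append by blast
  then show "iU v w (ptp (v @ p) (w @ p)) * Dc (2 * L) \<chi> (v @ p) (w @ p) = Dc (2 * L) \<chi> (v @ p) (w @ p)"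
   by simp
 qed
 also have "\<dots> = Dc (2 * L) \<chi> v w" by (rule Dc_ext[OF s]) (use L in auto)
 finally show ?thesis .
qed

lemma lev2_triple:
 assumes "same u v" "same v w" "length u \<le> L" "length v \<le> L" "length w \<le> L"
 shows "lev2 \<chi> L (%x. iU v w x - iU u w x + iU u v x) = 0"
proof -
 have "same u w" using assms by (simp add: same_def)
 then show ?thesis using assms by (simp add: lev2_add lev2_diff lev2_Ub Dc_def)
qed

text \<open>\<open>Dc\<close> telescopes along compositions, so the triple relations that generate
  the boundaries are annihilated.\<close>

lemma lev2_Bd: assumes "f \<in> Bd X" shows "\<exists>L0. \<forall>L\<ge>L0. lev2 \<chi> L f = 0"
 using clop_X assms
proof (induction rule: Bd_induct)
 case zero
 show ?case using lev2_zero by (intro exI[of _ 0]) simp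
next
 case (triple u v w)
 have "\<forall>L\<ge>max (length u) (max (length v) (length w)).
   lev2 \<chi> L (%x. iU v w x - iU u w x + iU u v x) = 0"
  using triple lev2_triple[of u v w _ \<chi>] by simp
 then show ?case by (intro exI)
next
 case (diff f g)
 then obtain L0 L1 where "\<forall>L\<ge>L0. lev2 \<chi> L f = 0" "\<forall>L\<ge>L1. lev2 \<chi> L g = 0" by (elim exE)
 then have "\<forall>L\<ge>max L0 L1. lev2 \<chi> L (%x. f x - g x) = 0" by (simp add: lev2_diff)
 then show ?case by (intro exI)
qed

section \<open>Counting expansions by type\<close>

lemma part_expand_sum:
 fixes g :: "'e list => int"
 assumes P: "part P S" and w: "w \<in> P"
 shows "(\<Sum>u\<in>P - {w} \<union> children w. g u) = (\<Sum>u\<in>P. g u) - g w + (\<Sum>f\<in>nx (last w). g (w @ [f]))"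
proof -
 have ww: "w \<in> words" using partD(2)[OF P] w by blast
 have "(P - {w}) \<inter> children w = {}"
 proof (rule ccontr)
  assume "(P - {w}) \<inter> children w ~= {}"
  then obtain u where u: "u \<in> P" "u ~= w" "u \<in> children w" by blast
  have uw: "u \<in> words" using children_words[OF ww] u(3) by blast
  have "cyl u \<subseteq> cyl w" using u(3) cyl_append_subset by (auto simp: children_def)
  then have "u = w" using pdisD[OF partD(3)[OF P] u(1) w pt_in[OF uw]] pt_in[OF uw] by blast
  then show False using u(2) by blast
 qed
 then have "(\<Sum>u\<in>P - {w} \<union> children w. g u) = (\<Sum>u\<in>P - {w}. g u) + (\<Sum>u\<in>children w. g u)"
  using partD(1)[OF P] by (intro sum.union_disjoint) auto
 then show ?thesis using sum.remove[OF partD(1)[OF P] w, of g] by (simp add: sum_children)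
qed

text \<open>Each expansion of a word of type \<open>e\<close> changes the sum of \<open>g\<close> by
  \<open>k e\<close>, so the total change depends only on the multiset of types.\<close>

lemma reach_sum:
 fixes g :: "'e list => int"
 assumes "reach B P ms" and B: "part B S"
  and g: "!!w. w \<in> words ==> length w < N ==> (\<Sum>f\<in>nx (last w). g (w @ [f])) = g w + k (last w)"
  and "\<forall>w\<in>P. length w \<le> N"
 shows "(\<Sum>w\<in>P. g w) = (\<Sum>w\<in>B. g w) + (\<Sum>e\<in>arcs Q. int (count ms e) * k e)"
 using assms(1,4)
proof (induction rule: reach.induct)
 case reach_refl
 show ?case by simp
next
 case (reach_step P ms w)
 have P: "part P S" using reach_part[OF reach_step.hyps(1) B] .
 have ww: "w \<in> words" using partD(2)[OF P] reach_step.hyps(2) by blast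
 note e = last_in_arcs[OF ww]
 obtain f where "f \<in> nx (last w)" using nx_nonempty[OF e] by blast
 then have "w @ [f] \<in> children w" by (simp add: children_def)
 then have "length (w @ [f]) \<le> N" using reach_step.prems by blast
 then have lw: "length w < N" by simp
 have "\<forall>v\<in>P. length v \<le> N" using reach_step.prems lw by (metis DiffI UnI1 less_imp_le singletonD)
 then have IH: "(\<Sum>w\<in>P. g w) = (\<Sum>w\<in>B. g w) + (\<Sum>e\<in>arcs Q. int (count ms e) * k e)" by (rule reach_step.IH)
 have "(\<Sum>e\<in>arcs Q. int (count (add_mset (last w) ms) e) * k e) =
   (\<Sum>x\<in>arcs Q. int (count ms x) * k x + (if x = last w then k x else 0))"
  by (rule sum.cong[OF refl]) (simp add: distrib_right)
 also have "\<dots> = (\<Sum>e\<in>arcs Q. int (count ms e) * k e) + k (last w)"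
  using e finite_arcs by (simp add: sum.distrib sum.delta)
 finally show ?case using IH part_expand_sum[OF P reach_step.hyps(2), of g] g[OF ww lw] by simp
qed

lemma finite_length_bound: "finite P ==> \<exists>N. \<forall>w\<in>P. length (w :: 'e list) \<le> N"
 by (rule exI[of _ "Max (length ` P)"]) auto

text \<open>A table preserves types, so the sum of \<open>\<chi>\<close> over the types is the same
  for both partitions, while an expansion of type \<open>e\<close> changes it by
  \<open>Aop \<chi> e - \<chi> e\<close>. The difference of the counts is therefore orthogonal to
  \<open>Aop \<chi> - \<chi>\<close>.\<close>

lemma counts_invariant:
 assumes B: "part B S" and P: "part P S" and r: "reach B P ms" "reach B (\<phi> ` P) ms'"
  and inj: "inj_on \<phi> P" and s: "!!w. w \<in> P ==> same (\<phi> w) w"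
 shows "(\<Sum>e\<in>arcs Q. (int (count ms' e) - int (count ms e)) * Aop \<chi> e) =
  (\<Sum>e\<in>arcs Q. (int (count ms' e) - int (count ms e)) * \<chi> e)"
proof -
 let ?k = "%e. Aop \<chi> e - \<chi> e"
 have g: "(\<Sum>f\<in>nx (last w). \<chi> (last (w @ [f]))) = \<chi> (last w) + ?k (last w)" for w by (simp add: Aop_def)
 obtain N where N: "\<forall>w\<in>P \<union> \<phi> ` P. length w \<le> N" using finite_length_bound[of "P \<union> \<phi> ` P"] partD(1)[OF P] by blast
 have "(\<Sum>w\<in>P. \<chi> (last w)) = (\<Sum>w\<in>B. \<chi> (last w)) + (\<Sum>e\<in>arcs Q. int (count ms e) * ?k e)"
  by (rule reach_sum[where N = N, OF r(1) B g]) (use N in auto)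
 moreover have "(\<Sum>w\<in>\<phi> ` P. \<chi> (last w)) = (\<Sum>w\<in>B. \<chi> (last w)) + (\<Sum>e\<in>arcs Q. int (count ms' e) * ?k e)"
  by (rule reach_sum[where N = N, OF r(2) B g]) (use N in auto)
 moreover have "(\<Sum>w\<in>\<phi> ` P. \<chi> (last w)) = (\<Sum>w\<in>P. \<chi> (last w))"
  unfolding sum.reindex[OF inj] o_def by (rule sum.cong[OF refl]) (use s in \<open>simp add: same_def\<close>)
 ultimately show ?thesis by (simp add: algebra_simps sum.distrib sum_subtractf)
qed

text \<open>The cocycle pairs to zero with a boundary, which makes the difference of the counts
  orthogonal to a power of \<open>Aop\<close> applied to \<open>\<chi>\<close>. Invariance strips
  off the power, and \<open>\<chi>\<close> is the point mass at \<open>e\<close>.\<close>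

lemma counts_equal:
 assumes B: "part B S" and P: "part P S" and r: "reach B P ms" "reach B (\<phi> ` P) ms'"
  and inj: "inj_on \<phi> P" and s: "!!w. w \<in> P ==> same (\<phi> w) w"
  and f: "(%z. \<Sum>w\<in>P. iU (\<phi> w) w z) \<in> Bd X" and e: "e \<in> arcs Q"
 shows "count ms e = count ms' e"
proof -
 define c where "c e = int (count ms' e) - int (count ms e)" for e
 have inv: "(\<Sum>e\<in>arcs Q. c e * Aop \<chi> e) = (\<Sum>e\<in>arcs Q. c e * \<chi> e)" for \<chi>
  unfolding c_def by (rule counts_invariant[OF B P r inj s])
 have pow: "(\<Sum>e\<in>arcs Q. c e * (Aop ^^ N) \<chi> e) = (\<Sum>e\<in>arcs Q. c e * \<chi> e)" for N \<chi>
  by (induction N) (simp_all add: inv)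
 define \<chi> :: "'e => int" where "\<chi> x = (if x = e then 1 else 0)" for x
 obtain L0 where L0: "\<forall>L\<ge>L0. lev2 \<chi> L (%z. \<Sum>w\<in>P. iU (\<phi> w) w z) = 0" using lev2_Bd[OF f, of \<chi>] by (elim exE)
 obtain N where N: "\<forall>w\<in>P \<union> \<phi> ` P. length w \<le> N" using finite_length_bound[of "P \<union> \<phi> ` P"] partD(1)[OF P] by blast
 define L where "L = max L0 N"
 have len: "length w \<le> L" "length (\<phi> w) \<le> L" if "w \<in> P" for w using N that by (auto simp: L_def le_max_iff_disj)
 have "0 = (\<Sum>w\<in>P. lev2 \<chi> L (iU (\<phi> w) w))"
  using L0[rule_format, of L] lev2_sum[of \<chi> L "%w. iU (\<phi> w) w" P] by (simp add: L_def)
 also have "\<dots> = (\<Sum>w\<in>P. Dc (2 * L) \<chi> (\<phi> w) w)"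
  by (rule sum.cong[OF refl]) (rule lev2_Ub[OF s len(2,1)])
 also have "\<dots> = (\<Sum>w\<in>\<phi> ` P. psi (2 * L) \<chi> w) - (\<Sum>w\<in>P. psi (2 * L) \<chi> w)"
  by (simp add: Dc_def sum_subtractf sum.reindex[OF inj])
 also have "(\<Sum>w\<in>P. psi (2 * L) \<chi> w) =
   (\<Sum>w\<in>B. psi (2 * L) \<chi> w) + (\<Sum>e\<in>arcs Q. int (count ms e) * (Aop ^^ (2 * L)) \<chi> e)"
  by (rule reach_sum[OF r(1) B psi_children]) (use len in fastforce)+
 also have "(\<Sum>w\<in>\<phi> ` P. psi (2 * L) \<chi> w) =
   (\<Sum>w\<in>B. psi (2 * L) \<chi> w) + (\<Sum>e\<in>arcs Q. int (count ms' e) * (Aop ^^ (2 * L)) \<chi> e)"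
  by (rule reach_sum[OF r(2) B psi_children]) (use len in fastforce)+
 finally have "(\<Sum>e\<in>arcs Q. c e * (Aop ^^ (2 * L)) \<chi> e) = 0"
  by (simp add: c_def left_diff_distrib sum_subtractf)
 then have "(\<Sum>x\<in>arcs Q. c x * \<chi> x) = 0" unfolding pow .
 moreover have "(\<Sum>x\<in>arcs Q. c x * \<chi> x) = (\<Sum>x\<in>arcs Q. if x = e then c x else 0)"
  by (rule sum.cong[OF refl]) (simp add: \<chi>_def)
 ultimately have "c e = 0" using e finite_arcs by (simp add: sum.delta)
 then show ?thesis by (simp add: c_def)
qed

lemma reach_arcs: "reach B P ms ==> part B S ==> set_mset ms \<subseteq> arcs Q"
proof (induction rule: reach.induct)
 case (reach_step P ms w)
 have "w \<in> words" using partD(2)[OF reach_part[OF reach_step.hyps(1) reach_step.prems]] reach_step.hyps(2) by blast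
 then show ?case using reach_step last_in_arcs by simp
qed simp

lemma reach_counts_eq:
 assumes "reach B P ms" "reach B P' ms'" "part B S" "!!e. e \<in> arcs Q ==> count ms e = count ms' e"
 shows "ms = ms'"
proof (rule multiset_eqI)
 fix e
 show "count ms e = count ms' e"
 proof (cases "e \<in> arcs Q")
  case False
  then have "e \<notin># ms" "e \<notin># ms'" using reach_arcs[OF assms(1,3)] reach_arcs[OF assms(2,3)] by blast+
  then show ?thesis by (simp add: not_in_iff)
 qed (rule assms(4))
qed

text \<open>The swap \<open>t\<close> makes a cylinder available, from which the stock for the
  normal form is taken. Membership in \<open>TN Y\<close> then only requires equal expansion counts,
  which the kernel of the index and perfectness obtain in different ways.\<close>

lemma TN_reduction:
 assumes Y: "clop Y L" "Y ~= {}" and a: "a \<in> Gam Y"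
 shows "\<exists>t\<in>TT Y. \<exists>S L' B P \<phi> ms ms'. clop S L' & S \<subseteq> Y & t \<circ> a \<in> Gam S & part B S & part P S &
  (\<forall>w\<in>P. tb (t \<circ> a) w (\<phi> w)) & reach B P ms & reach B (\<phi> ` P) ms' & (ms = ms' --> a \<in> TN Y)"
proof -
 obtain u c t where u: "u \<in> words" "c \<in> words" "t \<in> TT (Y - cyl u)" "cyl u \<subseteq> Y" "cyl c \<subseteq> Y"
  "t \<circ> a \<in> Gam (Y - cyl c)" "t \<circ> t = id"
  using fix_cylinder[OF Y a] by blast
 let ?S = "Y - cyl c" and ?L = "max L (length c)"
 have S: "clop ?S ?L"
  using clop_diff[OF clop_mono[OF Y(1), of ?L] clop_mono[OF clop_cyl[OF u(2)], of ?L]] by simp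
 note B = part_level[OF S]
 obtain P \<phi> ms ms' where P: "part P ?S" "\<forall>w\<in>P. tb (t \<circ> a) w (\<phi> w)"
  "reach ((%x. pfx x ?L) ` ?S) P ms" "reach ((%x. pfx x ?L) ` ?S) (\<phi> ` P) ms'"
  using table_exists[OF S u(6)] by blast
 have "a \<in> TN Y" if e: "ms = ms'"
 proof -
  have t: "tb (t \<circ> a) w (\<phi> w)" if "w \<in> P" for w using P(2) that by blast
  have "cyl c \<inter> ?S = {}" by blast
  from equal_expansions_TT[OF B P(1) u(6) t P(3) P(4)[folded e] u(2) this]
  obtain u' where u': "u' \<in> words" "cyl u' \<subseteq> cyl c" "t \<circ> a \<in> TT (?S \<union> cyl c - cyl u')" by blast
  have "?S \<union> cyl c - cyl u' = Y - cyl u'" using u(5) by blast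
  then have "t \<circ> a \<in> TT (Y - cyl u')" using u'(3) by simp
  moreover have "a = t \<circ> (t \<circ> a)" unfolding o_assoc u(7) by simp
  moreover have "cyl u' \<subseteq> Y" using u'(2) u(5) by blast
  ultimately show ?thesis using u(1,3,4) u'(1) unfolding TN_def by blast
 qed
 moreover have "t \<in> TT Y" using u(3) TT_mono[of "Y - cyl u" Y] by blast
 moreover have "?S \<subseteq> Y" by blast
 ultimately show ?thesis using S u(6) B P by (intro bexI[of _ t] exI conjI impI) 
qed

text \<open>Transpositions have trivial index, so the reduced element still has trivial index, and
  \<open>counts_equal\<close> applies to its table.\<close>

lemma kernel_TN:
 assumes Y: "clop Y L" "Y ~= {}" and a: "a \<in> Gam Y" and z: "indicator (Us Y a) \<in> Bd X"
 shows "a \<in> TN Y"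
proof -
 obtain t S L' B P \<phi> ms ms' where t: "t \<in> TT Y" and S: "clop S L'" "S \<subseteq> Y" "t \<circ> a \<in> Gam S" "part B S" "part P S"
  "\<forall>w\<in>P. tb (t \<circ> a) w (\<phi> w)" and r: "reach B P ms" "reach B (\<phi> ` P) ms'" and TN: "ms = ms' --> a \<in> TN Y"
  using TN_reduction[OF Y a] by (elim bexE exE conjE)
 have tb: "tb (t \<circ> a) w (\<phi> w)" if "w \<in> P" for w using S(6) that by blast
 note YX = clop_X_level(1)[OF Y(1)]
 have 1: "indicator (Us Y (t \<circ> a)) \<in> Bd X"
  using Us_comp_Bd[OF Y(1) TT_Gam[OF t] Us_TT[OF Y(1) t] a clop_X YX] z by blast
 have "(%z. indicator (Us Y (t \<circ> a)) z - indicator (Us S (t \<circ> a)) z) \<in> Bd X"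
  using Bd_subset[OF Y(1) clop_X YX Us_extend[OF Y(1) S(1-3)]] .
 from Bd_diff[OF clop_X 1 this] have "indicator (Us S (t \<circ> a)) \<in> Bd X" by simp
 moreover have "indicator (Us S (t \<circ> a)) = (%z. \<Sum>w\<in>P. (iU (\<phi> w) w z :: int))"
  by (rule ext) (rule Us_indicator[OF S(5) tb])
 ultimately have f: "(%z. \<Sum>w\<in>P. iU (\<phi> w) w z) \<in> Bd X" by (simp only:)
 have inj: "inj_on \<phi> P" using part_image(2)[OF S(3) S(5) tb] .
 have s: "same (\<phi> w) w" if "w \<in> P" for w using tb_same[OF tb[OF that]] .
 have "ms = ms'"
  by (rule reach_counts_eq[OF r S(4)]) (rule counts_equal[OF S(4) S(5) r inj s f])
 then show ?thesis using TN by blast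
qed

lemma TN_kernel: "clop Y L ==> a \<in> TN Y ==> indicator (Us Y a) \<in> Bd Y"
 using Us_TT TN_Gam by blast

end

context sft_basis
begin

section \<open>From surjectivity modulo two to injectivity over the integers\<close>

lemma arc_relation_lookup:
 "Poly_Mapping.lookup (bvec e + (\<Sum>f\<in>nx e. bvec f)) f = of_bool (e = f) + of_bool (f \<in> nx e)"
proof -
 have "(\<Sum>g\<in>nx e. Poly_Mapping.lookup (bvec g) f) = (\<Sum>g\<in>nx e. if g = f then 1 else (0::bit))"
  by (rule sum.cong) (simp_all add: lookup_single when_def)
 also have "\<dots> = of_bool (f \<in> nx e)" by (subst sum.delta) simp_all
 finally show ?thesis by (simp only: lookup_add lookup_sum lookup_single when_def) simp
qed

text \<open>If the quotient is trivial, every vector is a sum of relations: the map given by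
  identity minus adjacency is onto modulo two.\<close>

lemma arc_relation_span:
 fixes x :: "'e \<Rightarrow>\<^sub>0 bit"
 assumes E: "carrier EE = {\<one>\<^bsub>EE\<^esub>}"
 shows "\<exists>s. \<forall>f\<in>arcs Q. Poly_Mapping.lookup x f = (\<Sum>e\<in>arcs Q. s e * (of_bool (e = f) + of_bool (f \<in> nx e)))"
proof -
 have "coord x = \<one>\<^bsub>EE\<^esub>" using coord_EE[of x] E by blast
 then have c0: "coord x = (%_. 0)" by (simp only: EE_simps)
 have "chi b x = 0" if "b \<in> BB" for b using fun_cong[OF c0, of b] that by (simp only: coord_def if_True)
 then have "x \<in> bitvec.span ({bvec e + (\<Sum>f\<in>nx e. bvec f) | e. e \<in> arcs Q} \<union> {bvec e | e. e \<notin> arcs Q})"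
  by (rule chi_span)
 then show ?thesis
 proof (induction rule: bitvec.span_induct_alt)
  case base
  show ?case by (rule exI[of _ "%_. 0"]) simp
 next
  case (step c r y)
  then obtain s where s: "\<forall>f\<in>arcs Q. Poly_Mapping.lookup y f = (\<Sum>e\<in>arcs Q. s e * (of_bool (e = f) + of_bool (f \<in> nx e)))"
   by blast
  show ?case
  proof (cases "c = 0")
   case True
   then have e: "bscale c r + y = y" by (simp add: bscale_def)
   show ?thesis unfolding e by (rule exI[of _ s]) (rule s)
  next
   case False
   then have c: "bscale c r = r" by (simp add: bscale_def)
   consider e where "e \<in> arcs Q" "r = bvec e + (\<Sum>f\<in>nx e. bvec f)" | e where "e \<notin> arcs Q" "r = bvec e"
    using step(1) by blast
   then show ?thesis
   proof cases
    case (1 e)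
    show ?thesis unfolding c
    proof (intro exI[of _ "%x. of_bool (x = e) + s x"] ballI)
     fix f assume f: "f \<in> arcs Q"
     have "(\<Sum>x\<in>arcs Q. (of_bool (x = e) + s x) * (of_bool (x = f) + of_bool (f \<in> nx x))) =
       (\<Sum>x\<in>arcs Q. if x = e then of_bool (e = f) + of_bool (f \<in> nx e) else (0::bit)) +
       (\<Sum>x\<in>arcs Q. s x * (of_bool (x = f) + of_bool (f \<in> nx x)))"
      unfolding sum.distrib[symmetric]
     proof (rule sum.cong[OF refl])
      fix x
      show "(of_bool (x = e) + s x) * (of_bool (x = f) + of_bool (f \<in> nx x)) =
       (if x = e then of_bool (e = f) + of_bool (f \<in> nx e) else (0::bit)) +
       s x * (of_bool (x = f) + of_bool (f \<in> nx x))"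
       by (cases "x = e") (simp_all only: distrib_right of_bool_eq if_True if_False mult_1 add_0_left simp_thms)
     qed
     also have "(\<Sum>x\<in>arcs Q. if x = e then of_bool (e = f) + of_bool (f \<in> nx e) else (0::bit)) =
       Poly_Mapping.lookup r f"
      unfolding 1(2) arc_relation_lookup using 1(1) by (subst sum.delta[OF finite_arcs]) (simp only: if_True)
     also have "(\<Sum>x\<in>arcs Q. s x * (of_bool (x = f) + of_bool (f \<in> nx x))) = Poly_Mapping.lookup y f"
      using bspec[OF s f] by (rule sym)
     finally show "Poly_Mapping.lookup (r + y) f =
       (\<Sum>x\<in>arcs Q. (of_bool (x = e) + s x) * (of_bool (x = f) + of_bool (f \<in> nx x)))"
      by (simp only: lookup_add)
    qed
   next
    case (2 e)
    have h: "Poly_Mapping.lookup (r + y) f = Poly_Mapping.lookup y f" if "f \<in> arcs Q" for f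
    proof -
     have "Poly_Mapping.lookup r f = 0" using 2 that by (auto simp: lookup_single when_def)
     then show ?thesis by (simp only: lookup_add add_0_left)
    qed
    show ?thesis unfolding c
     by (rule exI[of _ s], rule ballI) (rule trans[OF h bspec[OF s]])
   qed
  qed
 qed
qed

text \<open>A surjection of the finite set of bit vectors on the arcs onto itself is
  injective.\<close>

lemma arc_relation_inj:
 assumes E: "carrier EE = {\<one>\<^bsub>EE\<^esub>}" and e: "e \<in> arcs Q"
  and s: "!!f. f \<in> arcs Q ==> (\<Sum>e\<in>arcs Q. s e * (of_bool (e = f) + of_bool (f \<in> nx e))) = (0::bit)"
 shows "s e = 0"
proof -
 let ?A = "arcs Q \<rightarrow>\<^sub>E (UNIV :: bit set)"
 define T where "T s = restrict (%f. \<Sum>e\<in>arcs Q. s e * (of_bool (e = f) + of_bool (f \<in> nx e))) (arcs Q)" for s :: "'e => bit"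
 have Tr: "T (restrict s (arcs Q)) = T s" for s unfolding T_def
  by (rule restrict_ext) (rule sum.cong, simp_all only: restrict_apply if_True)
 have bU: "(UNIV :: bit set) = {0, 1}" using bit.exhaust by blast
 have "finite (UNIV :: bit set)" unfolding bU by simp
 then have "finite ?A" using finite_arcs by (intro finite_PiE)
 moreover have "?A \<subseteq> T ` ?A"
 proof
  fix y assume y: "y \<in> ?A"
  let ?y = "%f. if f \<in> arcs Q then y f else 0"
  have "finite {x. ?y x ~= 0}" by (rule finite_subset[OF _ finite_arcs]) auto
  then have l: "Poly_Mapping.lookup (Abs_poly_mapping ?y) = ?y" by (intro Abs_poly_mapping_inverse) simp
  obtain s where s: "\<forall>f\<in>arcs Q. Poly_Mapping.lookup (Abs_poly_mapping ?y) f =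
    (\<Sum>e\<in>arcs Q. s e * (of_bool (e = f) + of_bool (f \<in> nx e)))"
   using arc_relation_span[OF E, of "Abs_poly_mapping ?y"] by (elim exE)
  have "T s = y"
  proof
   fix f
   show "T s f = y f"
   proof (cases "f \<in> arcs Q")
    case True
    then have "T s f = (\<Sum>e\<in>arcs Q. s e * (of_bool (e = f) + of_bool (f \<in> nx e)))"
     unfolding T_def by (simp only: restrict_apply if_True)
    also have "\<dots> = Poly_Mapping.lookup (Abs_poly_mapping ?y) f" using bspec[OF s True] by (rule sym)
    finally show ?thesis unfolding l using True by (simp only: if_True)
   next
    case False
    then show ?thesis using PiE_arb[OF y False] unfolding T_def by (simp only: restrict_apply if_False)
   qed
  qed
  then have "T (restrict s (arcs Q)) = y" unfolding Tr .
  moreover have "restrict s (arcs Q) \<in> ?A" by simp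
  ultimately show "y \<in> T ` ?A" by blast
 qed
 ultimately have inj: "inj_on T ?A" by (rule finite_surj_inj)
 have "T (restrict s (arcs Q)) = T (restrict (%_. 0) (arcs Q))"
  unfolding Tr unfolding T_def by (rule restrict_ext) (simp only: s mult_zero_left sum.neutral_const)
 then have "restrict s (arcs Q) = restrict (%_. 0) (arcs Q)"
  by (rule inj_onD[OF inj]) simp_all
 from fun_cong[OF this, of e] show ?thesis using e by (simp only: restrict_apply if_True)
qed

lemma invariant_even:
 assumes E: "carrier EE = {\<one>\<^bsub>EE\<^esub>}" and e: "e \<in> arcs Q"
  and c: "!!f. f \<in> arcs Q ==> (\<Sum>e\<in>arcs Q. c e * (of_bool (f \<in> nx e) - of_bool (e = f))) = (0::int)"
 shows "even (c e)"
proof -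
 have o: "of_int k = (of_bool (odd k) :: bit)" for k :: int
 proof (cases "even k")
  case True
  then obtain m where "k = 2 * m" by blast
  then show ?thesis using True by simp
 next
  case False
  then obtain m where "k = 2 * m + 1" by (elim oddE)
  then show ?thesis using False by simp
 qed
 have d: "a - b = b + (a::bit)" for a b by (cases a; cases b) simp_all
 have "(of_int (c e) :: bit) = 0"
 proof (rule arc_relation_inj[OF E e])
  fix f assume f: "f \<in> arcs Q"
  have "(0::bit) = of_int (\<Sum>e\<in>arcs Q. c e * (of_bool (f \<in> nx e) - of_bool (e = f)))"
   unfolding c[OF f] by (simp only: of_int_0)
  also have "\<dots> = (\<Sum>e\<in>arcs Q. of_int (c e) * (of_bool (e = f) + of_bool (f \<in> nx e)))"
   by (simp only: of_int_sum of_int_mult of_int_diff of_int_of_bool d)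
  finally show "(\<Sum>e\<in>arcs Q. (of_int (c e) :: bit) * (of_bool (e = f) + of_bool (f \<in> nx e))) = 0" ..
 qed
 then show ?thesis unfolding o by (simp split: if_splits)
qed

text \<open>All entries are even by reduction modulo two, and halving them keeps the equation, so
  every power of two divides them.\<close>

lemma invariant_zero:
 assumes E: "carrier EE = {\<one>\<^bsub>EE\<^esub>}" and e: "e \<in> arcs Q"
  and c: "!!f. f \<in> arcs Q ==> (\<Sum>e\<in>arcs Q. c e * (of_bool (f \<in> nx e) - of_bool (e = f))) = (0::int)"
 shows "c e = 0"
proof -
 have "2 ^ k dvd c e" for k
  using c
 proof (induction k arbitrary: c)
  case (Suc k)
  have ev: "c x = 2 * (c x div 2)" if "x \<in> arcs Q" for x using invariant_even[OF E that Suc.prems] by simp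
  have "(\<Sum>e\<in>arcs Q. (c e div 2) * (of_bool (f \<in> nx e) - of_bool (e = f))) = (0::int)" if f: "f \<in> arcs Q" for f
  proof -
   have "2 * (\<Sum>e\<in>arcs Q. (c e div 2) * (of_bool (f \<in> nx e) - of_bool (e = f))) =
     (\<Sum>e\<in>arcs Q. c e * (of_bool (f \<in> nx e) - of_bool (e = f)))"
    unfolding sum_distrib_left by (rule sum.cong[OF refl]) (metis ev mult.assoc)
   then show ?thesis using Suc.prems[OF f] by simp
  qed
  from Suc.IH[OF this] have "2 ^ k dvd c e div 2" .
  then have "2 * 2 ^ k dvd 2 * (c e div 2)" by (rule mult_dvd_mono[OF dvd_refl])
  then show ?case unfolding ev[OF e, symmetric] by simp
 qed simp
 \<comment> \<open>The exponent is the absolute value of the entry itself, which is smaller than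
   that power of two.\<close>
 then have d: "2 ^ nat \<bar>c e\<bar> dvd \<bar>c e\<bar>" by simp
 show ?thesis
 proof (rule ccontr)
  assume "c e ~= 0"
  then have "\<bar>c e\<bar> > 0" by simp
  moreover have "\<bar>c e\<bar> < 2 ^ nat \<bar>c e\<bar>"
   using of_nat_less_two_power[of "nat \<bar>c e\<bar>", where 'a=int] by simp
  ultimately show False using d zdvd_not_zless by blast
 qed
qed

text \<open>The difference of the expansion counts solves the invariance equation, tested on point
  masses, and hence vanishes.\<close>

lemma all_TN:
 assumes E: "carrier EE = {\<one>\<^bsub>EE\<^esub>}" and Y: "clop Y L" "Y ~= {}" and a: "a \<in> Gam Y"
 shows "a \<in> TN Y"
proof -
 obtain t S L' B P \<phi> ms ms' where t: "t \<in> TT Y" and S: "clop S L'" "S \<subseteq> Y" "t \<circ> a \<in> Gam S" "part B S" "part P S"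
  "\<forall>w\<in>P. tb (t \<circ> a) w (\<phi> w)" and r: "reach B P ms" "reach B (\<phi> ` P) ms'" and TN: "ms = ms' --> a \<in> TN Y"
  using TN_reduction[OF Y a] by (elim bexE exE conjE)
 have tb: "tb (t \<circ> a) w (\<phi> w)" if "w \<in> P" for w using S(6) that by blast
 have inj: "inj_on \<phi> P" using part_image(2)[OF S(3) S(5) tb] .
 have s: "same (\<phi> w) w" if "w \<in> P" for w using tb_same[OF tb[OF that]] .
 define c where "c e = int (count ms' e) - int (count ms e)" for e
 have inv: "(\<Sum>e\<in>arcs Q. c e * Aop \<chi> e) = (\<Sum>e\<in>arcs Q. c e * \<chi> e)" for \<chi>
  unfolding c_def by (rule counts_invariant[OF S(4,5) r inj s])
 have "c e = 0" if e: "e \<in> arcs Q" for e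
 proof (rule invariant_zero[OF E e])
  fix f assume "f \<in> arcs Q"
  have "Aop (%x. of_bool (x = f)) e = of_bool (f \<in> nx e)" for e
  proof -
   have "Aop (%x. of_bool (x = f)) e = (\<Sum>x\<in>nx e. if x = f then 1 else 0)"
    unfolding Aop_def by (rule sum.cong) simp_all
   also have "\<dots> = of_bool (f \<in> nx e)" by (subst sum.delta) simp_all
   finally show ?thesis .
  qed
  then show "(\<Sum>e\<in>arcs Q. c e * (of_bool (f \<in> nx e) - of_bool (e = f))) = 0"
   using inv[of "%x. of_bool (x = f)"] unfolding right_diff_distrib sum_subtractf by simp
 qed
 then have "ms = ms'" by (intro reach_counts_eq[OF r S(4)]) (simp add: c_def)
 then show ?thesis using TN by blast
qed

lemma derived_all:
 assumes E: "carrier EE = {\<one>\<^bsub>EE\<^esub>}" and Y: "clop Y L" "Y ~= {}" and a: "a \<in> Gam Y"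
 shows "a \<in> derived (GG Y) (Gam Y)"
 by (rule kernel_Sg[OF Y(1) all_TN[OF E Y a]]) (use Sg_EE[OF Y(1) a] E in blast)

end

section \<open>Topological full groups\<close>

context sft
begin

text \<open>Transport from sequences to the unit space; the restriction makes the result
  extensional, as the full group demands.\<close>

definition lft :: "(nat => 'e) set => ((nat => 'e) => nat => 'e) => 'e sft_arrow => 'e sft_arrow" where
 "lft Y a = restrict (%u. sft_unit (a (fst u))) (sft_unit ` Y)"

lemma fst_unit [simp]: "fst (sft_unit x) = x"
 by (simp add: sft_unit_def)

lemma lft_apply: "x \<in> Y ==> lft Y a (sft_unit x) = sft_unit (a x)"
 by (simp add: lft_def)

lemma dg_exists: "a \<in> Gam Y ==> x \<in> X ==> \<exists>n. dg a x n"
proof -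
 assume "a \<in> Gam Y" and x: "x \<in> X"
 then obtain n v where "tb a (pfx x n) v" using Gam_tb[of a Y x 0] by metis
 then show ?thesis using dg_eq[of a "pfx x n" v x] x by simp
qed

lemma dg_unique: "dg a x n ==> dg a x m ==> n = m"
 using dg_eq unfolding dg_def[of a x n] by metis

lemma Us_src:
 assumes Y: "Y \<subseteq> X" and a: "a \<in> Gam Y" shows "srcQ ` Us Y a = sft_unit ` Y"
proof
 show "sft_unit ` Y \<subseteq> srcQ ` Us Y a"
 proof
  fix u assume "u \<in> sft_unit ` Y"
  then obtain x where x: "x \<in> Y" "u = sft_unit x" by blast
  obtain n where "dg a x n" using dg_exists[OF a, of x] x(1) Y by blast
  then have "(a x, n, x) \<in> Us Y a" using x(1) by (auto simp: Us_def)
  then show "u \<in> srcQ ` Us Y a" unfolding x(2) by (rule rev_image_eqI) simp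
 qed
qed (auto simp: Us_def)

lemma Us_rng:
 assumes Y: "Y \<subseteq> X" and a: "a \<in> Gam Y" shows "rngQ ` Us Y a = sft_unit ` Y"
proof
 show "rngQ ` Us Y a \<subseteq> sft_unit ` Y" using Gam_maps[OF a] by (auto simp: Us_def)
 show "sft_unit ` Y \<subseteq> rngQ ` Us Y a"
 proof
  fix u assume "u \<in> sft_unit ` Y"
  then obtain y where y: "y \<in> Y" "u = sft_unit y" by blast
  have "y \<in> a ` Y" unfolding Gam_image[OF a] by (rule y(1))
  then obtain x where x: "x \<in> Y" "u = sft_unit (a x)" using y(2) by blast
  obtain n where "dg a x n" using dg_exists[OF a, of x] x(1) Y by blast
  then have "(a x, n, x) \<in> Us Y a" using x(1) by (auto simp: Us_def)
  then show "u \<in> rngQ ` Us Y a" unfolding x(2) by (rule rev_image_eqI) simp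
 qed
qed

lemma Us_inj:
 assumes a: "a \<in> Gam Y"
 shows "inj_on (srcQ) (Us Y a)" "inj_on (rngQ) (Us Y a)"
 using dg_unique Gam_inj[OF a] by (auto simp: inj_on_def Us_def)

lemma Us_Union:
 assumes P: "part P Y" and t: "!!w. w \<in> P ==> tb a w (\<phi> w)"
 shows "Us Y a = (\<Union>w\<in>P. Ub (\<phi> w) w)"
proof (rule subset_antisym; rule subsetI)
 fix z assume z: "z \<in> Us Y a"
 obtain x' n x where zx: "z = (x', n, x)" by (cases z)
 have x: "x \<in> Y" using z zx by (auto simp: Us_def)
 obtain w where w: "w \<in> P" "x \<in> cyl w" using part_point[OF P x] by blast
 have "z \<in> Ub (\<phi> w) w" using Us_Ub[OF t[OF w(1)] w(2) x] z zx by simp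
 then show "z \<in> (\<Union>w\<in>P. Ub (\<phi> w) w)" using w(1) by blast
next
 fix z assume "z \<in> (\<Union>w\<in>P. Ub (\<phi> w) w)"
 then obtain w where w: "w \<in> P" "z \<in> Ub (\<phi> w) w" by blast
 obtain x' n x where zx: "z = (x', n, x)" by (cases z)
 have x: "x \<in> cyl w" using w(2) zx by (auto simp: Ub_def)
 then have "x \<in> Y" using partD(5)[OF P w(1)] by blast
 then show "z \<in> Us Y a" using Us_Ub[OF t[OF w(1)] x] w(2) zx by simp
qed

lemma represents_Us:
 assumes Y: "clop Y L" and a: "a \<in> Gam Y" shows "represents (GR Y) (Us Y a) (lft Y a)"
proof -
 note YX = clop_X_level(1)[OF Y]
 obtain P \<phi> where P: "part P Y" "\<forall>w\<in>P. tb a w (\<phi> w)" using Gam_table[OF Y a, of 0] by blast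
 have t: "tb a w (\<phi> w)" if "w \<in> P" for w using P(2) that by blast
 have U: "Us Y a = (\<Union>w\<in>P. Ub (\<phi> w) w)" by (rule Us_Union[OF P(1) t])
 have s: "same (\<phi> w) w" "cyl (\<phi> w) \<subseteq> Y" "cyl w \<subseteq> Y" if "w \<in> P" for w
  using tb_same[OF t[OF that]] partD(5)[OF P(1) that] tb_Gam_in[OF a t[OF that]] by blast+
 have "openin (gtop (GR Y)) (Us Y a)"
  unfolding U by (rule openin_Union) (use openin_Ub_GR[OF s] in blast)
 moreover have "compactin (gtop (GR Y)) (Us Y a)"
  unfolding U by (rule compactin_Union) (use compactin_Ub[OF Y s] partD(1)[OF P(1)] in auto)
 moreover have "Us Y a \<subseteq> topspace (gtop (GR Y))" using calculation(1) by (rule openin_subset)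
 moreover have "lft Y a = G_set_map (GR Y) (Us Y a)"
  unfolding G_set_map_def src_reduction rng_reduction Us_src[OF YX a] lft_def
 proof (rule restrict_ext)
  fix u assume "u \<in> sft_unit ` Y"
  then obtain x where x: "x \<in> Y" "u = sft_unit x" by blast
  obtain n where "dg a x n" using dg_exists[OF a, of x] x(1) YX by blast
  then have m: "(a x, n, x) \<in> Us Y a" using x(1) by (auto simp: Us_def)
  have "inv_into (Us Y a) (srcQ) (srcQ (a x, n, x)) = (a x, n, x)"
   by (rule inv_into_f_f[OF Us_inj(1)[OF a] m])
  then show "sft_unit (a (fst u)) = (rngQ \<circ> inv_into (Us Y a) (srcQ)) u"
   using x(2) by simp
 qed
 ultimately show ?thesis
  unfolding represents_def G_set_def src_reduction rng_reduction units_GR[OF YX]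
  using Us_inj[OF a] Us_src[OF YX a] Us_rng[OF YX a] by blast
qed

lemma represents_point:
 assumes Y: "Y \<subseteq> X" and r: "represents (GR Y) U \<alpha>" and g: "(x', n, x) \<in> U"
 shows "x \<in> Y" "\<alpha> (sft_unit x) = sft_unit x'"
proof -
 have inj: "inj_on (srcQ) U" and im: "srcQ ` U = sft_unit ` Y"
  and \<alpha>: "\<alpha> = G_set_map (GR Y) U"
  using r unfolding represents_def G_set_def src_reduction units_GR[OF Y] by blast+
 have u: "sft_unit x \<in> srcQ ` U" using g by (rule rev_image_eqI) simp
 then show "x \<in> Y" unfolding im by auto
 have "inv_into U (srcQ) (srcQ (x', n, x)) = (x', n, x)"
  by (rule inv_into_f_f[OF inj g])
 then show "\<alpha> (sft_unit x) = sft_unit x'" unfolding \<alpha> G_set_map_def src_reduction rng_reduction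
  using u by simp
qed

lemma represents_local:
 assumes Y: "clop Y L" and r: "represents (GR Y) U \<alpha>" and g: "(x', n, x) \<in> U"
 shows "\<exists>v w. same v w & w = pfx x (length w) & cyl w \<subseteq> Y & n = int (length v) - int (length w) &
  (\<forall>y\<in>cyl w. \<alpha> (sft_unit y) = sft_unit (rp w v y))"
proof -
 note YX = clop_X_level(1)[OF Y]
 have "openin (gtop (GR Y)) U" using r by (simp add: represents_def)
 from openin_GR_Ub[OF Y this g] obtain v w where v: "same v w" "cyl v \<subseteq> Y" "cyl w \<subseteq> Y" "(x', n, x) \<in> Ub v w"
  "Ub v w \<subseteq> U" "v = pfx x' (length v)" "w = pfx x (length w)" by blast
 have "\<alpha> (sft_unit y) = sft_unit (rp w v y)" if y: "y \<in> cyl w" for y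
 proof (rule represents_point(2)[OF YX r])
  show "(rp w v y, int (length v) - int (length w), y) \<in> U" using y v(5) by (auto simp: Ub_def)
 qed
 moreover have "n = int (length v) - int (length w)" using v(4) in_Ub[OF v(1)] by blast
 ultimately show ?thesis using v(1,3,7) by blast
qed

text \<open>Near each of its arrows \<open>U\<close> is the graph of a prefix replacement, which is
  a row of \<open>a\<close>; uniqueness of the degree then determines the arrow.\<close>

lemma represents_unique:
 assumes Y: "clop Y L" and r: "represents (GR Y) U (lft Y a)"
 shows "U = Us Y a"
proof -
 note YX = clop_X_level(1)[OF Y]
 have sub: "z \<in> Us Y a" if "z \<in> U" for z
 proof -
  obtain x' n x where z: "z = (x', n, x)" by (cases z)
  have g: "(x', n, x) \<in> U" using that z by simp
  have x: "x \<in> Y" "x' = a x" using represents_point[OF YX r g] lft_apply[of x Y a] by auto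
  obtain v w where v: "same v w" "w = pfx x (length w)" "cyl w \<subseteq> Y" "n = int (length v) - int (length w)"
   "\<forall>y\<in>cyl w. lft Y a (sft_unit y) = sft_unit (rp w v y)"
   using represents_local[OF Y r g] by blast
  have "a y = rp w v y" if y: "y \<in> cyl w" for y
   using v(5) y lft_apply[of y Y a] v(3) by (metis inj_sft_unit subsetD)
  then have "tb a w v" using v(1) by (simp add: tb_def same_def)
  moreover have "x \<in> cyl w" using in_cyl_pfx[of x "length w"] x(1) YX v(2) by auto
  ultimately have "dg a x n" using v(4) by (auto simp: dg_def)
  then show ?thesis using x z by (auto simp: Us_def)
 qed
 have "Us Y a \<subseteq> U"
 proof
  fix z assume "z \<in> Us Y a"
  then obtain x n where z: "z = (a x, n, x)" "x \<in> Y" "dg a x n" by (auto simp: Us_def)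
  have "sft_unit x \<in> srcQ ` U"
   using r z(2) unfolding represents_def src_reduction units_GR[OF YX] by blast
  then obtain g where g: "g \<in> U" "srcQ g = sft_unit x" by auto
  obtain m where "g = (a x, m, x)" "dg a x m" using sub[OF g(1)] g(2) by (auto simp: Us_def)
  then show "z \<in> U" using g(1) z dg_unique by metis
 qed
 then show ?thesis using sub by blast
qed

lemma the_represents:
 assumes Y: "clop Y L" and a: "a \<in> Gam Y" shows "(THE U. represents (GR Y) U (lft Y a)) = Us Y a"
 using represents_Us[OF Y a] represents_unique[OF Y] by (rule the_equality)

section \<open>Isomorphism with the topological full group\<close>

lemma lft_continuous:
 assumes Y: "clop Y L" and a: "a \<in> Gam Y"
 shows "continuous_map (unit_top (GR Y)) (unit_top (GR Y)) (lft Y a)"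
 unfolding continuous_map_def topspace_unit_GR[OF clop_X_level(1)[OF Y]]
proof (intro conjI allI impI)
 note YX = clop_X_level(1)[OF Y]
 show "lft Y a \<in> sft_unit ` Y \<rightarrow> sft_unit ` Y" using lft_apply Gam_maps[OF a] by auto
 fix U assume U: "openin (unit_top (GR Y)) U"
 show "openin (unit_top (GR Y)) {u \<in> sft_unit ` Y. lft Y a u \<in> U}"
 proof (subst openin_subopen, intro ballI)
  fix u assume "u \<in> {u \<in> sft_unit ` Y. lft Y a u \<in> U}"
  then obtain x where x: "x \<in> Y" "u = sft_unit x" "sft_unit (a x) \<in> U" by (auto simp: lft_apply)
  have xX: "x \<in> X" using x(1) YX by blast
  from openin_unit_ex[OF Y U x(3)] obtain w where w: "w \<in> words" "a x \<in> cyl w" "sft_unit ` cyl w \<subseteq> U" by blast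
  obtain n v where n: "n > 0" "n \<ge> L + length w" "length v \<ge> L + length w" "tb a (pfx x n) v"
   using Gam_tb[OF a xX, of "L + length w"] by metis
  have ax: "a x \<in> cyl v" using tb_in_cyl[OF n(4)] xX by simp
  have "cyl v \<subseteq> cyl w" using cyl_prefix[OF cyl_meet[OF w(2) ax]] n(3) by simp
  have c: "cyl (pfx x n) \<subseteq> Y" using clopD[OF clop_mono[OF Y, of n] x(1)] n(2) by auto
  have "sft_unit y \<in> {u \<in> sft_unit ` Y. lft Y a u \<in> U}" if y: "y \<in> cyl (pfx x n)" for y
  proof -
   have yY: "y \<in> Y" using y c by blast
   have "a y \<in> cyl w" using tb_in_cyl[OF n(4) y] \<open>cyl v \<subseteq> cyl w\<close> by blast
   then show ?thesis using w(3) lft_apply[OF yY, of a] yY by auto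
  qed
  then have "sft_unit ` cyl (pfx x n) \<subseteq> {u \<in> sft_unit ` Y. lft Y a u \<in> U}" by (rule image_subsetI)
  moreover have "openin (unit_top (GR Y)) (sft_unit ` cyl (pfx x n))"
   by (rule openin_unit_cyl[OF YX pfx_words[OF xX n(1)] c])
  moreover have "u \<in> sft_unit ` cyl (pfx x n)" using x(2) xX by simp
  ultimately show "\<exists>T. openin (unit_top (GR Y)) T & u \<in> T & T \<subseteq> {u \<in> sft_unit ` Y. lft Y a u \<in> U}" by blast
 qed
qed

lemma lft_Bij: assumes a: "a \<in> Gam Y" shows "lft Y a \<in> Bij (sft_unit ` Y)"
proof -
 have "inj_on (lft Y a) (sft_unit ` Y)" using Gam_inj[OF a] by (auto simp: inj_on_def lft_apply)
 moreover have "lft Y a ` sft_unit ` Y = sft_unit ` a ` Y"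
  unfolding image_image by (rule image_cong[OF refl]) (rule lft_apply)
 ultimately show ?thesis unfolding Bij_def bij_betw_def Gam_image[OF a] by (simp add: lft_def)
qed

lemma lft_carrier:
 assumes Y: "clop Y L" and a: "a \<in> Gam Y" shows "lft Y a \<in> carrier (full_group (GR Y))"
proof -
 note YX = clop_X_level(1)[OF Y]
 note b = inv_Gam[OF a YX]
 have i: "inv_into UNIV a (a x) = x" "a (inv_into UNIV a x) = x" for x
  using GamD(1)[OF a] by (simp_all add: bij_def surj_f_inv_f)
 have "homeomorphic_maps (unit_top (GR Y)) (unit_top (GR Y)) (lft Y a) (lft Y (inv_into UNIV a))"
  unfolding homeomorphic_maps_def topspace_unit_GR[OF YX]
  using lft_continuous[OF Y a] lft_continuous[OF Y b] Gam_maps[OF a] Gam_maps[OF b] i by (auto simp: lft_apply)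
 then have "homeomorphic_map (unit_top (GR Y)) (unit_top (GR Y)) (lft Y a)" unfolding homeomorphic_map_maps by blast
 then show ?thesis using lft_Bij[OF a] represents_Us[OF Y a]
  by (auto simp: full_group_def units_GR[OF YX])
qed

lemma full_group_mult:
 assumes "Y \<subseteq> X" "\<alpha> \<in> Bij (sft_unit ` Y)" "\<beta> \<in> Bij (sft_unit ` Y)"
 shows "\<alpha> \<otimes>\<^bsub>full_group (GR Y)\<^esub> \<beta> = compose (sft_unit ` Y) \<alpha> \<beta>"
 using assms by (simp add: full_group_def units_GR BijGroup_def)

lemma lft_comp:
 assumes a: "a \<in> Gam Y" and b: "b \<in> Gam Y"
 shows "lft Y (a \<circ> b) = compose (sft_unit ` Y) (lft Y a) (lft Y b)"
proof
 fix u
 show "lft Y (a \<circ> b) u = compose (sft_unit ` Y) (lft Y a) (lft Y b) u"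
  using Gam_maps[OF b] by (cases "u \<in> sft_unit ` Y") (auto simp: compose_def lft_apply, auto simp: lft_def)
qed

lemma lft_surj:
 assumes Y: "clop Y L" and \<alpha>: "\<alpha> \<in> carrier (full_group (GR Y))"
 shows "\<exists>a\<in>Gam Y. lft Y a = \<alpha>"
proof -
 have YX: "Y \<subseteq> X" and L: "L \<ge> 1" using clop_X_level[OF Y] by auto
 have B: "\<alpha> \<in> extensional (sft_unit ` Y)" "bij_betw \<alpha> (sft_unit ` Y) (sft_unit ` Y)"
  using \<alpha> by (auto simp: full_group_def units_GR[OF YX] Bij_def)
 obtain U where U: "represents (GR Y) U \<alpha>" using \<alpha> by (auto simp: full_group_def)
 define a where "a x = (if x \<in> Y then fst (\<alpha> (sft_unit x)) else x)" for x
 have \<alpha>a: "\<alpha> (sft_unit x) = sft_unit (a x)" "a x \<in> Y" if "x \<in> Y" for x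
 proof -
  have "\<alpha> (sft_unit x) \<in> sft_unit ` Y" using bij_betwE[OF B(2)] that by blast
  then show "\<alpha> (sft_unit x) = sft_unit (a x)" "a x \<in> Y" using that by (auto simp: a_def)
 qed
 have off: "a x = x" if "x \<notin> Y" for x using that by (simp add: a_def)
 have "inj a"
 proof (rule injI)
  fix x y assume e: "a x = a y"
  have xy: "x \<in> Y \<longleftrightarrow> y \<in> Y" using e \<alpha>a(2) off by metis
  show "x = y"
  proof (cases "x \<in> Y")
   case True
   then have "\<alpha> (sft_unit x) = \<alpha> (sft_unit y)" using \<alpha>a(1) e xy by simp
   then have "sft_unit x = sft_unit y"
    using bij_betw_imp_inj_on[OF B(2)] True xy by (metis imageI inj_onD)
   then show ?thesis by simp
  qed (use e xy off in auto)
 qed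
 moreover have "surj a"
 proof -
  have "\<exists>x. a x = y" for y
  proof (cases "y \<in> Y")
   case True
   then have "sft_unit y \<in> \<alpha> ` sft_unit ` Y" using bij_betw_imp_surj_on[OF B(2)] by simp
   then obtain x where "x \<in> Y" "\<alpha> (sft_unit x) = sft_unit y" by auto
   then show ?thesis using \<alpha>a(1) by auto
  qed (use off in blast)
  then show ?thesis by (metis surj_def)
 qed
 ultimately have "bij a" by (simp add: bij_def)
 moreover have "\<exists>n>0. \<exists>v. tb a (pfx x n) v" if x: "x \<in> X" for x
 proof (cases "x \<in> Y")
  case True
  then have "sft_unit x \<in> srcQ ` U"
   using U unfolding represents_def src_reduction units_GR[OF YX] by blast
  then obtain g where g: "g \<in> U" "srcQ g = sft_unit x" by auto
  obtain x' n y where "g = (x', n, y)" by (cases g)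
  then have "(x', n, x) \<in> U" using g by simp
  from represents_local[OF Y U this] obtain v w where v: "same v w" "w = pfx x (length w)" "cyl w \<subseteq> Y"
   "\<forall>y\<in>cyl w. \<alpha> (sft_unit y) = sft_unit (rp w v y)" by blast
  have "a y = rp w v y" if y: "y \<in> cyl w" for y
   using v(4) y \<alpha>a(1)[of y] v(3) by (metis inj_sft_unit subsetD)
  then have "tb a w v" using v(1) by (simp add: tb_def same_def)
  moreover have "length w > 0" using v(1) by (auto simp: same_def)
  ultimately show ?thesis using v(2) by metis
 next
  case False
  have "clop (X - Y) L" using clop_diff[OF clop_mono[OF clop_X L] Y] .
  from clopD[OF this] have "y \<in> X - Y" if "y \<in> cyl (pfx x L)" for y using x False that by blast
  then have "tb a (pfx x L) (pfx x L)" using pfx_words[OF x, of L] L off by (intro tb_fix) auto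
  then show ?thesis using L by (intro exI[of _ L]) auto
 qed
 ultimately have "a \<in> Gam Y" using off by (simp add: Gam_def)
 moreover have "lft Y a = \<alpha>"
 proof
  fix u
  show "lft Y a u = \<alpha> u"
  proof (cases "u \<in> sft_unit ` Y")
   case True
   then show ?thesis using lft_apply \<alpha>a(1) by auto
  next
   case False
   then show ?thesis using extensional_arb[OF B(1) False] by (simp add: lft_def)
  qed
 qed
 ultimately show ?thesis by blast
qed

lemma lft_inj: assumes a: "a \<in> Gam Y" and b: "b \<in> Gam Y" and e: "lft Y a = lft Y b" shows "a = b"
proof
 fix x
 show "a x = b x"
 proof (cases "x \<in> Y")
  case True
  then show ?thesis using lft_apply[OF True, of a] lft_apply[OF True, of b] e by simp
 qed (use GamD(2)[OF a] GamD(2)[OF b] in simp)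
qed

lemma lft_iso: assumes Y: "clop Y L" shows "lft Y \<in> iso (GG Y) (full_group (GR Y))"
proof (rule isoI)
 note YX = clop_X_level(1)[OF Y]
 show "lft Y \<in> hom (GG Y) (full_group (GR Y))"
 proof (rule homI)
  fix a b assume "a \<in> carrier (GG Y)" "b \<in> carrier (GG Y)"
  then have ab: "a \<in> Gam Y" "b \<in> Gam Y" by simp_all
  show "lft Y a \<in> carrier (full_group (GR Y))" by (rule lft_carrier[OF Y ab(1)])
  show "lft Y (a \<otimes>\<^bsub>GG Y\<^esub> b) = lft Y a \<otimes>\<^bsub>full_group (GR Y)\<^esub> lft Y b"
   using lft_comp[OF ab] full_group_mult[OF YX lft_Bij[OF ab(1)] lft_Bij[OF ab(2)]] by simp
 qed
 show "bij_betw (lft Y) (carrier (GG Y)) (carrier (full_group (GR Y)))"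
  unfolding bij_betw_def inj_on_def GG_simps
  using lft_inj lft_carrier[OF Y] lft_surj[OF Y] by blast
qed

lemma group_full_group: assumes Y: "clop Y L" shows "group (full_group (GR Y))"
proof -
 note YX = clop_X_level(1)[OF Y]
 have "lft Y id = restrict (%u. u) (sft_unit ` Y)" unfolding lft_def by (rule restrict_ext) auto
 then have "\<one>\<^bsub>full_group (GR Y)\<^esub> = lft Y id"
  by (simp add: full_group_def BijGroup_def units_GR[OF YX])
 \<comment> \<open>The image group of an isomorphism carries the image of the unit, which is the
   unit already in place.\<close>
 then have "full_group (GR Y)\<lparr>one := lft Y \<one>\<^bsub>GG Y\<^esub>\<rparr> = full_group (GR Y)" by simp
 then show ?thesis using group.iso_imp_img_group[OF group_GG[OF YX] lft_iso[OF Y]] by simp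
qed

end

section \<open>Abelianization and simplicity\<close>

lemma is_simple_group_iso:
 assumes G: "group G" and H: "group H" and h: "h \<in> iso G H" and s: "is_simple_group G"
 shows "is_simple_group H"
proof -
 interpret G: group G by (rule G)
 interpret H: group H by (rule H)
 interpret h: group_hom G H h by unfold_locales (use h in \<open>simp add: iso_def\<close>)
 have im: "h ` carrier G = carrier H" and inj: "inj_on h (carrier G)" using h by (auto simp: iso_def bij_betw_def)
 have "carrier H ~= {\<one>\<^bsub>H\<^esub>}"
 proof
  assume e: "carrier H = {\<one>\<^bsub>H\<^esub>}"
  have "x = \<one>\<^bsub>G\<^esub>" if x: "x \<in> carrier G" for x
  proof (rule inj_onD[OF inj _ x G.one_closed])
   show "h x = h \<one>\<^bsub>G\<^esub>" using h.hom_closed[OF x] e by simp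
  qed
  then show False using s G.one_closed unfolding is_simple_group_def by blast
 qed
 moreover have "N = carrier H \<or> N = {\<one>\<^bsub>H\<^esub>}" if N: "N \<lhd> H" for N
 proof -
  interpret N: normal N H by (rule N)
  interpret k: group_hom G "H Mod N" "(%x. N #>\<^bsub>H\<^esub> x) \<circ> h"
   by (intro group_hom.intro group_hom_axioms.intro G.is_group N.factorgroup_is_group
     hom_compose[OF h.homh N.r_coset_hom_Mod])
  \<comment> \<open>The preimage of \<open>N\<close> is written as a kernel, which makes it
    normal.\<close>
  let ?M = "kernel G (H Mod N) ((%x. N #>\<^bsub>H\<^esub> x) \<circ> h)"
  have M: "?M = {x \<in> carrier G. h x \<in> N}"
  proof -
   have e: "N #>\<^bsub>H\<^esub> y = N \<longleftrightarrow> y \<in> N" if "y \<in> carrier H" for y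
    using H.coset_join1[OF _ that N.subgroup_axioms] H.coset_join2[OF that N.subgroup_axioms]
     N.subset by blast
   show ?thesis unfolding kernel_def
    by (intro Collect_cong conj_cong refl) (simp only: o_apply one_FactGroup e[OF h.hom_closed])
  qed
  have "?M = carrier G \<or> ?M = {\<one>\<^bsub>G\<^esub>}" using k.normal_kernel s unfolding is_simple_group_def by blast
  moreover have hM: "h ` ?M = N" unfolding M using im N.subset by (auto simp: image_iff)
  ultimately show ?thesis using im by (metis h.hom_one image_empty image_insert)
 qed
 ultimately show ?thesis using H unfolding is_simple_group_def by blast
qed

context sft
begin

text \<open>Two transpositions that share exactly one of three disjoint cylinders of the same type
  do not commute.\<close>

lemma Gam_noncommuting:
 assumes Y: "clop Y L" "Y ~= {}"
 shows "\<exists>a\<in>Gam Y. \<exists>b\<in>Gam Y. a \<circ> b ~= b \<circ> a"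
proof -
 obtain y where y: "y \<in> Y" using Y(2) by blast
 have yX: "y \<in> X" "L \<ge> 1" using y clop_X_level[OF Y(1)] by auto
 have z: "pfx y L \<in> words" "cyl (pfx y L) \<subseteq> Y" using yX clopD[OF Y(1) y] by (auto intro: pfx_words)
 let ?e = "y 0"
 have e: "?e \<in> arcs Q" using yX(1) by (simp add: X_iff)
 have "set [?e, ?e, ?e] \<subseteq> arcs Q" using e by simp
 then obtain ws where ws: "map last ws = [?e, ?e, ?e]" "distinct ws" "set ws \<subseteq> words" "pdis (set ws)"
  "!!v. v \<in> set ws ==> cyl v \<subseteq> cyl (pfx y L)" by (rule stock[OF z(1)]) (rule that)
 obtain u v w where uvw: "ws = [u, v, w]" using ws(1) by (auto simp: map_eq_Cons_conv)
 have W: "u \<in> words" "v \<in> words" "w \<in> words" "last u = ?e" "last v = ?e" "last w = ?e"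
  using ws(1,3) uvw by auto
 have d: "cyl u \<inter> cyl v = {}" "cyl v \<inter> cyl w = {}" "cyl u \<inter> cyl w = {}"
  using pdis_apart[OF ws(4)] ws(2) uvw by auto
 have c: "cyl u \<subseteq> Y" "cyl v \<subseteq> Y" "cyl w \<subseteq> Y" using ws(5) z(2) uvw by auto
 have s: "swappable u v" "swappable v w" using W d by (auto simp: swappable_def)
 let ?a = "tr u v" and ?b = "tr v w" and ?x = "pt u"
 have x: "?x \<in> cyl u" "?x \<notin> cyl v" "?x \<notin> cyl w" using pt_in[OF W(1)] d by blast+
 have "?b ?x = ?x" using tr_simps(3)[OF x(2,3)] .
 then have "?a (?b ?x) \<in> cyl v" using tb_in_cyl[OF tb_tr(1)[OF s(1)] x(1)] by simp
 moreover have "?b (?a ?x) \<in> cyl w"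
  using tb_in_cyl[OF tb_tr(1)[OF s(2)] tb_in_cyl[OF tb_tr(1)[OF s(1)] x(1)]] .
 ultimately have "?a (?b ?x) ~= ?b (?a ?x)" using d(2) by auto
 then have "?a \<circ> ?b ~= ?b \<circ> ?a" by (metis comp_apply)
 then show ?thesis using tr_in_Gam[OF s(1) c(1,2)] tr_in_Gam[OF s(2) c(2,3)] by blast
qed

end

context sft_basis
begin

abbreviation "FG Y \<equiv> full_group (GR Y)"

text \<open>The index with values in the first homology of the whole groupoid, as the statement asks
  for \<open>H1 G\<close>. No isomorphism between the homology of the reduction and that of the
  groupoid has to be constructed.\<close>

definition ind_hom :: "(nat => 'e) set => ((nat => 'e) => nat => 'e) => ('e sft_arrow => int) set" where
 "ind_hom Y a = hcl X (indicator (Us Y a))"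

lemma Zc_mono: assumes Y: "clop Y L" and f: "f \<in> Zc Y" shows "f \<in> Zc X"
proof -
 have "BU Y \<subseteq> BU X"
 proof
  fix B assume "B \<in> BU Y"
  then obtain v w where "same v w" "B = Ub v w" by (auto simp: BU_def)
  then show "B \<in> BU X" using BU_I[OF _ cyl_subset_X cyl_subset_X] by blast
 qed
 then have g: "gen (BU Y) \<subseteq> gen (BU X)" by (rule gen_mono)
 have fg: "f \<in> gen (BU Y)" "delta1 (GR Y) f = (%x. 0)" using f by (auto simp: Zc_def)
 have "delta1 (GR X) h = delta1 (GR Y) h" if "h \<in> gen (BU Y)" for h using that
 proof (induction rule: gen_induct)
  case zero
  show ?case by (simp add: delta1_zero)
 next
  case (ind B)
  then obtain v w where v: "same v w" "cyl v \<subseteq> Y" "cyl w \<subseteq> Y" "B = Ub v w" by (auto simp: BU_def)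
  show ?case unfolding v(4) delta1_Ub[OF Y v(1-3)] delta1_Ub[OF clop_X v(1) cyl_subset_X cyl_subset_X] ..
 next
  case (diff h k)
  have "h \<in> gen (BU X)" "k \<in> gen (BU X)" using diff.hyps g by blast+
  then show ?case using delta1_diff[OF Y diff.hyps] delta1_diff[OF clop_X, of h k] diff.IH by simp
 qed
 then show ?thesis using fg g unfolding Zc_def by auto
qed

lemma ind_hom_hom: assumes Y: "clop Y L" shows "ind_hom Y \<in> hom (GG Y) (H1 GQ)"
proof (rule homI)
 note YX = clop_X_level(1)[OF Y]
 fix a b assume "a \<in> carrier (GG Y)" "b \<in> carrier (GG Y)"
 then have ab: "a \<in> Gam Y" "b \<in> Gam Y" by simp_all
 have Z: "indicator (Us Y c) \<in> Zc X" if "c \<in> Gam Y" for c by (rule Zc_mono[OF Y Us_Zc[OF Y that]])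
 have "hcl X (indicator (Us Y a)) \<in> carrier (H1 (GR X))"
  by (rule hom_in_carrier[OF hcl_hom[OF clop_X]]) (simp only: cycles1_simps(1)[OF clop_X] Z[OF ab(1)])
 then show "ind_hom Y a \<in> carrier (H1 GQ)" unfolding ind_hom_def GR_X .
 have 1: "(%z. indicator (Us Y (a \<circ> b)) z - (indicator (Us Y a) z + indicator (Us Y b) z)) \<in> Bd X"
  using Bd_subset[OF Y clop_X YX Us_comp[OF Y ab(2,1)]] by (simp add: algebra_simps)
 have "hcl X (indicator (Us Y (a \<circ> b))) = hcl X (%z. indicator (Us Y a) z + indicator (Us Y b) z)"
  using hcl_eq_iff[OF clop_X Z[OF comp_Gam[OF ab(2,1)]] Zc_add[OF clop_X Z[OF ab(1)] Z[OF ab(2)]]] 1 by blast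
 also have "\<dots> = hcl X (indicator (Us Y a)) \<otimes>\<^bsub>H1 (GR X)\<^esub> hcl X (indicator (Us Y b))"
  by (rule hcl_add[OF clop_X Z[OF ab(1)] Z[OF ab(2)]])
 finally show "ind_hom Y (a \<otimes>\<^bsub>GG Y\<^esub> b) = ind_hom Y a \<otimes>\<^bsub>H1 GQ\<^esub> ind_hom Y b"
  unfolding ind_hom_def GR_X GG_simps .
qed

lemma ind_hom_one_iff:
 assumes Y: "clop Y L" "Y ~= {}" and a: "a \<in> Gam Y"
 shows "ind_hom Y a = \<one>\<^bsub>H1 GQ\<^esub> \<longleftrightarrow> a \<in> TN Y"
proof -
 have "ind_hom Y a = \<one>\<^bsub>H1 GQ\<^esub> \<longleftrightarrow> indicator (Us Y a) \<in> Bd X"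
  using hcl_one_iff[OF clop_X Zc_mono[OF Y(1) Us_Zc[OF Y(1) a]]] unfolding ind_hom_def GR_X .
 also have "\<dots> \<longleftrightarrow> a \<in> TN Y"
  using kernel_TN[OF Y a] Bd_subset[OF Y(1) clop_X clop_X_level(1)[OF Y(1)] TN_kernel[OF Y(1)]] by blast
 finally show ?thesis .
qed

text \<open>Boundaries over \<open>Y\<close> are boundaries over \<open>X\<close>, and conversely an
  element whose index bounds over \<open>X\<close> lies in \<open>TN Y\<close>, where it bounds over
  \<open>Y\<close> already. Both index maps therefore have the same kernel.\<close>

lemma index_one_iff:
 assumes Y: "clop Y L" "Y ~= {}" and a: "a \<in> Gam Y"
 shows "index_map (GR Y) (lft Y a) = \<one>\<^bsub>H1 (GR Y)\<^esub> \<longleftrightarrow> a \<in> TN Y"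
proof -
 have "index_map (GR Y) (lft Y a) = hcl Y (indicator (Us Y a))"
  unfolding index_map_def the_represents[OF Y(1) a] ..
 then have "index_map (GR Y) (lft Y a) = \<one>\<^bsub>H1 (GR Y)\<^esub> \<longleftrightarrow> indicator (Us Y a) \<in> Bd Y"
  using hcl_one_iff[OF Y(1) Us_Zc[OF Y(1) a]] by simp
 also have "\<dots> \<longleftrightarrow> a \<in> TN Y"
  using kernel_TN[OF Y a] Bd_subset[OF Y(1) clop_X clop_X_level(1)[OF Y(1)]] TN_kernel[OF Y(1)] by blast
 finally show ?thesis .
qed

lemma ind_hom_surj:
 assumes Y: "clop Y L" "Y ~= {}" and c: "c \<in> carrier (H1 GQ)"
 shows "\<exists>a\<in>Gam Y. ind_hom Y a = c"
proof -
 have "c \<in> carrier (H1 (GR X))" using c unfolding GR_X .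
 then obtain f where f: "f \<in> Zc X" "c = hcl X f" using H1_surj[OF clop_X] by blast
 obtain a where a: "a \<in> Gam Y" "(%z. f z - indicator (Us Y a) z) \<in> Bd X" using index_surj[OF Y f(1)] by blast
 have "hcl X f = hcl X (indicator (Us Y a))"
  using hcl_eq_iff[OF clop_X f(1) Zc_mono[OF Y(1) Us_Zc[OF Y(1) a(1)]]] a(2) by blast
 then show ?thesis using a(1) f(2) unfolding ind_hom_def by metis
qed

lemma exists_cyl: assumes Y: "clop Y L" "Y ~= {}" shows "\<exists>u\<in>words. cyl u \<subseteq> Y"
proof -
 obtain y where y: "y \<in> Y" using Y(2) by blast
 have yX: "y \<in> X" "L \<ge> 1" using y clop_X_level[OF Y(1)] by auto
 then show ?thesis using clopD[OF Y(1) y] pfx_words[OF yX(1), of L] by (intro bexI[of _ "pfx y L"]) auto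
qed

lemma Sg_onto:
 assumes Y: "clop Y L" "Y ~= {}" and g: "g \<in> carrier EE"
 shows "\<exists>a\<in>Gam Y. a \<in> TN Y & Sg Y a = g"
proof -
 obtain u where u: "u \<in> words" "cyl u \<subseteq> Y" using exists_cyl[OF Y] by blast
 obtain a v where a: "v \<in> words" "cyl v \<subseteq> cyl u" "a \<in> TT (Y - cyl v)" "Sg Y a = g"
  using Sg_surj[OF Y(1) u g] by metis
 have T: "a \<in> TT Y" using a(3) TT_mono[of "Y - cyl v" Y] by blast
 have "indicator (Us Y a) \<in> Bd X"
  using Bd_subset[OF Y(1) clop_X clop_X_level(1)[OF Y(1)] Us_TT[OF Y(1) T]] .
 then show ?thesis using kernel_TN[OF Y TT_Gam[OF T]] TT_Gam[OF T] a(4) by blast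
qed

context
 fixes Y :: "(nat => 'e) set" and L :: nat
 assumes Y: "clop Y L" "Y ~= {}"
begin

lemma group_H1: "group (H1 GQ)"
 using comm_group.axioms(2)[OF comm_group_H1[OF clop_X]] unfolding GR_X .

lemma comm_group_EH: "comm_group (EE \<times>\<times> H1 GQ)"
proof -
 interpret E: comm_group EE by (rule comm_group_EE)
 interpret H: comm_group "H1 GQ" using comm_group_H1[OF clop_X] unfolding GR_X .
 interpret P: group "EE \<times>\<times> H1 GQ" by (rule DirProd_group[OF E.is_group H.is_group])
 show ?thesis by (rule P.group_comm_groupI) (auto simp: mult_DirProd' E.m_comm H.m_comm simp del: EE_simps)
qed

definition theta :: "((nat => 'e) => nat => 'e) => (('e \<Rightarrow>\<^sub>0 bit) => bit) \<times> ('e sft_arrow => int) set" where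
 "theta a = (Sg Y a, ind_hom Y a)"

lemma theta_hom: "theta \<in> hom (GG Y) (EE \<times>\<times> H1 GQ)"
 unfolding theta_def[abs_def] hom_paired using Sg_hom[OF Y(1)] ind_hom_hom[OF Y(1)] by blast

text \<open>The target of \<open>theta\<close> is abelian, so sign and index vanish on commutators;
  the converse is \<open>kernel_Sg\<close>.\<close>

lemma derived_Gam: "derived (GG Y) (Gam Y) = {a \<in> TN Y. Sg Y a = \<one>\<^bsub>EE\<^esub>}"
proof
 note YX = clop_X_level(1)[OF Y(1)]
 interpret P: comm_group "EE \<times>\<times> H1 GQ" by (rule comm_group_EH)
 interpret G: group "GG Y" by (rule group_GG[OF YX])
 interpret t: group_hom "GG Y" "EE \<times>\<times> H1 GQ" theta by unfold_locales (rule theta_hom)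
 show "{a \<in> TN Y. Sg Y a = \<one>\<^bsub>EE\<^esub>} \<subseteq> derived (GG Y) (Gam Y)" using kernel_Sg[OF Y(1)] by blast
 show "derived (GG Y) (Gam Y) \<subseteq> {a \<in> TN Y. Sg Y a = \<one>\<^bsub>EE\<^esub>}"
 proof
  fix a assume a: "a \<in> derived (GG Y) (Gam Y)"
  have aG: "a \<in> Gam Y" using a G.derived_in_carrier[of "Gam Y"] by auto
  have "theta ` derived (GG Y) (Gam Y) = derived (EE \<times>\<times> H1 GQ) (theta ` Gam Y)"
   using t.derived_img[of "Gam Y"] by simp
  also have "\<dots> = {\<one>\<^bsub>EE \<times>\<times> H1 GQ\<^esub>}" by (intro P.derived_eq_singleton image_subsetI t.hom_closed) simp
  finally have "theta a = \<one>\<^bsub>EE \<times>\<times> H1 GQ\<^esub>" using a by blast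
  then have "Sg Y a = \<one>\<^bsub>EE\<^esub>" "ind_hom Y a = \<one>\<^bsub>H1 GQ\<^esub>"
   by (simp_all add: theta_def DirProd_def del: EE_simps)
  then show "a \<in> {a \<in> TN Y. Sg Y a = \<one>\<^bsub>EE\<^esub>}" using ind_hom_one_iff[OF Y aG] by blast
 qed
qed

definition unl :: "('e sft_arrow => 'e sft_arrow) => (nat => 'e) => nat => 'e" where
 "unl = inv_into (Gam Y) (lft Y)"

lemma unl_iso: "unl \<in> iso (FG Y) (GG Y)"
 using group.iso_set_sym[OF group_GG[OF clop_X_level(1)[OF Y(1)]] lft_iso[OF Y(1)]] by (simp add: unl_def)

lemma unl_lft: "a \<in> Gam Y ==> unl (lft Y a) = a"
 unfolding unl_def using lft_inj by (intro inv_into_f_f) (auto simp: inj_on_def)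

lemma carrier_FG: "carrier (FG Y) = lft Y ` Gam Y"
 using lft_carrier[OF Y(1)] lft_surj[OF Y(1)] by blast

lemma unl_hom: "unl \<in> hom (FG Y) (GG Y)"
 using unl_iso by (simp add: iso_def)

lemma derived_FG: "derived (FG Y) (carrier (FG Y)) = lft Y ` {a \<in> TN Y. Sg Y a = \<one>\<^bsub>EE\<^esub>}"
proof -
 note YX = clop_X_level(1)[OF Y(1)]
 interpret G: group "GG Y" by (rule group_GG[OF YX])
 interpret F: group "FG Y" by (rule group_full_group[OF Y(1)])
 interpret l: group_hom "GG Y" "FG Y" "lft Y" by unfold_locales (use lft_iso[OF Y(1)] in \<open>simp add: iso_def\<close>)
 show ?thesis using l.derived_img[of "Gam Y"] unfolding derived_Gam carrier_FG by simp
qed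

lemma TN_in_Gam: "a \<in> TN Y ==> a \<in> Gam Y"
 using TN_Gam TT_Gam by blast

lemma abelianization_iso: "abelianization (FG Y) \<cong> EE \<times>\<times> H1 GQ"
proof -
 note YX = clop_X_level(1)[OF Y(1)]
 interpret P: comm_group "EE \<times>\<times> H1 GQ" by (rule comm_group_EH)
 interpret F: group "FG Y" by (rule group_full_group[OF Y(1)])
 interpret E: comm_group EE by (rule comm_group_EE)
 let ?h = "theta \<circ> unl"
 interpret h: group_hom "FG Y" "EE \<times>\<times> H1 GQ" ?h by unfold_locales (rule hom_compose[OF unl_hom theta_hom])
 have "kernel (FG Y) (EE \<times>\<times> H1 GQ) ?h = lft Y ` {a \<in> TN Y. Sg Y a = \<one>\<^bsub>EE\<^esub>}"
 proof -
  have "?h (lft Y a) = \<one>\<^bsub>EE \<times>\<times> H1 GQ\<^esub> \<longleftrightarrow> a \<in> {a \<in> TN Y. Sg Y a = \<one>\<^bsub>EE\<^esub>}" if a: "a \<in> Gam Y" for a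
  proof -
   have "?h (lft Y a) = (Sg Y a, ind_hom Y a)" using unl_lft[OF a] by (simp add: theta_def)
   moreover have "\<one>\<^bsub>EE \<times>\<times> H1 GQ\<^esub> = (\<one>\<^bsub>EE\<^esub>, \<one>\<^bsub>H1 GQ\<^esub>)" by (simp add: DirProd_def)
   ultimately show ?thesis using ind_hom_one_iff[OF Y a] by (auto simp del: EE_simps)
  qed
  then show ?thesis unfolding kernel_def carrier_FG using TN_in_Gam by blast
 qed
 then have k: "kernel (FG Y) (EE \<times>\<times> H1 GQ) ?h = derived (FG Y) (carrier (FG Y))" unfolding derived_FG .
 have "?h ` carrier (FG Y) = carrier (EE \<times>\<times> H1 GQ)"
 proof
  show "?h ` carrier (FG Y) \<subseteq> carrier (EE \<times>\<times> H1 GQ)" using h.hom_closed by blast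
  show "carrier (EE \<times>\<times> H1 GQ) \<subseteq> ?h ` carrier (FG Y)"
  proof
   fix p assume p: "p \<in> carrier (EE \<times>\<times> H1 GQ)"
   obtain g c where gc: "p = (g, c)" "g \<in> carrier EE" "c \<in> carrier (H1 GQ)" using p by (auto simp: DirProd_def)
   obtain b where b: "b \<in> Gam Y" "ind_hom Y b = c" using ind_hom_surj[OF Y gc(3)] by blast
   have Sb: "Sg Y b \<in> carrier EE" by (rule Sg_EE[OF Y(1) b(1)])
   have "g \<otimes>\<^bsub>EE\<^esub> Sg Y b \<in> carrier EE" by (rule E.m_closed[OF gc(2) Sb])
   \<comment> \<open>\<open>t\<close> has trivial index and corrects the sign of \<open>b\<close>:
     since squares in \<open>EE\<close> are trivial, the two occurrences of \<open>Sg Y b\<close>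
     cancel and leave \<open>g\<close>.\<close>
   then obtain t where t: "t \<in> Gam Y" "t \<in> TN Y" "Sg Y t = g \<otimes>\<^bsub>EE\<^esub> Sg Y b" using Sg_onto[OF Y] by blast
   have 1: "Sg Y (t \<circ> b) = g"
   proof -
    have "Sg Y (t \<circ> b) = g \<otimes>\<^bsub>EE\<^esub> Sg Y b \<otimes>\<^bsub>EE\<^esub> Sg Y b" unfolding Sg_comp[OF Y(1) t(1) b(1)] t(3) ..
    also have "\<dots> = g \<otimes>\<^bsub>EE\<^esub> (Sg Y b \<otimes>\<^bsub>EE\<^esub> Sg Y b)" by (rule E.m_assoc[OF gc(2) Sb Sb])
    also have "\<dots> = g" unfolding EE_square by (rule E.r_one[OF gc(2)])
    finally show ?thesis .
   qed
   interpret H: group "H1 GQ" by (rule group_H1)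
   have "ind_hom Y (t \<circ> b) = ind_hom Y t \<otimes>\<^bsub>H1 GQ\<^esub> ind_hom Y b"
    using hom_mult[OF ind_hom_hom[OF Y(1)], of t b] t(1) b(1) by simp
   then have 2: "ind_hom Y (t \<circ> b) = c"
    using ind_hom_one_iff[OF Y t(1)] t(2) b(2) H.l_one[OF gc(3)] by simp
   have tb: "t \<circ> b \<in> Gam Y" by (rule comp_Gam[OF b(1) t(1)])
   have "?h (lft Y (t \<circ> b)) = p" unfolding gc(1) o_apply[of theta unl] unl_lft[OF tb] theta_def 1 2 ..
   then show "p \<in> ?h ` carrier (FG Y)" using lft_carrier[OF Y(1) tb] by blast
  qed
 qed
 then show ?thesis using h.FactGroup_iso unfolding k abelianization_def by blast
qed

lemma kernel_index: "kernel (FG Y) (H1 (GR Y)) (index_map (GR Y)) = lft Y ` TN Y"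
 unfolding kernel_def carrier_FG using index_one_iff[OF Y] TN_in_Gam by blast

lemma subgroup_TN: "subgroup (lft Y ` TN Y) (FG Y)"
proof -
 interpret F: group "FG Y" by (rule group_full_group[OF Y(1)])
 interpret H: group "H1 GQ" by (rule group_H1)
 interpret h: group_hom "FG Y" "H1 GQ" "ind_hom Y \<circ> unl" by unfold_locales (rule hom_compose[OF unl_hom ind_hom_hom[OF Y(1)]])
 have "(ind_hom Y \<circ> unl) (lft Y a) = \<one>\<^bsub>H1 GQ\<^esub> \<longleftrightarrow> a \<in> TN Y" if "a \<in> Gam Y" for a
  using ind_hom_one_iff[OF Y that] unl_lft[OF that] by simp
 then have "kernel (FG Y) (H1 GQ) (ind_hom Y \<circ> unl) = lft Y ` TN Y"
  unfolding kernel_def carrier_FG using TN_in_Gam by blast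
 then show ?thesis using h.subgroup_kernel by simp
qed

lemma full_group_0_iso: "full_group_0 (GR Y) Mod derived (FG Y) (carrier (FG Y)) \<cong> EE"
proof -
 interpret F: group "FG Y" by (rule group_full_group[OF Y(1)])
 interpret E: comm_group EE by (rule comm_group_EE)
 have f0: "full_group_0 (GR Y) = (FG Y)\<lparr>carrier := lft Y ` TN Y\<rparr>" unfolding full_group_0_def kernel_index ..
 interpret F0: group "(FG Y)\<lparr>carrier := lft Y ` TN Y\<rparr>"
  by (rule subgroup.subgroup_is_group[OF subgroup_TN F.is_group])
 let ?h = "Sg Y \<circ> unl"
 have hh: "?h \<in> hom (FG Y) EE" by (rule hom_compose[OF unl_hom Sg_hom[OF Y(1)]])
 have "?h \<in> hom ((FG Y)\<lparr>carrier := lft Y ` TN Y\<rparr>) EE"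
 proof (rule homI)
  fix x y assume "x \<in> carrier ((FG Y)\<lparr>carrier := lft Y ` TN Y\<rparr>)" "y \<in> carrier ((FG Y)\<lparr>carrier := lft Y ` TN Y\<rparr>)"
  then have xy: "x \<in> carrier (FG Y)" "y \<in> carrier (FG Y)" using subgroup.subset[OF subgroup_TN] by auto
  show "?h x \<in> carrier EE" by (rule hom_in_carrier[OF hh xy(1)])
  show "?h (x \<otimes>\<^bsub>(FG Y)\<lparr>carrier := lft Y ` TN Y\<rparr>\<^esub> y) = ?h x \<otimes>\<^bsub>EE\<^esub> ?h y"
   using hom_mult[OF hh xy] by simp
 qed
 then interpret h: group_hom "(FG Y)\<lparr>carrier := lft Y ` TN Y\<rparr>" EE ?h by unfold_locales
 have k: "kernel ((FG Y)\<lparr>carrier := lft Y ` TN Y\<rparr>) EE ?h = derived (FG Y) (carrier (FG Y))"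
  unfolding kernel_def derived_FG using unl_lft[OF TN_in_Gam] by (auto simp del: EE_simps)
 have "?h ` carrier ((FG Y)\<lparr>carrier := lft Y ` TN Y\<rparr>) = carrier EE"
 proof
  show "?h ` carrier ((FG Y)\<lparr>carrier := lft Y ` TN Y\<rparr>) \<subseteq> carrier EE" using h.hom_closed by blast
  show "carrier EE \<subseteq> ?h ` carrier ((FG Y)\<lparr>carrier := lft Y ` TN Y\<rparr>)"
  proof
   fix g assume "g \<in> carrier EE"
   then obtain a where a: "a \<in> Gam Y" "a \<in> TN Y" "Sg Y a = g" using Sg_onto[OF Y] by blast
   have "?h (lft Y a) = g" using a(3) unl_lft[OF a(1)] by simp
   then show "g \<in> ?h ` carrier ((FG Y)\<lparr>carrier := lft Y ` TN Y\<rparr>)" using a(2) by auto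
  qed
 qed
 then show ?thesis using h.FactGroup_iso unfolding k f0 by blast
qed

text \<open>A simple group that is not abelian equals its commutator subgroup, on which the sign
  vanishes, and the sign is onto. Conversely, if there are no signs, the group is perfect, and every
  nontrivial normal subgroup contains all commutators.\<close>

lemma simple_GG: "is_simple_group (GG Y) \<longleftrightarrow> carrier EE = {\<one>\<^bsub>EE\<^esub>}"
proof
 note YX = clop_X_level(1)[OF Y(1)]
 interpret G: group "GG Y" by (rule group_GG[OF YX])
 interpret E: comm_group EE by (rule comm_group_EE)
 obtain a b where ab: "a \<in> Gam Y" "b \<in> Gam Y" "a \<circ> b ~= b \<circ> a" using Gam_noncommuting[OF Y] by blast
 {
  assume s: "is_simple_group (GG Y)"
  have "derived (GG Y) (Gam Y) ~= {id}"
  proof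
   assume d: "derived (GG Y) (Gam Y) = {id}"
   interpret K: comm_group "Kab Y" by (rule comm_group_Kab[OF YX])
   have "cls Y (a \<circ> b) = cls Y (b \<circ> a)"
    unfolding cls_comp[OF YX ab(1,2)] cls_comp[OF YX ab(2,1)]
    by (rule K.m_comm[OF cls_closed[OF YX ab(1)] cls_closed[OF YX ab(2)]])
   then have "a \<circ> b = b \<circ> a" unfolding d by (simp add: r_coset_def)
   then show False using ab(3) by blast
  qed
  then have "derived (GG Y) (Gam Y) = Gam Y"
   using s normal_derived[OF YX] unfolding is_simple_group_def GG_simps by blast
  then have "Sg Y c = \<one>\<^bsub>EE\<^esub>" if "c \<in> Gam Y" for c using that derived_Gam by blast
  then show "carrier EE = {\<one>\<^bsub>EE\<^esub>}" using Sg_onto[OF Y] E.one_closed by blast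
 }
 assume E1: "carrier EE = {\<one>\<^bsub>EE\<^esub>}"
 have "Gam Y ~= {id}" using ab by auto
 moreover have "N = Gam Y \<or> N = {id}" if N: "N \<lhd> GG Y" for N
 proof (cases "N = {id}")
  case False
  have "Gam Y \<subseteq> N" using derived_all[OF E1 Y] derived_subset_normal[OF N Y(1) False] by blast
  moreover have "N \<subseteq> Gam Y" using subgroup.subset[OF normal_imp_subgroup[OF N]] by simp
  ultimately show ?thesis by blast
 qed blast
 ultimately show "is_simple_group (GG Y)"
  unfolding is_simple_group_def GG_simps using G.is_group by blast
qed

lemma simple_FG: "is_simple_group (FG Y) \<longleftrightarrow> two_divisible (H0 GQ)"
 unfolding two_divisible_H0 simple_GG[symmetric]
 using is_simple_group_iso[OF group_full_group[OF Y(1)] group_GG[OF clop_X_level(1)[OF Y(1)]] unl_iso]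
  is_simple_group_iso[OF group_GG[OF clop_X_level(1)[OF Y(1)]] group_full_group[OF Y(1)] lft_iso[OF Y(1)]]
 by blast

lemma full_group_quotients:
 "abelianization (FG Y) \<cong> tensor_group (H0 GQ) (integer_mod_group 2) \<times>\<times> H1 GQ"
 "full_group_0 (GR Y) Mod derived (FG Y) (carrier (FG Y)) \<cong> tensor_group (H0 GQ) (integer_mod_group 2)"
 "is_simple_group (FG Y) \<longleftrightarrow> two_divisible (H0 GQ)"
proof -
 note t = tensor_H0
 show "abelianization (FG Y) \<cong> tensor_group (H0 GQ) (integer_mod_group 2) \<times>\<times> H1 GQ"
  by (rule iso_trans[OF abelianization_iso group.DirProd_iso_trans[OF comm_group.axioms(2)[OF comm_group_EE] t iso_refl]])
 show "full_group_0 (GR Y) Mod derived (FG Y) (carrier (FG Y)) \<cong> tensor_group (H0 GQ) (integer_mod_group 2)"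
  by (rule iso_trans[OF full_group_0_iso t])
 show "is_simple_group (FG Y) \<longleftrightarrow> two_divisible (H0 GQ)" by (rule simple_FG)
qed

end

end

text \<open>Positive entries of matrix powers are walks, which connect the arcs. Without branching
  every vertex would have exactly one outgoing arc, and the matrix would be that of the map to the
  head of this arc, a surjection of a finite set and so a permutation.\<close>

lemma sft_of_matrix:
 assumes fin: "fin_digraph Q" and irr: "irreducible_mat (verts Q) (adjacency Q)"
  and np: "\<not> permutation_mat (verts Q) (adjacency Q)"
 shows "sft Q"
proof
 interpret fin_digraph Q by (rule fin)
 show fa: "finite (arcs Q)" by (rule finite_arcs)
 have adj: "adjacency Q \<xi> \<eta> > 0 \<longleftrightarrow> (\<exists>e\<in>arcs Q. tail Q e = \<xi> & head Q e = \<eta>)" for \<xi> \<eta>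
  using fa by (auto simp: adjacency_def card_gt_0_iff)
 let ?R = "{(a, b). a \<in> arcs Q & b \<in> arcs Q & tail Q b = head Q a}"
 have walk: "(e, f) \<in> ?R\<^sup>+"
  if "mat_power (verts Q) (adjacency Q) n (head Q e) (tail Q f) > 0" "e \<in> arcs Q" "f \<in> arcs Q" for n e f
  using that
 proof (induction n arbitrary: f)
  case 0
  then have "head Q e = tail Q f" by (simp split: if_splits)
  then show ?case using 0 by (intro r_into_trancl) auto
 next
  case (Suc n)
  have "(\<Sum>\<zeta>\<in>verts Q. mat_power (verts Q) (adjacency Q) n (head Q e) \<zeta> * adjacency Q \<zeta> (tail Q f)) ~= 0"
   using Suc.prems(1) unfolding mat_power.simps by (rule gr_implies_not0)
  then obtain \<zeta> where z: "\<zeta> \<in> verts Q" "mat_power (verts Q) (adjacency Q) n (head Q e) \<zeta> * adjacency Q \<zeta> (tail Q f) ~= 0"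
   by (rule sum.not_neutral_contains_not_neutral)
  then obtain g where g: "g \<in> arcs Q" "tail Q g = \<zeta>" "head Q g = tail Q f" using adj[of \<zeta> "tail Q f"] by auto
  have "(e, g) \<in> ?R\<^sup>+" using Suc.IH[of g] z(2) g Suc.prems(2) by simp
  moreover have "(g, f) \<in> ?R" using g Suc.prems(3) by simp
  ultimately show ?case by (rule trancl_into_trancl)
 qed
 show "(e, f) \<in> ?R\<^sup>+" if "e \<in> arcs Q" "f \<in> arcs Q" for e f
 proof -
  have "head Q e \<in> verts Q" "tail Q f \<in> verts Q" using that by auto
  then obtain n where "mat_power (verts Q) (adjacency Q) n (head Q e) (tail Q f) > 0"
   using irr unfolding irreducible_mat_def by blast
  then show ?thesis using walk that by blast
 qed
 show "\<exists>e\<in>arcs Q. \<exists>f\<in>arcs Q. \<exists>g\<in>arcs Q. tail Q f = head Q e & tail Q g = head Q e & f ~= g"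
 proof (rule ccontr)
  assume nb: "\<not> ?thesis"
  \<comment> \<open>Every vertex lies on a closed walk of positive length and so is the head of an
    arc; two arcs with the same tail would therefore be two successors of one arc.\<close>
  have arc_in: "\<exists>e\<in>arcs Q. head Q e = \<eta>" if v: "\<eta> \<in> verts Q" for \<eta>
  proof -
   obtain n where n: "n \<ge> 1" "mat_power (verts Q) (adjacency Q) n \<eta> \<eta> > 0"
    using irr v unfolding irreducible_mat_def by blast
   obtain m where m: "n = Suc m" using n(1) by (cases n) auto
   have "(\<Sum>\<zeta>\<in>verts Q. mat_power (verts Q) (adjacency Q) m \<eta> \<zeta> * adjacency Q \<zeta> \<eta>) ~= 0"
    using n(2) unfolding m mat_power.simps by (rule gr_implies_not0)
   then obtain \<zeta> where "mat_power (verts Q) (adjacency Q) m \<eta> \<zeta> * adjacency Q \<zeta> \<eta> ~= 0"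
    by (rule sum.not_neutral_contains_not_neutral)
   then have "adjacency Q \<zeta> \<eta> > 0" by simp
   then show ?thesis unfolding adj by blast
  qed
  have uniq: "f = g" if "f \<in> arcs Q" "g \<in> arcs Q" "tail Q f = tail Q g" for f g
  proof -
   have "tail Q f \<in> verts Q" using that(1) by auto
   then obtain e where "e \<in> arcs Q" "head Q e = tail Q f" using arc_in by blast
   then show ?thesis using nb that by metis
  qed
  have arc_out: "\<exists>f\<in>arcs Q. tail Q f = \<xi>" if v: "\<xi> \<in> verts Q" for \<xi>
  proof -
   obtain e where e: "e \<in> arcs Q" "head Q e = \<xi>" using arc_in[OF v] by blast
   have "(e, e) \<in> ?R\<^sup>+"
   proof -
    have "head Q e \<in> verts Q" "tail Q e \<in> verts Q" using e(1) by auto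
    then obtain n where "mat_power (verts Q) (adjacency Q) n (head Q e) (tail Q e) > 0"
     using irr unfolding irreducible_mat_def by blast
    then show ?thesis using walk e(1) by blast
   qed
   then obtain f where "(e, f) \<in> ?R" by (meson tranclD)
   then show ?thesis using e(2) by auto
  qed
  define out where "out \<xi> = (SOME f. f \<in> arcs Q & tail Q f = \<xi>)" for \<xi>
  have out: "out \<xi> \<in> arcs Q" "tail Q (out \<xi>) = \<xi>" if "\<xi> \<in> verts Q" for \<xi>
  proof -
   have "\<exists>f. f \<in> arcs Q & tail Q f = \<xi>" using arc_out[OF that] by blast
   from someI_ex[OF this] show "out \<xi> \<in> arcs Q" "tail Q (out \<xi>) = \<xi>" by (simp_all add: out_def)
  qed
  define p where "p \<xi> = (if \<xi> \<in> verts Q then head Q (out \<xi>) else \<xi>)" for \<xi>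
  have M: "adjacency Q \<xi> \<eta> = (if \<eta> = p \<xi> then 1 else 0)" if "\<xi> \<in> verts Q" "\<eta> \<in> verts Q" for \<xi> \<eta>
  proof -
   have "e = out \<xi>" if e: "e \<in> arcs Q" "tail Q e = \<xi>" for e
    using uniq[OF e(1) out(1)] out(2) e(2) \<open>\<xi> \<in> verts Q\<close> by simp
   note u = this
   have po: "head Q (out \<xi>) = p \<xi>" using that(1) by (simp add: p_def)
   show ?thesis
   proof (cases "\<eta> = p \<xi>")
    case True
    then have "head Q (out \<xi>) = \<eta>" using po by simp
    then have "{e \<in> arcs Q. tail Q e = \<xi> & head Q e = \<eta>} = {out \<xi>}" using u out[OF that(1)] by blast
    then show ?thesis using True by (simp add: adjacency_def)
   next
    case False
    have "head Q e ~= \<eta>" if e: "e \<in> arcs Q" "tail Q e = \<xi>" for e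
     unfolding u[OF e] po using False by simp
    then have "{e \<in> arcs Q. tail Q e = \<xi> & head Q e = \<eta>} = {}" by blast
    then show ?thesis using False by (simp add: adjacency_def)
   qed
  qed
  have pV: "p ` verts Q = verts Q"
  proof
   show "p ` verts Q \<subseteq> verts Q" using out by (auto simp: p_def)
   show "verts Q \<subseteq> p ` verts Q"
   proof
    fix \<eta> assume "\<eta> \<in> verts Q"
    then obtain e where e: "e \<in> arcs Q" "head Q e = \<eta>" using arc_in by blast
    have t: "tail Q e \<in> verts Q" using e(1) by auto
    have "out (tail Q e) = e" using uniq out[OF t] e(1) by blast
    then show "\<eta> \<in> p ` verts Q" using e(2) t by (intro image_eqI[of _ _ "tail Q e"]) (simp_all add: p_def)
   qed
  qed
  have "finite (verts Q)" by (rule finite_verts)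
  then have "bij_betw p (verts Q) (verts Q)" using pV eq_card_imp_inj_on[of "verts Q" p] by (simp add: bij_betw_def)
  then have "p permutes verts Q" by (rule bij_imp_permutes) (simp add: p_def)
  then show False using np M unfolding permutation_mat_def by blast
 qed
qed

theorem corollary6p24:
  fixes Q :: "('v, 'e) pre_digraph" and Y :: "(nat \<Rightarrow> 'e) set"
  assumes "fin_digraph Q"
    and "irreducible_mat (verts Q) (adjacency Q)"
    and "\<not> permutation_mat (verts Q) (adjacency Q)"
    and "openin (shift_space Q) Y" and "closedin (shift_space Q) Y" and "Y \<noteq> {}"
  shows "let G = sft_groupoid Q;
             GY = reduction G (sft_unit ` Y);
             \<Gamma> = full_group GY
         in (abelianization \<Gamma> \<cong> tensor_group (H0 G) (integer_mod_group 2) \<times>\<times> H1 G) \<and>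
            (full_group_0 GY Mod derived \<Gamma> (carrier \<Gamma>)
               \<cong> tensor_group (H0 G) (integer_mod_group 2)) \<and>
            (is_simple_group \<Gamma> \<longleftrightarrow> two_divisible (H0 G))"
proof -
  interpret s: sft Q by (rule sft_of_matrix[OF assms(1-3)])
  obtain BB chi where "sft_basis Q BB chi" using s.exists_basis by blast
  then interpret b: sft_basis Q BB chi .
  obtain L where L: "s.clop Y L" using s.clopen_level[OF assms(4,5)] .
  show ?thesis unfolding Let_def using b.full_group_quotients[OF L assms(6)] by blast
qed

end
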